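(* Let $l,r$ be positive integers with $l-r>2$, and let $D$, $G=SU(l,r)$, $h$, $S$, $dv$, $\mathcal H_\nu$ and $\varphi_\sigma$ be as in the context. Let $\nu=j-1$ with $2\le j\le r$ be a singular Wallach point, and suppose $l-r>2j-3$. Put $\sigma=j-1$ (equivalently, $\lambda$ is given by $i\lambda=2r(j-1)-r(1+l-r+(r-1))$). Then the spherical function $g\mapsto\varphi_\sigma(g\cdot0)$ on $G$ is positive definite, and the corresponding irreducible unitary spherical representation of $G$ appears as a discrete component (i.e. is unitarily equivalent to a closed irreducible $G$-invariant subspace) of the representation $\mathcal H_\nu\otimes\overline{\mathcal H_\nu}$ of $G\times G$ restricted to the diagonal subgroup $G$.
   Context: $D=\{z\in M_{r\times l}(\mathbb C): I_r-zz^*>0\}$ is the bounded symmetric domain $SU(l,r)/S(U(l)\times U(r))$ of rank $r$. The group $G=SU(l,r)$ acts on it by biholomorphic fractional linear transformations, and $J_g(z)$ denotes the complex Jacobian determinant of $z\mapsto gz$. We write $h(z,\bar w)=\det(I_r-zw^* )$, and the genus is $p=l+r$. $S=\{v: vv^*=I_r\}$ is the Shilov boundary, and $dv$ is its normalized $S(U(l)\times U(r))$-invariant probability measure. For $\nu$ in the Wallach set $\{0,1,\dots,r-1\}\cup(r-1,\infty)$, $\mathcal H_\nu$ is the Hilbert space of holomorphic functions on $D$ with reproducing kernel $h(z,\bar w)^{-\nu}$. $G$ acts on it by the (projective) unitary representation $\pi_\nu(g)f(z)=J_{g^{-1}}(z)^{\nu/p}f(g^{-1}z)$. $\mathcal H_\nu\otimes\overline{\mathcal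 H_\nu}$ is the space of functions $F(z,\bar w)$, holomorphic in $z$ and antiholomorphic in $w$, with reproducing kernel $h(z,\bar z')^{-\nu}h(w',\bar w)^{-\nu}$. It carries the representation $\pi_\nu\otimes\overline{\pi_\nu}$ of $G\times G$. The spherical function is $$\varphi_\sigma(z)=\int_S\Big(\frac{h(z,\bar z)}{h(z,\bar v)h(v,\bar z)}\Big)^{\sigma}dv,\qquad z\in D.$$ It is the spherical function of the degenerate principal series $\mathrm{Ind}_P^G(\lambda)$ on $L^2(S)$, where $i\lambda=2r\sigma-r(1+l-r+(r-1))$. *)

theory Defs
  imports "HOL-Analysis.Analysis" "HOL-Probability.Probability"
begin

text \<open>Matrices: an r x l complex matrix is  complex^'l::finite^'r::finite  (rows indexed by 'r::finite).
  Elements of the group are (r+l) x (r+l) matrices indexed by the sum type 'r::finite + 'l::finite.\<close>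

definition ctrans :: "complex^'n::finite^'m::finite \<Rightarrow> complex^'m::finite^'n::finite" where
  "ctrans A = (\<chi> i j. cnj (A $ j $ i))"

definition posdef_herm :: "complex^'n::finite^'n::finite \<Rightarrow> bool" where
  "posdef_herm M \<longleftrightarrow> ctrans M = M \<and>
     (\<forall>x::complex^'n::finite. x \<noteq> 0 \<longrightarrow>
        0 < Re (\<Sum>i\<in>UNIV. \<Sum>k\<in>UNIV. cnj (x $ i) * M $ i $ k * x $ k))"

definition Dom :: "(complex^'l::finite^'r::finite) set" where
  "Dom = {z. posdef_herm (mat 1 - z ** ctrans z)}"

definition Shilov :: "(complex^'l::finite^'r::finite) set" where
  "Shilov = {v. v ** ctrans v = mat 1}"

definition hfun :: "complex^'l::finite^'r::finite \<Rightarrow> complex^'l::finite^'r::finite \<Rightarrow> complex" where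
  "hfun z w = det (mat 1 - z ** ctrans w :: complex^'r::finite^'r::finite)"

definition ablk :: "complex^('r::finite+'l::finite)^('r::finite+'l::finite) \<Rightarrow> complex^'r::finite^'r::finite" where
  "ablk g = (\<chi> i j. g $ Inl i $ Inl j)"
definition bblk :: "complex^('r::finite+'l::finite)^('r::finite+'l::finite) \<Rightarrow> complex^'l::finite^'r::finite" where
  "bblk g = (\<chi> i j. g $ Inl i $ Inr j)"
definition cblk :: "complex^('r::finite+'l::finite)^('r::finite+'l::finite) \<Rightarrow> complex^'r::finite^'l::finite" where
  "cblk g = (\<chi> i j. g $ Inr i $ Inl j)"
definition dblk :: "complex^('r::finite+'l::finite)^('r::finite+'l::finite) \<Rightarrow> complex^'l::finite^'l::finite" where
  "dblk g = (\<chi> i j. g $ Inr i $ Inr j)"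

definition Jform :: "complex^('r::finite+'l::finite)^('r::finite+'l::finite)" where
  "Jform = (\<chi> i j. if i = j then (case i of Inl _ \<Rightarrow> -1 | Inr _ \<Rightarrow> 1) else 0)"

definition SUgrp :: "(complex^('r::finite+'l::finite)^('r::finite+'l::finite)) set" where
  "SUgrp = {g. ctrans g ** Jform ** g = Jform \<and> det g = 1}"

definition Kgrp :: "(complex^('r::finite+'l::finite)^('r::finite+'l::finite)) set" where
  "Kgrp = {g \<in> SUgrp. bblk g = 0 \<and> cblk g = 0}"

definition act :: "complex^('r::finite+'l::finite)^('r::finite+'l::finite) \<Rightarrow> complex^'l::finite^'r::finite \<Rightarrow> complex^'l::finite^'r::finite" where
  "act g z = (ablk g ** z + bblk g) ** matrix_inv (cblk g ** z + dblk g)"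

text \<open>Automorphy factor det(c z + d); for g in G the complex Jacobian is
  J_g(z) = det(c z + d)^(-p), so J_g(z)^(nu/p) = det(c z + d)^(-nu) for integer nu.\<close>
definition jfac :: "complex^('r::finite+'l::finite)^('r::finite+'l::finite) \<Rightarrow> complex^'l::finite^'r::finite \<Rightarrow> complex" where
  "jfac g z = det (cblk g ** z + dblk g)"

definition shilov_measure :: "(complex^'l::finite^'r::finite) measure \<Rightarrow> bool" where
  "shilov_measure \<mu> \<longleftrightarrow> sets \<mu> = sets borel \<and> prob_space \<mu> \<and>
     emeasure \<mu> (Shilov :: (complex^'l::finite^'r::finite) set) = 1 \<and>
     (\<forall>k \<in> (Kgrp :: (complex^('r::finite+'l::finite)^('r::finite+'l::finite)) set). distr \<mu> borel (act k) = \<mu>)"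

definition sph :: "(complex^'l::finite^'r::finite) measure \<Rightarrow> nat \<Rightarrow> complex^'l::finite^'r::finite \<Rightarrow> complex" where
  "sph \<mu> \<sigma> z = integral\<^sup>L \<mu> (\<lambda>v. (hfun z z / (hfun z v * hfun v z)) ^ \<sigma>)"

definition pos_def_on_G :: "(complex^('r::finite+'l::finite)^('r::finite+'l::finite) \<Rightarrow> complex) \<Rightarrow> bool" where
  "pos_def_on_G f \<longleftrightarrow> (\<forall>(n::nat) gs cs. (\<forall>i<n. gs i \<in> (SUgrp :: (complex^('r::finite+'l::finite)^('r::finite+'l::finite)) set)) \<longrightarrow>
     (let s = (\<Sum>i<n. \<Sum>k<n. cs i * cnj (cs k) * f (matrix_inv (gs k) ** gs i))
      in Im s = 0 \<and> 0 \<le> Re s))"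

text \<open>The RKHS on X of a positive kernel K (with K_y(x) = K x y and f(y) = <f, K_y>):
  f belongs iff |sum conj(c_i) f(x_i)|^2 <= C * ||sum c_i K_{x_i}||^2 for some C;
  the squared norm is the least such C. Functions are taken to vanish off X.\<close>
definition rkhs_bound :: "'a set \<Rightarrow> ('a \<Rightarrow> 'a \<Rightarrow> complex) \<Rightarrow> ('a \<Rightarrow> complex) \<Rightarrow> real \<Rightarrow> bool" where
  "rkhs_bound X K f C \<longleftrightarrow> (\<forall>(n::nat) xs cs. (\<forall>i<n. xs i \<in> X) \<longrightarrow>
      (cmod (\<Sum>i<n. cnj (cs i) * f (xs i)))\<^sup>2
        \<le> C * Re (\<Sum>i<n. \<Sum>k<n. cs i * cnj (cs k) * K (xs k) (xs i)))"

definition rkhs :: "'a set \<Rightarrow> ('a \<Rightarrow> 'a \<Rightarrow> complex) \<Rightarrow> ('a \<Rightarrow> complex) set" where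
  "rkhs X K = {f. (\<forall>x. x \<notin> X \<longrightarrow> f x = 0) \<and> (\<exists>C. rkhs_bound X K f C)}"

definition rkhs_norm2 :: "'a set \<Rightarrow> ('a \<Rightarrow> 'a \<Rightarrow> complex) \<Rightarrow> ('a \<Rightarrow> complex) \<Rightarrow> real" where
  "rkhs_norm2 X K f = Inf {C. rkhs_bound X K f C}"

text \<open>Inner product by polarization (linear in the first slot).\<close>
definition rkhs_inner :: "'a set \<Rightarrow> ('a \<Rightarrow> 'a \<Rightarrow> complex) \<Rightarrow> ('a \<Rightarrow> complex) \<Rightarrow> ('a \<Rightarrow> complex) \<Rightarrow> complex" where
  "rkhs_inner X K f g = (1/4) * (\<Sum>k<(4::nat). \<i> ^ k * complex_of_real (rkhs_norm2 X K (\<lambda>x. f x + \<i> ^ k * g x)))"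

definition closed_subspace :: "'a set \<Rightarrow> ('a \<Rightarrow> 'a \<Rightarrow> complex) \<Rightarrow> ('a \<Rightarrow> complex) set \<Rightarrow> bool" where
  "closed_subspace X K V \<longleftrightarrow> V \<subseteq> rkhs X K \<and> (\<lambda>x. 0) \<in> V \<and>
     (\<forall>f\<in>V. \<forall>g\<in>V. (\<lambda>x. f x + g x) \<in> V) \<and>
     (\<forall>f\<in>V. \<forall>c. (\<lambda>x. c * f x) \<in> V) \<and>
     (\<forall>fs f. (\<forall>m. fs m \<in> V) \<and> f \<in> rkhs X K \<and>
          (\<lambda>m. rkhs_norm2 X K (\<lambda>x. f x - fs m x)) \<longlonglongrightarrow> 0 \<longrightarrow> f \<in> V)"

definition DD :: "((complex^'l::finite^'r::finite) \<times> (complex^'l::finite^'r::finite)) set" where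
  "DD = Dom \<times> Dom"

definition tkernel :: "nat \<Rightarrow> ((complex^'l::finite^'r::finite) \<times> (complex^'l::finite^'r::finite)) \<Rightarrow> ((complex^'l::finite^'r::finite) \<times> (complex^'l::finite^'r::finite)) \<Rightarrow> complex" where
  "tkernel \<nu> p q = inverse (hfun (fst p) (fst q) ^ \<nu>) * inverse (hfun (snd q) (snd p) ^ \<nu>)"

text \<open>(pi_nu (x) conj pi_nu)(g,g) F (z, w) = J_{g^-1}(z)^(nu/p) conj(J_{g^-1}(w)^(nu/p)) F(g^-1 z, g^-1 w).\<close>
definition tact :: "nat \<Rightarrow> complex^('r::finite+'l::finite)^('r::finite+'l::finite) \<Rightarrow> ((complex^'l::finite^'r::finite) \<times> (complex^'l::finite^'r::finite) \<Rightarrow> complex)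
    \<Rightarrow> ((complex^'l::finite^'r::finite) \<times> (complex^'l::finite^'r::finite) \<Rightarrow> complex)" where
  "tact \<nu> g F = (\<lambda>(z, w). if (z, w) \<in> DD then
       inverse (jfac (matrix_inv g) z ^ \<nu>) * cnj (inverse (jfac (matrix_inv g) w ^ \<nu>))
         * F (act (matrix_inv g) z, act (matrix_inv g) w)
     else 0)"

definition invariant_closed_subspace :: "nat \<Rightarrow> ((complex^'l::finite^'r::finite) \<times> (complex^'l::finite^'r::finite) \<Rightarrow> complex) set \<Rightarrow> bool" where
  "invariant_closed_subspace \<nu> V \<longleftrightarrow> closed_subspace DD (tkernel \<nu>) V \<and>
     (\<forall>g \<in> (SUgrp :: (complex^('r::finite+'l::finite)^('r::finite+'l::finite)) set). \<forall>F\<in>V. tact \<nu> g F \<in> V)"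

definition irreducible_component :: "nat \<Rightarrow> ((complex^'l::finite^'r::finite) \<times> (complex^'l::finite^'r::finite) \<Rightarrow> complex) set \<Rightarrow> bool" where
  "irreducible_component \<nu> V \<longleftrightarrow> invariant_closed_subspace \<nu> V \<and> V \<noteq> {\<lambda>x. 0} \<and>
     (\<forall>W. invariant_closed_subspace \<nu> W \<and> W \<subseteq> V \<longrightarrow> W = {\<lambda>x. 0} \<or> W = V)"

end

theory Submission
  imports Defs "HOL-Real_Asymp.Real_Asymp"
begin

text \<open>Write \<open>K\<close> for the kernel of the tensor product and put
  \<open>xi = \<integral> K\<^bsub>(v,v)\<^esub> dv\<close>, the average over the Shilov boundary of the boundary kernel functions
  \<open>K\<^bsub>(v,v)\<^esub>(z,w) = h(z,v)\<^sup>-\<^sup>\<nu> h(v,w)\<^sup>-\<^sup>\<nu>\<close>. Its dilations \<open>xi(tz,tw)\<close> with \<open>t < 1\<close> lie in the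
  Hilbert space, with squared norm \<open>\<integral> |h(t\<^sup>2 v,u)|\<^bsup>-2\<nu>\<^esup> dv\<close>. This stays bounded as \<open>t \<rightarrow> 1\<close>: adding the rows of
  \<open>v\<close> one at a time to the determinant multiplies it by \<open>1 - t x\<close> with \<open>x\<close> a coordinate of a vector whose law is
  invariant under a unitary group of large rank, and the moments of \<open>x\<close> decay fast enough because
  \<open>l - r \<ge> 2\<nu>\<close>. Hence \<open>xi\<close> is a vector of the Hilbert space.
  Boundary evaluation gives \<open>\<langle>F, g xi\<rangle> = lim \<integral> |j(g,v)|\<^bsup>-2\<nu>\<^esup> F(t gv, t gv) dv\<close>. A \<open>K\<close>-fixed \<open>F\<close> is constant on
  the pairs \<open>(tv,tv)\<close>, so \<open>\<langle>F, g xi\<rangle>\<close> is \<open>\<langle>F, xi\<rangle>\<close> times a value of the spherical function. With \<open>F = xi\<close> this gives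
  positive definiteness; in general it shows that the \<open>K\<close>-fixed vectors in the closed span of the orbit of \<open>xi\<close>
  are the multiples of \<open>xi\<close>, so this span is irreducible. The reproducing kernel itself is positive definite because
  \<open>1/h(z,w)\<close> is the integral of \<open>(1 - \<langle>zx,wx\<rangle>)\<^sup>-\<^sup>l\<close> over the unit sphere.\<close>

section \<open>Reproducing kernel Hilbert spaces\<close>

text \<open>A point (v,v) with v on the Shilov boundary is not a point of the domain, so evaluation
  there is not given by a vector of the space; only the average over v can be one, and that is where
  the gap between l and r enters. For integers, l - r > 2j - 3 says l - r \<ge> 2\<nu>. When a row
  is added, at least l - r + 1 columns are still free, so the 2n-th absolute moment of the new
  coordinate decays at least like n^(-2\<nu>), while the squared Taylor coefficients of (1 -
  x)^(-\<nu>) grow like n^(2\<nu> - 2). The product is of order n^(-2), uniformly in t. The norm is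
  only given as the least constant in a family of inequalities and the inner product by
  polarization; sesquilinearity, completeness and projections therefore have to be derived from the
  kernel. The group acts naturally on a determinant of size l, whereas h is a determinant of size r.
  The sphere integral that yields positivity equals the inverse of either one, and so also provides
  the transformation law of h. For irreducibility, xi is projected to an invariant subspace: the
  projection is K-fixed, hence a multiple of xi, and the subspace either contains xi or is
  orthogonal to its orbit.\<close>

text \<open>A list of pairs \<open>(c,x)\<close> encodes the combination \<open>comb\<close> of kernel functions \<open>\<Sum> c K\<^sub>x\<close>.
  Then \<open>ev f\<close> is its inner product with \<open>f\<close>, and \<open>qf\<close> is the inner product of two combinations.\<close>

definition ev :: "('a \<Rightarrow> complex) \<Rightarrow> (complex \<times> 'a) list \<Rightarrow> complex" where
  "ev f ps = (\<Sum>(c,x)\<leftarrow>ps. cnj c * f x)"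

definition qf :: "('a \<Rightarrow> 'a \<Rightarrow> complex) \<Rightarrow> (complex \<times> 'a) list \<Rightarrow> (complex \<times> 'a) list \<Rightarrow> complex" where
  "qf K ps qs = (\<Sum>(c,x)\<leftarrow>ps. \<Sum>(d,y)\<leftarrow>qs. c * cnj d * K y x)"

definition sc :: "complex \<Rightarrow> (complex \<times> 'a) list \<Rightarrow> (complex \<times> 'a) list" where
  "sc a ps = map (\<lambda>(c,x). (a * c, x)) ps"

definition comb :: "'a set \<Rightarrow> ('a \<Rightarrow> 'a \<Rightarrow> complex) \<Rightarrow> (complex \<times> 'a) list \<Rightarrow> 'a \<Rightarrow> complex" where
  "comb X K ps = (\<lambda>y. if y \<in> X then (\<Sum>(c,x)\<leftarrow>ps. c * K y x) else 0)"

definition pts :: "'a set \<Rightarrow> (complex \<times> 'a) list \<Rightarrow> bool" where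
  "pts X ps \<longleftrightarrow> snd ` set ps \<subseteq> X"

definition pd_kernel :: "'a set \<Rightarrow> ('a \<Rightarrow> 'a \<Rightarrow> complex) \<Rightarrow> bool" where
  "pd_kernel X K \<longleftrightarrow> (\<forall>x\<in>X. \<forall>y\<in>X. K y x = cnj (K x y)) \<and> (\<forall>ps. pts X ps \<longrightarrow> 0 \<le> Re (qf K ps ps))"

lemma ev_Nil [simp]: "ev f [] = 0" and ev_Cons: "ev f (p # ps) = cnj (fst p) * f (snd p) + ev f ps"
  by (auto simp: ev_def split: prod.splits)

lemma ev_append [simp]: "ev f (ps @ qs) = ev f ps + ev f qs"
  by (simp add: ev_def)

lemma ev_sc [simp]: "ev f (sc a ps) = cnj a * ev f ps"
  by (induction ps) (auto simp: ev_def sc_def algebra_simps)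

lemma ev_add: "ev (\<lambda>x. f x + g x) ps = ev f ps + ev g ps"
  by (induction ps) (auto simp: ev_def algebra_simps)

lemma ev_diff: "ev (\<lambda>x. f x - g x) ps = ev f ps - ev g ps"
  by (induction ps) (auto simp: ev_def algebra_simps)

lemma ev_scale: "ev (\<lambda>x. a * f x) ps = a * ev f ps"
  by (induction ps) (auto simp: ev_def algebra_simps)

lemma qf_Nil [simp]: "qf K [] qs = 0" "qf K ps [] = 0"
proof -
  show "qf K [] qs = 0" by (simp add: qf_def)
  show "qf K ps [] = 0" by (induction ps) (auto simp: qf_def)
qed

lemma qf_append [simp]: "qf K (ps @ ps') qs = qf K ps qs + qf K ps' qs"
  by (simp add: qf_def)

lemma qf_append2 [simp]: "qf K ps (qs @ qs') = qf K ps qs + qf K ps qs'"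
  by (induction ps) (auto simp: qf_def algebra_simps)

lemma qf_sc [simp]: "qf K (sc a ps) qs = a * qf K ps qs"
proof (induction ps)
  case (Cons p ps)
  have "(\<Sum>(d,y)\<leftarrow>qs. a * c * cnj d * K y x) = a * (\<Sum>(d,y)\<leftarrow>qs. c * cnj d * K y x)" for c x
    by (induction qs) (auto simp: algebra_simps)
  with Cons show ?case by (auto simp: qf_def sc_def distrib_left split: prod.split)
qed (simp add: sc_def)

lemma qf_sc2 [simp]: "qf K ps (sc a qs) = cnj a * qf K ps qs"
proof -
  have "(\<Sum>(d,y)\<leftarrow>sc a qs. c * cnj d * K y x) = cnj a * (\<Sum>(d,y)\<leftarrow>qs. c * cnj d * K y x)" for c x
    by (induction qs) (auto simp: sc_def algebra_simps)
  then show ?thesis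
    by (induction ps) (auto simp: qf_def algebra_simps)
qed

lemma pts_simps [simp]: "pts X []" "pts X (ps @ qs) \<longleftrightarrow> pts X ps \<and> pts X qs" "pts X (sc a ps) \<longleftrightarrow> pts X ps"
  "pts X (p # ps) \<longleftrightarrow> snd p \<in> X \<and> pts X ps"
  by (auto simp: pts_def sc_def image_def split_beta)

lemma ev_comb: "pts X qs \<Longrightarrow> ev (comb X K ps) qs = qf K ps qs"
proof (induction qs)
  case (Cons q qs)
  have "qf K ps (q # qs) = qf K ps ([q] @ qs)" by simp
  also have "\<dots> = qf K ps [q] + qf K ps qs" by (rule qf_append2)
  also have "qf K ps [q] = cnj (fst q) * comb X K ps (snd q)"
    using Cons.prems
    by (induction ps) (auto simp: qf_def comb_def algebra_simps split_beta)
  finally show ?case using Cons by (simp add: ev_Cons)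
qed simp

lemma comb_append: "comb X K (ps @ qs) = (\<lambda>x. comb X K ps x + comb X K qs x)"
  by (auto simp: comb_def)

lemma comb_sc: "comb X K (sc a ps) = (\<lambda>x. a * comb X K ps x)"
proof
  fix y show "comb X K (sc a ps) y = a * comb X K ps y"
    by (induction ps) (auto simp: comb_def sc_def algebra_simps)
qed

lemma qf_herm: assumes "pd_kernel X K" "pts X ps" "pts X qs" shows "qf K qs ps = cnj (qf K ps qs)"
proof -
  have 1: "qf K qs [p] = cnj (qf K [p] qs)" if "snd p \<in> X" "pts X qs" for p qs
    using that(2)
  proof (induction qs)
    case (Cons q qs)
    have "K (snd p) (snd q) = cnj (K (snd q) (snd p))" using assms(1) that(1) Cons.prems unfolding pd_kernel_def pts_simps by blast
    then show ?case using Cons by (auto simp: qf_def split_beta)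
  qed simp
  show ?thesis using assms(2)
  proof (induction ps)
    case (Cons p ps)
    have "qf K qs (p # ps) = qf K qs [p] + qf K qs ps" using qf_append2[of K qs "[p]" ps] by simp
    moreover have "qf K (p # ps) qs = qf K [p] qs + qf K ps qs" using qf_append[of K "[p]" ps qs] by simp
    ultimately show ?case using Cons 1[of p qs] assms(3) by simp
  qed simp
qed

lemma qf_real: assumes "pd_kernel X K" "pts X ps" shows "qf K ps ps = of_real (Re (qf K ps ps))" "0 \<le> Re (qf K ps ps)"
proof -
  have "Im (qf K ps ps) = 0" using arg_cong[OF qf_herm[OF assms(1,2,2)], of Im] by simp
  then show "qf K ps ps = of_real (Re (qf K ps ps))" by (simp add: complex_eq_iff)
  show "0 \<le> Re (qf K ps ps)" using assms unfolding pd_kernel_def by blast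
qed

text \<open>The common source of all Cauchy-Schwarz arguments below. A quadratic that is nonnegative
  for every complex z is evaluated at its minimizer \<open>- cnj b / C\<close>; for C = 0 it is
  affine in z, and nonnegativity forces b = 0.\<close>

lemma discriminant_bound:
  fixes b :: complex and A C :: real
  assumes "\<And>z. 0 \<le> A + 2 * Re (z * b) + (cmod z)\<^sup>2 * C" "0 \<le> A" "0 \<le> C"
  shows "(cmod b)\<^sup>2 \<le> A * C"
proof (cases "C = 0")
  case True
  have "b = 0"
  proof (rule ccontr)
    assume "b \<noteq> 0"
    then have pos: "(cmod b)\<^sup>2 > 0" by simp
    \<comment> \<open>With this multiple of \<open>cnj b\<close> the affine function takes the value
      A - 2(A + 1), which is negative.\<close>
    define s where "s = (A + 1) / (cmod b)\<^sup>2"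
    have "0 \<le> A + 2 * Re ((- of_real s * cnj b) * b)"
      using assms(1)[of "- of_real s * cnj b"] True by simp
    moreover have "(- of_real s * cnj b) * b = of_real (- s * (cmod b)\<^sup>2)"
      by (simp add: complex_norm_square del: of_real_power)
    ultimately have "0 \<le> A + 2 * Re (complex_of_real (- s * (cmod b)\<^sup>2))" by metis
    then have "0 \<le> A - 2 * (s * (cmod b)\<^sup>2)" by (simp del: of_real_mult of_real_power)
    also have "s * (cmod b)\<^sup>2 = A + 1" using pos by (simp add: s_def)
    finally show False using assms(2) by simp
  qed
  then show ?thesis using True by simp
next
  case False
  then have C: "C > 0" using assms(3) by simp
  define s where "s = 1 / C"
  have e: "(- of_real s * cnj b) * b = of_real (- s * (cmod b)\<^sup>2)"
    by (simp add: complex_norm_square del: of_real_power)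
  have "0 \<le> A + 2 * Re ((- of_real s * cnj b) * b) + (cmod (- of_real s * cnj b))\<^sup>2 * C"
    by (rule assms(1))
  then have "0 \<le> A - 2 * (s * (cmod b)\<^sup>2) + s\<^sup>2 * (cmod b)\<^sup>2 * C"
    unfolding e by (simp add: norm_mult power_mult_distrib del: of_real_mult of_real_power)
  then have "0 \<le> A - (cmod b)\<^sup>2 / C" using C by (simp add: s_def power2_eq_square)
  then show ?thesis using C by (simp add: field_simps)
qed

lemma qf_CS: assumes "pd_kernel X K" "pts X ps" "pts X qs"
  shows "(cmod (qf K ps qs))\<^sup>2 \<le> Re (qf K ps ps) * Re (qf K qs qs)"
proof (rule discriminant_bound)
  fix z
  have "0 \<le> Re (qf K (ps @ sc (cnj z) qs) (ps @ sc (cnj z) qs))"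
    using assms by (intro qf_real) auto
  also have "qf K (ps @ sc (cnj z) qs) (ps @ sc (cnj z) qs)
     = qf K ps ps + (z * qf K ps qs + cnj (z * qf K ps qs)) + (z * cnj z) * qf K qs qs"
    using qf_herm[OF assms] by (simp add: algebra_simps)
  also have "Re \<dots> = Re (qf K ps ps) + 2 * Re (z * qf K ps qs) + (cmod z)\<^sup>2 * Re (qf K qs qs)"
    unfolding complex_norm_square[symmetric] by (simp del: of_real_power)
  finally show "0 \<le> Re (qf K ps ps) + 2 * Re (z * qf K ps qs) + (cmod z)\<^sup>2 * Re (qf K qs qs)" .
qed (rule qf_real[OF assms(1,2)] qf_real[OF assms(1,3)])+

lemma ev_nat: "ev f (map (\<lambda>i. (cs i, xs i)) [0..<n]) = (\<Sum>i<n. cnj (cs i) * f (xs i))"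
  by (simp add: ev_def interv_sum_list_conv_sum_set_nat o_def atLeast0LessThan)

lemma qf_nat: "qf K (map (\<lambda>i. (cs i, xs i)) [0..<n]) (map (\<lambda>i. (cs i, xs i)) [0..<n])
   = (\<Sum>i<n. \<Sum>k<n. cs i * cnj (cs k) * K (xs k) (xs i))"
  by (simp add: qf_def interv_sum_list_conv_sum_set_nat o_def atLeast0LessThan)

text \<open>Lists can be appended and rescaled, which finite families indexed by an initial segment
  of the naturals do not support directly; from here on the bound is only used in this form.\<close>

lemma rkhs_bound_iff:
  "rkhs_bound X K f C \<longleftrightarrow> (\<forall>ps. pts X ps \<longrightarrow> (cmod (ev f ps))\<^sup>2 \<le> C * Re (qf K ps ps))"
proof
  assume *: "rkhs_bound X K f C"
  show "\<forall>ps. pts X ps \<longrightarrow> (cmod (ev f ps))\<^sup>2 \<le> C * Re (qf K ps ps)"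
  proof (intro allI impI)
    fix ps :: "(complex \<times> 'a) list" assume ps: "pts X ps"
    have e: "ps = map (\<lambda>i. (fst (ps ! i), snd (ps ! i))) [0..<length ps]"
      by (rule nth_equalityI) auto
    have "\<forall>i<length ps. snd (ps ! i) \<in> X" using ps by (auto simp: pts_def)
    with *[unfolded rkhs_bound_def, rule_format, of "length ps" "\<lambda>i. snd (ps ! i)" "\<lambda>i. fst (ps ! i)"]
    have "(cmod (\<Sum>i<length ps. cnj (fst (ps ! i)) * f (snd (ps ! i))))\<^sup>2
        \<le> C * Re (\<Sum>i<length ps. \<Sum>k<length ps. fst (ps ! i) * cnj (fst (ps ! k)) * K (snd (ps ! k)) (snd (ps ! i)))"
      by blast
    then show "(cmod (ev f ps))\<^sup>2 \<le> C * Re (qf K ps ps)"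
      using ev_nat[of f "\<lambda>i. fst (ps ! i)" "\<lambda>i. snd (ps ! i)" "length ps"]
        qf_nat[of K "\<lambda>i. fst (ps ! i)" "\<lambda>i. snd (ps ! i)" "length ps"] unfolding e[symmetric] by metis
  qed
next
  assume *: "\<forall>ps. pts X ps \<longrightarrow> (cmod (ev f ps))\<^sup>2 \<le> C * Re (qf K ps ps)"
  show "rkhs_bound X K f C" unfolding rkhs_bound_def
  proof (intro allI impI)
    fix n :: nat and xs :: "nat \<Rightarrow> 'a" and cs assume "\<forall>i<n. xs i \<in> X"
    then have "pts X (map (\<lambda>i. (cs i, xs i)) [0..<n])" by (auto simp: pts_def)
    with * have "(cmod (ev f (map (\<lambda>i. (cs i, xs i)) [0..<n])))\<^sup>2
      \<le> C * Re (qf K (map (\<lambda>i. (cs i, xs i)) [0..<n]) (map (\<lambda>i. (cs i, xs i)) [0..<n]))" by blast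
    then show "(cmod (\<Sum>i<n. cnj (cs i) * f (xs i)))\<^sup>2
        \<le> C * Re (\<Sum>i<n. \<Sum>k<n. cs i * cnj (cs k) * K (xs k) (xs i))"
      unfolding ev_nat qf_nat .
  qed
qed

text \<open>A point with \<open>K x x\<close> nonzero forces every constant in
  \<open>rkhs_bound\<close> to be nonnegative. For the zero kernel every real C would bound f = 0,
  and the infimum defining the norm would range over a set unbounded below.\<close>

locale rkhs_locale =
  fixes X :: "'a set" and K :: "'a \<Rightarrow> 'a \<Rightarrow> complex"
  assumes pd: "pd_kernel X K" and nz: "\<exists>x\<in>X. K x x \<noteq> 0"
begin

abbreviation "H \<equiv> rkhs X K"
abbreviation "N \<equiv> rkhs_norm2 X K"
abbreviation "q ps \<equiv> Re (qf K ps ps)"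
abbreviation "cmb \<equiv> comb X K"

lemma q_nonneg: "pts X ps \<Longrightarrow> 0 \<le> q ps"
  using qf_real[OF pd] by blast

lemma bound_nonneg: assumes "rkhs_bound X K f C" shows "0 \<le> C"
proof -
  obtain x where x: "x \<in> X" "K x x \<noteq> 0" using nz by blast
  have p: "pts X [(1,x)]" using x by simp
  have "qf K [(1,x)] [(1,x)] = K x x" by (simp add: qf_def)
  then have "q [(1,x)] > 0" using qf_real[OF pd p] x by (metis of_real_0 less_eq_real_def)
  moreover have "0 \<le> C * q [(1,x)]"
    using assms p unfolding rkhs_bound_iff by (meson order_trans zero_le_power2)
  ultimately show ?thesis by (simp add: zero_le_mult_iff)
qed

lemma N_le: "rkhs_bound X K f C \<Longrightarrow> N f \<le> C"
  unfolding rkhs_norm2_def using bound_nonneg by (intro cInf_lower bdd_belowI[of _ 0]) auto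

lemma HI: "rkhs_bound X K f C \<Longrightarrow> (\<And>x. x \<notin> X \<Longrightarrow> f x = 0) \<Longrightarrow> f \<in> H"
  unfolding rkhs_def by blast

lemma H_off: "f \<in> H \<Longrightarrow> x \<notin> X \<Longrightarrow> f x = 0"
  unfolding rkhs_def by blast

lemma N_nonneg: assumes "f \<in> H" shows "0 \<le> N f"
  using assms bound_nonneg unfolding rkhs_norm2_def rkhs_def by (intro cInf_greatest) auto

text \<open>The infimum is attained: if the quadratic form vanishes at \<open>ps\<close>, the
  inequality does not involve C; otherwise dividing by it gives a lower bound of all admissible
  C.\<close>

lemma bound_N: assumes "f \<in> H" shows "rkhs_bound X K f (N f)"
  unfolding rkhs_bound_iff
proof (intro allI impI)
  fix ps assume ps: "pts X ps"
  obtain C where C: "rkhs_bound X K f C" using assms unfolding rkhs_def by blast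
  show "(cmod (ev f ps))\<^sup>2 \<le> N f * q ps"
  proof (cases "q ps = 0")
    case True
    then show ?thesis using C ps unfolding rkhs_bound_iff by fastforce
  next
    case False
    then have pos: "q ps > 0" using q_nonneg[OF ps] by simp
    have "(cmod (ev f ps))\<^sup>2 / q ps \<le> N f"
      unfolding rkhs_norm2_def
      by (intro cInf_greatest) (use C ps pos in \<open>auto simp: rkhs_bound_iff divide_simps\<close>)
    then show ?thesis using pos by (simp add: field_simps)
  qed
qed

lemma ev_bound: "f \<in> H \<Longrightarrow> pts X ps \<Longrightarrow> (cmod (ev f ps))\<^sup>2 \<le> N f * q ps"
  using bound_N unfolding rkhs_bound_iff by blast

text \<open>Cauchy-Schwarz for \<open>qf\<close> gives the upper bound of the norm, and testing with
  \<open>ps\<close> itself gives the lower one.\<close>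

lemma comb_H: assumes "pts X ps" shows "cmb ps \<in> H" "N (cmb ps) = q ps"
proof -
  have b: "rkhs_bound X K (cmb ps) (q ps)"
    unfolding rkhs_bound_iff using qf_CS[OF pd assms] by (simp add: ev_comb)
  then show 1: "cmb ps \<in> H" by (rule HI) (simp add: comb_def)
  have "(q ps)\<^sup>2 \<le> (cmod (qf K ps ps))\<^sup>2" using power_mono[OF abs_Re_le_cmod[of "qf K ps ps"], of 2] by simp
  also have "\<dots> \<le> N (cmb ps) * q ps"
    using ev_bound[OF 1 assms] by (simp add: ev_comb[OF assms])
  finally have "q ps \<le> N (cmb ps)"
    using q_nonneg[OF assms] N_nonneg[OF 1] by (cases "q ps = 0") (auto simp: power2_eq_square)
  with N_le[OF b] show "N (cmb ps) = q ps" by simp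
qed

text \<open>Half of the expansion of the squared norm of a sum, at a stage where no inner product
  exists and \<open>ev f ps\<close> stands in for it. The fact \<open>nn\<close> is the
  nonnegativity of the expected squared norm; applied to \<open>ps\<close> enlarged by a multiple of
  \<open>qs\<close>, it is a quadratic in that multiple, and its discriminant is the bound asked
  for.\<close>

lemma add_comb_le:
  assumes f: "f \<in> H" and ps: "pts X ps"
  shows "(\<lambda>x. f x + cmb ps x) \<in> H" "N (\<lambda>x. f x + cmb ps x) \<le> N f + 2 * Re (ev f ps) + q ps"
proof -
  have nn: "0 \<le> N f + 2 * Re (ev f qs) + q qs" if "pts X qs" for qs
  proof -
    have "\<bar>Re (ev f qs)\<bar> \<le> cmod (ev f qs)" by (rule abs_Re_le_cmod)
    also have "\<dots> \<le> sqrt (N f * q qs)" using ev_bound[OF f that] by (simp add: real_le_rsqrt)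
    also have "\<dots> \<le> (N f + q qs) / 2"
      using arith_geo_mean_sqrt[OF N_nonneg[OF f] q_nonneg[OF that]] .
    finally have "- Re (ev f qs) \<le> (N f + q qs) / 2" by (simp add: abs_le_iff)
    then show ?thesis by (simp add: field_simps)
  qed
  have "rkhs_bound X K (\<lambda>x. f x + cmb ps x) (N f + 2 * Re (ev f ps) + q ps)"
    unfolding rkhs_bound_iff
  proof (intro allI impI discriminant_bound)
    fix qs z assume qs: "pts X qs"
    let ?r = "ps @ sc (cnj z) qs"
    have "0 \<le> N f + 2 * Re (ev f ?r) + q ?r" by (rule nn) (use ps qs in simp)
    also have "q ?r = Re (qf K ps ps + (z * qf K ps qs + cnj (z * qf K ps qs)) + (z * cnj z) * qf K qs qs)"
      using qf_herm[OF pd ps qs] by (simp add: algebra_simps)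
    also have "\<dots> = q ps + 2 * Re (z * qf K ps qs) + (cmod z)\<^sup>2 * q qs"
      unfolding complex_norm_square[symmetric] by (simp del: of_real_power)
    finally show "0 \<le> N f + 2 * Re (ev f ps) + q ps + 2 * Re (z * ev (\<lambda>x. f x + cmb ps x) qs) + (cmod z)\<^sup>2 * q qs"
      by (simp add: ev_add ev_comb[OF qs] algebra_simps)
  qed (use nn[OF ps] q_nonneg in auto)
  then show "(\<lambda>x. f x + cmb ps x) \<in> H" "N (\<lambda>x. f x + cmb ps x) \<le> N f + 2 * Re (ev f ps) + q ps"
    using H_off[OF f] N_le by (auto intro!: HI simp: comb_def)
qed

lemma cmb_minus: "cmb (sc (-1) ps) = (\<lambda>x. - cmb ps x)"
  by (simp add: comb_sc)

text \<open>The upper bound is used twice, the second time to subtract the combination again; this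
  yields the missing lower bound.\<close>

lemma N_add_comb:
  assumes f: "f \<in> H" and ps: "pts X ps"
  shows "N (\<lambda>x. f x + cmb ps x) = N f + 2 * Re (ev f ps) + q ps"
proof -
  let ?g = "\<lambda>x. f x + cmb ps x"
  have g: "?g \<in> H" by (rule add_comb_le[OF assms])
  have "N (\<lambda>x. ?g x + cmb (sc (-1) ps) x) \<le> N ?g + 2 * Re (ev ?g (sc (-1) ps)) + q (sc (-1) ps)"
    by (rule add_comb_le[OF g]) (use ps in simp)
  then have "N f \<le> N ?g - 2 * Re (ev f ps) - 2 * q ps + q ps"
    by (simp add: cmb_minus ev_add ev_comb[OF ps])
  then show ?thesis using add_comb_le(2)[OF assms] by simp
qed

lemma H_add: assumes "f \<in> H" "g \<in> H"
  shows "(\<lambda>x. f x + g x) \<in> H" "sqrt (N (\<lambda>x. f x + g x)) \<le> sqrt (N f) + sqrt (N g)"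
proof -
  have b: "rkhs_bound X K (\<lambda>x. f x + g x) ((sqrt (N f) + sqrt (N g))\<^sup>2)"
    unfolding rkhs_bound_iff
  proof (intro allI impI)
    fix ps assume ps: "pts X ps"
    have 1: "cmod (ev f ps) \<le> sqrt (N f) * sqrt (q ps)" if "f \<in> H" for f
      using ev_bound[OF that ps] by (metis real_le_rsqrt real_sqrt_mult)
    have "cmod (ev (\<lambda>x. f x + g x) ps) \<le> cmod (ev f ps) + cmod (ev g ps)"
      unfolding ev_add by (rule norm_triangle_ineq)
    also have "\<dots> \<le> (sqrt (N f) + sqrt (N g)) * sqrt (q ps)"
      using 1[OF assms(1)] 1[OF assms(2)] by (simp add: algebra_simps)
    finally have "(cmod (ev (\<lambda>x. f x + g x) ps))\<^sup>2 \<le> ((sqrt (N f) + sqrt (N g)) * sqrt (q ps))\<^sup>2"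
      by (intro power_mono) auto
    then show "(cmod (ev (\<lambda>x. f x + g x) ps))\<^sup>2 \<le> (sqrt (N f) + sqrt (N g))\<^sup>2 * q ps"
      using q_nonneg[OF ps] by (simp add: power_mult_distrib)
  qed
  show "(\<lambda>x. f x + g x) \<in> H" by (intro HI[OF b]) (simp add: H_off[OF assms(1)] H_off[OF assms(2)])
  show "sqrt (N (\<lambda>x. f x + g x)) \<le> sqrt (N f) + sqrt (N g)"
    using N_le[OF b] N_nonneg[OF assms(1)] N_nonneg[OF assms(2)] by (intro real_le_lsqrt) auto
qed

lemma H_scale: assumes "f \<in> H"
  shows "(\<lambda>x. a * f x) \<in> H" "N (\<lambda>x. a * f x) = (cmod a)\<^sup>2 * N f"
proof -
  have *: "rkhs_bound X K (\<lambda>x. a * f x) ((cmod a)\<^sup>2 * N f)" if "f \<in> H" for f a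
    unfolding rkhs_bound_iff
    using ev_bound[OF that] by (auto simp: ev_scale norm_mult power_mult_distrib mult.assoc intro: mult_left_mono)
  show 1: "(\<lambda>x. a * f x) \<in> H" using assms H_off by (intro HI[OF *[OF assms]]) auto
  show "N (\<lambda>x. a * f x) = (cmod a)\<^sup>2 * N f"
  proof (cases "a = 0")
    case True
    have "N (\<lambda>x. a * f x) \<le> 0" using N_le[OF *[OF assms, of a]] True by simp
    then show ?thesis using N_nonneg[OF 1] True by simp
  next
    case False
    have "N (\<lambda>x. inverse a * (a * f x)) \<le> (cmod (inverse a))\<^sup>2 * N (\<lambda>x. a * f x)"
      by (rule N_le[OF *[OF 1]])
    then have "N f \<le> inverse ((cmod a)\<^sup>2) * N (\<lambda>x. a * f x)"
      using False by (simp add: mult.assoc[symmetric] norm_inverse power_inverse)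
    then have "N f \<le> N (\<lambda>x. a * f x) / (cmod a)\<^sup>2"
      by (simp add: divide_inverse mult.commute)
    then show ?thesis using N_le[OF *[OF assms, of a]] False by (simp add: field_simps)
  qed
qed

lemma H_diff: assumes "f \<in> H" "g \<in> H" shows "(\<lambda>x. f x - g x) \<in> H"
  using H_add(1)[OF assms(1) H_scale(1)[OF assms(2), of "-1"]] by simp

lemma N_minus: "f \<in> H \<Longrightarrow> g \<in> H \<Longrightarrow> N (\<lambda>x. f x - g x) = N (\<lambda>x. g x - f x)"
  using H_scale(2)[of "\<lambda>x. f x - g x" "-1"] H_diff by simp

lemma comb_Nil: "cmb [] = (\<lambda>x. 0)"
  by (rule ext) (simp add: comb_def)

lemma zero_H: "(\<lambda>x. 0) \<in> H" "N (\<lambda>x. 0) = 0"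
  using comb_H[of "[]"] by (simp_all add: comb_Nil)

lemma pt_bound: assumes "f \<in> H" "x \<in> X" shows "(cmod (f x))\<^sup>2 \<le> N f * Re (K x x)"
  using ev_bound[OF assms(1), of "[(1,x)]"] assms(2) by (simp add: ev_def qf_def)

lemma N_eq0: assumes "f \<in> H" "N f = 0" shows "f = (\<lambda>x. 0)"
proof
  fix x show "f x = 0" using pt_bound[OF assms(1), of x] assms(2) H_off[OF assms(1), of x] by (cases "x \<in> X") auto
qed

lemma N_cont: assumes "f \<in> H" "g \<in> H"
  shows "\<bar>sqrt (N f) - sqrt (N g)\<bar> \<le> sqrt (N (\<lambda>x. f x - g x))"
  using H_add(2)[OF H_diff[OF assms] assms(2)] H_add(2)[OF H_diff[OF assms(2,1)] assms(1)] N_minus[OF assms]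
  by simp

lemma N_tendsto:
  assumes "\<And>n. fs n \<in> H" "f \<in> H" "(\<lambda>n. N (\<lambda>x. f x - fs n x)) \<longlonglongrightarrow> 0"
  shows "(\<lambda>n. N (fs n)) \<longlonglongrightarrow> N f"
proof -
  have "(\<lambda>n. sqrt (N (\<lambda>x. f x - fs n x))) \<longlonglongrightarrow> 0" using tendsto_real_sqrt[OF assms(3)] by simp
  then have "(\<lambda>n. sqrt (N (fs n)) - sqrt (N f)) \<longlonglongrightarrow> 0"
    by (rule Lim_null_comparison[rotated])
       (use N_cont[OF assms(1,2)] N_minus[OF assms(1,2)] in \<open>auto intro!: always_eventually\<close>)
  then have "(\<lambda>n. sqrt (N (fs n))) \<longlonglongrightarrow> sqrt (N f)" by (simp add: LIM_zero_iff)
  from tendsto_power[OF this, of 2] have "(\<lambda>n. (sqrt (N (fs n)))\<^sup>2) \<longlonglongrightarrow> (sqrt (N f))\<^sup>2" .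
  moreover have "(\<lambda>n. (sqrt (N (fs n)))\<^sup>2) = (\<lambda>n. N (fs n))" "(sqrt (N f))\<^sup>2 = N f"
    using N_nonneg[OF assms(1)] N_nonneg[OF assms(2)] by auto
  ultimately show ?thesis by metis
qed

text \<open>Since no constant below \<open>N f\<close> is a bound, some combination almost attains
  it. Such a combination is nearly parallel to f, and a suitable multiple of it is close to f by
  \<open>N_add_comb\<close>.\<close>

lemma comb_dense: assumes f: "f \<in> H" and e: "e > 0" shows "\<exists>ps. pts X ps \<and> N (\<lambda>x. f x - cmb ps x) < e"
proof (cases "N f = 0")
  case True
  then show ?thesis using e by (intro exI[of _ "[]"]) (simp add: comb_Nil)
next
  case False
  define n where "n = N f"
  have n: "n > 0" using False N_nonneg[OF f] by (simp add: n_def)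
  \<comment> \<open>The estimate n^2 / (n - d) \<le> n + 2d holds for d \<le> n/2, and the final
    error is 2d, which must stay below e.\<close>
  define d where "d = min (n/2) (e/4)"
  have d: "0 < d" "d < n" "2 * d < e" using n e by (auto simp: d_def min_def)
  have "\<not> rkhs_bound X K f (n - d)"
    using N_le[of f "n - d"] d by (auto simp: n_def)
  then obtain ps where ps: "pts X ps" and big: "(n - d) * q ps < (cmod (ev f ps))\<^sup>2"
    unfolding rkhs_bound_iff by (auto simp: not_le)
  have q0: "q ps \<noteq> 0"
    using ev_bound[OF f ps] big by auto
  then have qp: "q ps > 0" using q_nonneg[OF ps] by simp
  define w where "w = ev f ps"
  have w0: "w \<noteq> 0" using big d qp unfolding w_def by (auto simp: mult_pos_pos not_less)
       (metis diff_gt_0_iff_gt less_asym mult_pos_pos)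
  have w1: "(n - d) * q ps < (cmod w)\<^sup>2" "(cmod w)\<^sup>2 \<le> n * q ps"
    using big ev_bound[OF f ps] by (auto simp: w_def n_def)
  \<comment> \<open>The multiple for which the pairing of f with the rescaled combination equals
    exactly n, the squared norm of f.\<close>
  define a where "a = w * of_real (n / (cmod w)\<^sup>2)"
  have ca: "(cmod a)\<^sup>2 = n\<^sup>2 / (cmod w)\<^sup>2"
    using w0 n by (simp add: a_def norm_mult power_mult_distrib norm_divide norm_power power2_eq_square)
  have "cnj a * w = of_real (n / (cmod w)\<^sup>2) * (w * cnj w)" by (simp add: a_def)
  also have "\<dots> = of_real n" unfolding complex_norm_square[symmetric] using w0 by (simp flip: of_real_mult of_real_power of_real_divide)
  finally have e1: "cnj a * w = of_real n" .
  let ?r = "sc (- a) ps"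
  have "N (\<lambda>x. f x + cmb ?r x) = n + 2 * Re (ev f ?r) + q ?r"
    using N_add_comb[OF f] ps by (simp add: n_def)
  also have "Re (ev f ?r) = - n" using e1 by (simp add: w_def)
  also have "qf K ?r ?r = (a * cnj a) * qf K ps ps" by simp
  also have "Re \<dots> = n\<^sup>2 / (cmod w)\<^sup>2 * q ps" unfolding complex_norm_square[symmetric] ca[symmetric]
    by (simp del: of_real_power)
  also have "n + 2 * - n + n\<^sup>2 / (cmod w)\<^sup>2 * q ps < e"
  proof -
    have "n\<^sup>2 / (cmod w)\<^sup>2 * q ps \<le> n\<^sup>2 / ((n - d) * q ps) * q ps"
      using w1 d qp w0 by (intro mult_right_mono divide_left_mono mult_pos_pos) auto
    also have "\<dots> = n\<^sup>2 / (n - d)" using qp by simp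
    also have "\<dots> \<le> n + 2 * d"
    proof -
      have "n / 2 \<le> n - d" by (simp add: d_def)
      then have "d * (n / 2) \<le> d * (n - d)" using d by (intro mult_left_mono) auto
      then have "n\<^sup>2 \<le> (n + 2 * d) * (n - d)"
        by (simp add: algebra_simps power2_eq_square)
      then show ?thesis using d by (simp add: pos_divide_le_eq)
    qed
    finally show ?thesis using d by simp
  qed
  finally have "N (\<lambda>x. f x + cmb ?r x) < e" .
  moreover have "cmb ?r = (\<lambda>x. - cmb (sc a ps) x)" by (simp add: comb_sc)
  ultimately have "N (\<lambda>x. f x - cmb (sc a ps) x) < e" by simp
  then show ?thesis using ps by (intro exI[of _ "sc a ps"]) simp
qed

lemma comb_dense_seq: assumes f: "f \<in> H"
  obtains P where "\<And>n. pts X (P n)" "(\<lambda>n. N (\<lambda>x. f x - cmb (P n) x)) \<longlonglongrightarrow> 0"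
proof -
  have "\<forall>n. \<exists>ps. pts X ps \<and> N (\<lambda>x. f x - cmb ps x) < 1 / real (Suc n)"
    using comb_dense[OF f] by simp
  then obtain P where P: "\<And>n. pts X (P n)" "\<And>n. N (\<lambda>x. f x - cmb (P n) x) < 1 / real (Suc n)" by metis
  have "(\<lambda>n. 1 / real (Suc n)) \<longlonglongrightarrow> 0" by real_asymp
  then have "(\<lambda>n. N (\<lambda>x. f x - cmb (P n) x)) \<longlonglongrightarrow> 0"
    by (rule tendsto_0_le[where K = 1])
       (use P N_nonneg[OF H_diff[OF f comb_H(1)[OF P(1)]]] in \<open>auto intro!: always_eventually simp: less_imp_le\<close>)
  with P that show ?thesis by blast
qed

end

section \<open>Inner product by polarization, completeness and orthogonal projection\<close>

context rkhs_locale begin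

abbreviation "ip \<equiv> rkhs_inner X K"

lemma ip_expand: "ip f g = (of_real (N (\<lambda>x. f x + g x)) + \<i> * of_real (N (\<lambda>x. f x + \<i> * g x))
   - of_real (N (\<lambda>x. f x - g x)) - \<i> * of_real (N (\<lambda>x. f x - \<i> * g x))) / 4"
proof -
  have "{..<4::nat} = {0,1,2,3}" by auto
  then show ?thesis unfolding rkhs_inner_def by (simp add: power3_eq_cube)
qed

text \<open>The reproducing property, read off from the norm expansion. It anchors the polarization
  formula: linearity in the first slot is evident for \<open>ev\<close> and passes to arbitrary
  second arguments by density.\<close>

lemma ip_comb: assumes f: "f \<in> H" and ps: "pts X ps" shows "ip f (cmb ps) = ev f ps"
proof -
  have *: "N (\<lambda>x. f x + a * cmb ps x) = N f + 2 * Re (cnj a * ev f ps) + (cmod a)\<^sup>2 * q ps" for a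
  proof -
    have "qf K (sc a ps) (sc a ps) = (a * cnj a) * qf K ps ps" by simp
    then have "q (sc a ps) = (cmod a)\<^sup>2 * q ps"
      unfolding complex_norm_square[symmetric] by (simp del: of_real_power qf_sc qf_sc2)
    then show ?thesis
      using N_add_comb[OF f, of "sc a ps"] ps by (simp add: comb_sc)
  qed
  show ?thesis
    unfolding ip_expand using *[of 1] *[of "\<i>"] *[of "-1"] *[of "-\<i>"] by (simp add: complex_eq_iff)
qed

lemma ip_tendsto:
  assumes f: "f \<in> H" and g: "g \<in> H" "\<And>n. gs n \<in> H" "(\<lambda>n. N (\<lambda>x. g x - gs n x)) \<longlonglongrightarrow> 0"
  shows "(\<lambda>n. ip f (gs n)) \<longlonglongrightarrow> ip f g"
proof -
  have *: "(\<lambda>n. N (\<lambda>x. f x + a * gs n x)) \<longlonglongrightarrow> N (\<lambda>x. f x + a * g x)" for a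
  proof (rule N_tendsto)
    have "N (\<lambda>x. f x + a * g x - (f x + a * gs n x)) = (cmod a)\<^sup>2 * N (\<lambda>x. g x - gs n x)" for n
      using H_scale(2)[OF H_diff[OF g(1) g(2)[of n]], of a] by (simp add: algebra_simps)
    then show "(\<lambda>n. N (\<lambda>x. f x + a * g x - (f x + a * gs n x))) \<longlonglongrightarrow> 0"
      using tendsto_mult_left[OF g(3), of "(cmod a)\<^sup>2"] by simp
  qed (use f g H_add H_scale in auto)
  show ?thesis
    unfolding ip_expand using *[of 1] *[of "\<i>"] *[of "-1"] *[of "-\<i>"]
    by (intro tendsto_intros) auto
qed

lemma ip_add: assumes "f \<in> H" "f' \<in> H" "g \<in> H" shows "ip (\<lambda>x. f x + f' x) g = ip f g + ip f' g"
proof -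
  obtain P where P: "\<And>n. pts X (P n)" "(\<lambda>n. N (\<lambda>x. g x - cmb (P n) x)) \<longlonglongrightarrow> 0"
    using comb_dense_seq[OF assms(3)] by blast
  have L: "(\<lambda>n. ip f (cmb (P n))) \<longlonglongrightarrow> ip f g" if "f \<in> H" for f
    using ip_tendsto[OF that assms(3) _ P(2)] comb_H P(1) by blast
  have "(\<lambda>n. ip f (cmb (P n)) + ip f' (cmb (P n))) \<longlonglongrightarrow> ip f g + ip f' g"
    by (intro tendsto_add L assms)
  moreover have "ip f (cmb (P n)) + ip f' (cmb (P n)) = ip (\<lambda>x. f x + f' x) (cmb (P n))" for n
    using assms H_add P(1) by (simp add: ip_comb ev_add)
  ultimately show ?thesis
    using LIMSEQ_unique[OF L[OF H_add(1)[OF assms(1,2)]]] by simp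
qed

lemma ip_scale: assumes "f \<in> H" "g \<in> H" shows "ip (\<lambda>x. a * f x) g = a * ip f g"
proof -
  obtain P where P: "\<And>n. pts X (P n)" "(\<lambda>n. N (\<lambda>x. g x - cmb (P n) x)) \<longlonglongrightarrow> 0"
    using comb_dense_seq[OF assms(2)] by blast
  have L: "(\<lambda>n. ip f (cmb (P n))) \<longlonglongrightarrow> ip f g" if "f \<in> H" for f
    using ip_tendsto[OF that assms(2) _ P(2)] comb_H P(1) by blast
  have "(\<lambda>n. a * ip f (cmb (P n))) \<longlonglongrightarrow> a * ip f g"
    by (intro tendsto_intros L assms)
  moreover have "a * ip f (cmb (P n)) = ip (\<lambda>x. a * f x) (cmb (P n))" for n
    using assms H_scale P(1) by (simp add: ip_comb ev_scale)
  ultimately show ?thesis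
    using LIMSEQ_unique[OF L[OF H_scale(1)[OF assms(1)]]] by simp
qed

lemma ip_cnj: assumes "f \<in> H" "g \<in> H" shows "ip g f = cnj (ip f g)"
proof -
  have s: "N (\<lambda>x. a * (f x + b * g x)) = (cmod a)\<^sup>2 * N (\<lambda>x. f x + b * g x)" for a b
    by (rule H_scale(2)) (intro H_add H_scale assms)
  have "N (\<lambda>x. g x + f x) = N (\<lambda>x. f x + g x)" by (simp add: add.commute)
  moreover have "N (\<lambda>x. g x + \<i> * f x) = N (\<lambda>x. f x - \<i> * g x)"
    using s[of "\<i>" "-\<i>"] by (simp add: algebra_simps)
  moreover have "N (\<lambda>x. g x - f x) = N (\<lambda>x. f x - g x)" by (rule N_minus[OF assms(2,1)])
  moreover have "N (\<lambda>x. g x - \<i> * f x) = N (\<lambda>x. f x + \<i> * g x)"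
    using s[of "-\<i>" "\<i>"] by (simp add: algebra_simps)
  ultimately show ?thesis unfolding ip_expand by (simp add: complex_eq_iff)
qed

lemma ip_self: assumes "f \<in> H" shows "ip f f = of_real (N f)"
proof -
  have s: "N (\<lambda>x. f x + b * f x) = (cmod (1 + b))\<^sup>2 * N f" for b
    using H_scale(2)[OF assms, of "1 + b"] by (simp add: algebra_simps)
  show ?thesis unfolding ip_expand
    using s[of 1] s[of "\<i>"] s[of "-1"] s[of "-\<i>"] by (simp add: cmod_power2 complex_eq_iff)
qed

lemma ip_add2: assumes "f \<in> H" "f' \<in> H" "g \<in> H" shows "ip g (\<lambda>x. f x + f' x) = ip g f + ip g f'"
  unfolding ip_cnj[OF H_add(1)[OF assms(1,2)] assms(3)] ip_add[OF assms] ip_cnj[OF assms(1,3)] ip_cnj[OF assms(2,3)]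
  by (rule complex_cnj_add)

lemma ip_scale2: assumes "f \<in> H" "g \<in> H" shows "ip g (\<lambda>x. a * f x) = cnj a * ip g f"
  unfolding ip_cnj[OF H_scale(1)[OF assms(1)] assms(2)] ip_scale[OF assms] ip_cnj[OF assms] by (rule complex_cnj_mult)

lemma ip_diff: assumes "f \<in> H" "f' \<in> H" "g \<in> H" shows "ip (\<lambda>x. f x - f' x) g = ip f g - ip f' g"
  using ip_add[OF assms(1) H_scale(1)[OF assms(2), of "-1"] assms(3)] ip_scale[OF assms(2,3), of "-1"] by simp

lemma ip_diff2: assumes "f \<in> H" "f' \<in> H" "g \<in> H" shows "ip g (\<lambda>x. f x - f' x) = ip g f - ip g f'"
  using ip_add2[OF assms(1) H_scale(1)[OF assms(2), of "-1"] assms(3)] ip_scale2[OF assms(2,3), of "-1"] by simp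

lemma N_add: assumes "f \<in> H" "g \<in> H"
  shows "N (\<lambda>x. f x + z * g x) = N f + 2 * Re (cnj z * ip f g) + (cmod z)\<^sup>2 * N g"
proof -
  let ?h = "\<lambda>x. f x + z * g x"
  have zg: "(\<lambda>x. z * g x) \<in> H" by (rule H_scale(1)[OF assms(2)])
  have h: "?h \<in> H" by (rule H_add(1)[OF assms(1) zg])
  have "of_real (N ?h) = ip ?h ?h" by (rule ip_self[OF h, symmetric])
  also have "\<dots> = ip f f + cnj z * ip f g + z * cnj (ip f g) + z * cnj z * ip g g"
    unfolding ip_add[OF assms(1) zg h] ip_add2[OF assms(1) zg assms(1)] ip_add2[OF assms(1) zg zg]
      ip_scale2[OF assms(2,1)] ip_scale[OF assms(2,1)] ip_scale[OF assms(2) zg] ip_scale2[OF assms(2,2)] ip_cnj[OF assms]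
    by (simp add: algebra_simps)
  also have "\<dots> = of_real (N f + 2 * Re (cnj z * ip f g) + (cmod z)\<^sup>2 * N g)"
    unfolding complex_norm_square[symmetric] ip_self[OF assms(1)] ip_self[OF assms(2)]
    by (simp add: complex_eq_iff)
  finally show ?thesis using of_real_eq_iff by blast
qed

lemma ip_CS: assumes "f \<in> H" "g \<in> H" shows "(cmod (ip f g))\<^sup>2 \<le> N f * N g"
proof (rule discriminant_bound)
  fix z
  have "0 \<le> N (\<lambda>x. f x + cnj z * g x)" by (intro N_nonneg H_add H_scale assms)
  then show "0 \<le> N f + 2 * Re (z * ip f g) + (cmod z)\<^sup>2 * N g"
    unfolding N_add[OF assms] by simp
qed (use N_nonneg assms in auto)

lemma parallelogram: assumes "f \<in> H" "g \<in> H"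
  shows "N (\<lambda>x. f x + g x) + N (\<lambda>x. f x - g x) = 2 * N f + 2 * N g"
  using N_add[OF assms, of 1] N_add[OF assms, of "-1"] by simp

lemma ev_tendsto:
  assumes "pts X ps" "\<And>x. x \<in> X \<Longrightarrow> (\<lambda>n. fs n x) \<longlonglongrightarrow> f x"
  shows "(\<lambda>n. ev (fs n) ps) \<longlonglongrightarrow> ev f ps"
  using assms(1)
proof (induction ps)
  case (Cons p ps)
  then show ?case unfolding ev_Cons by (intro tendsto_intros assms(2)) auto
qed simp

text \<open>Each instance of the defining inequality involves finitely many values of f, so it
  survives pointwise limits. This is lower semicontinuity of the norm.\<close>

lemma limit_bound:
  assumes "\<And>n. fs n \<in> H" "\<And>n. N (fs n) \<le> C" "\<And>x. x \<in> X \<Longrightarrow> (\<lambda>n. fs n x) \<longlonglongrightarrow> f x"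
    "\<And>x. x \<notin> X \<Longrightarrow> f x = 0"
  shows "f \<in> H" "N f \<le> C"
proof -
  have b: "rkhs_bound X K f C" unfolding rkhs_bound_iff
  proof (intro allI impI)
    fix ps assume ps: "pts X ps"
    show "(cmod (ev f ps))\<^sup>2 \<le> C * q ps"
    proof (rule LIMSEQ_le_const2)
      show "(\<lambda>n. (cmod (ev (fs n) ps))\<^sup>2) \<longlonglongrightarrow> (cmod (ev f ps))\<^sup>2"
        by (intro tendsto_intros ev_tendsto ps assms)
      show "\<exists>M. \<forall>n\<ge>M. (cmod (ev (fs n) ps))\<^sup>2 \<le> C * q ps"
        using ev_bound[OF assms(1) ps] mult_right_mono[OF assms(2) q_nonneg[OF ps]] order_trans by blast
    qed
  qed
  show "f \<in> H" by (rule HI[OF b assms(4)])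
  show "N f \<le> C" by (rule N_le[OF b])
qed

text \<open>Point evaluations are bounded, so a Cauchy sequence converges pointwise;
  \<open>limit_bound\<close> applied to the differences of late members turns this into convergence
  in norm.\<close>

lemma H_complete:
  assumes fs: "\<And>n. fs n \<in> H" and C: "\<And>e. e > 0 \<Longrightarrow> \<exists>M. \<forall>m\<ge>M. \<forall>n\<ge>M. N (\<lambda>x. fs m x - fs n x) \<le> e"
  shows "\<exists>f\<in>H. (\<lambda>n. N (\<lambda>x. f x - fs n x)) \<longlonglongrightarrow> 0"
proof -
  have "Cauchy (\<lambda>n. fs n x)" if x: "x \<in> X" for x
    unfolding Cauchy_altdef2
  proof (intro allI impI)
    fix e :: real assume e: "e > 0"
    define k where "k = \<bar>Re (K x x)\<bar> + 1"
    have k: "k > 0" "Re (K x x) \<le> k" by (auto simp: k_def)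
    have "(e/2)\<^sup>2 / k > 0" using e k by simp
    from C[OF this] obtain M where M: "\<And>m n. m \<ge> M \<Longrightarrow> n \<ge> M \<Longrightarrow> N (\<lambda>x. fs m x - fs n x) \<le> (e/2)\<^sup>2 / k"
      by blast
    have "dist (fs n x) (fs M x) < e" if "n \<ge> M" for n
    proof -
      have d: "(\<lambda>x. fs n x - fs M x) \<in> H" by (intro H_diff fs)
      have "(cmod (fs n x - fs M x))\<^sup>2 \<le> N (\<lambda>x. fs n x - fs M x) * Re (K x x)"
        using pt_bound[OF d x] .
      also have "\<dots> \<le> N (\<lambda>x. fs n x - fs M x) * k"
        by (intro mult_left_mono k N_nonneg d)
      also have "\<dots> \<le> (e/2)\<^sup>2 / k * k"
        using M[OF that order_refl] k(1) by (intro mult_right_mono) simp_all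
      also have "\<dots> = (e/2)\<^sup>2" using k(1) by simp
      finally have "cmod (fs n x - fs M x) \<le> e/2"
        by (rule power2_le_imp_le) (use e in simp)
      then show ?thesis using e by (simp add: dist_norm)
    qed
    then show "\<exists>M. \<forall>n\<ge>M. dist (fs n x) (fs M x) < e" by blast
  qed
  then have lim: "\<And>x. x \<in> X \<Longrightarrow> (\<lambda>n. fs n x) \<longlonglongrightarrow> lim (\<lambda>n. fs n x)"
    by (simp add: Cauchy_convergent_iff convergent_LIMSEQ_iff)
  define f where "f = (\<lambda>x. if x \<in> X then lim (\<lambda>n. fs n x) else 0)"
  have L: "(\<lambda>n. fs n x) \<longlonglongrightarrow> f x" if "x \<in> X" for x
    using lim[OF that] that unfolding f_def by simp
  have *: "\<exists>M. \<forall>n\<ge>M. (\<lambda>x. f x - fs n x) \<in> H \<and> N (\<lambda>x. f x - fs n x) \<le> e" if e: "e > 0" for e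
  proof -
    obtain M where M: "\<And>m n. m \<ge> M \<Longrightarrow> n \<ge> M \<Longrightarrow> N (\<lambda>x. fs m x - fs n x) \<le> e" using C[OF e] by blast
    have "(\<lambda>x. f x - fs n x) \<in> H \<and> N (\<lambda>x. f x - fs n x) \<le> e" if "n \<ge> M" for n
    proof -
      have 1: "(\<lambda>x. fs (m + M) x - fs n x) \<in> H" for m by (intro H_diff fs)
      have 2: "N (\<lambda>x. fs (m + M) x - fs n x) \<le> e" for m using M that by simp
      have 3: "(\<lambda>m. fs (m + M) x - fs n x) \<longlonglongrightarrow> f x - fs n x" if "x \<in> X" for x
        by (intro tendsto_intros LIMSEQ_ignore_initial_segment L that)
      have 4: "f x - fs n x = 0" if "x \<notin> X" for x using that H_off[OF fs that] unfolding f_def by simp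
      show ?thesis using limit_bound[of "\<lambda>m x. fs (m + M) x - fs n x", OF 1 2 3 4] by blast
    qed
    then show ?thesis by blast
  qed
  obtain n where "(\<lambda>x. f x - fs n x) \<in> H" using *[of 1] by auto
  from H_add(1)[OF this fs[of n]] have f: "f \<in> H" by simp
  have "(\<lambda>n. N (\<lambda>x. f x - fs n x)) \<longlonglongrightarrow> 0"
  proof (rule LIMSEQ_I)
    fix e :: real assume "e > 0"
    then obtain M where M: "\<And>n. n \<ge> M \<Longrightarrow> N (\<lambda>x. f x - fs n x) \<le> e/2" using *[of "e/2"] by auto
    have "norm (N (\<lambda>x. f x - fs n x) - 0) < e" if "n \<ge> M" for n
    proof -
      have "0 \<le> N (\<lambda>x. f x - fs n x)" by (intro N_nonneg H_diff f fs)
      then show ?thesis using M[OF that] \<open>e > 0\<close> by simp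
    qed
    then show "\<exists>M. \<forall>n\<ge>M. norm (N (\<lambda>x. f x - fs n x) - 0) < e" by blast
  qed
  with f show ?thesis by blast
qed

text \<open>Against a combination of kernel functions the inner product is a finite sum of point
  values, so pointwise convergence suffices there; boundedness of the norms extends the convergence
  to the closure, which is everything.\<close>

lemma weak_limit:
  assumes fs: "\<And>n. fs n \<in> H" "\<And>n. N (fs n) \<le> C" "\<And>x. x \<in> X \<Longrightarrow> (\<lambda>n. fs n x) \<longlonglongrightarrow> f x"
    "\<And>x. x \<notin> X \<Longrightarrow> f x = 0" and g: "g \<in> H"
  shows "(\<lambda>n. ip (fs n) g) \<longlonglongrightarrow> ip f g"
proof -
  have f: "f \<in> H" "N f \<le> C" using limit_bound[OF fs] by auto
  have C: "0 \<le> C" using N_nonneg[OF f(1)] f(2) by simp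
  have d: "(\<lambda>x. fs n x - f x) \<in> H" for n by (intro H_diff fs f)
  \<comment> \<open>The constant comes from the parallelogram law: 2C + 2C bounds the squared norm
    of the difference.\<close>
  have dn: "N (\<lambda>x. fs n x - f x) \<le> 4 * C" for n
    using parallelogram[OF fs(1)[of n] f(1)] fs(2)[of n] f(2) N_nonneg[OF H_add(1)[OF fs(1)[of n] f(1)]] by simp
  show ?thesis
  proof (rule LIMSEQ_I)
    fix e :: real assume e: "e > 0"
    \<comment> \<open>The summand 1 keeps the denominator positive when C = 0.\<close>
    define e' where "e' = (e/2)\<^sup>2 / (4 * C + 1)"
    have "e' > 0" using e C by (simp add: e'_def)
    then obtain ps where ps: "pts X ps" "N (\<lambda>x. g x - cmb ps x) < e'" using comb_dense[OF g] by blast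
    have gd: "(\<lambda>x. g x - cmb ps x) \<in> H" by (intro H_diff g comb_H ps)
    have "(\<lambda>n. ev (fs n) ps) \<longlonglongrightarrow> ev f ps" by (rule ev_tendsto[OF ps(1) fs(3)])
    then obtain M where M: "\<And>n. n \<ge> M \<Longrightarrow> cmod (ev (fs n) ps - ev f ps) < e/2"
      using LIMSEQ_D[of "\<lambda>n. ev (fs n) ps" "ev f ps" "e/2"] e by auto
    have "cmod (ip (fs n) g - ip f g) < e" if "n \<ge> M" for n
    proof -
      have "ip (fs n) g - ip f g = ip (\<lambda>x. fs n x - f x) g" by (rule ip_diff[OF fs(1) f(1) g, symmetric])
      also have "\<dots> = ip (\<lambda>x. fs n x - f x) (\<lambda>x. g x - cmb ps x) + (ev (fs n) ps - ev f ps)"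
        unfolding ip_diff2[OF g comb_H(1)[OF ps(1)] d[of n]] ip_comb[OF d ps(1)] ev_diff by simp
      finally have 1: "cmod (ip (fs n) g - ip f g) \<le> cmod (ip (\<lambda>x. fs n x - f x) (\<lambda>x. g x - cmb ps x)) + cmod (ev (fs n) ps - ev f ps)"
        by (metis norm_triangle_ineq)
      have "(cmod (ip (\<lambda>x. fs n x - f x) (\<lambda>x. g x - cmb ps x)))\<^sup>2 \<le> N (\<lambda>x. fs n x - f x) * N (\<lambda>x. g x - cmb ps x)"
        by (rule ip_CS[OF d gd])
      also have "\<dots> \<le> (4 * C + 1) * e'"
      proof (rule mult_mono)
        show "N (\<lambda>x. fs n x - f x) \<le> 4 * C + 1" using dn[of n] by simp
        show "N (\<lambda>x. g x - cmb ps x) \<le> e'" using ps(2) by simp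
        show "0 \<le> 4 * C + 1" using C by simp
        show "0 \<le> N (\<lambda>x. g x - cmb ps x)" by (rule N_nonneg[OF gd])
      qed
      also have "\<dots> = (e/2)\<^sup>2" unfolding e'_def using C by simp
      finally have "cmod (ip (\<lambda>x. fs n x - f x) (\<lambda>x. g x - cmb ps x)) \<le> e/2"
        by (rule power2_le_imp_le) (use e in simp)
      with 1 M[OF that] show ?thesis by linarith
    qed
    then show "\<exists>M. \<forall>n\<ge>M. cmod (ip (fs n) g - ip f g) < e" by blast
  qed
qed

text \<open>A minimizing sequence is Cauchy by the parallelogram law, its limit g lies in W, and
  minimality of the distance makes f - g orthogonal to W.\<close>

lemma projection:
  assumes W: "closed_subspace X K W" and f: "f \<in> H"
  shows "\<exists>g\<in>W. \<forall>w\<in>W. ip (\<lambda>x. f x - g x) w = 0"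
proof -
  have WH: "W \<subseteq> H" and W0: "(\<lambda>x. 0) \<in> W" and Wadd: "\<And>u v. u \<in> W \<Longrightarrow> v \<in> W \<Longrightarrow> (\<lambda>x. u x + v x) \<in> W"
    and Wsc: "\<And>u a. u \<in> W \<Longrightarrow> (\<lambda>x. a * u x) \<in> W"
    and Wcl: "\<And>ws w. (\<And>m. ws m \<in> W) \<Longrightarrow> w \<in> H \<Longrightarrow> (\<lambda>m. N (\<lambda>x. w x - ws m x)) \<longlonglongrightarrow> 0 \<Longrightarrow> w \<in> W"
    using W unfolding closed_subspace_def by (blast, blast, blast, blast, blast)
  define D where "D = (\<lambda>w. N (\<lambda>x. f x - w x)) ` W"
  define d where "d = Inf D"
  have D0: "D \<noteq> {}" using W0 by (auto simp: D_def)
  have Dn: "y \<ge> 0" if "y \<in> D" for y using that WH f by (auto simp: D_def intro!: N_nonneg H_diff)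
  have dle: "d \<le> N (\<lambda>x. f x - w x)" if "w \<in> W" for w
    unfolding d_def by (rule cInf_lower) (use that Dn in \<open>auto simp: D_def intro!: bdd_belowI[of _ 0]\<close>)
  have "\<exists>w\<in>W. N (\<lambda>x. f x - w x) < d + 1 / real (Suc n)" for n
    using cInf_lessD[OF D0, of "d + 1 / real (Suc n)"] by (auto simp: d_def D_def)
  then obtain w where w: "\<And>n. w n \<in> W" "\<And>n. N (\<lambda>x. f x - w n x) < d + 1 / real (Suc n)" by metis
  have wH: "w n \<in> H" for n using w WH by blast
  have est: "N (\<lambda>x. w m x - w n x) \<le> 2 / real (Suc m) + 2 / real (Suc n)" for m n
  proof -
    have a: "(\<lambda>x. f x - w m x) \<in> H" and b: "(\<lambda>x. f x - w n x) \<in> H" by (intro H_diff f wH)+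
    have "N (\<lambda>x. (f x - w m x) - (f x - w n x)) = N (\<lambda>x. w n x - w m x)" by (simp add: algebra_simps)
    also have "\<dots> = N (\<lambda>x. w m x - w n x)" by (rule N_minus[OF wH wH])
    finally have 1: "N (\<lambda>x. (f x - w m x) - (f x - w n x)) = N (\<lambda>x. w m x - w n x)" .
    \<comment> \<open>The midpoint of two members of the sequence is again in W, so its distance to
      f is at least the infimum; the parallelogram law then makes the two members close.\<close>
    let ?h = "\<lambda>x. (1/2) * (w m x + w n x)"
    have h: "?h \<in> W" by (intro Wsc Wadd w)
    have "N (\<lambda>x. 2 * (f x - ?h x)) = 4 * N (\<lambda>x. f x - ?h x)"
      using H_scale(2)[OF H_diff[OF f subsetD[OF WH h]], of 2] by simp
    moreover have "(\<lambda>x. 2 * (f x - ?h x)) = (\<lambda>x. (f x - w m x) + (f x - w n x))" by (auto simp: algebra_simps)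
    ultimately have "N (\<lambda>x. (f x - w m x) + (f x - w n x)) \<ge> 4 * d" using dle[OF h] by simp
    then show ?thesis using parallelogram[OF a b] w(2)[of m] w(2)[of n] 1 by simp
  qed
  have "\<exists>M. \<forall>m\<ge>M. \<forall>n\<ge>M. N (\<lambda>x. w m x - w n x) \<le> e" if "e > 0" for e
  proof -
    obtain M :: nat where M: "4 / e < real M" using reals_Archimedean2 by blast
    have "N (\<lambda>x. w m x - w n x) \<le> e" if "m \<ge> M" "n \<ge> M" for m n
    proof -
      have *: "2 / real (Suc k) \<le> e / 2" if "k \<ge> M" for k
      proof -
        have "4 / e \<le> real (Suc k)" using M that by simp
        then show ?thesis using \<open>e > 0\<close> by (simp add: field_simps)
      qed
      show ?thesis using est[of m n] *[OF that(1)] *[OF that(2)] by simp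
    qed
    then show ?thesis by blast
  qed
  from H_complete[OF wH this] obtain g where g: "g \<in> H" "(\<lambda>n. N (\<lambda>x. g x - w n x)) \<longlonglongrightarrow> 0" by blast
  have gW: "g \<in> W" by (rule Wcl[OF w(1) g])
  have fg: "(\<lambda>x. f x - g x) \<in> H" by (intro H_diff f g)
  have "(\<lambda>n. N (\<lambda>x. f x - w n x)) \<longlonglongrightarrow> N (\<lambda>x. f x - g x)"
  proof (rule N_tendsto[OF H_diff[OF f wH] fg])
    have "N (\<lambda>x. f x - g x - (f x - w n x)) = N (\<lambda>x. g x - w n x)" for n
      using N_minus[OF g(1) wH] by (simp add: algebra_simps)
    then show "(\<lambda>n. N (\<lambda>x. f x - g x - (f x - w n x))) \<longlonglongrightarrow> 0" using g by simp
  qed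
  moreover have "(\<lambda>n. d + 1 / real (Suc n)) \<longlonglongrightarrow> d" by real_asymp
  ultimately have le: "N (\<lambda>x. f x - g x) \<le> d"
    by (rule LIMSEQ_le) (use w(2) less_imp_le in blast)
  have "ip (\<lambda>x. f x - g x) v = 0" if v: "v \<in> W" for v
  proof -
    have vH: "v \<in> H" using v WH by blast
    \<comment> \<open>Moving g in the direction v cannot bring it closer to f, so after cancelling
      the minimum the quadratic in z has constant term 0.\<close>
    have "(cmod (ip (\<lambda>x. f x - g x) v))\<^sup>2 \<le> 0 * N v"
    proof (rule discriminant_bound)
      fix z
      have "(\<lambda>x. g x + (- cnj z) * v x) \<in> W" by (intro Wadd Wsc gW v)
      from dle[OF this] have "d \<le> N (\<lambda>x. (f x - g x) + cnj z * v x)" by (simp add: algebra_simps)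
      then show "0 \<le> 0 + 2 * Re (z * ip (\<lambda>x. f x - g x) v) + (cmod z)\<^sup>2 * N v"
        using N_add[OF fg vH, of "cnj z"] le by simp
    qed (use N_nonneg[OF vH] in auto)
    then show ?thesis by simp
  qed
  with gW show ?thesis by blast
qed

text \<open>Elements of the space are defined by a bound on combinations of kernel functions, so a bounded functional
  is represented by the conjugates of its values on the kernel functions.\<close>

lemma riesz:
  assumes off: "\<And>x. x \<notin> X \<Longrightarrow> \<eta> x = 0"
    and add: "\<And>f g. f \<in> H \<Longrightarrow> g \<in> H \<Longrightarrow> L (\<lambda>x. f x - g x) = L f - L g"
    and bd: "\<And>f. f \<in> H \<Longrightarrow> (cmod (L f))\<^sup>2 \<le> C * N f" and C: "0 \<le> C"
    and eta: "\<And>ps. pts X ps \<Longrightarrow> L (cmb ps) = cnj (ev \<eta> ps)"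
  shows "\<eta> \<in> H" "\<And>f. f \<in> H \<Longrightarrow> ip f \<eta> = L f"
proof -
  have b: "rkhs_bound X K \<eta> C" unfolding rkhs_bound_iff
  proof (intro allI impI)
    fix ps assume ps: "pts X ps"
    show "(cmod (ev \<eta> ps))\<^sup>2 \<le> C * q ps"
      using bd[OF comb_H(1)[OF ps]] eta[OF ps] comb_H(2)[OF ps] by simp
  qed
  show e: "\<eta> \<in> H" by (rule HI[OF b off])
  fix f assume f: "f \<in> H"
  obtain P where P: "\<And>n. pts X (P n)" "(\<lambda>n. N (\<lambda>x. f x - cmb (P n) x)) \<longlonglongrightarrow> 0"
    using comb_dense_seq[OF f] by blast
  have c: "cmb (P n) \<in> H" for n by (rule comb_H[OF P(1)])
  have "(\<lambda>n. ip \<eta> (cmb (P n))) \<longlonglongrightarrow> ip \<eta> f" by (rule ip_tendsto[OF e f c P(2)])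
  then have 1: "(\<lambda>n. L (cmb (P n))) \<longlonglongrightarrow> ip f \<eta>"
    using tendsto_cnj ip_comb[OF e P(1)] eta[OF P(1)] ip_cnj[OF e f] by fastforce
  have "(\<lambda>n. sqrt (C * N (\<lambda>x. f x - cmb (P n) x))) \<longlonglongrightarrow> sqrt (C * 0)"
    by (intro tendsto_intros P)
  then have "(\<lambda>n. L (cmb (P n)) - L f) \<longlonglongrightarrow> 0"
  proof (rule Lim_null_comparison[rotated, OF tendsto_eq_rhs])
    show "\<forall>\<^sub>F n in sequentially. norm (L (cmb (P n)) - L f) \<le> sqrt (C * N (\<lambda>x. f x - cmb (P n) x))"
    proof (intro always_eventually allI)
      fix n
      have "norm (L (cmb (P n)) - L f) = cmod (L (\<lambda>x. f x - cmb (P n) x))"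
        using add[OF f c] by (simp add: norm_minus_commute)
      also have "\<dots> \<le> sqrt (C * N (\<lambda>x. f x - cmb (P n) x))"
        by (intro real_le_rsqrt bd H_diff f c)
      finally show "norm (L (cmb (P n)) - L f) \<le> sqrt (C * N (\<lambda>x. f x - cmb (P n) x))" .
    qed
  qed simp
  then have "(\<lambda>n. L (cmb (P n))) \<longlonglongrightarrow> L f" by (simp add: LIM_zero_iff)
  with 1 show "ip f \<eta> = L f" using LIMSEQ_unique by blast
qed

end

section \<open>The domain and the group action\<close>

definition cip :: "complex^'n::finite \<Rightarrow> complex^'n \<Rightarrow> complex" where
  "cip x y = (\<Sum>i\<in>UNIV. x $ i * cnj (y $ i))"

lemma norm_vec_sq: "(norm (x :: complex^'n::finite))\<^sup>2 = (\<Sum>i\<in>UNIV. (cmod (x $ i))\<^sup>2)"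
  unfolding norm_vec_def L2_set_def by (simp add: sum_nonneg)

lemma cip_self: "cip x x = of_real ((norm x)\<^sup>2)"
  unfolding norm_vec_sq cip_def by (simp only: of_real_sum complex_norm_square)

lemma cip_cnj: "cip y x = cnj (cip x y)"
  by (simp add: cip_def mult.commute)

lemma cip_linear [simp]:
  "cip (x + x') y = cip x y + cip x' y" "cip (x - x') y = cip x y - cip x' y"
  "cip (a *s x) y = a * cip x y" "cip x (y + y') = cip x y + cip x y'"
  "cip x (y - y') = cip x y - cip x y'" "cip x (a *s y) = cnj a * cip x y" "cip 0 y = 0" "cip x 0 = 0"
  by (simp_all add: cip_def algebra_simps sum.distrib sum_subtractf sum_distrib_left)

lemma cip_CS: "cmod (cip x y) \<le> norm x * norm y"
proof -
  have "cmod (cip x y) \<le> (\<Sum>i\<in>UNIV. cmod (x $ i) * cmod (y $ i))"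
    unfolding cip_def by (rule order_trans[OF norm_sum]) (simp add: norm_mult)
  also have "\<dots> \<le> norm x * norm y"
    unfolding norm_vec_def using L2_set_mult_ineq[of "\<lambda>i. cmod (x $ i)" "\<lambda>i. cmod (y $ i)" UNIV] by simp
  finally show ?thesis .
qed

lemma cip_axis: "cip x (axis i 1) = x $ i"
proof -
  have "x $ k * cnj (axis i 1 $ k) = (if k = i then x $ k else 0)" for k by (simp add: axis_def)
  then show ?thesis by (simp add: cip_def)
qed

lemma mv_axis: "(A :: complex^'n::finite^'m::finite) *v axis k 1 = (\<chi> i. A $ i $ k)"
proof -
  have "A $ i $ j * axis k 1 $ j = (if j = k then A $ i $ j else 0)" for i j by (simp add: axis_def)
  then show ?thesis by (simp add: vec_eq_iff matrix_vector_mult_def)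
qed

lemma cip_ext: assumes "\<And>y. cip x y = cip x' y" shows "x = x'"
  using assms cip_axis by (metis vec_eq_iff)

lemma cip_adj: "cip (A *v x) y = cip x (ctrans A *v y)"
proof -
  have "cip (A *v x) y = (\<Sum>i\<in>UNIV. \<Sum>j\<in>UNIV. A $ i $ j * x $ j * cnj (y $ i))"
    by (simp add: cip_def matrix_vector_mult_def sum_distrib_right)
  also have "\<dots> = (\<Sum>j\<in>UNIV. \<Sum>i\<in>UNIV. A $ i $ j * x $ j * cnj (y $ i))" by (rule sum.swap)
  also have "\<dots> = cip x (ctrans A *v y)"
    by (simp add: cip_def matrix_vector_mult_def ctrans_def sum_distrib_left mult_ac)
  finally show ?thesis .
qed

lemma ctrans_ctrans [simp]: "ctrans (ctrans A) = A"
  by (simp add: ctrans_def vec_eq_iff)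

lemma cip_adj2: "cip x (A *v y) = cip (ctrans A *v x) y"
  by (simp add: cip_adj)

lemma ctrans_mul: "ctrans (A ** B) = ctrans B ** ctrans A"
  by (simp add: ctrans_def vec_eq_iff matrix_matrix_mult_def mult.commute)

lemma ctrans_mat1 [simp]: "ctrans (mat 1) = mat 1"
  by (simp add: ctrans_def vec_eq_iff mat_def)

lemma ctrans_diff [simp]: "ctrans (A - B) = ctrans A - ctrans B"
  and ctrans_add [simp]: "ctrans (A + B) = ctrans A + ctrans B"
  and ctrans_scaleR [simp]: "ctrans (t *\<^sub>R A) = t *\<^sub>R ctrans A"
  and ctrans_0 [simp]: "ctrans 0 = 0"
  by (simp_all add: ctrans_def vec_eq_iff)

lemma det_ctrans: "det (ctrans A) = cnj (det (A :: complex^'n::finite^'n))"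
proof -
  have "det (ctrans A) = det (\<chi> i j. cnj (A $ i $ j))"
    using det_transpose[of "\<chi> i j. cnj (A $ i $ j)"] by (simp add: transpose_def ctrans_def)
  also have "\<dots> = cnj (det A)" by (simp add: det_def)
  finally show ?thesis .
qed

lemma mat_ext: fixes A B :: "complex^'n::finite^'m::finite"
  assumes "\<And>x y. cip (A *v x) y = cip (B *v x) y" shows "A = B"
  using assms cip_ext matrix_eq by blast

text \<open>Complex polarization: the scalars 1 and \<i> in x + a y separate the two mixed terms,
  which a real scalar alone could not do.\<close>

lemma mat_ext_quad: fixes B :: "complex^'n::finite^'n"
  assumes "\<And>x. cip (B *v x) x = 0" shows "B = 0"
proof (rule mat_ext)
  fix x y
  have e: "cnj a * cip (B *v x) y + a * cip (B *v y) x = 0" for a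
  proof -
    have "0 = cip (B *v (x + a *s y)) (x + a *s y)" using assms[of "x + a *s y"] by (rule sym)
    also have "\<dots> = cip (B *v x) x + cnj a * cip (B *v x) y + (a * cip (B *v y) x + a * (cnj a * cip (B *v y) y))"
      by (simp only: matrix_vector_right_distrib vector_scalar_commute cip_linear distrib_left mult_ac add_ac)
    finally show ?thesis unfolding assms by simp
  qed
  have 1: "cip (B *v x) y + cip (B *v y) x = 0" using e[of 1] by simp
  have "- \<i> * cip (B *v x) y + \<i> * cip (B *v y) x = 0" using e[of "\<i>"] by simp
  then have "\<i> * (cip (B *v y) x - cip (B *v x) y) = 0" by (simp add: algebra_simps)
  then have 2: "cip (B *v y) x = cip (B *v x) y" by simp
  have "2 * cip (B *v x) y = 0" using 1 unfolding 2 by simp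
  then have "cip (B *v x) y = 0" by simp
  then show "cip (B *v x) y = cip (0 *v x) y" by simp
qed

text \<open>The closed unit ball for the operator norm. It contains both \<open>Dom\<close> and
  \<open>Shilov\<close>, so that facts about the action and its automorphy factor cover interior and
  boundary points at once.\<close>

definition Cl :: "(complex^'l::finite^'r::finite) set" where
  "Cl = {z. \<forall>y. norm (z *v y) \<le> norm y}"

lemma contr_adj:
  assumes "\<And>y. norm (z *v y) \<le> norm y" shows "norm (ctrans z *v x) \<le> norm (x :: complex^'r::finite)"
proof (cases "ctrans z *v x = 0")
  case False
  have "(norm (ctrans z *v x))\<^sup>2 = cmod (cip (ctrans z *v x) (ctrans z *v x))"
    by (simp add: cip_self norm_power)
  also have "\<dots> = cmod (cip x (z *v (ctrans z *v x)))" by (simp add: cip_adj2)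
  also have "\<dots> \<le> norm x * norm (z *v (ctrans z *v x))" by (rule cip_CS)
  also have "\<dots> \<le> norm x * norm (ctrans z *v x)" by (intro mult_left_mono assms) simp
  finally show ?thesis using False by (simp add: power2_eq_square)
qed simp

lemma contr_adj_strict:
  assumes "\<And>y. y \<noteq> 0 \<Longrightarrow> norm (z *v y) < norm y" "x \<noteq> 0" shows "norm (ctrans z *v x) < norm (x :: complex^'r::finite)"
proof (cases "ctrans z *v x = 0")
  case False
  have "(norm (ctrans z *v x))\<^sup>2 = cmod (cip (ctrans z *v x) (ctrans z *v x))"
    by (simp add: cip_self norm_power)
  also have "\<dots> = cmod (cip x (z *v (ctrans z *v x)))" by (simp add: cip_adj2)
  also have "\<dots> \<le> norm x * norm (z *v (ctrans z *v x))" by (rule cip_CS)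
  also have "\<dots> < norm x * norm (ctrans z *v x)" using assms False by (intro mult_strict_left_mono) auto
  finally show ?thesis using False by (simp add: power2_eq_square)
qed (use assms in simp)

lemma Cl_iff: "z \<in> Cl \<longleftrightarrow> (\<forall>x. norm (ctrans z *v x) \<le> norm x)"
  unfolding Cl_def using contr_adj[of z] contr_adj[of "ctrans z"] by auto

lemma cip_1_minus: "cip ((mat 1 - z ** ctrans w) *v x) y = cip x y - cip (ctrans w *v x) (ctrans z *v y)"
  by (simp add: matrix_vector_mult_diff_rdistrib cip_adj matrix_vector_mul_assoc[symmetric])

lemma Dom_iff_adj: "z \<in> Dom \<longleftrightarrow> (\<forall>x. x \<noteq> 0 \<longrightarrow> norm (ctrans z *v x) < norm x)"
proof -
  have 1: "(\<Sum>i\<in>UNIV. \<Sum>k\<in>UNIV. cnj (x $ i) * M $ i $ k * x $ k) = cip (M *v x) x" for M and x :: "complex^'b"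
    by (simp add: cip_def matrix_vector_mult_def sum_distrib_right sum_distrib_left mult_ac)
  have 2: "Re (cip ((mat 1 - z ** ctrans z) *v x) x) = (norm x)\<^sup>2 - (norm (ctrans z *v x))\<^sup>2" for x
    unfolding cip_1_minus cip_self by simp
  have 3: "0 < (norm x)\<^sup>2 - (norm y)\<^sup>2 \<longleftrightarrow> norm y < norm x" for x :: "complex^'b" and y :: "complex^'a"
    using power_strict_mono[of "norm y" "norm x" 2] power_less_imp_less_base[of "norm y" 2 "norm x"] by auto
  show ?thesis
    unfolding Dom_def posdef_herm_def mem_Collect_eq 1 2 3 by (simp add: ctrans_mul)
qed

lemma Dom_iff: "z \<in> Dom \<longleftrightarrow> (\<forall>y. y \<noteq> 0 \<longrightarrow> norm (z *v y) < norm y)"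
  unfolding Dom_iff_adj using contr_adj_strict[of z] contr_adj_strict[of "ctrans z"] by auto

lemma Dom_Cl: "z \<in> Dom \<Longrightarrow> z \<in> Cl"
  unfolding Dom_iff Cl_def mem_Collect_eq by (metis less_imp_le matrix_vector_mult_0_right norm_zero order_refl)

lemma Shilov_norm: "v \<in> Shilov \<Longrightarrow> norm (ctrans v *v x) = norm x"
proof -
  assume "v \<in> Shilov"
  then have "cip ((mat 1 - v ** ctrans v) *v x) x = 0" by (simp add: Shilov_def)
  then have "of_real ((norm x)\<^sup>2) = (of_real ((norm (ctrans v *v x))\<^sup>2) :: complex)"
    unfolding cip_1_minus cip_self by simp
  then have "(norm x)\<^sup>2 = (norm (ctrans v *v x))\<^sup>2" by (simp only: of_real_eq_iff)
  then show ?thesis by (simp add: power2_eq_iff_nonneg)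
qed

lemma Shilov_iff: "v \<in> Shilov \<longleftrightarrow> (\<forall>x. norm (ctrans v *v x) = norm x)"
proof
  assume *: "\<forall>x. norm (ctrans v *v x) = norm x"
  have "mat 1 - v ** ctrans v = 0"
    by (rule mat_ext_quad) (simp only: cip_1_minus cip_self * diff_self)
  then show "v \<in> Shilov" by (simp add: Shilov_def)
qed (use Shilov_norm in blast)

lemma Shilov_Cl: "v \<in> Shilov \<Longrightarrow> v \<in> Cl"
  unfolding Cl_iff using Shilov_norm by force

lemma scale_mv: "(t *\<^sub>R z) *v (y :: complex^'l::finite) = t *\<^sub>R (z *v y)"
  by (simp add: vec_eq_iff matrix_vector_mult_def scaleR_sum_right)

lemma scale_Dom: assumes "z \<in> Cl" "0 \<le> t" "t < 1" shows "t *\<^sub>R z \<in> Dom"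
  unfolding Dom_iff
proof (intro allI impI)
  fix y :: "complex^'a" assume y: "y \<noteq> 0"
  have "norm ((t *\<^sub>R z) *v y) = t * norm (z *v y)" using assms by (simp add: scale_mv)
  also have "\<dots> \<le> t * norm y" using assms by (intro mult_left_mono) (auto simp: Cl_def)
  also have "\<dots> < norm y" using assms y by simp
  finally show "norm ((t *\<^sub>R z) *v y) < norm y" .
qed

lemma scale_Dom1: assumes "z \<in> Dom" "0 \<le> t" "t \<le> 1" shows "t *\<^sub>R z \<in> Dom"
  using scale_Dom[OF Dom_Cl[OF assms(1)] assms(2)] assms by (cases "t = 1") auto

lemma invertible_inj: fixes A :: "complex^'n::finite^'n"
  assumes "\<And>x. A *v x = 0 \<Longrightarrow> x = 0" shows "invertible A"
  unfolding invertible_left_inverse matrix_left_invertible_ker using assms by simp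

text \<open>A kernel vector x satisfies x = z y with y the image of x under \<open>ctrans w\<close>.
  Contractivity gives |x| \<le> |y| \<le> |x|, and one of the two inequalities is strict because one
  of the matrices is interior.\<close>

lemma hfun_matrix_invertible: assumes "z \<in> Cl" "w \<in> Cl" "z \<in> Dom \<or> w \<in> Dom"
  shows "invertible (mat 1 - z ** ctrans w :: complex^'r::finite^'r)"
proof (rule invertible_inj, rule ccontr)
  fix x :: "complex^'r" assume "(mat 1 - z ** ctrans w) *v x = 0" and x: "x \<noteq> 0"
  then have e: "x = z *v (ctrans w *v x)" by (simp add: matrix_vector_mult_diff_rdistrib matrix_vector_mul_assoc)
  have 1: "norm (ctrans w *v x) \<le> norm x" using assms(2) by (simp add: Cl_iff)
  have 2: "norm x \<le> norm (ctrans w *v x)" using assms(1) unfolding Cl_def by (subst (1) e) simp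
  have "ctrans w *v x \<noteq> 0"
  proof
    assume "ctrans w *v x = 0"
    then have "x = z *v 0" using e by simp
    then show False using x by simp
  qed
  from assms(3) show False
  proof
    assume "z \<in> Dom"
    then have "norm (z *v (ctrans w *v x)) < norm (ctrans w *v x)" using \<open>ctrans w *v x \<noteq> 0\<close> unfolding Dom_iff by blast
    with 1 show False using e by simp
  next
    assume "w \<in> Dom"
    then have "norm (ctrans w *v x) < norm x" using x unfolding Dom_iff_adj by blast
    with 2 show False by simp
  qed
qed

lemma hfun_nz: assumes "z \<in> Cl" "w \<in> Cl" "z \<in> Dom \<or> w \<in> Dom" shows "hfun z w \<noteq> 0"
  using hfun_matrix_invertible[OF assms] by (simp add: hfun_def invertible_det_nz)

lemma hfun_cnj: "hfun w z = cnj (hfun z w)"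
proof -
  have "mat 1 - w ** ctrans z = ctrans (mat 1 - z ** ctrans w)" by (simp add: ctrans_mul)
  then show ?thesis unfolding hfun_def by (simp only: det_ctrans)
qed

lemma continuous_det: "continuous_on UNIV (det :: complex^'n::finite^'n \<Rightarrow> complex)"
  unfolding det_def by (intro continuous_intros)

lemma continuous_det' [continuous_intros]:
  "continuous_on S f \<Longrightarrow> continuous_on S (\<lambda>x. det (f x :: complex^'n::finite^'n))"
  using continuous_on_compose2[OF continuous_det] by blast

lemma continuous_matmul [continuous_intros]:
  fixes f :: "'a::topological_space \<Rightarrow> complex^'n::finite^'m::finite" and g :: "'a \<Rightarrow> complex^'k::finite^'n"
  shows "continuous_on S f \<Longrightarrow> continuous_on S g \<Longrightarrow> continuous_on S (\<lambda>x. f x ** g x)"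
  unfolding matrix_matrix_mult_def by (intro continuous_intros)

lemma continuous_ctrans [continuous_intros]:
  fixes f :: "'a::topological_space \<Rightarrow> complex^'n::finite^'m::finite"
  shows "continuous_on S f \<Longrightarrow> continuous_on S (\<lambda>x. ctrans (f x))"
  unfolding ctrans_def by (intro continuous_intros)

lemma continuous_hfun [continuous_intros]:
  "continuous_on S f \<Longrightarrow> continuous_on S g \<Longrightarrow> continuous_on S (\<lambda>x. hfun (f x) (g x))"
  unfolding hfun_def by (intro continuous_intros)

lemma compact_Shilov: "compact (Shilov :: (complex^'l::finite^'r::finite) set)"
proof -
  have "closed ((\<lambda>v :: complex^'l^'r. v ** ctrans v) -` {mat 1})"
    by (rule closed_vimage[OF closed_singleton continuous_matmul[OF continuous_on_id continuous_ctrans[OF continuous_on_id]]])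
  moreover have "bounded (Shilov :: (complex^'l^'r) set)"
  proof (rule boundedI)
    fix v :: "complex^'l^'r" assume v: "v \<in> Shilov"
    have 1: "norm (v $ i) \<le> 1" for i
    proof -
      have "ctrans v *v axis i 1 = (\<chi> j. cnj (v $ i $ j))"
        unfolding mv_axis by (simp add: ctrans_def)
      moreover have "norm (\<chi> j. cnj (v $ i $ j)) = norm (v $ i)" by (simp add: norm_vec_def)
      moreover have "norm (axis i (1::complex)) = 1" by (simp add: norm_axis_1)
      ultimately show ?thesis using Shilov_norm[OF v, of "axis i 1"] by simp
    qed
    have "norm v \<le> (\<Sum>i\<in>UNIV. norm (v $ i))" unfolding norm_vec_def by (rule L2_set_le_sum) simp
    also have "\<dots> \<le> (\<Sum>i\<in>(UNIV::'r set). 1)" by (intro sum_mono 1)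
    finally show "norm v \<le> real CARD('r)" by simp
  qed
  ultimately show ?thesis by (simp add: Shilov_def compact_eq_bounded_closed vimage_def)
qed

section \<open>Block vectors, the indefinite form and the group\<close>

lemma sum_UNIV_sum: "(\<Sum>i\<in>(UNIV :: ('a::finite + 'b::finite) set). f i) = (\<Sum>a\<in>UNIV. f (Inl a)) + (\<Sum>b\<in>UNIV. f (Inr b))"
  using sum.Plus[of UNIV UNIV f] by (simp add: o_def)

definition join_vec :: "complex^'r::finite \<Rightarrow> complex^'l::finite \<Rightarrow> complex^('r + 'l)" where
  "join_vec x y = (\<chi> i. case i of Inl a \<Rightarrow> x $ a | Inr b \<Rightarrow> y $ b)"

lemma join_vec_nth [simp]: "join_vec x y $ Inl a = x $ a" "join_vec x y $ Inr b = y $ b"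
  by (simp_all add: join_vec_def)

lemma sum_type_all: "(\<forall>i :: 'a + 'b. P i) \<longleftrightarrow> (\<forall>a. P (Inl a)) \<and> (\<forall>b. P (Inr b))"
  by (metis sum.exhaust)

lemma join_vec_eq [simp]: "join_vec x y = join_vec x' y' \<longleftrightarrow> x = x' \<and> y = y'"
  by (simp add: vec_eq_iff sum_type_all)

lemma join_vec_0: "join_vec 0 0 = 0"
  by (simp add: vec_eq_iff sum_type_all)

lemma join_vec_cases: obtains x y where "u = join_vec x y"
proof
  show "u = join_vec (\<chi> a. u $ Inl a) (\<chi> b. u $ Inr b)" by (simp add: vec_eq_iff sum_type_all)
qed

lemma cip_jv [simp]: "cip (join_vec x y) (join_vec x' y') = cip x x' + cip y y'"
  by (simp add: cip_def sum_UNIV_sum)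

lemma mv_jv: "g *v join_vec x y = join_vec (ablk g *v x + bblk g *v y) (cblk g *v x + dblk g *v y)"
  by (simp add: vec_eq_iff sum_type_all matrix_vector_mult_def sum_UNIV_sum ablk_def bblk_def cblk_def dblk_def)

lemma Jform_jv: "Jform *v join_vec x y = join_vec (- x) y"
proof -
  have "Jform $ i $ k * u $ k = (if k = i then (case i of Inl _ \<Rightarrow> - u $ i | Inr _ \<Rightarrow> u $ i) else 0)" for i k and u :: "complex^('a + 'b)"
    by (simp add: Jform_def split: sum.split)
  then show ?thesis by (simp add: vec_eq_iff matrix_vector_mult_def sum_type_all)
qed

definition indef_form :: "complex^('r::finite + 'l::finite) \<Rightarrow> complex^('r + 'l) \<Rightarrow> complex" where
  "indef_form u v = cip (Jform *v u) v"

lemma cip_minus_left [simp]: "cip (- x) y = - cip x y"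
  by (simp add: cip_def sum_negf)

lemma indef_form_jv [simp]: "indef_form (join_vec x y) (join_vec x' y') = cip y y' - cip x x'"
  by (simp add: indef_form_def Jform_jv)

lemma form_iff: "ctrans g ** Jform ** g = Jform \<longleftrightarrow> (\<forall>u v. indef_form (g *v u) (g *v v) = indef_form u v)"
proof -
  have *: "indef_form (g *v u) (g *v v) = cip ((ctrans g ** Jform ** g) *v u) v" for u v
    by (simp add: indef_form_def cip_adj2 matrix_vector_mul_assoc matrix_mul_assoc)
  show ?thesis
  proof
    assume "ctrans g ** Jform ** g = Jform"
    with * show "\<forall>u v. indef_form (g *v u) (g *v v) = indef_form u v" by (simp add: indef_form_def)
  next
    assume **: "\<forall>u v. indef_form (g *v u) (g *v v) = indef_form u v"
    show "ctrans g ** Jform ** g = Jform"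
      by (rule mat_ext) (use * ** in \<open>simp add: indef_form_def\<close>)
  qed
qed

lemma SU_iff: "g \<in> SUgrp \<longleftrightarrow> (\<forall>u v. indef_form (g *v u) (g *v v) = indef_form u v) \<and> det g = 1"
  unfolding SUgrp_def mem_Collect_eq form_iff ..

lemma matrix_inv_works: assumes "invertible (A :: complex^'n::finite^'n)"
  shows "A ** matrix_inv A = mat 1" "matrix_inv A ** A = mat 1"
proof -
  have "\<exists>A'. A ** A' = mat 1 \<and> A' ** A = mat 1" using assms by (simp add: invertible_def)
  then have "A ** matrix_inv A = mat 1 \<and> matrix_inv A ** A = mat 1" unfolding matrix_inv_def by (rule someI_ex)
  then show "A ** matrix_inv A = mat 1" "matrix_inv A ** A = mat 1" by auto
qed

lemma matrix_inv_eqI: assumes "A ** B = mat 1" "B ** A = mat 1" shows "matrix_inv A = (B :: complex^'n::finite^'n)"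
proof -
  have i: "invertible A" using assms by (auto simp: invertible_def)
  have "matrix_inv A = matrix_inv A ** (A ** B)" using assms by simp
  also have "\<dots> = (matrix_inv A ** A) ** B" by (simp only: matrix_mul_assoc)
  also have "\<dots> = B" by (simp add: matrix_inv_works[OF i])
  finally show ?thesis .
qed

lemma SU_inv: assumes "g \<in> SUgrp" shows "invertible g" "matrix_inv g \<in> SUgrp"
   "g *v (matrix_inv g *v u) = u" "matrix_inv g *v (g *v u) = u"
proof -
  show i: "invertible g" using assms by (simp add: invertible_det_nz SUgrp_def)
  show 1: "g *v (matrix_inv g *v u) = u" "matrix_inv g *v (g *v u) = u" for u
    by (simp_all add: matrix_vector_mul_assoc matrix_inv_works[OF i])
  have "det (g ** matrix_inv g) = 1" by (simp add: matrix_inv_works[OF i] det_I)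
  then have "det (matrix_inv g) = 1" using assms by (simp add: det_mul SUgrp_def)
  moreover have "indef_form (matrix_inv g *v u) (matrix_inv g *v v) = indef_form u v" for u v
  proof -
    have "indef_form (g *v (matrix_inv g *v u)) (g *v (matrix_inv g *v v)) = indef_form (matrix_inv g *v u) (matrix_inv g *v v)"
      using assms unfolding SU_iff by blast
    then show ?thesis unfolding 1 by (rule sym)
  qed
  ultimately show "matrix_inv g \<in> SUgrp" by (simp add: SU_iff)
qed

lemma SU_mult: "g \<in> SUgrp \<Longrightarrow> h \<in> SUgrp \<Longrightarrow> g ** h \<in> SUgrp"
  by (simp add: SU_iff det_mul matrix_vector_mul_assoc[symmetric])

lemma SU_1: "mat 1 \<in> SUgrp"
  by (simp add: SU_iff det_I)

section \<open>The fractional linear action and its automorphy factor\<close>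

definition den :: "complex^('r::finite + 'l::finite)^('r + 'l) \<Rightarrow> complex^'l^'r \<Rightarrow> complex^'l^'l" where
  "den g z = cblk g ** z + dblk g"

lemma jfac_den: "jfac g z = det (den g z)"
  by (simp add: jfac_def den_def)

lemma mv_add: "(A + B) *v (x :: complex^'n::finite) = A *v x + B *v x"
  by (simp add: vec_eq_iff matrix_vector_mult_def algebra_simps sum.distrib)

text \<open>If y is in the kernel, g maps (z y, y) to a vector (p, 0). The form is nonnegative on
  the first because z is a contraction and nonpositive on the second, so p = 0, and injectivity of g
  gives y = 0.\<close>

lemma den_inv: assumes "g \<in> SUgrp" "z \<in> Cl" shows "invertible (den g z)"
proof (rule invertible_inj)
  fix y assume y: "den g z *v y = 0"
  define p where "p = ablk g *v (z *v y) + bblk g *v y"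
  have e: "g *v join_vec (z *v y) y = join_vec p 0"
    using y by (simp add: mv_jv p_def den_def mv_add matrix_vector_mul_assoc[symmetric])
  have "indef_form (g *v join_vec (z *v y) y) (g *v join_vec (z *v y) y) = indef_form (join_vec (z *v y) y) (join_vec (z *v y) y)"
    using assms unfolding SU_iff by blast
  then have "- of_real ((norm p)\<^sup>2) = (of_real ((norm y)\<^sup>2 - (norm (z *v y))\<^sup>2) :: complex)"
    unfolding e indef_form_jv cip_self by simp
  then have "- ((norm p)\<^sup>2) = (norm y)\<^sup>2 - (norm (z *v y))\<^sup>2" by (simp only: of_real_minus[symmetric] of_real_eq_iff)
  moreover have "(norm (z *v y))\<^sup>2 \<le> (norm y)\<^sup>2"
    using assms(2) by (intro power_mono) (auto simp: Cl_def)
  ultimately have "(norm p)\<^sup>2 \<le> 0" by linarith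
  then have "p = 0" by simp
  then have "g *v join_vec (z *v y) y = 0" using e by (simp add: join_vec_0)
  then have "join_vec (z *v y) y = 0" using SU_inv(4)[OF assms(1), of "join_vec (z *v y) y"] by simp
  then show "y = 0" unfolding join_vec_0[symmetric] by simp
qed

lemma jfac_nz: "g \<in> SUgrp \<Longrightarrow> z \<in> Cl \<Longrightarrow> jfac g z \<noteq> 0"
  using den_inv unfolding jfac_den invertible_det_nz by blast

lemma act_den: assumes "g \<in> SUgrp" "z \<in> Cl" shows "act g z ** den g z = ablk g ** z + bblk g"
proof -
  have "act g z ** den g z = (ablk g ** z + bblk g) ** (matrix_inv (den g z) ** den g z)"
    unfolding act_def den_def[symmetric] by (simp only: matrix_mul_assoc)
  then show ?thesis by (simp add: matrix_inv_works[OF den_inv[OF assms]])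
qed

text \<open>A matrix z is represented by its graph, the vectors (z y, y); g maps the graph of z to
  the graph of \<open>act g z\<close>, with \<open>den g z\<close> as the change of parameter.
  Invariance of \<open>Cl\<close> and \<open>Dom\<close>, the cocycle identity and the composition
  law all follow from this picture.\<close>

lemma act_mv: assumes "g \<in> SUgrp" "z \<in> Cl"
  shows "g *v join_vec (z *v y) y = join_vec (act g z *v (den g z *v y)) (den g z *v y)"
  by (simp add: mv_jv matrix_vector_mul_assoc act_den[OF assms] mv_add) (simp add: den_def mv_add)

lemma den_surj: assumes "g \<in> SUgrp" "z \<in> Cl" obtains y where "u = den g z *v y"
  using that[of "matrix_inv (den g z) *v u"] by (simp add: matrix_vector_mul_assoc matrix_inv_works[OF den_inv[OF assms]])

lemma den_form: assumes "g \<in> SUgrp" "z \<in> Cl" "w \<in> Cl"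
  shows "cip (den g z *v y) (den g w *v y') - cip (act g z *v (den g z *v y)) (act g w *v (den g w *v y'))
       = cip y y' - cip (z *v y) (w *v y')"
proof -
  have "indef_form (g *v join_vec (z *v y) y) (g *v join_vec (w *v y') y') = indef_form (join_vec (z *v y) y) (join_vec (w *v y') y')"
    using assms(1) unfolding SU_iff by blast
  then show ?thesis unfolding act_mv[OF assms(1,2)] act_mv[OF assms(1,3)] indef_form_jv .
qed

lemma den_norm: assumes "g \<in> SUgrp" "z \<in> Cl"
  shows "(norm (den g z *v y))\<^sup>2 - (norm (act g z *v (den g z *v y)))\<^sup>2 = (norm y)\<^sup>2 - (norm (z *v y))\<^sup>2"
  using den_form[OF assms(1,2,2), of y y] unfolding cip_self by (simp only: of_real_diff[symmetric] of_real_eq_iff)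

lemma act_Cl: assumes "g \<in> SUgrp" "z \<in> Cl" shows "act g z \<in> Cl"
  unfolding Cl_def mem_Collect_eq
proof
  fix u
  obtain y where y: "u = den g z *v y" using den_surj[OF assms] by blast
  have "(norm (z *v y))\<^sup>2 \<le> (norm y)\<^sup>2" using assms(2) by (intro power_mono) (auto simp: Cl_def)
  then have "(norm (act g z *v u))\<^sup>2 \<le> (norm u)\<^sup>2" using den_norm[OF assms, of y] unfolding y by linarith
  then show "norm (act g z *v u) \<le> norm u" by (rule power2_le_imp_le) simp
qed

lemma act_Dom: assumes "g \<in> SUgrp" "z \<in> Dom" shows "act g z \<in> Dom"
  unfolding Dom_iff
proof (intro allI impI)
  fix u :: "complex^'b" assume u: "u \<noteq> 0"
  obtain y where y: "u = den g z *v y" using den_surj[OF assms(1) Dom_Cl[OF assms(2)]] by blast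
  then have "y \<noteq> 0" using u by auto
  then have "norm (z *v y) < norm y" using assms(2) unfolding Dom_iff by blast
  then have "(norm (z *v y))\<^sup>2 < (norm y)\<^sup>2" by (intro power_strict_mono) auto
  then have "(norm (act g z *v u))\<^sup>2 < (norm u)\<^sup>2" using den_norm[OF assms(1) Dom_Cl[OF assms(2)], of y] y by simp
  then show "norm (act g z *v u) < norm u" by (rule power2_less_imp_less) simp
qed

text \<open>The vectors (x, u), with u the image of x under \<open>ctrans v\<close>, are orthogonal
  to the graph of v for the indefinite form. Their images under g are orthogonal to the graph of
  \<open>act g v\<close>, hence of the same shape for \<open>act g v\<close>. For v in
  \<open>Shilov\<close> they are isotropic, so the adjoint of \<open>act g v\<close> preserves norms
  on the range of \<open>Nm\<close>, which is the whole space.\<close>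

lemma act_Shilov: assumes "g \<in> SUgrp" "v \<in> Shilov" shows "act g v \<in> Shilov"
  unfolding Shilov_iff
proof
  fix p0
  have vC: "v \<in> Cl" by (rule Shilov_Cl[OF assms(2)])
  define Nm where "Nm = ablk g + bblk g ** ctrans v"
  have *: "\<exists>q. g *v join_vec x (ctrans v *v x) = join_vec (Nm *v x) (ctrans (act g v) *v (Nm *v x)) \<and> norm (ctrans (act g v) *v (Nm *v x)) = norm (Nm *v x)" for x
  proof -
    define q where "q = cblk g *v x + dblk g *v (ctrans v *v x)"
    have e: "g *v join_vec x (ctrans v *v x) = join_vec (Nm *v x) q"
      by (simp add: mv_jv q_def Nm_def mv_add matrix_vector_mul_assoc)
    have "cip q u = cip (ctrans (act g v) *v (Nm *v x)) u" for u
    proof -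
      obtain y where y: "u = den g v *v y" using den_surj[OF assms(1) vC] by blast
      have "indef_form (g *v join_vec x (ctrans v *v x)) (g *v join_vec (v *v y) y) = indef_form (join_vec x (ctrans v *v x)) (join_vec (v *v y) y)"
        using assms(1) unfolding SU_iff by blast
      also have "\<dots> = 0" by (simp add: cip_adj)
      finally show ?thesis unfolding e act_mv[OF assms(1) vC] indef_form_jv y by (simp add: cip_adj)
    qed
    then have q: "q = ctrans (act g v) *v (Nm *v x)" by (rule cip_ext)
    have "indef_form (g *v join_vec x (ctrans v *v x)) (g *v join_vec x (ctrans v *v x)) = indef_form (join_vec x (ctrans v *v x)) (join_vec x (ctrans v *v x))"
      using assms(1) unfolding SU_iff by blast
    then have "of_real ((norm q)\<^sup>2) = (of_real ((norm (Nm *v x))\<^sup>2) :: complex)"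
      unfolding e indef_form_jv cip_self Shilov_norm[OF assms(2)] by simp
    then have "(norm q)\<^sup>2 = (norm (Nm *v x))\<^sup>2" by (simp only: of_real_eq_iff)
    then have "norm q = norm (Nm *v x)" by (simp add: power2_eq_iff_nonneg)
    with e q show ?thesis by simp
  qed
  have "invertible Nm"
  proof (rule invertible_inj)
    fix x assume "Nm *v x = 0"
    then have "g *v join_vec x (ctrans v *v x) = 0" using *[of x] by (simp add: join_vec_0)
    then have "join_vec x (ctrans v *v x) = 0" using SU_inv(4)[OF assms(1), of "join_vec x (ctrans v *v x)"] by simp
    then show "x = 0" unfolding join_vec_0[symmetric] by simp
  qed
  then have "p0 = Nm *v (matrix_inv Nm *v p0)" by (simp add: matrix_vector_mul_assoc matrix_inv_works)
  then show "norm (ctrans (act g v) *v p0) = norm p0" using *[of "matrix_inv Nm *v p0"] by simp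
qed

lemma den_mult: assumes "h \<in> SUgrp" "z \<in> Cl" "g \<in> SUgrp"
  shows "den (g ** h) z = den g (act h z) ** den h z" "act (g ** h) z = act g (act h z)"
proof -
  have gh: "g ** h \<in> SUgrp" by (rule SU_mult[OF assms(3,1)])
  have "join_vec (act (g ** h) z *v (den (g ** h) z *v y)) (den (g ** h) z *v y)
     = join_vec (act g (act h z) *v (den g (act h z) *v (den h z *v y))) (den g (act h z) *v (den h z *v y))" for y
    unfolding act_mv[OF gh assms(2), symmetric] act_mv[OF assms(3) act_Cl[OF assms(1,2)], symmetric]
      act_mv[OF assms(1,2), symmetric] by (simp add: matrix_vector_mul_assoc)
  then have 0: "act (g ** h) z *v (den (g ** h) z *v y) = act g (act h z) *v (den g (act h z) *v (den h z *v y))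
      \<and> den (g ** h) z *v y = den g (act h z) *v (den h z *v y)" for y unfolding join_vec_eq .
  have 1: "den (g ** h) z *v y = den g (act h z) *v (den h z *v y)"
    "act (g ** h) z *v (den (g ** h) z *v y) = act g (act h z) *v (den (g ** h) z *v y)" for y
    using 0[of y] by auto
  show "den (g ** h) z = den g (act h z) ** den h z"
    unfolding matrix_eq matrix_vector_mul_assoc[symmetric] using 1(1) by blast
  show "act (g ** h) z = act g (act h z)"
    unfolding matrix_eq using 1(2) den_surj[OF gh assms(2)] by metis
qed

lemma jfac_mult: assumes "h \<in> SUgrp" "z \<in> Cl" "g \<in> SUgrp"
  shows "jfac (g ** h) z = jfac g (act h z) * jfac h z"
  unfolding jfac_den den_mult(1)[OF assms] det_mul ..

lemma act_1 [simp]: "act (mat 1) z = z" "jfac (mat 1) z = 1"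
proof -
  have b: "ablk (mat 1) = mat 1" "bblk (mat 1) = 0" "cblk (mat 1) = 0" "dblk (mat 1) = mat 1"
    by (simp_all add: ablk_def bblk_def cblk_def dblk_def mat_def vec_eq_iff)
  have z: "(0 :: complex^'b^'a) ** (z :: complex^'a^'b) = 0" by (simp add: matrix_matrix_mult_def vec_eq_iff)
  show "act (mat 1) z = z" unfolding act_def b using matrix_inv_eqI[of "mat 1 :: complex^'a^'a" "mat 1"]
    by (simp add: matrix_matrix_mult_def[of "0 :: complex^'b^'a"] vec_eq_iff[of "\<chi> i j. 0"] zero_vec_def[symmetric])
  show "jfac (mat 1) z = 1" unfolding jfac_def b
    by (simp add: matrix_matrix_mult_def[of "0 :: complex^'b^'a"] zero_vec_def[symmetric] det_I)
qed

lemma act_inv: assumes "g \<in> SUgrp" "z \<in> Cl"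
  shows "act (matrix_inv g) (act g z) = z" "act g (act (matrix_inv g) z) = z"
    "jfac (matrix_inv g) (act g z) * jfac g z = 1" "jfac g (act (matrix_inv g) z) * jfac (matrix_inv g) z = 1"
proof -
  note i = SU_inv(2)[OF assms(1)] and w = matrix_inv_works[OF SU_inv(1)[OF assms(1)]]
  show "act (matrix_inv g) (act g z) = z" using den_mult(2)[OF assms i] w by simp
  show "act g (act (matrix_inv g) z) = z" using den_mult(2)[OF i assms(2,1)] w by simp
  show "jfac (matrix_inv g) (act g z) * jfac g z = 1" using jfac_mult[OF assms i] w by simp
  show "jfac g (act (matrix_inv g) z) * jfac (matrix_inv g) z = 1" using jfac_mult[OF i assms(2,1)] w by simp
qed

section \<open>Integration by parts for rotation invariant vectors\<close>

text \<open>Dominated convergence for the remainder of the difference quotient: the Lipschitz bound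
  contributes C and the derivative another C. The set S is left general because the lemma is applied
  both on the whole line and on the interval from 0 to 1 with its endpoints.\<close>

lemma has_vector_derivative_integral:
  fixes f :: "real \<Rightarrow> 'a \<Rightarrow> complex"
  assumes M: "finite_measure M" and s0: "s0 \<in> S"
    and int: "\<And>s. s \<in> S \<Longrightarrow> integrable M (f s)" and f'm: "f' \<in> borel_measurable M"
    and der: "AE x in M. ((\<lambda>s. f s x) has_vector_derivative f' x) (at s0 within S)"
    and lip: "AE x in M. \<forall>s\<in>S. cmod (f s x - f s0 x) \<le> C * \<bar>s - s0\<bar>"
    and bd: "AE x in M. cmod (f' x) \<le> C"
  shows "((\<lambda>s. \<integral>x. f s x \<partial>M) has_vector_derivative (\<integral>x. f' x \<partial>M)) (at s0 within S)"
proof -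
  interpret finite_measure M by (rule M)
  have f'i: "integrable M f'" by (rule integrable_const_bound[OF bd f'm])
  show ?thesis
    unfolding has_vector_derivative_def has_derivative_within
  proof
    show "bounded_linear (\<lambda>x. x *\<^sub>R integral\<^sup>L M f')" by (rule bounded_linear_scaleR_left)
    show "((\<lambda>y. (1 / norm (y - s0)) *\<^sub>R (integral\<^sup>L M (f y) - (integral\<^sup>L M (f s0) + (y - s0) *\<^sub>R integral\<^sup>L M f'))) \<longlongrightarrow> 0) (at s0 within S)"
      unfolding tendsto_at_iff_sequentially
    proof (intro allI impI)
      fix X :: "nat \<Rightarrow> real" assume X: "\<forall>i. X i \<in> S - {s0}" "X \<longlonglongrightarrow> s0"
      let ?u = "\<lambda>n x. (1 / norm (X n - s0)) *\<^sub>R (f (X n) x - (f s0 x + (X n - s0) *\<^sub>R f' x))"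
      have iX: "integrable M (f (X n))" "integrable M (f s0)" for n using int X s0 by auto
      have lim: "(\<lambda>n. \<integral>x. ?u n x \<partial>M) \<longlonglongrightarrow> (\<integral>x. 0 \<partial>M)"
      proof (rule integral_dominated_convergence[where w = "\<lambda>_. C + C"])
        show "?u n \<in> borel_measurable M" for n
          using borel_measurable_integrable[OF iX(1)[of n]] borel_measurable_integrable[OF iX(2)] f'm by measurable
        show "AE x in M. (\<lambda>n. ?u n x) \<longlonglongrightarrow> 0"
          using der
        proof eventually_elim
          case (elim x)
          then have "((\<lambda>y. (1 / norm (y - s0)) *\<^sub>R (f y x - (f s0 x + (y - s0) *\<^sub>R f' x))) \<longlongrightarrow> 0) (at s0 within S)"
            unfolding has_vector_derivative_def has_derivative_within by simp
          then show ?case unfolding tendsto_at_iff_sequentially using X by (auto simp: o_def)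
        qed
        show "AE x in M. norm (?u n x) \<le> C + C" for n
          using lip bd
        proof eventually_elim
          case (elim x)
          have p: "\<bar>X n - s0\<bar> > 0" "X n \<in> S" using X by auto
          have "norm (f (X n) x - (f s0 x + (X n - s0) *\<^sub>R f' x)) \<le> norm (f (X n) x - f s0 x) + norm ((X n - s0) *\<^sub>R f' x)"
            by (metis norm_triangle_ineq4 diff_diff_eq)
          also have "\<dots> \<le> C * \<bar>X n - s0\<bar> + \<bar>X n - s0\<bar> * C"
            using elim p by (intro add_mono) (auto intro: mult_left_mono)
          finally have "(1 / \<bar>X n - s0\<bar>) * norm (f (X n) x - (f s0 x + (X n - s0) *\<^sub>R f' x)) \<le> (1 / \<bar>X n - s0\<bar>) * (C * \<bar>X n - s0\<bar> + \<bar>X n - s0\<bar> * C)"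
            by (intro mult_left_mono) simp_all
          also have "\<dots> = C + C" using p(1) by (simp add: divide_simps)
          finally show ?case by (simp only: norm_scaleR real_norm_def abs_divide abs_one abs_idempotent)
        qed
      qed simp_all
      have e: "(\<integral>x. ?u n x \<partial>M) = (1 / norm (X n - s0)) *\<^sub>R (integral\<^sup>L M (f (X n)) - (integral\<^sup>L M (f s0) + (X n - s0) *\<^sub>R integral\<^sup>L M f'))" for n
        using iX f'i by simp
      show "((\<lambda>y. (1 / norm (y - s0)) *\<^sub>R (integral\<^sup>L M (f y) - (integral\<^sup>L M (f s0) + (y - s0) *\<^sub>R integral\<^sup>L M f'))) \<circ> X) \<longlonglongrightarrow> 0"
        using lim unfolding e o_def by simp
    qed
  qed
qed

lemma borel_measurable_cnj [measurable (raw)]: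
  "f \<in> borel_measurable M \<Longrightarrow> (\<lambda>x. cnj (f x)) \<in> borel_measurable M"
  by (rule measurable_compose[of f M borel cnj]) (auto intro!: borel_measurable_continuous_onI continuous_intros)

text \<open>For a unit vector y this is the unitary map that multiplies the component along y by
  \<open>cis \<theta>\<close> and fixes the orthogonal complement of y.\<close>

definition rot :: "complex^'n::finite \<Rightarrow> real \<Rightarrow> complex^'n \<Rightarrow> complex^'n" where
  "rot y \<theta> x = x + ((cis \<theta> - 1) * cip x y) *s y"

lemma norm_vector_scalar: "norm (a *s (x :: complex^'n::finite)) = cmod a * norm x"
proof -
  have "(norm (a *s x))\<^sup>2 = (cmod a * norm x)\<^sup>2"
    unfolding norm_vec_sq power_mult_distrib by (simp add: norm_mult power_mult_distrib sum_distrib_left)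
  then show ?thesis by (simp add: power2_eq_iff_nonneg)
qed

lemma cis_minus_1_identity: "(cis \<theta> - 1) * cnj (cis \<theta> - 1) + (cis \<theta> - 1) + cnj (cis \<theta> - 1) = 0"
proof -
  have "cis \<theta> * cnj (cis \<theta>) = 1" by (simp add: complex_norm_square[symmetric])
  then show ?thesis by (simp add: algebra_simps)
qed

lemma cip_rot: assumes "norm y = 1" shows "cip (rot y \<theta> x) (rot y \<theta> x') = cip x x'"
proof -
  have "cip y y = 1" using assms by (simp add: cip_self)
  then have "cip (rot y \<theta> x) (rot y \<theta> x') = cip x x' +
      ((cis \<theta> - 1) * cnj (cis \<theta> - 1) + (cis \<theta> - 1) + cnj (cis \<theta> - 1)) * (cip x y * cip y x')"
    unfolding rot_def by (simp add: algebra_simps cip_cnj[of x' y])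
  then show ?thesis unfolding cis_minus_1_identity by simp
qed

lemma norm_rot: assumes "norm y = 1" shows "norm (rot y \<theta> x) = norm x"
proof -
  have "of_real ((norm (rot y \<theta> x))\<^sup>2) = (of_real ((norm x)\<^sup>2) :: complex)"
    using cip_rot[OF assms, of \<theta> x x] unfolding cip_self .
  then show ?thesis by (simp only: of_real_eq_iff) (simp add: power2_eq_iff_nonneg)
qed

lemma cmod_cis_m1: "cmod (cis \<theta> - 1) \<le> \<bar>\<theta>\<bar>"
proof -
  have "cmod (cis \<theta> - cis 0) \<le> 1 * norm (\<theta> - 0)"
  proof (rule differentiable_bound[of UNIV cis "\<lambda>x h. h *\<^sub>R (\<i> * cis x)"])
    show "(cis has_derivative (\<lambda>h. h *\<^sub>R (\<i> * cis x))) (at x within UNIV)" for x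
      using has_derivative_cis[OF has_derivative_ident] .
    show "onorm (\<lambda>h. h *\<^sub>R (\<i> * cis x)) \<le> 1" for x by (rule onorm_le) (simp add: norm_mult)
  qed auto
  then show ?thesis by simp
qed

text \<open>The law of X is invariant only under rotations whose axis is supported in the
  coordinates I. The full index set occurs for a row of a Shilov matrix, a proper subset after some
  columns have been used up in the norm estimate; there M is a weighted measure, so it is only
  assumed finite.\<close>

locale rotation_invariant = finite_measure M for M :: "'a measure" +
  fixes X :: "'a \<Rightarrow> complex^'n::finite" and I :: "'n set"
  assumes Xm [measurable]: "X \<in> borel_measurable M"
    and Xb: "AE v in M. norm (X v) \<le> 1"
    and inv: "\<And>y \<theta> g. norm y = 1 \<Longrightarrow> (\<And>k. k \<notin> I \<Longrightarrow> y $ k = 0) \<Longrightarrow> (g :: complex^'n \<Rightarrow> complex) \<in> borel_measurable borel \<Longrightarrow>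
       (\<integral>v. g (rot y \<theta> (X v)) \<partial>M) = (\<integral>v. g (X v) \<partial>M)"
begin

text \<open>P and Q are the derivatives of f in the coordinates and in their conjugates. The
  velocity of the rotation at angle 0 is \<i> times the component of x along y, so
  \<open>D y\<close> is the derivative of f along the orbit; its mean vanishes because the mean of f
  does not change along the orbit.\<close>

lemma stein_diagonal:
  fixes f :: "complex^'n \<Rightarrow> complex"
  assumes fm: "f \<in> borel_measurable borel" and Pm: "\<And>a. P a \<in> borel_measurable borel" and Qm: "\<And>a. Q a \<in> borel_measurable borel"
    and der: "\<And>x. norm x \<le> 1 \<Longrightarrow> (f has_derivative (\<lambda>h. \<Sum>a\<in>UNIV. P a x * h $ a + Q a x * cnj (h $ a))) (at x)"
    and bP: "\<And>a x. norm x \<le> 1 \<Longrightarrow> cmod (P a x) \<le> C" and bQ: "\<And>a x. norm x \<le> 1 \<Longrightarrow> cmod (Q a x) \<le> C"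
    and y: "norm y = 1" "\<And>k. k \<notin> I \<Longrightarrow> y $ k = 0"
  defines "D \<equiv> \<lambda>y x. \<Sum>a\<in>UNIV. P a x * (\<i> * cip x y * y $ a) + Q a x * cnj (\<i> * cip x y * y $ a)"
  shows "(\<integral>v. D y (X v) \<partial>M) = 0"
proof -
  \<comment> \<open>A Lipschitz constant of f on the unit ball: each of the coordinates contributes
    one term with P and one with Q.\<close>
  define L where "L = 2 * C * real CARD('n)"
  have C0: "0 \<le> C" by (rule order_trans[OF norm_ge_zero bP[where x = 0 and a = undefined]]) simp
  have yn: "cmod (y $ a) \<le> 1" for a using Finite_Cartesian_Product.norm_nth_le[of y a] y by simp
  have sb: "norm (\<Sum>a\<in>UNIV. P a x * h a + Q a x * cnj (h a)) \<le> L * B" if "norm x \<le> 1" "\<And>a. cmod (h a) \<le> B" for x h B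
  proof -
    have "norm (\<Sum>a\<in>UNIV. P a x * h a + Q a x * cnj (h a)) \<le> (\<Sum>a\<in>(UNIV::'n set). C * B + C * B)"
    proof (rule sum_norm_le)
      fix a
      have "norm (P a x * h a + Q a x * cnj (h a)) \<le> cmod (P a x) * cmod (h a) + cmod (Q a x) * cmod (h a)"
        by (rule order_trans[OF norm_triangle_ineq]) (simp add: norm_mult)
      also have "\<dots> \<le> C * B + C * B"
        by (intro add_mono mult_mono bP bQ that C0) auto
      finally show "norm (P a x * h a + Q a x * cnj (h a)) \<le> C * B + C * B" .
    qed
    then show ?thesis by (simp add: L_def algebra_simps)
  qed
  have lip: "norm (f u - f v) \<le> L * norm (u - v)" if "norm u \<le> 1" "norm v \<le> 1" for u v
  proof (rule differentiable_bound[of "cball 0 1" f "\<lambda>x h. \<Sum>a\<in>UNIV. P a x * h $ a + Q a x * cnj (h $ a)"])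
    fix x :: "complex^'n" assume x: "x \<in> cball 0 1"
    then show "(f has_derivative (\<lambda>h. \<Sum>a\<in>UNIV. P a x * h $ a + Q a x * cnj (h $ a))) (at x within cball 0 1)"
      using der[of x] has_derivative_at_withinI by auto
    show "onorm (\<lambda>h. \<Sum>a\<in>UNIV. P a x * h $ a + Q a x * cnj (h $ a)) \<le> L"
      by (rule onorm_le) (use x in \<open>auto intro!: sb Finite_Cartesian_Product.norm_nth_le\<close>)
  qed (use that in auto)
  have cipb: "cmod (cip x y) \<le> 1" if "norm x \<le> 1" for x
    using cip_CS[of x y] that y by simp
  have fb: "cmod (f x) \<le> cmod (f 0) + L" if "norm x \<le> 1" for x
  proof -
    have "cmod (f x) \<le> cmod (f 0) + cmod (f x - f 0)" by (metis norm_triangle_sub)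
    also have "cmod (f x - f 0) \<le> L * 1"
      using lip[OF that, of 0] that C0 mult_left_mono[of "norm x" 1 L] by (simp add: L_def)
    finally show ?thesis by simp
  qed
  have rm: "(\<lambda>v. rot y \<theta> (X v)) \<in> borel_measurable M" for \<theta>
  proof -
    have "continuous_on UNIV (rot y \<theta>)" unfolding rot_def cip_def vector_scalar_mult_def by (intro continuous_intros)
    then show ?thesis using measurable_compose[OF Xm borel_measurable_continuous_onI] by blast
  qed
  have "((\<lambda>\<theta>. \<integral>v. f (rot y \<theta> (X v)) \<partial>M) has_vector_derivative (\<integral>v. D y (X v) \<partial>M)) (at 0 within UNIV)"
  proof (rule has_vector_derivative_integral[where C = L])
    show "finite_measure M" by unfold_locales
    show "(0::real) \<in> UNIV" by simp
    show "integrable M (\<lambda>v. f (rot y s (X v)))" for s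
    proof (rule integrable_const_bound[where B = "cmod (f 0) + L"])
      show "AE v in M. cmod (f (rot y s (X v))) \<le> cmod (f 0) + L"
        using Xb by eventually_elim (use norm_rot[OF y(1)] fb in simp)
      show "(\<lambda>v. f (rot y s (X v))) \<in> borel_measurable M" using measurable_compose[OF rm fm] .
    qed
    have "cip x y = (\<Sum>i\<in>UNIV. x $ i * cnj (y $ i))" for x by (simp add: cip_def)
    have cm: "(\<lambda>x. cip x y) \<in> borel_measurable borel"
      unfolding cip_def by (intro borel_measurable_continuous_onI continuous_intros)
    have "D y \<in> borel_measurable borel"
      unfolding D_def using Pm Qm cm by measurable
    then show "(\<lambda>v. D y (X v)) \<in> borel_measurable M" by measurable
    show "AE v in M. ((\<lambda>\<theta>. f (rot y \<theta> (X v))) has_vector_derivative D y (X v)) (at 0 within UNIV)"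
      using Xb
    proof eventually_elim
      case (elim v)
      have 1: "((\<lambda>\<theta>. rot y \<theta> (X v)) has_derivative (\<lambda>t. t *\<^sub>R ((\<i> * cip (X v) y) *s y))) (at 0)"
      proof -
        have bl: "bounded_linear (\<lambda>c. c *s y)"
        proof (rule bounded_linear_intro[where K = "norm y"])
          show "(b + c) *s y = b *s y + c *s y" for b c by (rule vector_sadd_rdistrib)
          show "(r *\<^sub>R c) *s y = r *\<^sub>R (c *s y)" for r c by (simp add: vec_eq_iff)
        qed (simp add: norm_vector_scalar)
        have "((\<lambda>\<theta>. (cis \<theta> - 1) * cip (X v) y) has_derivative (\<lambda>t. t *\<^sub>R (\<i> * cip (X v) y))) (at 0)"
          by (auto intro!: derivative_eq_intros simp: algebra_simps scaleR_conv_of_real)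
        from bounded_linear.has_derivative[OF bl this]
        have "((\<lambda>\<theta>. X v + ((cis \<theta> - 1) * cip (X v) y) *s y) has_derivative (\<lambda>t. (t *\<^sub>R (\<i> * cip (X v) y)) *s y)) (at 0)"
          by (auto intro!: derivative_eq_intros)
        moreover have "(\<lambda>t. (t *\<^sub>R (\<i> * cip (X v) y)) *s y) = (\<lambda>t. t *\<^sub>R ((\<i> * cip (X v) y) *s y))"
          by (simp add: fun_eq_iff vec_eq_iff)
        ultimately show ?thesis unfolding rot_def by simp
      qed
      have r0: "rot y 0 (X v) = X v" by (simp add: rot_def)
      have 2: "((\<lambda>\<theta>. f (rot y \<theta> (X v))) has_derivative
          (\<lambda>t. \<Sum>a\<in>UNIV. P a (X v) * (t *\<^sub>R ((\<i> * cip (X v) y) *s y)) $ a + Q a (X v) * cnj ((t *\<^sub>R ((\<i> * cip (X v) y) *s y)) $ a))) (at 0)"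
        using has_derivative_compose[OF 1, of f] der[OF elim] unfolding r0 by blast
      show ?case unfolding has_vector_derivative_def
        by (rule has_derivative_eq_rhs[OF 2])
           (simp add: fun_eq_iff D_def scaleR_sum_right scaleR_add_right scaleR_diff_right)
    qed
    show "AE v in M. \<forall>s\<in>UNIV. cmod (f (rot y s (X v)) - f (rot y 0 (X v))) \<le> L * \<bar>s - 0\<bar>"
      using Xb
    proof eventually_elim
      case (elim v)
      show ?case
      proof
        fix s
        have "cmod (f (rot y s (X v)) - f (rot y 0 (X v))) \<le> L * norm (rot y s (X v) - rot y 0 (X v))"
          using elim norm_rot[OF y(1)] by (intro lip) auto
        also have "rot y s (X v) - rot y 0 (X v) = ((cis s - 1) * cip (X v) y) *s y" by (simp add: rot_def)
        also have "norm \<dots> = cmod (cis s - 1) * cmod (cip (X v) y)"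
          using y by (simp add: norm_vector_scalar norm_mult)
        also have "L * \<dots> \<le> L * (\<bar>s\<bar> * 1)"
          using C0 cipb[OF elim] cmod_cis_m1 by (intro mult_left_mono mult_mono) (auto simp: L_def)
        finally show "cmod (f (rot y s (X v)) - f (rot y 0 (X v))) \<le> L * \<bar>s - 0\<bar>" by simp
      qed
    qed
    show "AE v in M. cmod (D y (X v)) \<le> L"
      using Xb
    proof eventually_elim
      case (elim v)
      have "norm (D y (X v)) \<le> L * 1" unfolding D_def
        by (rule sb[OF elim]) (use cipb[OF elim] yn in \<open>simp add: norm_mult mult_le_one\<close>)
      then show ?case by simp
    qed
  qed
  moreover have "(\<lambda>\<theta>. \<integral>v. f (rot y \<theta> (X v)) \<partial>M) = (\<lambda>\<theta>. \<integral>v. f (X v) \<partial>M)"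
    using inv[OF y fm] by auto
  ultimately have "((\<lambda>\<theta>::real. \<integral>v. f (X v) \<partial>M) has_vector_derivative (\<integral>v. D y (X v) \<partial>M)) (at 0)" by simp
  moreover have "((\<lambda>\<theta>::real. \<integral>v. f (X v) \<partial>M) has_vector_derivative 0) (at 0)" by (rule has_vector_derivative_const)
  ultimately show ?thesis by (rule vector_derivative_unique_at)
qed

text \<open>Differentiate the invariance along the rotations \<open>rot y \<theta>\<close> at \<open>\<theta> = 0\<close>, and polarise over
  \<open>y = e\<^sub>p + w e\<^sub>q\<close> with \<open>w \<in> {1, \<i>, -1, -\<i>}\<close>.\<close>

lemma stein:
  fixes f :: "complex^'n \<Rightarrow> complex"
  assumes fm: "f \<in> borel_measurable borel" and Pm: "\<And>a. P a \<in> borel_measurable borel" and Qm: "\<And>a. Q a \<in> borel_measurable borel"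
    and der: "\<And>x. norm x \<le> 1 \<Longrightarrow> (f has_derivative (\<lambda>h. \<Sum>a\<in>UNIV. P a x * h $ a + Q a x * cnj (h $ a))) (at x)"
    and bP: "\<And>a x. norm x \<le> 1 \<Longrightarrow> cmod (P a x) \<le> C" and bQ: "\<And>a x. norm x \<le> 1 \<Longrightarrow> cmod (Q a x) \<le> C"
    and pq: "p \<in> I" "q \<in> I"
  shows "integrable M (\<lambda>v. P p (X v) * X v $ q - Q q (X v) * cnj (X v $ p))"
    "(\<integral>v. (P p (X v) * X v $ q - Q q (X v) * cnj (X v $ p)) \<partial>M) = 0"
proof -
  define D where "D = (\<lambda>y x. \<Sum>a\<in>UNIV. P a x * (\<i> * cip x y * y $ a) + Q a x * cnj (\<i> * cip x y * y $ a))"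
  have C0: "0 \<le> C" by (rule order_trans[OF norm_ge_zero bP[where x = 0 and a = undefined]]) simp
  have D1: "(\<integral>v. D y (X v) \<partial>M) = 0" if "norm y = 1" "\<And>k. k \<notin> I \<Longrightarrow> y $ k = 0" for y
    unfolding D_def by (rule stein_diagonal[OF fm Pm Qm der bP bQ that])
  have Dsc: "D (of_real c *s y) x = of_real (c\<^sup>2) * D y x" for c y x
    by (simp add: D_def sum_distrib_left power2_eq_square algebra_simps)
  have D2: "(\<integral>v. D y (X v) \<partial>M) = 0" if "y \<noteq> 0" "\<And>k. k \<notin> I \<Longrightarrow> y $ k = 0" for y
  proof -
    have "(\<integral>v. D (of_real (1 / norm y) *s y) (X v) \<partial>M) = 0"
      by (rule D1) (use that in \<open>auto simp: norm_vector_scalar norm_divide\<close>)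
    then show ?thesis unfolding Dsc using that(1) by simp
  qed
  have cb: "cmod (X v $ a) \<le> 1" if "norm (X v) \<le> 1" for v a
    using Finite_Cartesian_Product.norm_nth_le[of "X v" a] that by linarith
  have Xam: "(\<lambda>v. X v $ a) \<in> borel_measurable M" for a
    by (rule measurable_compose[OF Xm]) (intro borel_measurable_continuous_onI continuous_intros)
  have PX: "(\<lambda>v. P a (X v)) \<in> borel_measurable M" "(\<lambda>v. Q a (X v)) \<in> borel_measurable M" for a
    using measurable_compose[OF Xm Pm] measurable_compose[OF Xm Qm] by auto
  have i1: "integrable M (\<lambda>v. P a (X v) * X v $ b)" "integrable M (\<lambda>v. Q a (X v) * cnj (X v $ b))" for a b
  proof -
    show "integrable M (\<lambda>v. P a (X v) * X v $ b)"
    proof (rule integrable_const_bound[where B = "C * 1"])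
      show "AE v in M. norm (P a (X v) * X v $ b) \<le> C * 1"
        using Xb by eventually_elim (use bP cb C0 in \<open>simp only: norm_mult, intro mult_mono, auto\<close>)
      show "(\<lambda>v. P a (X v) * X v $ b) \<in> borel_measurable M" using PX Xam by measurable
    qed
    show "integrable M (\<lambda>v. Q a (X v) * cnj (X v $ b))"
    proof (rule integrable_const_bound[where B = "C * 1"])
      show "AE v in M. norm (Q a (X v) * cnj (X v $ b)) \<le> C * 1"
        using Xb by eventually_elim (use bQ cb C0 in \<open>simp only: norm_mult complex_mod_cnj, intro mult_mono, auto\<close>)
      show "(\<lambda>v. Q a (X v) * cnj (X v $ b)) \<in> borel_measurable M" using PX Xam by measurable
    qed
  qed
  show int: "integrable M (\<lambda>v. P p (X v) * X v $ q - Q q (X v) * cnj (X v $ p))" using i1 by simp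
  show "(\<integral>v. (P p (X v) * X v $ q - Q q (X v) * cnj (X v $ p)) \<partial>M) = 0"
  proof (cases "p = q")
    case True
    have c: "cip x (axis p 1) = x $ p" for x by (rule cip_axis)
    have s: "(\<Sum>a\<in>UNIV. F a * axis p 1 $ a) = F p" for F :: "'n \<Rightarrow> complex"
    proof -
      have "F a * axis p 1 $ a = (if a = p then F a else 0)" for a by (simp add: axis_def)
      then show ?thesis by simp
    qed
    have "D (axis p 1) x = \<i> * (P p x * x $ p - Q p x * cnj (x $ p))" for x
    proof -
      have "D (axis p 1) x = (\<Sum>a\<in>UNIV. (P a x * (\<i> * x $ p) + Q a x * cnj (\<i> * x $ p)) * axis p 1 $ a)"
        unfolding D_def c by (intro sum.cong refl) (simp add: axis_def)
      then show ?thesis unfolding s by (simp add: algebra_simps)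
    qed
    moreover have "(\<integral>v. D (axis p 1) (X v) \<partial>M) = 0"
    proof (rule D1)
      show "norm (axis p (1::complex)) = 1" by (simp add: norm_axis_1)
    qed (use pq in \<open>auto simp: axis_def\<close>)
    ultimately show ?thesis using True by simp
  next
    case False
    define y where "y w = (\<chi> a. if a = p then 1 else if a = q then w else (0::complex))" for w
    have yn: "y w \<noteq> 0" for w unfolding y_def vec_eq_iff by (auto intro!: exI[of _ p])
    have c: "cip x (y w) = x $ p + cnj w * x $ q" for x w
    proof -
      have "x $ a * cnj (y w $ a) = (if a = p then x $ a else 0) + (if a = q then cnj w * x $ a else 0)" for a
        using False by (simp add: y_def)
      then show ?thesis by (simp add: cip_def sum.distrib)
    qed
    have s: "(\<Sum>a\<in>UNIV. F a * y w $ a) = F p + w * F q" for F :: "'n \<Rightarrow> complex" and w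
    proof -
      have "F a * y w $ a = (if a = p then F a else 0) + (if a = q then w * F a else 0)" for a
        using False by (simp add: y_def)
      then show ?thesis by (simp add: sum.distrib)
    qed
    have s': "(\<Sum>a\<in>UNIV. F a * cnj (y w $ a)) = F p + cnj w * F q" for F :: "'n \<Rightarrow> complex" and w
    proof -
      have "F a * cnj (y w $ a) = (if a = p then F a else 0) + (if a = q then cnj w * F a else 0)" for a
        using False by (simp add: y_def)
      then show ?thesis by (simp add: sum.distrib)
    qed
    have De: "D (y w) x = \<i> * (x $ p + cnj w * x $ q) * (P p x + w * P q x)
        - \<i> * (cnj (x $ p) + w * cnj (x $ q)) * (Q p x + cnj w * Q q x)" for w x
    proof -
      have "D (y w) x = (\<Sum>a\<in>UNIV. (\<i> * cip x (y w) * P a x) * y w $ a) + (\<Sum>a\<in>UNIV. (- \<i> * cnj (cip x (y w)) * Q a x) * cnj (y w $ a))"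
        unfolding D_def sum.distrib[symmetric] by (intro sum.cong refl) (simp add: algebra_simps)
      then show ?thesis unfolding s s' c by (simp add: algebra_simps)
    qed
    \<comment> \<open>Each \<open>D (y w)\<close> is weighted by w. Summed over the fourth roots of
      unity, only the terms carrying the factor \<open>cnj w\<close> survive, each of them four
      times.\<close>
    have comb: "D (y 1) x + \<i> * D (y \<i>) x - D (y (-1)) x - \<i> * D (y (-\<i>)) x
        = (4 * \<i>) * (P p x * x $ q - Q q x * cnj (x $ p))" for x
      unfolding De by (simp add: algebra_simps)
    have iD: "integrable M (\<lambda>v. D (y w) (X v))" for w
    proof -
      have "D (y w) (X v) = \<i> * (P p (X v) * X v $ p) + (\<i> * w) * (P q (X v) * X v $ p) + (\<i> * cnj w) * (P p (X v) * X v $ q)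
         + (\<i> * (w * cnj w)) * (P q (X v) * X v $ q)
         - (\<i> * (Q p (X v) * cnj (X v $ p)) + (\<i> * cnj w) * (Q q (X v) * cnj (X v $ p)) + (\<i> * w) * (Q p (X v) * cnj (X v $ q))
         + (\<i> * (w * cnj w)) * (Q q (X v) * cnj (X v $ q)))" for v
        unfolding De by (simp add: algebra_simps)
      then show ?thesis using i1 by (auto intro!: Bochner_Integration.integrable_add Bochner_Integration.integrable_diff integrable_mult_right)
    qed
    have z: "(\<integral>v. D (y w) (X v) \<partial>M) = 0" for w
      by (rule D2[OF yn]) (use pq in \<open>auto simp: y_def\<close>)
    have "(\<integral>v. (D (y 1) (X v) + \<i> * D (y \<i>) (X v) - D (y (-1)) (X v) - \<i> * D (y (-\<i>)) (X v)) \<partial>M) = 0"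
      using iD z by simp
    then show ?thesis unfolding comb by simp
  qed
qed

end

section \<open>A determinant as an integral over the sphere\<close>

lemma permutes_not_id_two:
  assumes "p permutes (UNIV :: 'n::finite set)" "p \<noteq> id"
  shows "\<exists>k. k \<noteq> i \<and> p k \<noteq> k"
proof (rule ccontr)
  assume "\<nexists>k. k \<noteq> i \<and> p k \<noteq> k"
  then have *: "\<And>k. k \<noteq> i \<Longrightarrow> p k = k" by blast
  obtain k where "p k = i" using permutes_surj[OF assms(1)] by (metis surjD)
  then have "p i = i" using * by (cases "k = i") auto
  then have "p = id" using * by (metis ext id_apply)
  with assms show False by simp
qed

text \<open>A permutation other than the identity moves at least two points, so its product still
  contains a vanishing off-diagonal factor after one factor has been differentiated. Only the
  identity contributes at first order.\<close>

lemma det_deriv0: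
  fixes P :: "complex^'n::finite^'n"
  shows "((\<lambda>e. det (mat 1 - (\<chi> i j. e * P $ i $ j))) has_field_derivative - trace P) (at 0)"
proof -
  define d where "d = (\<lambda>i j :: 'n. if i = j then 1 else 0 :: complex)"
  have entry: "(mat 1 - (\<chi> i j. e * P $ i $ j)) $ i $ j = d i j - e * P $ i $ j" for e i j
    by (simp add: mat_def d_def)
  let ?S = "{p. p permutes (UNIV :: 'n set)}"
  have T: "((\<lambda>e. of_int (sign p) * (\<Prod>i\<in>UNIV. d i (p i) - e * P $ i $ p i)) has_field_derivative
      (if p = id then - trace P else 0)) (at 0)" if p: "p permutes UNIV" for p
  proof -
    have "((\<lambda>e. \<Prod>i\<in>UNIV. d i (p i) - e * P $ i $ p i) has_field_derivative
       (\<Sum>i\<in>UNIV. (- P $ i $ p i) * (\<Prod>k\<in>UNIV - {i}. d k (p k) - 0 * P $ k $ p k))) (at 0)"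
      by (intro has_field_derivative_prod) (auto intro!: derivative_eq_intros)
    then have 1: "((\<lambda>e. of_int (sign p) * (\<Prod>i\<in>UNIV. d i (p i) - e * P $ i $ p i)) has_field_derivative
       of_int (sign p) * (\<Sum>i\<in>UNIV. (- P $ i $ p i) * (\<Prod>k\<in>UNIV - {i}. d k (p k)))) (at 0)"
      by (intro DERIV_cmult) simp
    show ?thesis
    proof (cases "p = id")
      case True
      then show ?thesis using 1 by (simp add: trace_def d_def sum_negf sign_id)
    next
      case False
      have z: "(\<Prod>k\<in>UNIV - {i}. d k (p k)) = 0" for i
      proof -
        obtain k where k: "k \<noteq> i" "p k \<noteq> k" using permutes_not_id_two[OF p False, of i] by blast
        then show ?thesis by (intro prod_zero bexI[of _ k]) (auto simp: d_def)
      qed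
      show ?thesis using 1 False unfolding z by simp
    qed
  qed
  have "((\<lambda>e. \<Sum>p\<in>?S. of_int (sign p) * (\<Prod>i\<in>UNIV. d i (p i) - e * P $ i $ p i)) has_field_derivative
      (\<Sum>p\<in>?S. if p = id then - trace P else 0)) (at 0)"
    by (intro DERIV_sum T) auto
  moreover have "(\<Sum>p\<in>?S. if p = id then - trace P else 0) = - trace P"
    by (simp add: finite_permutations permutes_id)
  ultimately show ?thesis unfolding det_def entry by simp
qed

lemma matmul_scale: "(\<chi> i j. e * A $ i $ j) = mat e ** (A :: complex^'n::finite^'m::finite)"
proof -
  have "(mat e :: complex^'m^'m) $ i $ k * A $ k $ j = (if k = i then e * A $ k $ j else 0)" for i k j by (simp add: mat_def)
  then show ?thesis by (simp add: vec_eq_iff matrix_matrix_mult_def)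
qed

lemma mat_commute: "mat e ** A = A ** mat (e :: complex)" for A :: "complex^'n::finite^'m::finite"
proof -
  have "A $ i $ k * (mat e :: complex^'n^'n) $ k $ j = (if k = j then e * A $ i $ k else 0)" for i k j by (simp add: mat_def)
  then show ?thesis unfolding matmul_scale[symmetric] by (simp add: vec_eq_iff matrix_matrix_mult_def)
qed

lemma mat_diff_ldistrib: "A ** (B - C) = A ** B - A ** (C :: complex^'k::finite^'n::finite)"
  and mat_diff_rdistrib: "(D - E) ** B = D ** B - E ** (B :: complex^'k::finite^'n::finite)"
  by (simp_all add: vec_eq_iff matrix_matrix_mult_def algebra_simps sum_subtractf)

text \<open>With R the inverse of 1 - s B, the matrix 1 - (s + e) B factors as (1 - e B R)(1 - s B),
  which moves the derivative to the identity matrix.\<close>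

lemma det_deriv:
  fixes B :: "complex^'n::finite^'n" and s :: complex
  assumes inv: "invertible (mat 1 - mat s ** B)"
  shows "((\<lambda>s. det (mat 1 - mat s ** B)) has_field_derivative
     - det (mat 1 - mat s ** B) * trace (B ** matrix_inv (mat 1 - mat s ** B))) (at s)"
proof -
  let ?A = "mat 1 - mat s ** B" and ?R = "matrix_inv (mat 1 - mat s ** B)"
  have "mat 1 - mat (s + e) ** B = (mat 1 - mat e ** (B ** ?R)) ** ?A" for e
  proof -
    have "(mat 1 - mat e ** (B ** ?R)) ** ?A = ?A - mat e ** (B ** (?R ** ?A))"
      by (simp only: mat_diff_rdistrib matrix_mul_lid matrix_mul_assoc)
    also have "\<dots> = ?A - mat e ** B" by (simp add: matrix_inv_works[OF inv])
    also have "\<dots> = mat 1 - mat (s + e) ** B"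
      unfolding matmul_scale[symmetric] by (simp add: vec_eq_iff algebra_simps)
    finally show ?thesis by simp
  qed
  then have e: "det (mat 1 - mat (s + e) ** B) = det (mat 1 - mat e ** (B ** ?R)) * det ?A" for e
    by (simp add: det_mul)
  have "((\<lambda>e. det (mat 1 - mat e ** (B ** ?R)) * det ?A) has_field_derivative - trace (B ** ?R) * det ?A) (at 0)"
    using DERIV_cmult_right[OF det_deriv0[of "B ** ?R"]] unfolding matmul_scale by blast
  then have "((\<lambda>e. det (mat 1 - mat (s + e) ** B)) has_field_derivative - trace (B ** ?R) * det ?A) (at 0)"
    unfolding e .
  then have "((\<lambda>e. det (mat 1 - mat e ** B)) has_field_derivative - trace (B ** ?R) * det ?A) (at s)"
    using DERIV_shift[of "\<lambda>e. det (mat 1 - mat e ** B)" _ 0 s] by (simp add: add.commute)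
  then show ?thesis by (simp add: mult.commute)
qed

lemma trace_mul_commute: "trace (A ** B) = trace (B ** (A :: complex^'n::finite^'m::finite))"
  unfolding trace_def matrix_matrix_mult_def by (simp add: mult.commute) (rule sum.swap)

lemma bounded_bilinear_cip: "bounded_bilinear cip"
proof
  show "cip (r *\<^sub>R a) b = r *\<^sub>R cip a b" "cip a (r *\<^sub>R b) = r *\<^sub>R cip a b" for r a and b :: "complex^'a::finite"
    by (simp_all add: cip_def scaleR_sum_right)
  show "\<exists>K. \<forall>a b :: complex^'a. norm (cip a b) \<le> norm a * norm b * K"
    using cip_CS by (intro exI[of _ 1]) auto
qed simp_all

lemma bounded_linear_mv: "bounded_linear (\<lambda>x. (A :: complex^'n::finite^'m::finite) *v x)"
proof (rule linear_conv_bounded_linear[THEN iffD1], rule linearI)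
  show "A *v (r *\<^sub>R b) = r *\<^sub>R (A *v b)" for r b by (simp add: vec_eq_iff matrix_vector_mult_def scaleR_sum_right)
qed (rule matrix_vector_right_distrib)

lemma continuous_cip [continuous_intros]:
  "continuous_on S f \<Longrightarrow> continuous_on S g \<Longrightarrow> continuous_on S (\<lambda>x. cip (f x) (g x))"
  by (rule bounded_bilinear.continuous_on[OF bounded_bilinear_cip])

lemma continuous_mv [continuous_intros]:
  "continuous_on S f \<Longrightarrow> continuous_on S (\<lambda>x. (A :: complex^'n::finite^'m::finite) *v f x)"
  by (rule bounded_linear.continuous_on[OF bounded_linear_mv])

context rotation_invariant begin

lemma stein_cont:
  fixes f :: "complex^'n \<Rightarrow> complex"
  assumes fm: "f \<in> borel_measurable borel" and Pm: "\<And>a. P a \<in> borel_measurable borel" and Qm: "\<And>a. Q a \<in> borel_measurable borel"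
    and der: "\<And>x. norm x \<le> 1 \<Longrightarrow> (f has_derivative (\<lambda>h. \<Sum>a\<in>UNIV. P a x * h $ a + Q a x * cnj (h $ a))) (at x)"
    and cP: "\<And>a. continuous_on (cball 0 1) (P a)" and cQ: "\<And>a. continuous_on (cball 0 1) (Q a)"
    and pq: "p \<in> I" "q \<in> I"
  shows "integrable M (\<lambda>v. P p (X v) * X v $ q - Q q (X v) * cnj (X v $ p))"
    "(\<integral>v. (P p (X v) * X v $ q - Q q (X v) * cnj (X v $ p)) \<partial>M) = 0"
proof -
  have ex: "\<exists>C\<ge>0. \<forall>x. norm x \<le> 1 \<longrightarrow> cmod (F x) \<le> C" if "continuous_on (cball 0 1) F" for F :: "complex^'n \<Rightarrow> complex"
  proof -
    have "bounded (F ` cball 0 1)" by (intro compact_imp_bounded compact_continuous_image that compact_cball)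
    then obtain b where "b > 0" "\<forall>y\<in>F ` cball 0 1. norm y \<le> b" unfolding bounded_pos by blast
    then show ?thesis by (intro exI[of _ b]) auto
  qed
  obtain c where c: "\<And>a. c a \<ge> 0" "\<And>a x. norm x \<le> 1 \<Longrightarrow> cmod (P a x) \<le> c a" using ex[OF cP] by metis
  obtain d where d: "\<And>a. d a \<ge> 0" "\<And>a x. norm x \<le> 1 \<Longrightarrow> cmod (Q a x) \<le> d a" using ex[OF cQ] by metis
  have le: "c a \<le> sum c UNIV + sum d UNIV" "d a \<le> sum c UNIV + sum d UNIV" for a
    using member_le_sum[of a UNIV c] member_le_sum[of a UNIV d] c(1) d(1) sum_nonneg[of UNIV c] sum_nonneg[of UNIV d]
    by (auto intro: add_increasing add_increasing2)
  have bP: "cmod (P a x) \<le> sum c UNIV + sum d UNIV" "cmod (Q a x) \<le> sum c UNIV + sum d UNIV" if "norm x \<le> 1" for a x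
    using order_trans[OF c(2)[OF that] le(1)] order_trans[OF d(2)[OF that] le(2)] by auto
  show "integrable M (\<lambda>v. P p (X v) * X v $ q - Q q (X v) * cnj (X v $ p))"
    by (rule stein(1)[OF fm Pm Qm der bP pq])
  show "(\<integral>v. (P p (X v) * X v $ q - Q q (X v) * cnj (X v $ p)) \<partial>M) = 0"
    by (rule stein(2)[OF fm Pm Qm der bP pq])
qed

end

locale sphere_invariant = rotation_invariant M X UNIV for M :: "'a measure" and X :: "'a \<Rightarrow> complex^'n::finite" +
  assumes Xn: "AE v in M. norm (X v) = 1" and tot: "measure M (space M) = 1"
begin

lemma X_int:
  assumes "continuous_on (cball 0 1) g" "g \<in> borel_measurable borel"
  shows "integrable M (\<lambda>v. g (X v) :: complex)"
proof -
  have "bounded (g ` cball 0 1)" by (intro compact_imp_bounded compact_continuous_image assms compact_cball)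
  then obtain b where "b > 0" and b: "\<forall>y\<in>g ` cball 0 1. norm y \<le> b" unfolding bounded_pos by blast
  show ?thesis
  proof (rule integrable_const_bound[where B = b])
    show "AE v in M. norm (g (X v)) \<le> b" using Xb by eventually_elim (use b in auto)
    show "(\<lambda>v. g (X v)) \<in> borel_measurable M" using measurable_compose[OF Xm assms(2)] .
  qed
qed

text \<open>The identity of the previous section for \<open>f x = x\<^sub>p cnj x\<^sub>i k(x)\<^sup>n\<close>, summed over \<open>p\<close>.\<close>

lemma G_identity:
  fixes B :: "complex^'n^'n"
  assumes \<rho>: "\<And>x. norm x \<le> 1 \<Longrightarrow> 1 - cip (B *v x) x \<noteq> 0"
  defines "k \<equiv> \<lambda>x. inverse (1 - cip (B *v x) x)" and "n \<equiv> CARD('n)"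
  defines "F \<equiv> \<integral>v. k (X v) ^ n \<partial>M" and "G \<equiv> (\<chi> q i. \<integral>v. X v $ q * cnj (X v $ i) * k (X v) ^ Suc n \<partial>M)"
  shows "mat (of_nat n) ** ((mat 1 - B) ** G) = mat F"
proof -
  define dQ where "dQ x h = cip (B *v h) x + cip (B *v x) h" for x h
  have Qd: "((\<lambda>x. cip (B *v x) x) has_derivative dQ x) (at x)" for x
    unfolding dQ_def
    by (rule has_derivative_eq_rhs[OF bounded_bilinear.FDERIV[OF bounded_bilinear_cip
        bounded_linear.has_derivative[OF bounded_linear_mv has_derivative_ident] has_derivative_ident]])
       (simp add: fun_eq_iff add.commute)
  have npos: "n > 0" by (simp add: n_def)
  have kd: "((\<lambda>x. k x ^ n) has_derivative (\<lambda>h. of_nat n * k x ^ Suc n * dQ x h)) (at x)" if "norm x \<le> 1" for x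
  proof -
    have "((\<lambda>x. k x ^ n) has_derivative (\<lambda>h. of_nat n * (k x * dQ x h * k x) * k x ^ (n - 1))) (at x)"
      unfolding k_def using \<rho>[OF that] Qd[of x] by (auto intro!: derivative_eq_intros simp: algebra_simps)
    moreover have e: "k x ^ Suc n = k x * k x * k x ^ (n - 1)" using npos by (cases n) (auto simp: algebra_simps)
    have "(\<lambda>h. of_nat n * (k x * dQ x h * k x) * k x ^ (n - 1)) = (\<lambda>h. of_nat n * k x ^ Suc n * dQ x h)"
      unfolding e by (simp only: mult_ac)
    ultimately show ?thesis by simp
  qed
  have cQ: "continuous_on S (\<lambda>x. cip (B *v x) x)" for S by (intro continuous_intros)
  have ck: "continuous_on (cball 0 1) k" unfolding k_def using \<rho> by (intro continuous_intros) auto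
  have mQ: "(\<lambda>x. cip (B *v x) x) \<in> borel_measurable borel" by (intro borel_measurable_continuous_onI cQ)
  have mk: "k \<in> borel_measurable borel" unfolding k_def using mQ by measurable
  have mB: "(\<lambda>x. (A *v x) $ a) \<in> borel_measurable borel" for A :: "complex^'n^'n" and a
    by (intro borel_measurable_continuous_onI continuous_intros)
  have mx: "(\<lambda>x :: complex^'n. x $ a) \<in> borel_measurable borel" for a
    by (intro borel_measurable_continuous_onI continuous_intros)
  have ki: "integrable M (\<lambda>v. k (X v) ^ m)" for m
    using ck mk by (intro X_int continuous_intros) auto
  have Gi: "integrable M (\<lambda>v. X v $ q * cnj (X v $ i) * k (X v) ^ m)" for q i m
    using ck mk mx by (intro X_int[of "\<lambda>x. x $ q * cnj (x $ i) * k x ^ m"] continuous_intros) auto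
  have st: "integrable M (\<lambda>v. (cnj (X v $ i) * X v $ q * k (X v) ^ n
        + of_nat n * k (X v) ^ Suc n * X v $ p * cnj (X v $ i) * cnj ((ctrans B *v X v) $ p) * X v $ q)
        - ((if q = i then X v $ p * k (X v) ^ n else 0) + of_nat n * k (X v) ^ Suc n * X v $ p * cnj (X v $ i) * (B *v X v) $ q) * cnj (X v $ p))"
     "(\<integral>v. ((cnj (X v $ i) * X v $ q * k (X v) ^ n
        + of_nat n * k (X v) ^ Suc n * X v $ p * cnj (X v $ i) * cnj ((ctrans B *v X v) $ p) * X v $ q)
        - ((if q = i then X v $ p * k (X v) ^ n else 0) + of_nat n * k (X v) ^ Suc n * X v $ p * cnj (X v $ i) * (B *v X v) $ q) * cnj (X v $ p)) \<partial>M) = 0"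
    for p q i
  proof -
    define f where "f x = x $ p * cnj (x $ i) * k x ^ n" for x
    define P where "P a x = (if a = p then cnj (x $ i) * k x ^ n else 0) + of_nat n * k x ^ Suc n * x $ p * cnj (x $ i) * cnj ((ctrans B *v x) $ a)" for a x
    define Q where "Q a x = (if a = i then x $ p * k x ^ n else 0) + of_nat n * k x ^ Suc n * x $ p * cnj (x $ i) * (B *v x) $ a" for a x
    have fm: "f \<in> borel_measurable borel" unfolding f_def using mk mx by measurable
    have Pm: "P a \<in> borel_measurable borel" for a unfolding P_def using mk mx mB by measurable
    have Qm: "Q a \<in> borel_measurable borel" for a unfolding Q_def using mk mx mB by measurable
    have cP: "continuous_on (cball 0 1) (P a)" for a
      unfolding P_def using ck by (cases "a = p") (auto intro!: continuous_intros)
    have cQ: "continuous_on (cball 0 1) (Q a)" for a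
      unfolding Q_def using ck by (cases "a = i") (auto intro!: continuous_intros)
    have der: "(f has_derivative (\<lambda>h. \<Sum>a\<in>UNIV. P a x * h $ a + Q a x * cnj (h $ a))) (at x)" if "norm x \<le> 1" for x
    proof -
      have 1: "((\<lambda>x. x $ p * cnj (x $ i)) has_derivative (\<lambda>h. x $ p * cnj (h $ i) + h $ p * cnj (x $ i))) (at x)"
        by (auto intro!: derivative_eq_intros bounded_linear.has_derivative[OF bounded_linear_cnj] bounded_linear.has_derivative[OF bounded_linear_vec_nth])
      have d: "dQ x h = (\<Sum>a\<in>UNIV. cnj ((ctrans B *v x) $ a) * h $ a + (B *v x) $ a * cnj (h $ a))" for h
        unfolding dQ_def cip_adj[of B h x] by (simp add: cip_def sum.distrib mult.commute)
      have "(f has_derivative (\<lambda>h. x $ p * cnj (x $ i) * (of_nat n * k x ^ Suc n * dQ x h) + (x $ p * cnj (h $ i) + h $ p * cnj (x $ i)) * k x ^ n)) (at x)"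
        unfolding f_def by (rule has_derivative_mult[OF 1 kd[OF that]])
      moreover have "x $ p * cnj (x $ i) * (of_nat n * k x ^ Suc n * dQ x h) + (x $ p * cnj (h $ i) + h $ p * cnj (x $ i)) * k x ^ n
          = (\<Sum>a\<in>UNIV. P a x * h $ a + Q a x * cnj (h $ a))" for h
      proof -
        have "(\<Sum>a\<in>UNIV. P a x * h $ a + Q a x * cnj (h $ a)) = (\<Sum>a\<in>UNIV. (if a = p then cnj (x $ i) * k x ^ n * h $ a else 0))
            + (\<Sum>a\<in>UNIV. (if a = i then x $ p * k x ^ n * cnj (h $ a) else 0))
            + (\<Sum>a\<in>UNIV. (of_nat n * k x ^ Suc n * x $ p * cnj (x $ i)) * (cnj ((ctrans B *v x) $ a) * h $ a + (B *v x) $ a * cnj (h $ a)))"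
          unfolding sum.distrib[symmetric] by (intro sum.cong refl) (simp add: P_def Q_def algebra_simps)
        then show ?thesis unfolding d sum_distrib_left[symmetric] by (simp add: algebra_simps)
      qed
      ultimately show ?thesis by simp
    qed
    show "integrable M (\<lambda>v. (cnj (X v $ i) * X v $ q * k (X v) ^ n
        + of_nat n * k (X v) ^ Suc n * X v $ p * cnj (X v $ i) * cnj ((ctrans B *v X v) $ p) * X v $ q)
        - ((if q = i then X v $ p * k (X v) ^ n else 0) + of_nat n * k (X v) ^ Suc n * X v $ p * cnj (X v $ i) * (B *v X v) $ q) * cnj (X v $ p))"
      using stein_cont(1)[OF fm Pm Qm der cP cQ UNIV_I UNIV_I, of p q] by (simp add: P_def Q_def algebra_simps)
    show "(\<integral>v. ((cnj (X v $ i) * X v $ q * k (X v) ^ n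
        + of_nat n * k (X v) ^ Suc n * X v $ p * cnj (X v $ i) * cnj ((ctrans B *v X v) $ p) * X v $ q)
        - ((if q = i then X v $ p * k (X v) ^ n else 0) + of_nat n * k (X v) ^ Suc n * X v $ p * cnj (X v $ i) * (B *v X v) $ q) * cnj (X v $ p)) \<partial>M) = 0"
      using stein_cont(2)[OF fm Pm Qm der cP cQ UNIV_I UNIV_I, of p q] by (simp add: P_def Q_def algebra_simps)
  qed
  have main: "of_nat n * (G $ q $ i - (\<Sum>m\<in>UNIV. B $ q $ m * G $ m $ i)) = (if q = i then F else 0)" for q i
  proof -
    let ?T = "\<lambda>v p. (cnj (X v $ i) * X v $ q * k (X v) ^ n
        + of_nat n * k (X v) ^ Suc n * X v $ p * cnj (X v $ i) * cnj ((ctrans B *v X v) $ p) * X v $ q)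
        - ((if q = i then X v $ p * k (X v) ^ n else 0) + of_nat n * k (X v) ^ Suc n * X v $ p * cnj (X v $ i) * (B *v X v) $ q) * cnj (X v $ p)"
    have "(\<integral>v. (\<Sum>p\<in>UNIV. ?T v p) \<partial>M) = (\<Sum>p\<in>UNIV. \<integral>v. ?T v p \<partial>M)"
      by (rule Bochner_Integration.integral_sum[OF st(1)])
    then have z: "(\<integral>v. (\<Sum>p\<in>UNIV. ?T v p) \<partial>M) = 0" unfolding st(2) by simp
    have "AE v in M. (\<Sum>p\<in>UNIV. ?T v p) = of_nat n * (X v $ q * cnj (X v $ i) * k (X v) ^ Suc n)
        - (if q = i then k (X v) ^ n else 0) - of_nat n * (\<Sum>m\<in>UNIV. B $ q $ m * (X v $ m * cnj (X v $ i) * k (X v) ^ Suc n))"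
      using Xn
    proof eventually_elim
      case (elim v)
      define x where "x = X v"
      have x1: "norm x \<le> 1" using elim by (simp add: x_def)
      have "cip x x = 1" using elim by (simp add: cip_self x_def)
      then have s1: "(\<Sum>p\<in>UNIV. x $ p * cnj (x $ p)) = 1" by (simp add: cip_def)
      have s2: "(\<Sum>p\<in>UNIV. x $ p * cnj ((ctrans B *v x) $ p)) = cip (B *v x) x"
        unfolding cip_adj by (simp add: cip_def)
      have s3: "(\<Sum>m\<in>UNIV. B $ q $ m * (x $ m * cnj (x $ i) * k x ^ Suc n)) = (B *v x) $ q * (cnj (x $ i) * k x ^ Suc n)"
        by (simp add: matrix_vector_mult_def sum_distrib_right mult.assoc del: power_Suc)
      \<comment> \<open>The defect between the powers n and n + 1 cancels the term with
        \<open>cip (B *v x) x\<close> below. The cancellation works because the sum over p has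
        exactly n terms, which is why the exponent of the integrand equals the dimension.\<close>
      have kk: "k x ^ n = k x ^ Suc n * (1 - cip (B *v x) x)" using \<rho>[OF x1] by (simp add: k_def)
      have "(\<Sum>p\<in>UNIV. ?T v p) = (\<Sum>p\<in>(UNIV :: 'n set). cnj (x $ i) * x $ q * k x ^ n)
          + of_nat n * k x ^ Suc n * cnj (x $ i) * x $ q * (\<Sum>p\<in>UNIV. x $ p * cnj ((ctrans B *v x) $ p))
          - ((if q = i then k x ^ n else 0) * (\<Sum>p\<in>UNIV. x $ p * cnj (x $ p))
             + of_nat n * k x ^ Suc n * cnj (x $ i) * (B *v x) $ q * (\<Sum>p\<in>UNIV. x $ p * cnj (x $ p)))"
        unfolding sum_distrib_left sum_subtractf[symmetric] sum.distrib[symmetric] x_def[symmetric]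
        by (intro sum.cong refl) (simp add: algebra_simps)
      also have "\<dots> = of_nat n * (cnj (x $ i) * x $ q * k x ^ n)
          + of_nat n * k x ^ Suc n * cnj (x $ i) * x $ q * cip (B *v x) x
          - (if q = i then k x ^ n else 0) - of_nat n * k x ^ Suc n * cnj (x $ i) * (B *v x) $ q"
        unfolding s1 s2 by (simp add: n_def)
      also have "of_nat n * (cnj (x $ i) * x $ q * k x ^ n) = of_nat n * (cnj (x $ i) * x $ q * (k x ^ Suc n * (1 - cip (B *v x) x)))"
        using kk by simp
      also have "\<dots> + of_nat n * k x ^ Suc n * cnj (x $ i) * x $ q * cip (B *v x) x = of_nat n * (x $ q * cnj (x $ i) * k x ^ Suc n)"
        by (simp add: algebra_simps)
      finally have "(\<Sum>p\<in>UNIV. ?T v p) = of_nat n * (x $ q * cnj (x $ i) * k x ^ Suc n) - (if q = i then k x ^ n else 0)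
          - of_nat n * ((B *v x) $ q * (cnj (x $ i) * k x ^ Suc n))" by (simp add: mult_ac)
      then show ?case unfolding s3[symmetric] unfolding x_def .
    qed
    then have "(\<integral>v. (\<Sum>p\<in>UNIV. ?T v p) \<partial>M) = (\<integral>v. (of_nat n * (X v $ q * cnj (X v $ i) * k (X v) ^ Suc n)
        - (if q = i then k (X v) ^ n else 0) - of_nat n * (\<Sum>m\<in>UNIV. B $ q $ m * (X v $ m * cnj (X v $ i) * k (X v) ^ Suc n))) \<partial>M)"
      by (rule integral_cong_AE[rotated 2]) (use mk mx mB Xm in \<open>measurable\<close>)
    also have "\<dots> = of_nat n * G $ q $ i - (if q = i then F else 0) - of_nat n * (\<Sum>m\<in>UNIV. B $ q $ m * G $ m $ i)"
    proof -
      have i2: "integrable M (\<lambda>v. if q = i then k (X v) ^ n else 0)" using ki by (cases "q = i") simp_all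
      have i3: "integrable M (\<lambda>v. of_nat n * (\<Sum>m\<in>UNIV. B $ q $ m * (X v $ m * cnj (X v $ i) * k (X v) ^ Suc n)))"
        by (intro integrable_mult_right Bochner_Integration.integrable_sum Gi)
      have i1: "integrable M (\<lambda>v. of_nat n * (X v $ q * cnj (X v $ i) * k (X v) ^ Suc n))"
        by (intro integrable_mult_right Gi)
      have e3: "(\<integral>v. (\<Sum>m\<in>UNIV. B $ q $ m * (X v $ m * cnj (X v $ i) * k (X v) ^ Suc n)) \<partial>M) = (\<Sum>m\<in>UNIV. B $ q $ m * G $ m $ i)"
        by (subst Bochner_Integration.integral_sum) (use Gi in \<open>auto simp: G_def simp del: power_Suc intro!: integrable_mult_right\<close>)
      have e2: "(\<integral>v. (if q = i then k (X v) ^ n else 0) \<partial>M) = (if q = i then F else 0)" by (simp add: F_def)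
      show ?thesis
        unfolding Bochner_Integration.integral_diff[OF Bochner_Integration.integrable_diff[OF i1 i2] i3]
          Bochner_Integration.integral_diff[OF i1 i2] integral_mult_right_zero e2 e3
        by (simp add: G_def del: power_Suc)
    qed
    finally show ?thesis using z by (simp add: algebra_simps)
  qed
  have "(mat (of_nat n) ** ((mat 1 - B) ** G)) $ q $ i = of_nat n * (G $ q $ i - (\<Sum>m\<in>UNIV. B $ q $ m * G $ m $ i))" for q i
    unfolding matmul_scale[symmetric] mat_diff_rdistrib by (simp add: matrix_matrix_mult_def[of B G])
  then show ?thesis unfolding vec_eq_iff main by (simp add: mat_def)
qed

text \<open>Replacing \<open>C ** E\<close> by its multiple by \<open>s\<close>, the left-hand side has derivative zero in \<open>s\<close>: the logarithmic derivatives
  of the integral and of the determinant are traces that cancel by \<open>G_identity\<close>.\<close>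

lemma integral_inverse_power_det:
  fixes C :: "complex^'m::finite^'n" and E :: "complex^'n^'m"
  assumes \<rho>: "\<rho> < 1" "\<And>x. norm x \<le> 1 \<Longrightarrow> cmod (cip ((C ** E) *v x) x) \<le> \<rho>"
    and inv1: "\<And>s. 0 \<le> s \<Longrightarrow> s \<le> 1 \<Longrightarrow> invertible (mat 1 - mat (of_real s) ** (C ** E))"
    and inv2: "\<And>s. 0 \<le> s \<Longrightarrow> s \<le> 1 \<Longrightarrow> invertible (mat 1 - mat (of_real s) ** (E ** C))"
  shows "(\<integral>v. inverse (1 - cip ((C ** E) *v X v) (X v)) ^ CARD('n) \<partial>M) * det (mat 1 - E ** C) = 1"
proof -
  define B where "B = C ** E"
  define n where "n = CARD('n)"
  define Q where "Q x = cip (B *v x) x" for x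
  define k where "k s x = inverse (1 - of_real s * Q x)" for s :: real and x
  define F where "F s = (\<integral>v. k s (X v) ^ n \<partial>M)" for s
  have npos: "n > 0" by (simp add: n_def)
  have \<rho>0: "0 \<le> \<rho>" using \<rho>(2)[of 0] norm_ge_zero order_trans by fastforce
  have Qb: "cmod (Q x) \<le> \<rho>" if "norm x \<le> 1" for x using \<rho>(2)[OF that] by (simp add: Q_def B_def)
  have lo: "1 - \<rho> \<le> cmod (1 - of_real s * Q x)" if "0 \<le> s" "s \<le> 1" "norm x \<le> 1" for s x
  proof -
    have "cmod (of_real s * Q x) \<le> 1 * \<rho>"
      unfolding norm_mult using that Qb[OF that(3)] by (intro mult_mono) auto
    moreover have "1 - cmod (of_real s * Q x) \<le> cmod (1 - of_real s * Q x)"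
      using norm_triangle_ineq2[of 1 "of_real s * Q x"] by simp
    ultimately show ?thesis by linarith
  qed
  have nz: "1 - of_real s * Q x \<noteq> 0" if "0 \<le> s" "s \<le> 1" "norm x \<le> 1" for s x
    using lo[OF that] \<rho>(1) by auto
  have kb: "cmod (k s x) \<le> inverse (1 - \<rho>)" if "0 \<le> s" "s \<le> 1" "norm x \<le> 1" for s x
    unfolding k_def norm_inverse using lo[OF that] \<rho>(1) by (intro le_imp_inverse_le) auto
  have mQ: "Q \<in> borel_measurable borel" unfolding Q_def by (intro borel_measurable_continuous_onI continuous_intros)
  have mk: "k s \<in> borel_measurable borel" for s unfolding k_def using mQ by measurable
  have mkX [measurable]: "(\<lambda>v. k s (X v)) \<in> borel_measurable M" "(\<lambda>v. Q (X v)) \<in> borel_measurable M" for s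
    using measurable_compose[OF Xm mk] measurable_compose[OF Xm mQ] by auto
  have ki: "integrable M (\<lambda>v. k s (X v) ^ m)" if "0 \<le> s" "s \<le> 1" for s m
  proof (rule integrable_const_bound[where B = "inverse (1 - \<rho>) ^ m"])
    show "AE v in M. norm (k s (X v) ^ m) \<le> inverse (1 - \<rho>) ^ m"
      using Xb by eventually_elim (use kb[OF that] in \<open>auto simp: norm_power intro!: power_mono\<close>)
  qed measurable
  have dk: "((\<lambda>s. k s x ^ n) has_vector_derivative of_nat n * Q x * k s x ^ Suc n) (at s within {0..1})"
    if "s \<in> {0..1}" "norm x \<le> 1" for s x
  proof -
    have z: "1 - of_real s * Q x \<noteq> 0" using nz[of s x] that by auto
    have "((\<lambda>u. inverse (1 - u * Q x) ^ n) has_field_derivative of_nat n * Q x * inverse (1 - of_real s * Q x) ^ Suc n) (at (of_real s))"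
    proof -
      obtain m where m: "n = Suc m" using npos by (cases n) auto
      have "((\<lambda>u. inverse (1 - u * Q x)) has_field_derivative Q x * (inverse (1 - of_real s * Q x) * inverse (1 - of_real s * Q x))) (at (of_real s))"
        using z by (auto intro!: derivative_eq_intros simp: algebra_simps)
      from DERIV_power[OF this, of n] show ?thesis unfolding m by (simp add: mult_ac)
    qed
    then show ?thesis unfolding k_def
      using has_vector_derivative_real_field has_vector_derivative_at_within by blast
  qed
  define L where "L = real n * \<rho> * inverse (1 - \<rho>) ^ Suc n"
  have db: "cmod (of_nat n * Q x * k s x ^ Suc n) \<le> L" if "s \<in> {0..1}" "norm x \<le> 1" for s x
    unfolding L_def norm_mult norm_power norm_of_nat
    using kb[of s x] Qb[of x] that \<rho>0 by (intro mult_mono power_mono) (auto simp del: power_Suc)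
  have F': "(F has_vector_derivative (\<integral>v. of_nat n * Q (X v) * k s (X v) ^ Suc n \<partial>M)) (at s within {0..1})"
    if s: "s \<in> {0..1}" for s
    unfolding F_def
  proof (rule has_vector_derivative_integral[where C = L])
    show "finite_measure M" by unfold_locales
    show "s \<in> {0..1}" by (rule s)
    show "integrable M (\<lambda>v. k t (X v) ^ n)" if "t \<in> {0..1}" for t using ki that by auto
    show "(\<lambda>v. of_nat n * Q (X v) * k s (X v) ^ Suc n) \<in> borel_measurable M" by measurable
    show "AE v in M. ((\<lambda>s. k s (X v) ^ n) has_vector_derivative of_nat n * Q (X v) * k s (X v) ^ Suc n) (at s within {0..1})"
      using Xb by eventually_elim (rule dk[OF s])
    show "AE v in M. cmod (of_nat n * Q (X v) * k s (X v) ^ Suc n) \<le> L"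
      using Xb by eventually_elim (rule db[OF s])
    show "AE v in M. \<forall>t\<in>{0..1}. cmod (k t (X v) ^ n - k s (X v) ^ n) \<le> L * \<bar>t - s\<bar>"
      using Xb
    proof eventually_elim
      case (elim v)
      show ?case
      proof
        fix t :: real assume t: "t \<in> {0..1}"
        have "norm (k t (X v) ^ n - k s (X v) ^ n) \<le> L * norm (t - s)"
        proof (rule differentiable_bound[of "{0..1}" "\<lambda>t. k t (X v) ^ n" "\<lambda>u h. h *\<^sub>R (of_nat n * Q (X v) * k u (X v) ^ Suc n)"])
          fix u :: real assume u: "u \<in> {0..1}"
          show "((\<lambda>t. k t (X v) ^ n) has_derivative (\<lambda>h. h *\<^sub>R (of_nat n * Q (X v) * k u (X v) ^ Suc n))) (at u within {0..1})"
            using dk[OF u elim] unfolding has_vector_derivative_def .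
          show "onorm (\<lambda>h. h *\<^sub>R (of_nat n * Q (X v) * k u (X v) ^ Suc n)) \<le> L"
          proof (rule onorm_le)
            fix h :: real
            show "norm (h *\<^sub>R (of_nat n * Q (X v) * k u (X v) ^ Suc n)) \<le> L * norm h"
              unfolding norm_scaleR using mult_left_mono[OF db[OF u elim], of "\<bar>h\<bar>"] by (simp add: mult.commute)
          qed
        qed (use s t in auto)
        then show "cmod (k t (X v) ^ n - k s (X v) ^ n) \<le> L * \<bar>t - s\<bar>" by simp
      qed
    qed
  qed
  have Ftr: "(\<integral>v. of_nat n * Q (X v) * k s (X v) ^ Suc n \<partial>M)
      = F s * trace (B ** matrix_inv (mat 1 - mat (of_real s) ** B))" if s: "0 \<le> s" "s \<le> 1" for s
  proof -
    let ?B = "mat (of_real s) ** B" and ?R = "matrix_inv (mat 1 - mat (of_real s) ** B)"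
    have Qs: "cip (?B *v x) x = of_real s * Q x" for x
    proof -
      have "?B *v x = of_real s *s (B *v x)"
        unfolding matmul_scale[symmetric] by (simp add: vec_eq_iff matrix_vector_mult_def sum_distrib_left mult.assoc)
      then show ?thesis by (simp add: Q_def)
    qed
    define G where "G = (\<chi> q i. \<integral>v. X v $ q * cnj (X v $ i) * k s (X v) ^ Suc n \<partial>M)"
    have "mat (of_nat n) ** ((mat 1 - ?B) ** G) = mat (F s)"
      using G_identity[of ?B] nz[OF s] unfolding Qs k_def[symmetric] F_def G_def n_def by blast
    then have "?R ** (mat (of_nat n) ** ((mat 1 - ?B) ** G)) = ?R ** mat (F s)" by simp
    also have "?R ** (mat (of_nat n) ** ((mat 1 - ?B) ** G)) = mat (of_nat n) ** ((?R ** (mat 1 - ?B)) ** G)"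
      by (simp only: matrix_mul_assoc mat_commute[of "of_nat n" ?R])
    also have "\<dots> = mat (of_nat n) ** G" using matrix_inv_works(2)[OF inv1[OF s]] by (simp add: B_def)
    finally have G: "mat (of_nat n) ** G = ?R ** mat (F s)" .
    have tm: "trace (A ** mat e) = e * trace A" for A :: "complex^'n^'n" and e
      unfolding mat_commute[symmetric] matmul_scale[symmetric] by (simp add: trace_def sum_distrib_left)
    have "of_nat n * trace (B ** G) = trace (B ** (G ** mat (of_nat n)))"
      by (simp only: matrix_mul_assoc tm)
    also have "\<dots> = trace (B ** (?R ** mat (F s)))" by (simp only: mat_commute[symmetric] G)
    also have "\<dots> = F s * trace (B ** ?R)" by (simp only: matrix_mul_assoc tm)
    finally have 1: "of_nat n * trace (B ** G) = F s * trace (B ** ?R)" .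
    have mx: "(\<lambda>v. X v $ a) \<in> borel_measurable M" for a
      by (rule measurable_compose[OF Xm]) (intro borel_measurable_continuous_onI continuous_intros)
    have Gi: "integrable M (\<lambda>v. X v $ q * cnj (X v $ i) * k s (X v) ^ Suc n)" for q i
    proof (rule integrable_const_bound[where B = "1 * 1 * inverse (1 - \<rho>) ^ Suc n"])
      show "AE v in M. norm (X v $ q * cnj (X v $ i) * k s (X v) ^ Suc n) \<le> 1 * 1 * inverse (1 - \<rho>) ^ Suc n"
        using Xb
      proof eventually_elim
        case (elim v)
        have c: "cmod (X v $ a) \<le> 1" for a
          using Finite_Cartesian_Product.norm_nth_le[of "X v" a] elim by linarith
        show ?case unfolding norm_mult norm_power complex_mod_cnj
          by (intro mult_mono power_mono c kb s elim) auto
      qed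
    qed (use mx in measurable)
    have "trace (B ** G) = (\<Sum>i\<in>UNIV. \<Sum>q\<in>UNIV. \<integral>v. B $ i $ q * (X v $ q * cnj (X v $ i) * k s (X v) ^ Suc n) \<partial>M)"
      by (simp add: trace_def matrix_matrix_mult_def G_def del: power_Suc)
    also have "\<dots> = (\<integral>v. (\<Sum>i\<in>UNIV. \<Sum>q\<in>UNIV. B $ i $ q * (X v $ q * cnj (X v $ i) * k s (X v) ^ Suc n)) \<partial>M)"
      by (subst Bochner_Integration.integral_sum, intro Bochner_Integration.integrable_sum integrable_mult_right Gi,
          subst Bochner_Integration.integral_sum, intro integrable_mult_right Gi, rule refl)
    also have "(\<lambda>v. \<Sum>i\<in>UNIV. \<Sum>q\<in>UNIV. B $ i $ q * (X v $ q * cnj (X v $ i) * k s (X v) ^ Suc n)) = (\<lambda>v. Q (X v) * k s (X v) ^ Suc n)"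
      by (simp add: fun_eq_iff Q_def cip_def matrix_vector_mult_def sum_distrib_left sum_distrib_right mult_ac del: power_Suc)
    finally have "trace (B ** G) = (\<integral>v. Q (X v) * k s (X v) ^ Suc n \<partial>M)" .
    with 1 show ?thesis by (simp add: mult.assoc del: power_Suc)
  qed
  define A where "A = E ** C"
  define D where "D s = det (mat 1 - mat (of_real s) ** A)" for s :: real
  have D': "(D has_vector_derivative - D s * trace (A ** matrix_inv (mat 1 - mat (of_real s) ** A))) (at s within {0..1})"
    if "s \<in> {0..1}" for s
    unfolding D_def
    using has_vector_derivative_real_field[OF det_deriv[OF inv2[of s]]] that has_vector_derivative_at_within
    by (auto simp: A_def)
  have tr: "trace (A ** matrix_inv (mat 1 - mat (of_real s) ** A)) = trace (B ** matrix_inv (mat 1 - mat (of_real s) ** B))"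
    if s: "0 \<le> s" "s \<le> 1" for s
  proof -
    let ?c = "mat (of_real s)"
    let ?RA = "matrix_inv (mat 1 - ?c ** A)" and ?RB = "matrix_inv (mat 1 - ?c ** B)"
    note ia = matrix_inv_works[OF inv2[OF s], folded A_def] and ib = matrix_inv_works[OF inv1[OF s], folded B_def]
    \<comment> \<open>E intertwines the two resolvents, so that cyclicity of the trace can exchange
      the orders C E and E C, although these products may have different sizes.\<close>
    have "(mat 1 - ?c ** A) ** E = E ** (mat 1 - ?c ** B)"
      by (simp add: mat_diff_ldistrib mat_diff_rdistrib A_def B_def matrix_mul_assoc mat_commute[of _ E])
    then have "?RA ** ((mat 1 - ?c ** A) ** E) ** ?RB = ?RA ** (E ** (mat 1 - ?c ** B)) ** ?RB" by simp
    moreover have "?RA ** ((mat 1 - ?c ** A) ** E) ** ?RB = E ** ?RB"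
      unfolding matrix_mul_assoc ia by simp
    moreover have "?RA ** (E ** (mat 1 - ?c ** B)) ** ?RB = ?RA ** E"
      unfolding matrix_mul_assoc[symmetric] ib by simp
    ultimately have e: "E ** ?RB = ?RA ** E" by simp
    have "trace (B ** ?RB) = trace (C ** (E ** ?RB))" by (simp add: B_def matrix_mul_assoc)
    also have "\<dots> = trace ((E ** ?RB) ** C)" by (rule trace_mul_commute)
    also have "\<dots> = trace (?RA ** A)" unfolding e by (simp add: A_def matrix_mul_assoc)
    also have "\<dots> = trace (A ** ?RA)" by (rule trace_mul_commute)
    finally show ?thesis by simp
  qed
  have "((\<lambda>s. F s * D s) has_vector_derivative 0) (at s within {0..1})" if s: "s \<in> {0..1}" for s
  proof -
    have s': "0 \<le> s" "s \<le> 1" using s by auto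
    show ?thesis
      using has_vector_derivative_mult[OF F'[OF s] D'[OF s]] unfolding Ftr[OF s'] tr[OF s']
      by (simp add: algebra_simps)
  qed
  then obtain c where c: "\<And>s. s \<in> {0..1} \<Longrightarrow> F s * D s = c"
    using has_vector_derivative_zero_constant[of "{0..1}" "\<lambda>s. F s * D s"] convex_real_interval by blast
  have "F 0 * D 0 = 1"
  proof -
    have "mat 1 - mat 0 ** A = mat 1" unfolding matmul_scale[symmetric] by (simp add: vec_eq_iff)
    then show ?thesis using tot by (simp add: F_def k_def D_def det_I)
  qed
  then have "F 1 * D 1 = 1" using c[of 0] c[of 1] by simp
  then show ?thesis by (simp add: F_def k_def D_def A_def Q_def B_def n_def)
qed

end

section \<open>The invariant measure on the Shilov boundary\<close>

lemma unitary_cip: "ctrans U ** U = mat 1 \<longleftrightarrow> (\<forall>x y. cip (U *v x) (U *v y) = cip x (y :: complex^'n::finite))"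
proof
  assume "ctrans U ** U = mat 1"
  then show "\<forall>x y. cip (U *v x) (U *v y) = cip x y" by (simp add: cip_adj matrix_vector_mul_assoc)
next
  assume *: "\<forall>x y. cip (U *v x) (U *v y) = cip x y"
  show "ctrans U ** U = mat 1"
    by (rule mat_ext) (use * in \<open>simp add: matrix_vector_mul_assoc[symmetric] cip_adj[of "ctrans U"]\<close>)
qed

definition block_diag :: "complex^'l::finite^'l \<Rightarrow> complex^('r::finite + 'l)^('r + 'l)" where
  "block_diag D = (\<chi> i j. case i of Inl a \<Rightarrow> (case j of Inl b \<Rightarrow> if a = b then 1 else 0 | Inr _ \<Rightarrow> 0)
      | Inr a \<Rightarrow> (case j of Inl _ \<Rightarrow> 0 | Inr b \<Rightarrow> D $ a $ b))"

lemma block_diag_mv: fixes x :: "complex^'r::finite" and D :: "complex^'l::finite^'l"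
  shows "block_diag D *v join_vec x y = join_vec x (D *v y)"
proof -
  let ?g = "block_diag D :: complex^('r + 'l)^('r + 'l)"
  have "ablk ?g = mat 1" "bblk ?g = 0" "cblk ?g = 0" "dblk ?g = D"
    by (simp_all add: vec_eq_iff ablk_def bblk_def cblk_def dblk_def block_diag_def mat_def)
  then show ?thesis unfolding mv_jv by simp
qed

lemma det_mat: "det (mat e :: complex^'n::finite^'n) = e ^ CARD('n)"
  by (subst det_diagonal) (auto simp: mat_def)

lemma mat_mat: "mat a ** (mat b ** A) = mat (a * b) ** (A :: complex^'n::finite^'m::finite)"
  unfolding matmul_scale[symmetric] by (simp add: vec_eq_iff)

lemma mat_mv: "mat e *v (x :: complex^'n::finite) = e *s x"
proof -
  have "(mat e :: complex^'n^'n) $ i $ k * x $ k = (if k = i then e * x $ k else 0)" for i k by (simp add: mat_def)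
  then show ?thesis by (simp add: vec_eq_iff matrix_vector_mult_def)
qed

text \<open>The block matrix with diagonal blocks 1 and \<open>ctrans U\<close> induces right
  multiplication by U but has determinant of modulus 1 rather than 1. Multiplying by a scalar of
  modulus 1 corrects the determinant and leaves the action unchanged.\<close>

lemma K_right_unitary:
  fixes U :: "complex^'l::finite^'l"
  assumes U: "ctrans U ** U = mat 1"
  shows "\<exists>k \<in> (Kgrp :: (complex^('r::finite + 'l)^('r + 'l)) set). (\<forall>z :: complex^'l^'r. act k z = z ** U \<and> cmod (jfac k z) = 1)"
proof -
  have U': "U ** ctrans U = mat 1" using U by (metis matrix_left_right_inverse)
  define g0 where "g0 = (block_diag (ctrans U) :: complex^('r + 'l)^('r + 'l))"
  have g0: "g0 *v join_vec x y = join_vec x (ctrans U *v y)" for x y by (simp add: g0_def block_diag_mv)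
  have Uc: "cip (ctrans U *v y) (ctrans U *v y') = cip y y'" for y y'
    using unitary_cip[of "ctrans U"] U' by simp
  have "cip (g0 *v u) (g0 *v v) = cip u v" for u v
    by (rule join_vec_cases[of u], rule join_vec_cases[of v]) (simp add: g0 Uc)
  then have un: "ctrans g0 ** g0 = mat 1" unfolding unitary_cip by blast
  have "cnj (det g0) * det g0 = 1" using arg_cong[OF un, of det] by (simp add: det_mul det_ctrans det_I)
  then have d1: "cmod (det g0) = 1"
  proof -
    have "cmod (det g0) * cmod (det g0) = 1" using \<open>cnj (det g0) * det g0 = 1\<close> by (metis complex_mod_cnj norm_mult norm_one)
    then show ?thesis using abs_square_eq_1[of "cmod (det g0)"] by (simp add: power2_eq_square)
  qed
  define N where "N = CARD('r + 'l)"
  have N: "N > 0" by (simp add: N_def)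
  define c where "c = cnj (det g0)"
  \<comment> \<open>An N-th root of the conjugate, hence of the inverse, of \<open>det g0\<close>,
    where N is the size of the full matrix.\<close>
  define e where "e = cis (Arg c / real N)"
  have c1: "cmod c = 1" using d1 by (simp add: c_def)
  have "e ^ N = cis (Arg c)" using N unfolding e_def Complex.DeMoivre by simp
  also have "\<dots> = c" using c1 by (subst cis_Arg) (auto simp: sgn_eq)
  finally have eN: "e ^ N = cnj (det g0)" by (simp add: c_def)
  have e1: "cmod e = 1" by (simp add: e_def)
  have ee: "e * cnj e = 1" using e1 complex_norm_square[of e] by simp
  define m where "m = mat e ** g0"
  have m: "m *v join_vec x y = join_vec (e *s x) (e *s (ctrans U *v y))" for x y
    by (simp add: m_def matrix_vector_mul_assoc[symmetric] g0 mat_mv vec_eq_iff sum_type_all)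
  have "det m = e ^ N * det g0" by (simp add: m_def det_mul det_mat N_def)
  then have dm: "det m = 1" using eN \<open>cnj (det g0) * det g0 = 1\<close> by simp
  have "indef_form (m *v u) (m *v v) = indef_form u v" for u v
  proof -
    obtain x y where u: "u = join_vec x y" by (rule join_vec_cases)
    obtain x' y' where v: "v = join_vec x' y'" by (rule join_vec_cases)
    have "indef_form (m *v u) (m *v v) = (e * cnj e) * (cip y y' - cip x x')"
      unfolding u v m indef_form_jv by (simp add: Uc algebra_simps)
    then show ?thesis unfolding ee u v indef_form_jv by simp
  qed
  with dm have mS: "m \<in> SUgrp" by (simp add: SU_iff)
  have mm: "m = (\<chi> i j. e * g0 $ i $ j)" by (simp add: m_def matmul_scale)
  have "dblk m = (\<chi> i j. e * ctrans U $ i $ j)"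
    by (simp add: vec_eq_iff dblk_def mm g0_def block_diag_def)
  then have bl: "ablk m = mat e" "bblk m = 0" "cblk m = 0" "dblk m = mat e ** ctrans U"
    unfolding matmul_scale by (simp_all add: vec_eq_iff ablk_def bblk_def cblk_def mm g0_def block_diag_def mat_def[of e])
  have mK: "m \<in> Kgrp" using mS bl by (simp add: Kgrp_def)
  have i: "matrix_inv (mat e ** ctrans U) = mat (cnj e) ** U"
  proof (rule matrix_inv_eqI)
    show "mat e ** ctrans U ** (mat (cnj e) ** U) = mat 1"
    proof -
      have "mat e ** ctrans U ** (mat (cnj e) ** U) = mat e ** ((ctrans U ** mat (cnj e)) ** U)"
        by (simp only: matrix_mul_assoc)
      also have "\<dots> = mat e ** (mat (cnj e) ** (ctrans U ** U))"
        unfolding mat_commute[of "cnj e" "ctrans U", symmetric] by (simp only: matrix_mul_assoc)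
      also have "\<dots> = mat 1" unfolding U mat_mat ee by simp
      finally show ?thesis .
    qed
    show "mat (cnj e) ** U ** (mat e ** ctrans U) = mat 1"
    proof -
      have "mat (cnj e) ** U ** (mat e ** ctrans U) = mat (cnj e) ** ((U ** mat e) ** ctrans U)"
        by (simp only: matrix_mul_assoc)
      also have "\<dots> = mat (cnj e) ** (mat e ** (U ** ctrans U))"
        unfolding mat_commute[of e U, symmetric] by (simp only: matrix_mul_assoc)
      also have "\<dots> = mat 1" unfolding U' mat_mat mult.commute[of "cnj e" e] ee by simp
      finally show ?thesis .
    qed
  qed
  have "act m z = z ** U" for z :: "complex^'l^'r"
  proof -
    have "act m z = mat e ** z ** (mat (cnj e) ** U)" by (simp add: act_def bl i)
    also have "\<dots> = mat e ** (mat (cnj e) ** z) ** U" by (simp only: matrix_mul_assoc mat_commute[of "cnj e" z])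
    also have "\<dots> = z ** U" unfolding mat_mat ee by simp
    finally show ?thesis .
  qed
  moreover have "cmod (jfac m z) = 1" for z :: "complex^'l^'r"
  proof -
    have "cnj (det U) * det U = 1" using arg_cong[OF U, of det] by (simp add: det_mul det_ctrans det_I)
    then have "cmod (det U) * cmod (det U) = 1" by (metis complex_mod_cnj norm_mult norm_one)
    then have "cmod (det U) = 1" using abs_square_eq_1[of "cmod (det U)"] by (simp add: power2_eq_square)
    then show ?thesis by (simp add: jfac_def bl det_mul det_mat det_ctrans norm_mult norm_power e1)
  qed
  ultimately show ?thesis using mK by blast
qed

definition rotation_matrix :: "complex^'n::finite \<Rightarrow> real \<Rightarrow> complex^'n^'n" where
  "rotation_matrix y \<theta> = (\<chi> a b. (if a = b then 1 else 0) + (cis \<theta> - 1) * cnj (y $ a) * y $ b)"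

lemma rotation_matrix_row: "(v ** rotation_matrix y \<theta>) $ i = rot y \<theta> ((v :: complex^'n::finite^'m::finite) $ i)"
proof -
  have "v $ i $ a * ((if a = b then 1 else 0) + (cis \<theta> - 1) * cnj (y $ a) * y $ b)
    = (if a = b then v $ i $ a else 0) + (cis \<theta> - 1) * (v $ i $ a * cnj (y $ a)) * y $ b" for a b
    by (simp add: algebra_simps)
  then show ?thesis
    by (simp add: vec_eq_iff matrix_matrix_mult_def rotation_matrix_def rot_def cip_def sum.distrib sum_distrib_left sum_distrib_right)
qed

lemma rotation_matrix_unitary: assumes "norm y = 1" shows "ctrans (rotation_matrix y \<theta>) ** rotation_matrix y \<theta> = mat 1"
  unfolding unitary_cip
proof -
  define y' where "y' = (\<chi> a. cnj (y $ a))"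
  have ny: "norm y' = 1" using assms by (simp add: y'_def norm_vec_def)
  have "rotation_matrix y \<theta> *v x = rot y' \<theta> x" for x
  proof -
    have "((if a = b then 1 else 0) + (cis \<theta> - 1) * cnj (y $ a) * y $ b) * x $ b
      = (if a = b then x $ b else 0) + (cis \<theta> - 1) * (x $ b * y $ b) * cnj (y $ a)" for a b
      by (simp add: algebra_simps)
    then show ?thesis
      by (simp add: vec_eq_iff matrix_vector_mult_def rotation_matrix_def rot_def cip_def sum.distrib sum_distrib_left sum_distrib_right y'_def)
  qed
  then show "\<forall>x x'. cip (rotation_matrix y \<theta> *v x) (rotation_matrix y \<theta> *v x') = cip x x'" using cip_rot[OF ny] by simp
qed

lemma Shilov_row: assumes "v \<in> Shilov" shows "cip (v $ i) (v $ j) = (if i = j then 1 else 0)" "norm (v $ i) = 1"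
proof -
  have "(v ** ctrans v) $ i $ j = (if i = j then 1 else 0)" for i j using assms by (simp add: Shilov_def mat_def)
  then show 1: "cip (v $ i) (v $ j) = (if i = j then 1 else 0)" for i j
    by (simp add: cip_def matrix_matrix_mult_def ctrans_def)
  have "(norm (v $ i))\<^sup>2 = 1" using 1[of i i] unfolding cip_self by (metis of_real_1 of_real_eq_iff)
  then show "norm (v $ i) = 1" using abs_square_eq_1[of "norm (v $ i)"] by simp
qed

lemma ctrans_Dom: "z \<in> Dom \<Longrightarrow> ctrans z \<in> Dom"
  unfolding Dom_iff_adj[of z] Dom_iff[of "ctrans z"] .

lemma ctrans_Cl: "w \<in> Cl \<Longrightarrow> ctrans w \<in> Cl"
  unfolding Cl_def using contr_adj[of w] by simp

lemma mat_real: "mat (complex_of_real s) ** A = s *\<^sub>R (A :: complex^'n::finite^'m::finite)"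
  unfolding matmul_scale[symmetric] vec_eq_iff vector_scaleR_component vec_lambda_beta by (simp add: scaleR_conv_of_real)

lemma Dom_rho: assumes "z \<in> Dom" obtains \<rho> where "0 \<le> \<rho>" "\<rho> < 1" "\<And>x. norm x \<le> 1 \<Longrightarrow> norm (z *v x) \<le> \<rho>"
proof -
  obtain x0 :: "complex^'a" where x0: "x0 \<in> cball 0 1" "\<And>x. x \<in> cball 0 1 \<Longrightarrow> norm (z *v x) \<le> norm (z *v x0)"
  proof -
    have c: "continuous_on (cball 0 1) (\<lambda>x. norm (z *v x))" by (intro continuous_intros)
    have "cball 0 1 \<noteq> ({} :: (complex^'a) set)" by simp
    from continuous_attains_sup[OF compact_cball this c] show ?thesis using that by blast
  qed
  have "norm (z *v x0) < 1"
  proof (cases "x0 = 0")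
    case False
    then have "norm (z *v x0) < norm x0" using assms unfolding Dom_iff by blast
    then show ?thesis using x0(1) by simp
  qed simp
  then show ?thesis using that[of "norm (z *v x0)"] x0(2) by simp
qed

locale shilov_space =
  fixes \<mu> :: "(complex^'l::finite^'r::finite) measure"
  assumes sm: "shilov_measure \<mu>"
begin

sublocale prob_space \<mu> using sm by (simp add: shilov_measure_def)

lemma sets_mu [measurable_cong, simp]: "sets \<mu> = sets borel" using sm by (simp add: shilov_measure_def)

lemma space_mu [simp]: "space \<mu> = UNIV" using sets_eq_imp_space_eq[OF sets_mu] by simp

lemma AE_Shilov: "AE v in \<mu>. v \<in> Shilov"
proof -
  have "emeasure \<mu> Shilov = 1" using sm unfolding shilov_measure_def by blast
  moreover have "Shilov \<in> sets \<mu>" unfolding sets_mu by (intro borel_closed compact_imp_closed compact_Shilov)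
  ultimately show ?thesis using AE_iff_emeasure_eq_1[of "\<lambda>v. v \<in> Shilov"] by simp
qed

lemma mu_cong: "f \<in> borel_measurable borel \<Longrightarrow> f \<in> borel_measurable \<mu>"
  by (simp add: measurable_def)

lemma unitary_integral:
  fixes g :: "complex^'l^'r \<Rightarrow> 'c::{banach, second_countable_topology}"
  assumes "ctrans U ** U = mat 1" "g \<in> borel_measurable borel"
  shows "(\<integral>v. g (v ** U) \<partial>\<mu>) = (\<integral>v. g v \<partial>\<mu>)"
proof -
  obtain k where k: "k \<in> (Kgrp :: (complex^('r + 'l)^('r + 'l)) set)" "\<And>z :: complex^'l^'r. act k z = z ** U"
    using K_right_unitary[OF assms(1)] by blast
  have "distr \<mu> borel (act k) = \<mu>" using sm k(1) unfolding shilov_measure_def by blast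
  moreover have "act k = (\<lambda>v. v ** U)" using k(2) by auto
  ultimately have d: "distr \<mu> borel (\<lambda>v. v ** U) = \<mu>" by simp
  have m: "(\<lambda>v :: complex^'l^'r. v ** U) \<in> borel_measurable \<mu>"
    by (intro mu_cong borel_measurable_continuous_onI continuous_intros)
  have "(\<integral>v. g v \<partial>distr \<mu> borel (\<lambda>v. v ** U)) = (\<integral>v. g (v ** U) \<partial>\<mu>)"
    by (rule integral_distr[OF m assms(2)])
  then show ?thesis unfolding d by simp
qed

lemma row_measurable: "(\<lambda>v :: complex^'l^'r. v $ i) \<in> borel_measurable \<mu>"
  by (intro mu_cong borel_measurable_continuous_onI continuous_intros)

lemma row_sphere: "sphere_invariant \<mu> (\<lambda>v. v $ i)"
proof
  show "AE v in \<mu>. norm (v $ i) \<le> 1" using AE_Shilov by eventually_elim (simp add: Shilov_row)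
  show "AE v in \<mu>. norm (v $ i) = 1" using AE_Shilov by eventually_elim (simp add: Shilov_row)
  show "measure \<mu> (space \<mu>) = 1" by (rule prob_space)
  show "(\<integral>v. g (rot y \<theta> (v $ i)) \<partial>\<mu>) = (\<integral>v. g (v $ i) \<partial>\<mu>)"
    if "norm y = 1" and g: "(g :: complex^'l \<Rightarrow> complex) \<in> borel_measurable borel" for y \<theta> g
  proof -
    have "(\<lambda>v :: complex^'l^'r. g (v $ i)) \<in> borel_measurable borel"
      by (rule measurable_compose[OF _ g]) (intro borel_measurable_continuous_onI continuous_intros)
    from unitary_integral[OF rotation_matrix_unitary[OF that(1), of \<theta>] this] show ?thesis by (simp add: rotation_matrix_row)
  qed
qed (rule row_measurable)

lemma Cl_mv: "w \<in> Cl \<Longrightarrow> norm (w *v x) \<le> norm x"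
  by (simp add: Cl_def)

text \<open>The sphere integral is evaluated for two factorizations of the same matrix
  \<open>ctrans w ** z\<close>: into \<open>ctrans w\<close> and z, which gives a determinant of
  size r, and into the identity and the matrix itself, which gives one of size l. Comparing the two
  is Sylvester's determinant identity.\<close>

lemma h_integral:
  assumes z: "z \<in> Dom" and w: "w \<in> Cl"
  shows "(\<integral>v. inverse (1 - cip (z *v (v $ i)) (w *v (v $ i))) ^ CARD('l) \<partial>\<mu>) * hfun z w = 1"
    "det (mat 1 - ctrans w ** z) = hfun z (w :: complex^'l^'r)"
proof -
  interpret sphere_invariant \<mu> "\<lambda>v. v $ i" by (rule row_sphere)
  obtain \<rho> where \<rho>: "0 \<le> \<rho>" "\<rho> < 1" "\<And>x. norm x \<le> 1 \<Longrightarrow> norm (z *v x) \<le> \<rho>" using Dom_rho[OF z] by blast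
  have e: "cip ((ctrans w ** z) *v x) x = cip (z *v x) (w *v x)" for x
    by (simp add: matrix_vector_mul_assoc[symmetric] cip_adj)
  have b: "cmod (cip ((ctrans w ** z) *v x) x) \<le> \<rho>" if "norm x \<le> 1" for x
  proof -
    have "cmod (cip (z *v x) (w *v x)) \<le> norm (z *v x) * norm (w *v x)" by (rule cip_CS)
    also have "\<dots> \<le> \<rho> * 1" using \<rho> that order_trans[OF Cl_mv[OF w] that] by (intro mult_mono) auto
    finally show ?thesis unfolding e by simp
  qed
  have sz: "s *\<^sub>R z \<in> Dom" if "0 \<le> s" "s \<le> 1" for s using scale_Dom1[OF z that] .
  have i1: "invertible (mat 1 - mat (of_real s) ** (ctrans w ** z))" if "0 \<le> s" "s \<le> 1" for s
  proof -
    have "mat (of_real s) ** (ctrans w ** z) = ctrans w ** ctrans (ctrans (s *\<^sub>R z))"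
      unfolding ctrans_ctrans mat_real[symmetric] by (simp only: mat_commute[of _ "ctrans w"] matrix_mul_assoc)
    then show ?thesis using hfun_matrix_invertible[OF ctrans_Cl[OF w] Dom_Cl[OF ctrans_Dom[OF sz[OF that]]]] ctrans_Dom[OF sz[OF that]] by auto
  qed
  have i2: "invertible (mat 1 - mat (of_real s) ** (z ** ctrans w))" if "0 \<le> s" "s \<le> 1" for s
  proof -
    have "mat (of_real s) ** (z ** ctrans w) = (s *\<^sub>R z) ** ctrans w"
      by (simp add: mat_real[symmetric] matrix_mul_assoc)
    then show ?thesis using hfun_matrix_invertible[OF Dom_Cl[OF sz[OF that]] w] sz[OF that] by auto
  qed
  have 1: "(\<integral>v. inverse (1 - cip ((ctrans w ** z) *v v $ i) (v $ i)) ^ CARD('l) \<partial>\<mu>) * det (mat 1 - z ** ctrans w) = 1"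
    by (rule integral_inverse_power_det[OF \<rho>(2) b i1 i2])
  then show "(\<integral>v. inverse (1 - cip (z *v (v $ i)) (w *v (v $ i))) ^ CARD('l) \<partial>\<mu>) * hfun z w = 1"
    unfolding e hfun_def .
  have "(\<integral>v. inverse (1 - cip ((mat 1 ** (ctrans w ** z)) *v v $ i) (v $ i)) ^ CARD('l) \<partial>\<mu>) * det (mat 1 - (ctrans w ** z) ** mat 1) = 1"
    by (rule integral_inverse_power_det[OF \<rho>(2)]) (use b i1 in simp_all)
  then have 2: "(\<integral>v. inverse (1 - cip ((ctrans w ** z) *v v $ i) (v $ i)) ^ CARD('l) \<partial>\<mu>) * det (mat 1 - ctrans w ** z) = 1" by simp
  have "c = b" if "a * b = 1" "a * c = 1" for a b c :: complex
    using that by (metis mult_cancel_left mult_zero_left zero_neq_one)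
  from this[OF 1 2] show "det (mat 1 - ctrans w ** z) = hfun z w" unfolding hfun_def .
qed

text \<open>Invariance of the indefinite form on graphs is a congruence of the size-l matrix 1 -
  \<open>ctrans w ** z\<close> by the denominators of w and z. Taking determinants and returning to
  size r by Sylvester's identity gives the law; when only w is interior, conjugation exchanges the
  two arguments.\<close>

lemma hfun_act:
  assumes g: "g \<in> SUgrp" and zw: "z \<in> Cl" "w \<in> Cl" "z \<in> Dom \<or> w \<in> Dom"
  shows "hfun z (w :: complex^'l^'r) = hfun (act g z) (act g w) * jfac g z * cnj (jfac g w)"
proof -
  have *: "hfun z w = hfun (act g z) (act g w) * jfac g z * cnj (jfac g w)"
    if z: "z \<in> Dom" and w: "w \<in> Cl" for z w :: "complex^'l^'r"
  proof -
    have "mat 1 - ctrans w ** z = ctrans (den g w) ** (mat 1 - ctrans (act g w) ** act g z) ** den g z"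
    proof (rule mat_ext)
      fix y y'
      have "cip ((ctrans (den g w) ** (mat 1 - ctrans (act g w) ** act g z) ** den g z) *v y) y'
         = cip ((mat 1 - ctrans (act g w) ** act g z) *v (den g z *v y)) (den g w *v y')"
        by (simp add: matrix_vector_mul_assoc[symmetric] cip_adj[of "ctrans (den g w)"])
      also have "\<dots> = cip (den g z *v y) (den g w *v y') - cip (act g z *v (den g z *v y)) (act g w *v (den g w *v y'))"
        by (simp add: matrix_vector_mult_diff_rdistrib matrix_vector_mul_assoc[symmetric] cip_adj[of "ctrans (act g w)"])
      also have "\<dots> = cip y y' - cip (z *v y) (w *v y')" by (rule den_form[OF g Dom_Cl[OF z] w])
      also have "\<dots> = cip ((mat 1 - ctrans w ** z) *v y) y'"
        by (simp add: matrix_vector_mult_diff_rdistrib matrix_vector_mul_assoc[symmetric] cip_adj[of "ctrans w"])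
      finally show "cip ((mat 1 - ctrans w ** z) *v y) y' = cip ((ctrans (den g w) ** (mat 1 - ctrans (act g w) ** act g z) ** den g z) *v y) y'"
        by simp
    qed
    then have "det (mat 1 - ctrans w ** z) = cnj (jfac g w) * det (mat 1 - ctrans (act g w) ** act g z) * jfac g z"
      by (simp add: det_mul det_ctrans jfac_den)
    then show ?thesis
      unfolding h_integral(2)[OF z w] h_integral(2)[OF act_Dom[OF g z] act_Cl[OF g w]] by (simp add: mult_ac)
  qed
  show ?thesis
  proof (cases "z \<in> Dom")
    case False
    then have "w \<in> Dom" using zw by blast
    from *[OF this zw(1)] show ?thesis
      by (subst hfun_cnj, subst (2) hfun_cnj) (simp add: mult_ac)
  qed (use * zw in blast)
qed

end

section \<open>Positive definite kernels\<close>

lemma qf_sum: "qf K ps qs = (\<Sum>i<length ps. \<Sum>j<length qs. fst (ps ! i) * cnj (fst (qs ! j)) * K (snd (qs ! j)) (snd (ps ! i)))"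
  unfolding qf_def sum_list_sum_nth split_beta by (simp add: atLeast0LessThan)

lemma qf_add: "qf (\<lambda>x y. K x y + L x y) ps qs = qf K ps qs + qf L ps qs"
  by (simp add: qf_sum distrib_left sum.distrib)

lemma qf_scale: "qf (\<lambda>x y. c * K x y) ps qs = c * qf K ps qs"
  by (simp add: qf_sum sum_distrib_left mult_ac)

lemma pd_kernelI: assumes "\<And>x y. x \<in> X \<Longrightarrow> y \<in> X \<Longrightarrow> K y x = cnj (K x y)" "\<And>ps. pts X ps \<Longrightarrow> 0 \<le> Re (qf K ps ps)"
  shows "pd_kernel X K"
  using assms unfolding pd_kernel_def by blast

lemma pd_kernel_herm: "pd_kernel X K \<Longrightarrow> x \<in> X \<Longrightarrow> y \<in> X \<Longrightarrow> K y x = cnj (K x y)"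
  unfolding pd_kernel_def by blast

lemma pd_kernel_nonneg: "pd_kernel X K \<Longrightarrow> pts X ps \<Longrightarrow> 0 \<le> Re (qf K ps ps)"
  unfolding pd_kernel_def by blast

lemma pd_kernel_add: assumes "pd_kernel X K" "pd_kernel X L" shows "pd_kernel X (\<lambda>x y. K x y + L x y)"
proof (rule pd_kernelI)
  show "K y x + L y x = cnj (K x y + L x y)" if "x \<in> X" "y \<in> X" for x y
    using pd_kernel_herm[OF assms(1) that] pd_kernel_herm[OF assms(2) that] by simp
  show "0 \<le> Re (qf (\<lambda>x y. K x y + L x y) ps ps)" if "pts X ps" for ps
    using pd_kernel_nonneg[OF assms(1) that] pd_kernel_nonneg[OF assms(2) that] by (simp add: qf_add)
qed

lemma pd_kernel_scale: assumes "pd_kernel X K" "0 \<le> c" shows "pd_kernel X (\<lambda>x y. of_real c * K x y)"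
proof (rule pd_kernelI)
  show "of_real c * K y x = cnj (of_real c * K x y)" if "x \<in> X" "y \<in> X" for x y
    using pd_kernel_herm[OF assms(1) that] by simp
  show "0 \<le> Re (qf (\<lambda>x y. of_real c * K x y) ps ps)" if "pts X ps" for ps
    using pd_kernel_nonneg[OF assms(1) that] assms(2) by (simp add: qf_scale)
qed

lemma pd_kernel_limit:
  assumes "\<And>n. pd_kernel X (Kn n)" "\<And>x y. x \<in> X \<Longrightarrow> y \<in> X \<Longrightarrow> (\<lambda>n. Kn n x y) \<longlonglongrightarrow> K x y"
  shows "pd_kernel X K"
proof (rule pd_kernelI)
  fix x y assume xy: "x \<in> X" "y \<in> X"
  have "(\<lambda>n. cnj (Kn n x y)) \<longlonglongrightarrow> cnj (K x y)" by (intro tendsto_intros assms xy)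
  moreover have "(\<lambda>n. cnj (Kn n x y)) = (\<lambda>n. Kn n y x)" using pd_kernel_herm[OF assms(1) xy] by simp
  ultimately show "K y x = cnj (K x y)" using LIMSEQ_unique[OF assms(2)[OF xy(2,1)]] by simp
next
  fix ps :: "(complex \<times> 'a) list" assume ps: "pts X ps"
  have "snd (ps ! i) \<in> X" if "i < length ps" for i using ps that unfolding pts_def by (meson image_subset_iff nth_mem)
  then have "(\<lambda>n. Re (qf (Kn n) ps ps)) \<longlonglongrightarrow> Re (qf K ps ps)"
    unfolding qf_sum by (intro tendsto_intros assms(2)) auto
  then show "0 \<le> Re (qf K ps ps)"
    by (rule LIMSEQ_le_const) (use pd_kernel_nonneg[OF assms(1) ps] in auto)
qed

lemma pd_kernel_integral:
  assumes "AE v in M. pd_kernel X (k v)" "\<And>x y. x \<in> X \<Longrightarrow> y \<in> X \<Longrightarrow> integrable M (\<lambda>v. k v x y :: complex)"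
  shows "pd_kernel X (\<lambda>x y. \<integral>v. k v x y \<partial>M)"
proof (rule pd_kernelI)
  fix x y assume xy: "x \<in> X" "y \<in> X"
  have "(\<integral>v. k v y x \<partial>M) = (\<integral>v. cnj (k v x y) \<partial>M)"
  proof (rule integral_cong_AE)
    show "(\<lambda>v. k v y x) \<in> borel_measurable M" using assms(2)[OF xy(2,1)] by (rule borel_measurable_integrable)
    show "(\<lambda>v. cnj (k v x y)) \<in> borel_measurable M"
      using borel_measurable_integrable[OF assms(2)[OF xy]] by (rule borel_measurable_cnj)
    show "AE v in M. k v y x = cnj (k v x y)" using assms(1) by eventually_elim (rule pd_kernel_herm[OF _ xy])
  qed
  also have "\<dots> = cnj (\<integral>v. k v x y \<partial>M)" by simp
  finally show "(\<integral>v. k v y x \<partial>M) = cnj (\<integral>v. k v x y \<partial>M)" .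
next
  fix ps assume ps: "pts X ps"
  have px: "snd (ps ! i) \<in> X" if "i < length ps" for i using ps that unfolding pts_def by (meson image_subset_iff nth_mem)
  have int: "integrable M (\<lambda>v. fst (ps ! i) * cnj (fst (ps ! j)) * k v (snd (ps ! j)) (snd (ps ! i)))"
    if "i < length ps" "j < length ps" for i j using that px by (intro integrable_mult_right assms(2)) auto
  have int2: "integrable M (\<lambda>v. \<Sum>j<length ps. fst (ps ! i) * cnj (fst (ps ! j)) * k v (snd (ps ! j)) (snd (ps ! i)))"
    if "i < length ps" for i by (intro Bochner_Integration.integrable_sum int that) simp
  have int3: "integrable M (\<lambda>v. qf (k v) ps ps)"
    unfolding qf_sum by (intro Bochner_Integration.integrable_sum int2) simp
  have "qf (\<lambda>x y. \<integral>v. k v x y \<partial>M) ps ps = (\<integral>v. qf (k v) ps ps \<partial>M)"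
  proof -
    have "(\<integral>v. qf (k v) ps ps \<partial>M) = (\<Sum>i<length ps. \<integral>v. (\<Sum>j<length ps. fst (ps ! i) * cnj (fst (ps ! j)) * k v (snd (ps ! j)) (snd (ps ! i))) \<partial>M)"
      unfolding qf_sum by (rule Bochner_Integration.integral_sum) (simp add: int2)
    also have "\<dots> = (\<Sum>i<length ps. \<Sum>j<length ps. \<integral>v. fst (ps ! i) * cnj (fst (ps ! j)) * k v (snd (ps ! j)) (snd (ps ! i)) \<partial>M)"
      by (intro sum.cong refl Bochner_Integration.integral_sum) (simp add: int)
    finally show ?thesis unfolding qf_sum by simp
  qed
  also have "Re \<dots> = (\<integral>v. Re (qf (k v) ps ps) \<partial>M)" using int3 by simp
  also have "\<dots> \<ge> 0"
    by (rule integral_nonneg_AE) (use assms(1) in \<open>eventually_elim, use pd_kernel_nonneg[OF _ ps] in blast\<close>)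
  finally show "0 \<le> Re (qf (\<lambda>x y. \<integral>v. k v x y \<partial>M) ps ps)" .
qed

lemma pd_kernel_rank1: assumes "pd_kernel X K" shows "pd_kernel X (\<lambda>p q. f p * cnj (f q) * K p q)"
proof (rule pd_kernelI)
  show "f y * cnj (f x) * K y x = cnj (f x * cnj (f y) * K x y)" if "x \<in> X" "y \<in> X" for x y
    using pd_kernel_herm[OF assms that] by simp
  fix ps assume ps: "pts X ps"
  define qs where "qs = map (\<lambda>p. (fst p * cnj (f (snd p)), snd p)) ps"
  have "pts X qs" using ps by (auto simp: pts_def qs_def)
  moreover have "qf (\<lambda>p q. f p * cnj (f q) * K p q) ps ps = qf K qs qs"
    unfolding qf_sum by (simp add: qs_def mult_ac)
  ultimately show "0 \<le> Re (qf (\<lambda>p q. f p * cnj (f q) * K p q) ps ps)" using pd_kernel_nonneg[OF assms] by simp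
qed

lemma pd_kernel_swap: assumes "pd_kernel X K" shows "pd_kernel X (\<lambda>p q. K q p)"
proof (rule pd_kernelI)
  show "K x y = cnj (K y x)" if "x \<in> X" "y \<in> X" for x y using pd_kernel_herm[OF assms that(2,1)] .
  fix ps assume ps: "pts X ps"
  define qs where "qs = map (\<lambda>p. (cnj (fst p), snd p)) ps"
  have "pts X qs" using ps by (auto simp: pts_def qs_def)
  moreover have "qf (\<lambda>p q. K q p) ps ps = qf K qs qs"
    unfolding qf_sum by (subst sum.swap) (simp add: qs_def mult_ac)
  ultimately show "0 \<le> Re (qf (\<lambda>p q. K q p) ps ps)" using pd_kernel_nonneg[OF assms] by simp
qed

lemma pd_kernel_1: "pd_kernel X (\<lambda>p q. 1)"
proof (rule pd_kernelI)
  fix ps :: "(complex \<times> 'a) list"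
  have "qf (\<lambda>p q. 1) ps ps = (\<Sum>i<length ps. fst (ps ! i)) * cnj (\<Sum>i<length ps. fst (ps ! i))"
    unfolding qf_sum cnj_sum sum_product by simp
  then show "0 \<le> Re (qf (\<lambda>p q. 1) ps ps)" by (simp add: complex_norm_square[symmetric] del: cnj_sum)
qed simp

text \<open>Positive definiteness of products is needed only for factors that are limits of combinations of
  \<open>f p * cnj (f q)\<close>; multipliers are closed under products by definition, so Schur's theorem is avoided.\<close>

definition pd_multiplier :: "'a set \<Rightarrow> ('a \<Rightarrow> 'a \<Rightarrow> complex) \<Rightarrow> bool" where
  "pd_multiplier X k \<longleftrightarrow> (\<forall>K. pd_kernel X K \<longrightarrow> pd_kernel X (\<lambda>p q. k p q * K p q))"

lemma pd_multiplierD: "pd_multiplier X k \<Longrightarrow> pd_kernel X K \<Longrightarrow> pd_kernel X (\<lambda>p q. k p q * K p q)"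
  unfolding pd_multiplier_def by blast

lemma pd_multiplier_pdk: "pd_multiplier X k \<Longrightarrow> pd_kernel X k"
  using pd_multiplierD[OF _ pd_kernel_1] by simp

lemma pd_multiplier_1: "pd_multiplier X (\<lambda>p q. 1)" by (simp add: pd_multiplier_def)

lemma pd_multiplier_0: "pd_multiplier X (\<lambda>p q. 0)"
  unfolding pd_multiplier_def using pd_kernel_scale[of X _ 0] by simp

lemma pd_multiplier_rank1: "pd_multiplier X (\<lambda>p q. f p * cnj (f q))"
  unfolding pd_multiplier_def using pd_kernel_rank1 by blast

lemma pd_multiplier_add: assumes "pd_multiplier X k" "pd_multiplier X k'" shows "pd_multiplier X (\<lambda>p q. k p q + k' p q)"
  unfolding pd_multiplier_def using pd_kernel_add[OF pd_multiplierD[OF assms(1)] pd_multiplierD[OF assms(2)]] by (simp add: distrib_right)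

lemma pd_multiplier_mult: assumes "pd_multiplier X k" "pd_multiplier X k'" shows "pd_multiplier X (\<lambda>p q. k p q * k' p q)"
  unfolding pd_multiplier_def using pd_multiplierD[OF assms(1) pd_multiplierD[OF assms(2)]] by (simp add: mult.assoc)

lemma pd_multiplier_scale: assumes "pd_multiplier X k" "0 \<le> c" shows "pd_multiplier X (\<lambda>p q. of_real c * k p q)"
  unfolding pd_multiplier_def using pd_kernel_scale[OF pd_multiplierD[OF assms(1)] assms(2)] by (simp add: mult.assoc)

lemma pd_multiplier_power: assumes "pd_multiplier X k" shows "pd_multiplier X (\<lambda>p q. k p q ^ n)"
  by (induction n) (simp_all add: pd_multiplier_1 pd_multiplier_mult[OF assms])

lemma pd_multiplier_sum: assumes "\<And>i. i \<in> I \<Longrightarrow> pd_multiplier X (k i)" shows "pd_multiplier X (\<lambda>p q. \<Sum>i\<in>I. k i p q)"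
  using assms by (induction I rule: infinite_finite_induct) (auto simp: pd_multiplier_0 intro: pd_multiplier_add)

lemma pd_multiplier_limit:
  assumes "\<And>n. pd_multiplier X (k n)" "\<And>x y. x \<in> X \<Longrightarrow> y \<in> X \<Longrightarrow> (\<lambda>n. k n x y) \<longlonglongrightarrow> l x y" shows "pd_multiplier X l"
  unfolding pd_multiplier_def
proof (intro allI impI)
  fix K assume K: "pd_kernel X K"
  show "pd_kernel X (\<lambda>p q. l p q * K p q)"
    by (rule pd_kernel_limit[where Kn = "\<lambda>n p q. k n p q * K p q"]) (rule pd_multiplierD[OF assms(1) K], intro tendsto_intros assms(2))
qed

lemma pd_multiplier_swap: assumes "pd_multiplier X k" shows "pd_multiplier X (\<lambda>p q. k q p)"
  unfolding pd_multiplier_def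
proof (intro allI impI)
  fix K assume K: "pd_kernel X K"
  show "pd_kernel X (\<lambda>p q. k q p * K p q)" using pd_kernel_swap[OF pd_multiplierD[OF assms pd_kernel_swap[OF K]]] .
qed

lemma pd_multiplier_integral:
  assumes "AE v in M. pd_multiplier X (k v)" "\<And>x y. x \<in> X \<Longrightarrow> y \<in> X \<Longrightarrow> integrable M (\<lambda>v. k v x y :: complex)"
  shows "pd_multiplier X (\<lambda>x y. \<integral>v. k v x y \<partial>M)"
  unfolding pd_multiplier_def
proof (intro allI impI)
  fix K assume K: "pd_kernel X K"
  have "pd_kernel X (\<lambda>p q. \<integral>v. k v p q * K p q \<partial>M)"
    by (rule pd_kernel_integral) (use assms(1) in \<open>eventually_elim, use pd_multiplierD[OF _ K] in blast\<close>, intro integrable_mult_left assms(2))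
  then show "pd_kernel X (\<lambda>p q. (\<integral>v. k v p q \<partial>M) * K p q)" by simp
qed

lemma pd_multiplier_cong: assumes "pd_multiplier X k" "\<And>x y. x \<in> X \<Longrightarrow> y \<in> X \<Longrightarrow> k x y = k' x y" shows "pd_multiplier X k'"
  using pd_multiplier_limit[of X "\<lambda>_. k" k'] assms by (simp add: tendsto_const)

text \<open>The order a \<ge> b \<ge> 0 among multipliers. It is carried through the whole
  construction of the kernel, since the comparison of the kernel with its dilate is what makes
  dilation a contraction of the Hilbert space.\<close>

definition dom_multiplier :: "'a set \<Rightarrow> ('a \<Rightarrow> 'a \<Rightarrow> complex) \<Rightarrow> ('a \<Rightarrow> 'a \<Rightarrow> complex) \<Rightarrow> bool" where
  "dom_multiplier X a b \<longleftrightarrow> pd_multiplier X b \<and> pd_multiplier X (\<lambda>p q. a p q - b p q)"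

lemma dom_multiplier_fst: "dom_multiplier X a b \<Longrightarrow> pd_multiplier X a"
  unfolding dom_multiplier_def using pd_multiplier_add[of X b "\<lambda>p q. a p q - b p q"] by simp

lemma dom_multiplier_mult: assumes "dom_multiplier X a b" "dom_multiplier X c d" shows "dom_multiplier X (\<lambda>p q. a p q * c p q) (\<lambda>p q. b p q * d p q)"
proof -
  have "pd_multiplier X (\<lambda>p q. (a p q - b p q) * c p q + b p q * (c p q - d p q))"
    using assms dom_multiplier_fst[OF assms(2)] unfolding dom_multiplier_def by (intro pd_multiplier_add pd_multiplier_mult) auto
  moreover have "(\<lambda>p q. (a p q - b p q) * c p q + b p q * (c p q - d p q)) = (\<lambda>p q. a p q * c p q - b p q * d p q)"
    by (simp add: fun_eq_iff algebra_simps)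
  ultimately show ?thesis using assms unfolding dom_multiplier_def by (simp add: pd_multiplier_mult)
qed

lemma dom_multiplier_power: assumes "dom_multiplier X a b" shows "dom_multiplier X (\<lambda>p q. a p q ^ n) (\<lambda>p q. b p q ^ n)"
proof (induction n)
  case 0
  then show ?case by (simp add: dom_multiplier_def pd_multiplier_1 pd_multiplier_0)
qed (use dom_multiplier_mult[OF assms] in simp)

lemma dom_multiplier_swap: "dom_multiplier X a b \<Longrightarrow> dom_multiplier X (\<lambda>p q. a q p) (\<lambda>p q. b q p)"
  unfolding dom_multiplier_def using pd_multiplier_swap[of X b] pd_multiplier_swap[of X "\<lambda>p q. a p q - b p q"] by blast

text \<open>In the geometric series the dilated kernel has coefficients t^n in place of 1, and the
  differences 1 - t^n are nonnegative.\<close>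

lemma dom_multiplier_geometric:
  assumes k: "pd_multiplier X k" and lt: "\<And>x y. x \<in> X \<Longrightarrow> y \<in> X \<Longrightarrow> cmod (k x y) < 1" and t: "0 \<le> t" "t \<le> 1"
  shows "dom_multiplier X (\<lambda>p q. inverse (1 - k p q)) (\<lambda>p q. inverse (1 - of_real t * k p q))"
proof -
  have L: "(\<lambda>n. \<Sum>i<n. (of_real s * k x y) ^ i) \<longlonglongrightarrow> inverse (1 - of_real s * k x y)"
    if "x \<in> X" "y \<in> X" "0 \<le> s" "s \<le> 1" for x y s
  proof -
    have "cmod (of_real s * k x y) \<le> cmod (k x y)"
      unfolding norm_mult using that by (simp add: mult_left_le_one_le)
    then have "cmod (of_real s * k x y) < 1" using lt[OF that(1,2)] by simp
    from geometric_sums[OF this] show ?thesis by (simp add: sums_def inverse_eq_divide)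
  qed
  have e: "(of_real t * k x y) ^ i = of_real (t ^ i) * k x y ^ i" for x y i by (simp add: power_mult_distrib)
  have "pd_multiplier X (\<lambda>p q. inverse (1 - of_real t * k p q))"
  proof (rule pd_multiplier_limit[of X "\<lambda>n p q. \<Sum>i<n. (of_real t * k p q) ^ i"])
    show "pd_multiplier X (\<lambda>p q. \<Sum>i<n. (of_real t * k p q) ^ i)" for n
      unfolding e using t by (intro pd_multiplier_sum pd_multiplier_scale pd_multiplier_power k) simp
  qed (rule L[OF _ _ t])
  moreover have "pd_multiplier X (\<lambda>p q. inverse (1 - k p q) - inverse (1 - of_real t * k p q))"
  proof (rule pd_multiplier_limit[of X "\<lambda>n p q. \<Sum>i<n. of_real (1 - t ^ i) * k p q ^ i"])
    show "pd_multiplier X (\<lambda>p q. \<Sum>i<n. of_real (1 - t ^ i) * k p q ^ i)" for n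
      using t by (intro pd_multiplier_sum pd_multiplier_scale pd_multiplier_power k) (simp add: power_le_one)
    fix x y assume xy: "x \<in> X" "y \<in> X"
    have "(\<lambda>n. (\<Sum>i<n. (of_real 1 * k x y) ^ i) - (\<Sum>i<n. (of_real t * k x y) ^ i)) \<longlonglongrightarrow> inverse (1 - of_real 1 * k x y) - inverse (1 - of_real t * k x y)"
      by (intro tendsto_diff L xy t) auto
    moreover have "(\<Sum>i<n. (of_real 1 * k x y) ^ i) - (\<Sum>i<n. (of_real t * k x y) ^ i) = (\<Sum>i<n. of_real (1 - t ^ i) * k x y ^ i)" for n
      unfolding sum_subtractf[symmetric] by (intro sum.cong refl) (simp add: e algebra_simps)
    ultimately show "(\<lambda>n. \<Sum>i<n. of_real (1 - t ^ i) * k x y ^ i) \<longlonglongrightarrow> inverse (1 - k x y) - inverse (1 - of_real t * k x y)"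
      by simp
  qed
  ultimately show ?thesis by (simp add: dom_multiplier_def)
qed

lemma pd_multiplier_cip: "pd_multiplier Y (\<lambda>p q. cip (f p) (f q))"
  unfolding cip_def by (intro pd_multiplier_sum pd_multiplier_rank1)

lemma continuous_mv2 [continuous_intros]:
  fixes f :: "'a::topological_space \<Rightarrow> complex^'n::finite^'m::finite"
  shows "continuous_on S f \<Longrightarrow> continuous_on S g \<Longrightarrow> continuous_on S (\<lambda>x. f x *v g x)"
  unfolding matrix_vector_mult_def by (intro continuous_intros)

section \<open>Positivity of the tensor product kernel and domination of its dilates\<close>

context shilov_space begin

lemma cont_integrable:
  fixes g :: "complex^'l^'r \<Rightarrow> 'c::{banach, second_countable_topology}"
  assumes "continuous_on Shilov g" "g \<in> borel_measurable borel"
  shows "integrable \<mu> g"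
proof -
  have "bounded (g ` Shilov)" by (intro compact_imp_bounded compact_continuous_image assms compact_Shilov)
  then obtain b where b: "\<forall>y\<in>g ` Shilov. norm y \<le> b" unfolding bounded_pos by blast
  show ?thesis
  proof (rule integrable_const_bound[where B = b])
    show "AE v in \<mu>. norm (g v) \<le> b" using AE_Shilov by eventually_elim (use b in auto)
  qed (rule mu_cong[OF assms(2)])
qed

text \<open>For a fixed unit vector both integrands are powers of geometric series in a positive
  kernel, and domination survives integration. Dilating both arguments by t multiplies the inner
  product by t^2, so the geometric comparison is used with ratio t^2.\<close>

lemma dom_multiplier_h:
  assumes f: "f ` Y \<subseteq> (Dom :: (complex^'l^'r) set)" and t: "0 \<le> t" "t \<le> 1"
  shows "dom_multiplier Y (\<lambda>p q. inverse (hfun (f p) (f q))) (\<lambda>p q. inverse (hfun (t *\<^sub>R f p) (t *\<^sub>R f q)))"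
proof -
  \<comment> \<open>Any row serves: each is a unit vector almost everywhere, with a unitarily
    invariant law.\<close>
  define i :: 'r where "i = undefined"
  define k where "k v p q = cip (f p *v (v $ i)) (f q *v (v $ i))" for v :: "complex^'l^'r" and p q
  have t2: "0 \<le> t\<^sup>2" "t\<^sup>2 \<le> 1" using t by (auto simp: power_le_one)
  have lt: "cmod (cip (z *v x) (w *v x)) < 1" if zD: "z \<in> Dom" and that: "w \<in> Dom" "norm x \<le> 1" for z w :: "complex^'l^'r" and x
  proof -
    obtain \<rho> where r: "0 \<le> \<rho>" "\<rho> < 1" "\<And>x. norm x \<le> 1 \<Longrightarrow> norm (z *v x) \<le> \<rho>" using Dom_rho[OF zD] by blast
    have "cmod (cip (z *v x) (w *v x)) \<le> norm (z *v x) * norm (w *v x)" by (rule cip_CS)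
    also have "\<dots> \<le> \<rho> * 1"
      using r that(2) order_trans[OF Cl_mv[OF Dom_Cl[OF that(1)]] that(2)] by (intro mult_mono) auto
    finally show ?thesis using r by simp
  qed
  have fD: "f p \<in> Dom" if "p \<in> Y" for p using f that by blast
  have A: "AE v in \<mu>. dom_multiplier Y (\<lambda>p q. inverse (1 - k v p q) ^ CARD('l)) (\<lambda>p q. inverse (1 - of_real (t\<^sup>2) * k v p q) ^ CARD('l))"
    using AE_Shilov
  proof eventually_elim
    case (elim v)
    show ?case unfolding k_def
      by (intro dom_multiplier_power dom_multiplier_geometric pd_multiplier_cip lt fD t2) (use Shilov_row(2)[OF elim] in simp_all)
  qed
  have kt: "of_real (t\<^sup>2) * k v p q = cip ((t *\<^sub>R f p) *v (v $ i)) ((t *\<^sub>R f q) *v (v $ i))" for v p q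
    unfolding k_def scale_mv cip_def vector_scaleR_component
    by (simp add: scaleR_conv_of_real sum_distrib_left power2_eq_square mult_ac)
  have int0: "integrable \<mu> (\<lambda>v. inverse (1 - cip (z *v (v $ i)) (w *v (v $ i))) ^ CARD('l))" if zw: "z \<in> Dom" "w \<in> Dom" for z w :: "complex^'l^'r"
  proof (rule cont_integrable)
    have c: "continuous_on S (\<lambda>v :: complex^'l^'r. cip (z *v (v $ i)) (w *v (v $ i)))" for S by (intro continuous_intros)
    have "1 - cip (z *v (v $ i)) (w *v (v $ i)) \<noteq> 0" if "v \<in> Shilov" for v
      using lt[OF zw, of "v $ i"] Shilov_row(2)[OF that, of i] by auto
    then show "continuous_on Shilov (\<lambda>v. inverse (1 - cip (z *v (v $ i)) (w *v (v $ i))) ^ CARD('l))"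
      by (intro continuous_intros c) auto
    have "(\<lambda>v :: complex^'l^'r. cip (z *v (v $ i)) (w *v (v $ i))) \<in> borel_measurable borel"
      by (rule borel_measurable_continuous_onI[OF c])
    then show "(\<lambda>v :: complex^'l^'r. inverse (1 - cip (z *v (v $ i)) (w *v (v $ i))) ^ CARD('l)) \<in> borel_measurable borel"
      by measurable
  qed
  have val: "(\<integral>v. inverse (1 - cip (z *v (v $ i)) (w *v (v $ i))) ^ CARD('l) \<partial>\<mu>) = inverse (hfun z w)" if "z \<in> Dom" "w \<in> Dom" for z w :: "complex^'l^'r"
  proof -
    have "hfun z w \<noteq> 0" using that Dom_Cl by (intro hfun_nz) auto
    then show ?thesis using h_integral(1)[OF that(1) Dom_Cl[OF that(2)], of i] by (simp add: field_simps)
  qed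
  have tD: "t *\<^sub>R f p \<in> Dom" if "p \<in> Y" for p by (rule scale_Dom1[OF fD[OF that] t])
  have "pd_multiplier Y (\<lambda>p q. \<integral>v. inverse (1 - of_real (t\<^sup>2) * k v p q) ^ CARD('l) \<partial>\<mu>)"
  proof (rule pd_multiplier_integral)
    show "AE v in \<mu>. pd_multiplier Y (\<lambda>p q. inverse (1 - of_real (t\<^sup>2) * k v p q) ^ CARD('l))"
      using A by eventually_elim (simp add: dom_multiplier_def)
  qed (unfold kt, intro int0 tD)
  then have 1: "pd_multiplier Y (\<lambda>p q. inverse (hfun (t *\<^sub>R f p) (t *\<^sub>R f q)))"
    by (rule pd_multiplier_cong) (unfold kt, intro val tD)
  have "pd_multiplier Y (\<lambda>p q. \<integral>v. (inverse (1 - k v p q) ^ CARD('l) - inverse (1 - of_real (t\<^sup>2) * k v p q) ^ CARD('l)) \<partial>\<mu>)"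
  proof (rule pd_multiplier_integral)
    show "AE v in \<mu>. pd_multiplier Y (\<lambda>p q. inverse (1 - k v p q) ^ CARD('l) - inverse (1 - of_real (t\<^sup>2) * k v p q) ^ CARD('l))"
      using A by eventually_elim (simp add: dom_multiplier_def)
  qed (unfold kt, unfold k_def, intro Bochner_Integration.integrable_diff int0 tD fD)
  then have 2: "pd_multiplier Y (\<lambda>p q. inverse (hfun (f p) (f q)) - inverse (hfun (t *\<^sub>R f p) (t *\<^sub>R f q)))"
  proof (rule pd_multiplier_cong)
    fix p q assume pq: "p \<in> Y" "q \<in> Y"
    show "(\<integral>v. (inverse (1 - k v p q) ^ CARD('l) - inverse (1 - of_real (t\<^sup>2) * k v p q) ^ CARD('l)) \<partial>\<mu>)
       = inverse (hfun (f p) (f q)) - inverse (hfun (t *\<^sub>R f p) (t *\<^sub>R f q))"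
      unfolding kt unfolding k_def
      by (subst Bochner_Integration.integral_diff[OF int0[OF fD fD] int0[OF tD tD]]) (use pq val fD tD in auto)
  qed
  from 1 2 show ?thesis by (simp add: dom_multiplier_def)
qed

definition dl :: "real \<Rightarrow> (complex^'l^'r) \<times> (complex^'l^'r) \<Rightarrow> (complex^'l^'r) \<times> (complex^'l^'r)" where
  "dl t p = (t *\<^sub>R fst p, t *\<^sub>R snd p)"

lemma tkernel_mpp:
  assumes t: "0 \<le> t" "t \<le> 1"
  shows "dom_multiplier (DD :: ((complex^'l^'r) \<times> (complex^'l^'r)) set) (tkernel \<nu>) (\<lambda>p q. tkernel \<nu> (dl t p) (dl t q))"
proof -
  have "dom_multiplier (DD :: ((complex^'l^'r) \<times> (complex^'l^'r)) set)
     (\<lambda>p q. inverse (hfun (fst p) (fst q)) ^ \<nu> * inverse (hfun (snd q) (snd p)) ^ \<nu>)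
     (\<lambda>p q. inverse (hfun (t *\<^sub>R fst p) (t *\<^sub>R fst q)) ^ \<nu> * inverse (hfun (t *\<^sub>R snd q) (t *\<^sub>R snd p)) ^ \<nu>)"
    by (intro dom_multiplier_mult dom_multiplier_power dom_multiplier_swap[of _ "\<lambda>p q. inverse (hfun (snd p) (snd q))" "\<lambda>p q. inverse (hfun (t *\<^sub>R snd p) (t *\<^sub>R snd q))"] dom_multiplier_h t)
       (auto simp: DD_def)
  then show ?thesis by (simp add: tkernel_def[abs_def] dl_def power_inverse)
qed

lemma tkernel_pdk: "pd_kernel (DD :: ((complex^'l^'r) \<times> (complex^'l^'r)) set) (tkernel \<nu>)"
  using pd_multiplier_pdk[OF dom_multiplier_fst[OF tkernel_mpp[of 1 \<nu>]]] by simp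

lemma tkernel_dl: assumes "0 \<le> t" "t \<le> 1"
  shows "pd_kernel (DD :: ((complex^'l^'r) \<times> (complex^'l^'r)) set) (\<lambda>p q. tkernel \<nu> p q - tkernel \<nu> (dl t p) (dl t q))"
  using tkernel_mpp[OF assms, of \<nu>] pd_multiplier_pdk unfolding dom_multiplier_def by blast

end

section \<open>Moments and the norm estimate\<close>

text \<open>These binomials are the Taylor coefficients of (1 - z)^(-(s+1)). Their growth of degree
  s is what the decay of the moments has to beat.\<close>

lemma binomial_le_power: "(n + s) choose n \<le> (n + 1) ^ s"
proof (induction s)
  case (Suc s)
  have e: "(n + s) choose n = (n + s) choose s" "(n + Suc s) choose n = Suc (n + s) choose Suc s"
    using binomial_symmetric[of n "n + s"] binomial_symmetric[of n "n + Suc s"] by simp_all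
  have "Suc s * ((n + Suc s) choose n) = Suc (n + s) * ((n + s) choose n)"
    unfolding e by (rule Suc_times_binomial)
  also have "\<dots> \<le> (Suc s * (n + 1)) * (n + 1) ^ s"
    using Suc.IH by (intro mult_mono) auto
  finally have "Suc s * ((n + Suc s) choose n) \<le> Suc s * (n + 1) ^ Suc s" by (simp only: power_Suc mult.assoc)
  then show ?case by (simp only: mult_le_cancel1)
qed simp

lemma inverse_power_series:
  fixes z :: complex
  assumes "cmod z < 1"
  shows "(\<lambda>n. of_nat ((n + s) choose n) * z ^ n) sums inverse ((1 - z) ^ Suc s)"
proof -
  have "(\<lambda>n. (- of_nat (Suc s) gchoose n) * (- z) ^ n) sums (1 + - z) powr (- of_nat (Suc s))"
    by (rule gen_binomial_complex) (use assms in simp)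
  moreover have "(- of_nat (Suc s) gchoose n) * (- z) ^ n = of_nat ((n + s) choose n) * z ^ n" for n
  proof -
    have "(- of_nat (Suc s) gchoose n) = (-1) ^ n * ((of_nat (Suc s) + of_nat n - 1 :: complex) gchoose n)"
      by (rule gbinomial_minus)
    also have "(of_nat (Suc s) + of_nat n - 1 :: complex) = of_nat (n + s)" by simp
    finally show ?thesis unfolding binomial_gbinomial by (simp add: power_mult_distrib[symmetric] flip: power_minus)
  qed
  moreover have nz: "1 - z \<noteq> 0" using assms by auto
  have "(1 + - z) powr (- of_nat (Suc s)) = inverse ((1 - z) ^ Suc s)"
    by (simp only: powr_minus powr_nat'[OF disjI1[OF nz]] add_uminus_conv_diff)
  ultimately show ?thesis by simp
qed

lemma of_real_cmod_power: "of_real (cmod z ^ (2 * n)) = z ^ n * cnj z ^ n"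
  by (simp only: power_mult of_real_power[of "(cmod z)\<^sup>2" n] complex_norm_square power_mult_distrib)

context rotation_invariant begin

lemma Xc_meas: "(\<lambda>v. X v $ a) \<in> borel_measurable M"
  by (rule measurable_compose[OF Xm]) (intro borel_measurable_continuous_onI continuous_intros)

lemma Xc_bound: "norm (X v) \<le> 1 \<Longrightarrow> cmod (X v $ a) \<le> 1"
  using Finite_Cartesian_Product.norm_nth_le[of "X v" a] by linarith

lemma mono_integrable: "integrable M (\<lambda>v. X v $ a ^ k * cnj (X v $ a) ^ l * (X v $ b) ^ r * cnj (X v $ b) ^ s)"
proof (rule integrable_const_bound[where B = 1])
  show "AE v in M. norm (X v $ a ^ k * cnj (X v $ a) ^ l * (X v $ b) ^ r * cnj (X v $ b) ^ s) \<le> 1"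
    using Xb by eventually_elim (auto simp: norm_mult norm_power intro!: mult_le_one power_le_one Xc_bound)
qed (use Xc_meas in measurable)

text \<open>A rotation of the single coordinate \<kappa> multiplies the monomial by a phase
  depending on a - b; for a \<noteq> b the phase can be made -1, so the mean equals its own
  negative.\<close>

lemma moment_orthogonal:
  assumes k: "\<kappa> \<in> I" and ab: "a \<noteq> b"
  shows "(\<integral>v. X v $ \<kappa> ^ a * cnj (X v $ \<kappa>) ^ b \<partial>M) = 0"
proof -
  \<comment> \<open>The phase is \<open>cis ((real a - real b) * \<theta>)\<close>; this angle turns
    it into \<open>cis pi\<close>.\<close>
  define \<theta> where "\<theta> = pi / (real a - real b)"
  let ?g = "\<lambda>x :: complex^'n. x $ \<kappa> ^ a * cnj (x $ \<kappa>) ^ b"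
  have gm: "?g \<in> borel_measurable borel" by (intro borel_measurable_continuous_onI continuous_intros)
  have r: "rot (axis \<kappa> 1) \<theta> x $ \<kappa> = cis \<theta> * x $ \<kappa>" for x
    unfolding rot_def cip_axis by (simp add: algebra_simps)
  have "cis \<theta> ^ a * cnj (cis \<theta>) ^ b = -1"
  proof -
    have "cis \<theta> ^ a * cnj (cis \<theta>) ^ b = cis (real a * \<theta>) * cis (- (real b * \<theta>))"
      by (simp add: Complex.DeMoivre cis_cnj)
    also have "\<dots> = cis ((real a - real b) * \<theta>)" by (simp add: cis_mult algebra_simps)
    also have "(real a - real b) * \<theta> = pi" using ab by (simp add: \<theta>_def)
    finally show ?thesis by simp
  qed
  then have g: "?g (rot (axis \<kappa> 1) \<theta> x) = - ?g x" for x
    unfolding r by (simp add: power_mult_distrib mult_ac) (metis (no_types, lifting) mult.assoc mult.commute mult_minus1)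
  have "(\<integral>v. ?g (rot (axis \<kappa> 1) \<theta> (X v)) \<partial>M) = (\<integral>v. ?g (X v) \<partial>M)"
  proof (rule inv[OF _ _ gm])
    show "norm (axis \<kappa> (1::complex)) = 1" by (simp add: norm_axis_1)
  qed (use k in \<open>auto simp: axis_def\<close>)
  then show ?thesis unfolding g by (simp add: eq_neg_iff_add_eq_0 flip: minus_equation_iff)
qed

definition moment :: "'n \<Rightarrow> nat \<Rightarrow> real" where
  "moment \<kappa> n = (\<integral>v. cmod (X v $ \<kappa>) ^ (2 * n) \<partial>M)"

lemma moment_integrable: "integrable M (\<lambda>v. cmod (X v $ a) ^ k * cmod (X v $ b) ^ l)"
proof (rule integrable_const_bound[where B = 1])
  show "AE v in M. norm (cmod (X v $ a) ^ k * cmod (X v $ b) ^ l) \<le> 1"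
    using Xb by eventually_elim (auto simp: norm_mult norm_power intro!: mult_le_one power_le_one Xc_bound)
qed (use Xc_meas in measurable)

lemma moment_int: "integrable M (\<lambda>v. cmod (X v $ a) ^ k)"
  using moment_integrable[of a k a 0] by simp

lemma moment_complex: "(\<integral>v. X v $ \<kappa> ^ n * cnj (X v $ \<kappa>) ^ n \<partial>M) = of_real (moment \<kappa> n)"
  unfolding of_real_cmod_power[symmetric] moment_def by (rule integral_complex_of_real)

lemma moment_nonneg: "0 \<le> moment \<kappa> n"
  unfolding moment_def by (intro integral_nonneg_AE) simp

text \<open>Integration by parts for the function \<open>f\<close> below, with indices \<kappa> and
  i: the derivative in \<kappa> produces the factor n + 1, and the derivative in the conjugate of
  coordinate i removes that coordinate.\<close>

lemma moment_rel:
  assumes k: "\<kappa> \<in> I" "i \<in> I" "i \<noteq> \<kappa>"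
  shows "of_nat (Suc n) * (\<integral>v. cmod (X v $ \<kappa>) ^ (2 * n) * (cmod (X v $ i))\<^sup>2 \<partial>M) = moment \<kappa> (Suc n)"
proof -
  define f where "f x = x $ \<kappa> ^ Suc n * cnj (x $ \<kappa>) ^ n * cnj (x $ i)" for x :: "complex^'n"
  define P where "P a x = (if a = \<kappa> then of_nat (Suc n) * x $ \<kappa> ^ n * cnj (x $ \<kappa>) ^ n * cnj (x $ i) else 0)" for a and x :: "complex^'n"
  \<comment> \<open>For n = 0 the truncated exponent n - 1 is harmless, as the factor
    \<open>of_nat n\<close> removes the term.\<close>
  define Q where "Q a x = (if a = i then x $ \<kappa> ^ Suc n * cnj (x $ \<kappa>) ^ n else 0)
      + (if a = \<kappa> then of_nat n * x $ \<kappa> ^ Suc n * cnj (x $ \<kappa>) ^ (n - 1) * cnj (x $ i) else 0)" for a and x :: "complex^'n"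
  have cP: "continuous_on S (P a)" for S a unfolding P_def by (cases "a = \<kappa>") (auto intro!: continuous_intros)
  have cQ: "continuous_on S (Q a)" for S a unfolding Q_def by (cases "a = \<kappa>"; cases "a = i") (auto intro!: continuous_intros)
  have fm: "f \<in> borel_measurable borel" unfolding f_def by (intro borel_measurable_continuous_onI continuous_intros)
  have der: "(f has_derivative (\<lambda>h. \<Sum>a\<in>UNIV. P a x * h $ a + Q a x * cnj (h $ a))) (at x)" for x
  proof -
    have s: "(\<Sum>a\<in>UNIV. P a x * h $ a + Q a x * cnj (h $ a)) =
        of_nat (Suc n) * x $ \<kappa> ^ n * cnj (x $ \<kappa>) ^ n * cnj (x $ i) * h $ \<kappa>
        + x $ \<kappa> ^ Suc n * cnj (x $ \<kappa>) ^ n * cnj (h $ i)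
        + of_nat n * x $ \<kappa> ^ Suc n * cnj (x $ \<kappa>) ^ (n - 1) * cnj (x $ i) * cnj (h $ \<kappa>)" for h
    proof -
      have "P a x * h $ a + Q a x * cnj (h $ a) =
         (if a = \<kappa> then of_nat (Suc n) * x $ \<kappa> ^ n * cnj (x $ \<kappa>) ^ n * cnj (x $ i) * h $ a else 0)
        + (if a = i then x $ \<kappa> ^ Suc n * cnj (x $ \<kappa>) ^ n * cnj (h $ a) else 0)
        + (if a = \<kappa> then of_nat n * x $ \<kappa> ^ Suc n * cnj (x $ \<kappa>) ^ (n - 1) * cnj (x $ i) * cnj (h $ a) else 0)" for a
        by (simp add: P_def Q_def algebra_simps)
      then show ?thesis by (simp add: sum.distrib del: power_Suc)
    qed
    have d1: "((\<lambda>x :: complex^'n. x $ a) has_derivative (\<lambda>h. h $ a)) (at x)" for a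
      by (rule bounded_linear.has_derivative[OF bounded_linear_vec_nth has_derivative_ident])
    have d2: "((\<lambda>x :: complex^'n. cnj (x $ a)) has_derivative (\<lambda>h. cnj (h $ a))) (at x)" for a
      by (rule bounded_linear.has_derivative[OF bounded_linear_cnj d1])
    show ?thesis unfolding f_def s
      by (rule has_derivative_eq_rhs[OF has_derivative_mult[OF has_derivative_mult[OF has_derivative_power[OF d1] has_derivative_power[OF d2]] d2]])
         (simp add: fun_eq_iff algebra_simps)
  qed
  have "(\<integral>v. (P \<kappa> (X v) * X v $ i - Q i (X v) * cnj (X v $ \<kappa>)) \<partial>M) = 0"
    by (rule stein_cont(2)[OF fm borel_measurable_continuous_onI[OF cP] borel_measurable_continuous_onI[OF cQ] der cP cQ k(1,2)])
  moreover have "P \<kappa> (X v) * X v $ i - Q i (X v) * cnj (X v $ \<kappa>)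
     = of_real (of_nat (Suc n) * (cmod (X v $ \<kappa>) ^ (2 * n) * (cmod (X v $ i))\<^sup>2) - cmod (X v $ \<kappa>) ^ (2 * Suc n))" for v
  proof -
    have "P \<kappa> (X v) * X v $ i - Q i (X v) * cnj (X v $ \<kappa>)
      = of_nat (Suc n) * ((X v $ \<kappa> ^ n * cnj (X v $ \<kappa>) ^ n) * (X v $ i ^ 1 * cnj (X v $ i) ^ 1)) - X v $ \<kappa> ^ Suc n * cnj (X v $ \<kappa>) ^ Suc n"
      using k(3) by (simp add: P_def Q_def mult_ac)
    then show ?thesis unfolding of_real_cmod_power[symmetric] by (simp del: power_Suc)
  qed
  ultimately have "(\<integral>v. of_real (of_nat (Suc n) * (cmod (X v $ \<kappa>) ^ (2 * n) * (cmod (X v $ i))\<^sup>2) - cmod (X v $ \<kappa>) ^ (2 * Suc n)) \<partial>M) = (0::complex)"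
    by simp
  then have "(\<integral>v. of_nat (Suc n) * (cmod (X v $ \<kappa>) ^ (2 * n) * (cmod (X v $ i))\<^sup>2) - cmod (X v $ \<kappa>) ^ (2 * Suc n) \<partial>M) = 0"
    unfolding integral_complex_of_real of_real_eq_0_iff .
  moreover have "(\<integral>v. of_nat (Suc n) * (cmod (X v $ \<kappa>) ^ (2 * n) * (cmod (X v $ i))\<^sup>2) - cmod (X v $ \<kappa>) ^ (2 * Suc n) \<partial>M)
     = of_nat (Suc n) * (\<integral>v. cmod (X v $ \<kappa>) ^ (2 * n) * (cmod (X v $ i))\<^sup>2 \<partial>M) - moment \<kappa> (Suc n)"
    unfolding moment_def using moment_integrable moment_int
    by (subst Bochner_Integration.integral_diff) (auto simp del: power_Suc mult_Suc_right of_nat_Suc)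
  ultimately show ?thesis by simp
qed

text \<open>\<open>moment_rel\<close> is summed over the coordinates in I, whose squared moduli add
  up to at most 1. The coordinate \<kappa> itself contributes n + 1 copies of the next moment and
  each other coordinate one copy.\<close>

lemma moment_rec:
  assumes k: "\<kappa> \<in> I"
  shows "real (Suc n + (card I - 1)) * moment \<kappa> (Suc n) \<le> real (Suc n) * moment \<kappa> n"
proof -
  let ?s = "\<lambda>i. \<integral>v. cmod (X v $ \<kappa>) ^ (2 * n) * (cmod (X v $ i))\<^sup>2 \<partial>M"
  have "(\<Sum>i\<in>I. ?s i) = (\<integral>v. (\<Sum>i\<in>I. cmod (X v $ \<kappa>) ^ (2 * n) * (cmod (X v $ i))\<^sup>2) \<partial>M)"
    by (rule Bochner_Integration.integral_sum[symmetric]) (rule moment_integrable)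
  also have "\<dots> \<le> moment \<kappa> n" unfolding moment_def
  proof (rule integral_mono_AE)
    show "integrable M (\<lambda>v. \<Sum>i\<in>I. cmod (X v $ \<kappa>) ^ (2 * n) * (cmod (X v $ i))\<^sup>2)"
      by (intro Bochner_Integration.integrable_sum moment_integrable)
    show "AE v in M. (\<Sum>i\<in>I. cmod (X v $ \<kappa>) ^ (2 * n) * (cmod (X v $ i))\<^sup>2) \<le> cmod (X v $ \<kappa>) ^ (2 * n)"
      using Xb
    proof eventually_elim
      case (elim v)
      have "(\<Sum>i\<in>I. (cmod (X v $ i))\<^sup>2) \<le> (norm (X v))\<^sup>2" unfolding norm_vec_sq by (intro sum_mono2) auto
      also have "\<dots> \<le> 1" using elim by (simp add: power_le_one)
      finally show ?case unfolding sum_distrib_left[symmetric] by (simp add: mult_left_le)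
    qed
  qed (rule moment_int)
  finally have le: "real (Suc n) * (\<Sum>i\<in>I. ?s i) \<le> real (Suc n) * moment \<kappa> n" by (intro mult_left_mono) auto
  have "real (Suc n) * (\<Sum>i\<in>I. ?s i) = real (Suc n) * ?s \<kappa> + (\<Sum>i\<in>I - {\<kappa>}. real (Suc n) * ?s i)"
    using k by (subst sum.remove[of I \<kappa>]) (auto simp: distrib_left sum_distrib_left)
  also have "(\<Sum>i\<in>I - {\<kappa>}. real (Suc n) * ?s i) = (\<Sum>i\<in>I - {\<kappa>}. moment \<kappa> (Suc n))"
    by (intro sum.cong refl moment_rel k) auto
  also have "\<dots> = real (card I - 1) * moment \<kappa> (Suc n)" using k by simp
  also have "?s \<kappa> = moment \<kappa> (Suc n)" by (simp add: moment_def power_add[symmetric])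
  finally show ?thesis using le by (simp only: of_nat_add distrib_right)
qed

text \<open>By the recursion, the moment times the rising factorial of n + 1 with 2s factors does
  not increase in n. That factorial is (2s)! at n = 0 and at least (n+1)^(2s) in general.\<close>

lemma moment_bound:
  assumes k: "\<kappa> \<in> I" and c: "2 * s < card I"
  shows "moment \<kappa> n * real (n + 1) ^ (2 * s) \<le> moment \<kappa> 0 * fact (2 * s)"
proof -
  have "moment \<kappa> n * pochhammer (real (n + 1)) (2 * s) \<le> moment \<kappa> 0 * fact (2 * s)"
  proof (induction n)
    case 0
    then show ?case by (simp add: pochhammer_fact)
  next
    case (Suc n)
    have p: "real (Suc n) * pochhammer (real (Suc n + 1)) (2 * s) = pochhammer (real (Suc n)) (2 * s) * real (Suc n + 2 * s)"
      using pochhammer_rec[of "real (Suc n)" "2 * s"] pochhammer_rec'[of "real (Suc n)" "2 * s"] by (simp add: algebra_simps)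
    have "real (Suc n + 2 * s) * moment \<kappa> (Suc n) \<le> real (Suc n + (card I - 1)) * moment \<kappa> (Suc n)"
      using c by (intro mult_right_mono moment_nonneg) auto
    also have "\<dots> \<le> real (Suc n) * moment \<kappa> n" by (rule moment_rec[OF k])
    finally have r: "real (Suc n + 2 * s) * moment \<kappa> (Suc n) \<le> real (Suc n) * moment \<kappa> n" .
    have "real (Suc n) * (moment \<kappa> (Suc n) * pochhammer (real (Suc n + 1)) (2 * s))
        = moment \<kappa> (Suc n) * (real (Suc n) * pochhammer (real (Suc n + 1)) (2 * s))" by (simp only: mult_ac)
    also have "\<dots> = (real (Suc n + 2 * s) * moment \<kappa> (Suc n)) * pochhammer (real (Suc n)) (2 * s)"
      unfolding p by (simp only: mult_ac)
    also have "\<dots> \<le> (real (Suc n) * moment \<kappa> n) * pochhammer (real (Suc n)) (2 * s)"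
      by (intro mult_right_mono r pochhammer_nonneg) auto
    also have "\<dots> = real (Suc n) * (moment \<kappa> n * pochhammer (real (n + 1)) (2 * s))" by simp
    finally have "moment \<kappa> (Suc n) * pochhammer (real (Suc n + 1)) (2 * s) \<le> moment \<kappa> n * pochhammer (real (n + 1)) (2 * s)"
      by (simp only: mult_le_cancel_left_pos of_nat_0_less_iff zero_less_Suc)
    with Suc.IH show ?case by simp
  qed
  moreover have "real (n + 1) ^ (2 * s) \<le> pochhammer (real (n + 1)) (2 * s)"
  proof -
    have "(\<Prod>i\<in>{0..<2 * s}. real (n + 1)) \<le> (\<Prod>i\<in>{0..<2 * s}. real (n + 1) + real i)" by (intro prod_mono) auto
    then show ?thesis by (simp add: pochhammer_prod)
  qed
  then have "moment \<kappa> n * real (n + 1) ^ (2 * s) \<le> moment \<kappa> n * pochhammer (real (n + 1)) (2 * s)"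
    by (intro mult_left_mono moment_nonneg)
  ultimately show ?thesis by linarith
qed

text \<open>Parseval's identity: powers of the coordinate are orthogonal, so the integral of |1 - t
  x|^(-2(s+1)) is the sum of squared Taylor coefficients times t^(2n) times moments. The
  coefficients give at most (n+1)^(2s) and the moments decay like (n+1)^(-2s-2), leaving the sum of
  the inverse squares for every t < 1.\<close>

lemma power_bound:
  assumes k: "\<kappa> \<in> I" and c: "2 * Suc s < card I" and t: "0 \<le> t" "t < 1"
  shows "(\<integral>v. inverse (cmod (1 - of_real t * X v $ \<kappa>)) ^ (2 * Suc s) \<partial>M)
     \<le> fact (2 * Suc s) * (\<Sum>n. 1 / real (Suc n) ^ 2) * measure M (space M)"
proof -
  define cf where "cf n = (n + s) choose n" for n
  define S where "S N v = (\<Sum>n<N. of_nat (cf n) * (of_real t * X v $ \<kappa>) ^ n)" for N v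
  have Sm: "S N \<in> borel_measurable M" for N unfolding S_def using Xc_meas by measurable
  have tb: "cmod (of_real t * X v $ \<kappa>) \<le> t" if "norm (X v) \<le> 1" for v
    unfolding norm_mult using t Xc_bound[OF that, of \<kappa>] by (simp add: mult_left_le)
  have lim: "(\<lambda>N. S N v) \<longlonglongrightarrow> inverse ((1 - of_real t * X v $ \<kappa>) ^ Suc s)" if "norm (X v) \<le> 1" for v
    using inverse_power_series[of "of_real t * X v $ \<kappa>" s] tb[OF that] t unfolding sums_def S_def cf_def by simp
  have ts: "(\<lambda>n. of_nat (cf n) * of_real t ^ n) sums inverse ((1 - of_real t :: complex) ^ Suc s)"
    using inverse_power_series[of "of_real t" s] t unfolding cf_def by simp
  have ts': "(\<lambda>n. real (cf n) * t ^ n) sums Re (inverse ((1 - of_real t :: complex) ^ Suc s))"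
    using sums_Re[OF ts] by (simp flip: of_real_power)
  \<comment> \<open>This bound depends on t and only serves as the dominating constant for the limit
    over partial sums; the uniform estimate is \<open>fin\<close>.\<close>
  define B where "B = Re (inverse ((1 - of_real t :: complex) ^ Suc s))"
  have Sb: "cmod (S N v) \<le> B" if "norm (X v) \<le> 1" for N v
  proof -
    have "cmod (S N v) \<le> (\<Sum>n<N. real (cf n) * t ^ n)"
      unfolding S_def
      by (rule sum_norm_le) (unfold norm_mult norm_power norm_of_nat, intro mult_left_mono power_mono tb[OF that, unfolded norm_mult], auto)
    also have "\<dots> \<le> B" unfolding B_def sums_unique[OF ts']
      using sum_le_suminf[OF sums_summable[OF ts'], of "{..<N}"] t by simp
    finally show ?thesis .
  qed
  have B0: "0 \<le> B" unfolding B_def sums_unique[OF ts'] using t by (intro suminf_nonneg sums_summable[OF ts']) auto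
  have fin: "(\<integral>v. (cmod (S N v))\<^sup>2 \<partial>M) \<le> fact (2 * Suc s) * (\<Sum>n. 1 / real (Suc n) ^ 2) * measure M (space M)" for N
  proof -
    have e: "of_real ((cmod (S N v))\<^sup>2) = (\<Sum>a<N. \<Sum>b<N. of_nat (cf a) * of_nat (cf b) * of_real (t ^ a * t ^ b) * (X v $ \<kappa> ^ a * cnj (X v $ \<kappa>) ^ b))" for v
      unfolding complex_norm_square S_def cnj_sum sum_product
      by (intro sum.cong refl) (simp add: power_mult_distrib mult_ac)
    have im: "integrable M (\<lambda>v. X v $ \<kappa> ^ a * cnj (X v $ \<kappa>) ^ b)" for a b
      using mono_integrable[of \<kappa> a b \<kappa> 0 0] by simp
    have "of_real (\<integral>v. (cmod (S N v))\<^sup>2 \<partial>M) = (\<integral>v. of_real ((cmod (S N v))\<^sup>2) \<partial>M :: complex)"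
      by (rule integral_complex_of_real[symmetric])
    also have "\<dots> = (\<Sum>a<N. \<Sum>b<N. of_nat (cf a) * of_nat (cf b) * of_real (t ^ a * t ^ b) * (\<integral>v. X v $ \<kappa> ^ a * cnj (X v $ \<kappa>) ^ b \<partial>M))"
      unfolding e
      by (subst Bochner_Integration.integral_sum, intro Bochner_Integration.integrable_sum integrable_mult_right im,
          subst Bochner_Integration.integral_sum, intro integrable_mult_right im, simp)
    also have "\<dots> = (\<Sum>a<N. \<Sum>b<N. if b = a then of_real (real (cf a) ^ 2 * (t ^ a * t ^ a) * moment \<kappa> a) else 0)"
    proof (intro sum.cong refl)
      fix a b
      show "of_nat (cf a) * of_nat (cf b) * of_real (t ^ a * t ^ b) * (\<integral>v. X v $ \<kappa> ^ a * cnj (X v $ \<kappa>) ^ b \<partial>M)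
        = (if b = a then of_real (real (cf a) ^ 2 * (t ^ a * t ^ a) * moment \<kappa> a) else 0)"
        using moment_orthogonal[OF k, of a b] moment_complex[of \<kappa> a] by (auto simp: power2_eq_square)
    qed
    also have "\<dots> = of_real (\<Sum>a<N. real (cf a) ^ 2 * (t ^ a * t ^ a) * moment \<kappa> a)" by simp
    finally have "(\<integral>v. (cmod (S N v))\<^sup>2 \<partial>M) = (\<Sum>a<N. real (cf a) ^ 2 * (t ^ a * t ^ a) * moment \<kappa> a)"
      by (simp only: of_real_eq_iff)
    also have "\<dots> \<le> (\<Sum>a<N. (fact (2 * Suc s) * measure M (space M)) * (1 / real (Suc a) ^ 2))"
    proof (rule sum_mono)
      fix a
      have "real (cf a) ^ 2 * (t ^ a * t ^ a) * moment \<kappa> a \<le> (real (a + 1) ^ s) ^ 2 * (1 * 1) * moment \<kappa> a"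
      proof (intro mult_mono power_mono moment_nonneg)
        show "real (cf a) \<le> real (a + 1) ^ s" unfolding cf_def using binomial_le_power[of a s]
          by (simp only: of_nat_power[symmetric] of_nat_le_iff)
      qed (use t in \<open>auto intro: power_le_one\<close>)
      also have "\<dots> = (moment \<kappa> a * real (a + 1) ^ (2 * Suc s)) / real (Suc a) ^ 2"
      proof -
        have "x ^ (2 * Suc s) = (x ^ s)\<^sup>2 * x\<^sup>2" for x :: real
          unfolding power_even_eq power_Suc power_mult_distrib by (rule mult.commute)
        from this[of "real (a + 1)"] have "real (a + 1) ^ (2 * Suc s) = (real (a + 1) ^ s)\<^sup>2 * (real (Suc a))\<^sup>2" by simp
        then show ?thesis by simp
      qed
      also have "\<dots> \<le> (moment \<kappa> 0 * fact (2 * Suc s)) / real (Suc a) ^ 2"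
        by (intro divide_right_mono moment_bound k c) auto
      also have "moment \<kappa> 0 = measure M (space M)" by (simp add: moment_def)
      finally show "real (cf a) ^ 2 * (t ^ a * t ^ a) * moment \<kappa> a \<le> (fact (2 * Suc s) * measure M (space M)) * (1 / real (Suc a) ^ 2)"
        by (simp add: mult_ac)
    qed
    also have "\<dots> = (fact (2 * Suc s) * measure M (space M)) * (\<Sum>a<N. 1 / real (Suc a) ^ 2)" by (simp add: sum_distrib_left)
    also have "\<dots> \<le> (fact (2 * Suc s) * measure M (space M)) * (\<Sum>n. 1 / real (Suc n) ^ 2)"
    proof (intro mult_left_mono sum_le_suminf)
      have "summable (\<lambda>n. inverse (real n ^ 2))" by (rule inverse_power_summable) simp
      then show "summable (\<lambda>n. 1 / real (Suc n) ^ 2)" by (subst (asm) summable_Suc_iff[symmetric]) (simp add: inverse_eq_divide)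
    qed auto
    finally show ?thesis by (simp add: mult_ac)
  qed
  have "(\<lambda>N. \<integral>v. (cmod (S N v))\<^sup>2 \<partial>M) \<longlonglongrightarrow> (\<integral>v. inverse (cmod (1 - of_real t * X v $ \<kappa>)) ^ (2 * Suc s) \<partial>M)"
  proof (rule integral_dominated_convergence[where w = "\<lambda>_. B\<^sup>2"])
    show "(\<lambda>v. inverse (cmod (1 - of_real t * X v $ \<kappa>)) ^ (2 * Suc s)) \<in> borel_measurable M" using Xc_meas by measurable
    show "(\<lambda>v. (cmod (S N v))\<^sup>2) \<in> borel_measurable M" for N using Sm by measurable
    show "AE v in M. (\<lambda>N. (cmod (S N v))\<^sup>2) \<longlonglongrightarrow> inverse (cmod (1 - of_real t * X v $ \<kappa>)) ^ (2 * Suc s)"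
      using Xb
    proof eventually_elim
      case (elim v)
      have "(\<lambda>N. (cmod (S N v))\<^sup>2) \<longlonglongrightarrow> (cmod (inverse ((1 - of_real t * X v $ \<kappa>) ^ Suc s)))\<^sup>2"
        by (intro tendsto_intros lim elim)
      also have "(cmod (inverse ((1 - of_real t * X v $ \<kappa>) ^ Suc s)))\<^sup>2 = inverse (cmod (1 - of_real t * X v $ \<kappa>)) ^ (2 * Suc s)"
        by (simp only: norm_inverse norm_power power_inverse power_mult[symmetric] mult.commute)
      finally show ?case .
    qed
    show "AE v in M. norm ((cmod (S N v))\<^sup>2) \<le> B\<^sup>2" for N
      using Xb by eventually_elim (use Sb B0 in \<open>auto intro: power_mono\<close>)
  qed simp
  then show ?thesis by (rule LIMSEQ_le_const2) (use fin in auto)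
qed

end

section \<open>Adding the rows of a Shilov matrix to the determinant one at a time\<close>

lemma det_row_op:
  fixes \<beta> :: "'n::finite \<Rightarrow> complex"
  assumes "\<beta> k = 0"
  shows "det (\<chi> i j. (if i = j then 1 else 0) + (if i = k then \<beta> j else 0)) = 1"
proof -
  let ?I = "mat 1 :: complex^'n^'n"
  define w where "w = (\<Sum>j\<in>UNIV - {k}. \<beta> j *s row j ?I)"
  have "w \<in> vec.span {row j ?I |j. j \<noteq> k}"
    unfolding w_def by (intro vec.span_sum vec.span_scale vec.span_base) auto
  then have "det (\<chi> i. if i = k then row k ?I + w else row i ?I) = det ?I"
    by (rule det_row_span)
  moreover have "(\<chi> i. if i = k then row k ?I + w else row i ?I) = (\<chi> i j. (if i = j then 1 else 0) + (if i = k then \<beta> j else 0))"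
  proof -
    have "w $ j = \<beta> j" for j
    proof -
      have "w $ j = (\<Sum>i\<in>UNIV - {k}. if i = j then \<beta> i else 0)"
        unfolding w_def sum_component by (intro sum.cong refl) (simp add: row_def mat_def)
      then show ?thesis using assms by (cases "j = k") (auto simp: sum.delta)
    qed
    then show ?thesis by (simp add: vec_eq_iff row_def mat_def)
  qed
  ultimately show ?thesis by (simp add: det_I)
qed

lemma det_diag1:
  "det (\<chi> i j. if i = j then (if i = k then c else 1) else 0 :: complex^'n::finite^'n) = c"
proof -
  have "det (\<chi> i j. if i = j then (if i = k then c else 1) else 0 :: complex^'n^'n) = (\<Prod>i\<in>UNIV. if i = k then c else 1)"
    by (subst det_diagonal) auto
  then show ?thesis by simp
qed

definition pr :: "'r set \<Rightarrow> complex^'l::finite^'r::finite \<Rightarrow> complex^'l^'r" where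
  "pr A v = (\<chi> i. if i \<in> A then v $ i else 0)"

lemma pr_Cl: assumes "v \<in> Cl" shows "pr A v \<in> Cl"
  unfolding Cl_def mem_Collect_eq
proof
  fix y
  have e: "(pr A v *v y) $ i = (if i \<in> A then (v *v y) $ i else 0)" for i by (simp add: pr_def matrix_vector_mult_def)
  have "(norm (pr A v *v y))\<^sup>2 \<le> (norm (v *v y))\<^sup>2"
    unfolding norm_vec_sq e by (intro sum_mono) auto
  then have "norm (pr A v *v y) \<le> norm (v *v y)" by (rule power2_le_imp_le) simp
  also have "\<dots> \<le> norm y" using assms by (simp add: Cl_def)
  finally show "norm (pr A v *v y) \<le> norm y" .
qed

lemma continuous_pr [continuous_intros]: "continuous_on S f \<Longrightarrow> continuous_on S (\<lambda>x. pr A (f x))"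
  unfolding pr_def
proof (rule continuous_on_vec_lambda)
  fix i assume "continuous_on S f"
  then show "continuous_on S (\<lambda>x. if i \<in> A then f x $ i else 0)" by (cases "i \<in> A") (auto intro!: continuous_intros)
qed

locale minors =
  fixes \<iota> :: "'r::finite \<Rightarrow> 'l::finite"
  assumes inj: "inj \<iota>"
begin

text \<open>The base point whose rows are the coordinate vectors selected by \<iota>. Pairing with
  it turns \<open>hfun (t *\<^sub>R v) u0\<close> into the determinant of 1 minus t times an r by r
  submatrix of v.\<close>

definition u0 :: "complex^'l^'r" where
  "u0 = (\<chi> i a. if a = \<iota> i then 1 else 0)"

lemma u0_mul: "(w ** ctrans u0) $ i $ j = w $ i $ \<iota> j"
proof -
  have "w $ i $ a * cnj (u0 $ j $ a) = (if a = \<iota> j then w $ i $ a else 0)" for a by (simp add: u0_def)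
  then show ?thesis by (simp add: matrix_matrix_mult_def ctrans_def)
qed

lemma u0_Shilov: "u0 \<in> Shilov"
proof -
  have "(u0 ** ctrans u0) $ i $ j = (mat 1 :: complex^'r^'r) $ i $ j" for i j
    unfolding u0_mul using inj by (auto simp: u0_def mat_def inj_def)
  then show ?thesis by (simp add: Shilov_def vec_eq_iff)
qed

text \<open>\<open>1 - t v u\<^sub>0\<^sup>*\<close> with only the rows and columns in \<open>A\<close> kept.\<close>

definition Mx :: "'r set \<Rightarrow> real \<Rightarrow> complex^'l^'r \<Rightarrow> complex^'r^'r" where
  "Mx A t v = mat 1 - (t *\<^sub>R pr A v) ** ctrans (pr A u0)"

lemma Mx_nth: "Mx A t v $ i $ j = (if i = j then 1 else 0) - (if i \<in> A \<and> j \<in> A then of_real t * v $ i $ \<iota> j else 0)"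
proof -
  have "((t *\<^sub>R pr A v) ** ctrans (pr A u0)) $ i $ j = (if j \<in> A then ((t *\<^sub>R pr A v) ** ctrans u0) $ i $ j else 0)"
    by (simp add: matrix_matrix_mult_def ctrans_def pr_def)
  also have "\<dots> = (if i \<in> A \<and> j \<in> A then of_real t * v $ i $ \<iota> j else 0)"
    unfolding u0_mul by (simp add: pr_def) (simp add: scaleR_conv_of_real)
  finally show ?thesis by (simp add: Mx_def mat_def)
qed

lemma det_Mx: "det (Mx A t v) = hfun (t *\<^sub>R pr A v) (pr A u0)"
  by (simp add: Mx_def hfun_def)

lemma det_Mx_nz: assumes "v \<in> Cl" "0 \<le> t" "t < 1" shows "det (Mx A t v) \<noteq> 0"
  unfolding det_Mx using scale_Dom[OF pr_Cl[OF assms(1)] assms(2,3), of A] pr_Cl[OF Shilov_Cl[OF u0_Shilov], of A]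
  by (intro hfun_nz) (auto intro: Dom_Cl)

lemma Mx_cont: "continuous_on S (\<lambda>v. Mx A t v)"
  unfolding Mx_def by (intro continuous_intros)

text \<open>By Cramer's rule, the coefficients of the row combination that eliminates the \<open>k\<close>-th row in \<open>det_step\<close>.\<close>

definition det_coeff :: "'r set \<Rightarrow> 'r \<Rightarrow> real \<Rightarrow> complex^'l^'r \<Rightarrow> complex^'r" where
  "det_coeff A k t v = (\<chi> j. det (\<chi> i m. if m = j then (if i \<in> A then of_real t * v $ k $ \<iota> i else 0) else transpose (Mx A t v) $ i $ m) / det (transpose (Mx A t v)))"

text \<open>Row k of v after elimination against the rows in A; its entry in column
  \<open>\<iota> k\<close> determines the new pivot.\<close>

definition yv :: "'r set \<Rightarrow> 'r \<Rightarrow> real \<Rightarrow> complex^'l^'r \<Rightarrow> complex^'l" where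
  "yv A k t v = v $ k + (\<Sum>i\<in>UNIV. det_coeff A k t v $ i *s v $ i)"

text \<open>Truncating the columns in \<open>\<iota> ` A\<close> gives a vector of norm at most 1 which is equivariant under the
  unitary group of the remaining columns.\<close>

definition xv :: "'r set \<Rightarrow> 'r \<Rightarrow> real \<Rightarrow> complex^'l^'r \<Rightarrow> complex^'l" where
  "xv A k t v = (\<chi> a. if a \<in> \<iota> ` A then 0 else yv A k t v $ a)"

lemma det_coeff_eq:
  assumes "det (Mx A t v) \<noteq> 0"
  shows "(\<Sum>i\<in>UNIV. det_coeff A k t v $ i * Mx A t v $ i $ j) = (if j \<in> A then of_real t * v $ k $ \<iota> j else 0)"
proof -
  let ?b = "(\<chi> i. if i \<in> A then of_real t * v $ k $ \<iota> i else 0) :: complex^'r"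
  have "det (transpose (Mx A t v)) \<noteq> 0" using assms by (simp add: det_transpose)
  note cr = cramer[OF this, of "det_coeff A k t v" ?b]
  have "det_coeff A k t v = (\<chi> m. det (\<chi> i j. if j = m then ?b $ i else transpose (Mx A t v) $ i $ j) / det (transpose (Mx A t v)))"
    unfolding det_coeff_def vec_lambda_beta ..
  with cr have "transpose (Mx A t v) *v det_coeff A k t v = ?b" by blast
  then have "(transpose (Mx A t v) *v det_coeff A k t v) $ j = ?b $ j" by simp
  then show ?thesis by (simp add: matrix_vector_mult_def transpose_def mult.commute)
qed

lemma det_coeff_off: assumes "det (Mx A t v) \<noteq> 0" "j \<notin> A" shows "det_coeff A k t v $ j = 0"
proof -
  have "det_coeff A k t v $ i * Mx A t v $ i $ j = (if i = j then det_coeff A k t v $ i else 0)" for i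
    using assms(2) by (simp add: Mx_nth)
  then show ?thesis using det_coeff_eq[OF assms(1), of k j] assms(2) by simp
qed

text \<open>The linear system for the coefficients says that each one reproduces, up to the factor
  t, an entry of the row it helps to build. Their squared sum is thereby controlled by the part of
  \<open>yv\<close> in the columns selected by A, the part that \<open>xv\<close> drops.\<close>

lemma det_coeff_on: assumes "det (Mx A t v) \<noteq> 0" "j \<in> A" shows "det_coeff A k t v $ j = of_real t * yv A k t v $ \<iota> j"
proof -
  have "det_coeff A k t v $ i * Mx A t v $ i $ j = (if i = j then det_coeff A k t v $ i else 0) - of_real t * (det_coeff A k t v $ i * v $ i $ \<iota> j)" for i
    using assms(2) det_coeff_off[OF assms(1), of i k] by (simp add: Mx_nth algebra_simps)
  then have "(\<Sum>i\<in>UNIV. det_coeff A k t v $ i * Mx A t v $ i $ j) = det_coeff A k t v $ j - of_real t * (\<Sum>i\<in>UNIV. det_coeff A k t v $ i * v $ i $ \<iota> j)"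
    by (simp add: sum_subtractf sum_distrib_left)
  with det_coeff_eq[OF assms(1), of k j] assms(2) show ?thesis
    by (simp add: yv_def algebra_simps)
qed

text \<open>A Schur complement written as a product: the shear E clears row k in the columns of A
  and leaves the pivot c, the shear C creates the new column k above a row k that is still trivial,
  and S scales that row by the pivot. Both shears have determinant 1.\<close>

lemma det_step:
  assumes "det (Mx A t v) \<noteq> 0" "k \<notin> A"
  shows "det (Mx (insert k A) t v) = det (Mx A t v) * (1 - of_real t * xv A k t v $ \<iota> k)"
proof -
  define \<beta> where "\<beta> = det_coeff A k t v"
  define c where "c = 1 - of_real t * yv A k t v $ \<iota> k"
  let ?N = "Mx (insert k A) t v"
  have \<beta>0: "\<beta> $ j = 0" if "j \<notin> A" for j using det_coeff_off[OF assms(1) that] by (simp add: \<beta>_def)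
  define E where "E = (\<chi> i j. (if i = j then 1 else 0) + (if i = k then \<beta> $ j else 0) :: complex^'r^'r)"
  define \<gamma> where "\<gamma> i = (if i \<in> A then - of_real t * v $ i $ \<iota> k else 0)" for i
  define C where "C = (\<chi> i j. (if i = j then 1 else 0) + (if j = k then \<gamma> i else 0) :: complex^'r^'r)"
  define S where "S = (\<chi> i j. if i = j then (if i = k then c else 1) else 0 :: complex^'r^'r)"
  have dE: "det E = 1" unfolding E_def by (rule det_row_op) (rule \<beta>0[OF assms(2)])
  have "transpose C = (\<chi> i j. (if i = j then 1 else 0) + (if i = k then \<gamma> j else 0))"
    by (simp add: C_def transpose_def vec_eq_iff)
  then have dC: "det C = 1" using det_row_op[of \<gamma> k] assms(2) det_transpose[of C] by (simp add: \<gamma>_def)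
  have dS: "det S = c" unfolding S_def by (rule det_diag1)
  have EN: "(E ** ?N) $ i $ j = ?N $ i $ j + (if i = k then (\<Sum>m\<in>UNIV. \<beta> $ m * ?N $ m $ j) else 0)" for i j
  proof -
    have "E $ i $ m * ?N $ m $ j = (if m = i then ?N $ m $ j else 0) + (if i = k then \<beta> $ m * ?N $ m $ j else 0)" for m
      by (simp add: E_def algebra_simps)
    then show ?thesis by (simp add: matrix_matrix_mult_def sum.distrib)
  qed
  have CM: "(C ** Mx A t v) $ i $ j = Mx A t v $ i $ j + \<gamma> i * Mx A t v $ k $ j" for i j
  proof -
    have "C $ i $ m * Mx A t v $ m $ j = (if m = i then Mx A t v $ m $ j else 0) + (if m = k then \<gamma> i * Mx A t v $ m $ j else 0)" for m
      by (simp add: C_def algebra_simps)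
    then show ?thesis by (simp add: matrix_matrix_mult_def sum.distrib)
  qed
  have Shilov_subset_Cl: "(S ** (C ** Mx A t v)) $ i $ j = (if i = k then c else 1) * (C ** Mx A t v) $ i $ j" for i j
  proof -
    have "S $ i $ m * W $ m $ j = (if m = i then (if i = k then c else 1) * W $ m $ j else 0)" for m and W :: "complex^'r^'r"
      by (simp add: S_def)
    then show ?thesis by (simp add: matrix_matrix_mult_def[of S])
  qed
  have bN: "(\<Sum>m\<in>UNIV. \<beta> $ m * ?N $ m $ j) = (if j \<in> A then of_real t * v $ k $ \<iota> j else if j = k then - of_real t * (\<Sum>m\<in>UNIV. \<beta> $ m * v $ m $ \<iota> k) else 0)" for j
  proof (cases "j = k")
    case True
    have "\<beta> $ m * ?N $ m $ k = - of_real t * (\<beta> $ m * v $ m $ \<iota> k)" for m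
      using \<beta>0[of m] assms(2) by (cases "m \<in> A") (auto simp: Mx_nth)
    then show ?thesis using True assms(2) by (simp add: sum_distrib_left sum_negf)
  next
    case False
    have "\<beta> $ m * ?N $ m $ j = \<beta> $ m * Mx A t v $ m $ j" for m
      using \<beta>0[of m] False by (cases "m \<in> A") (auto simp: Mx_nth)
    then have "(\<Sum>m\<in>UNIV. \<beta> $ m * ?N $ m $ j) = (\<Sum>m\<in>UNIV. \<beta> $ m * Mx A t v $ m $ j)" by (simp only:)
    then show ?thesis using False det_coeff_eq[OF assms(1), of k j] by (simp add: \<beta>_def)
  qed
  have yk: "yv A k t v $ \<iota> k = v $ k $ \<iota> k + (\<Sum>m\<in>UNIV. \<beta> $ m * v $ m $ \<iota> k)" by (simp add: yv_def \<beta>_def)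
  have "E ** ?N = S ** (C ** Mx A t v)"
  proof -
    have "(E ** ?N) $ i $ j = (S ** (C ** Mx A t v)) $ i $ j" for i j
      unfolding EN Shilov_subset_Cl CM bN unfolding Mx_nth
      using assms(2) by (cases "i = k"; cases "j = k"; cases "i \<in> A"; cases "j \<in> A") (auto simp: \<gamma>_def c_def yk algebra_simps)
    then show ?thesis by (simp add: vec_eq_iff)
  qed
  then have "det (E ** ?N) = det (S ** (C ** Mx A t v))" by simp
  then have "det ?N = c * det (Mx A t v)" by (simp add: det_mul dE dC dS)
  moreover have "xv A k t v $ \<iota> k = yv A k t v $ \<iota> k" using assms(2) inj by (auto simp: xv_def inj_def)
  ultimately show ?thesis by (simp add: c_def)
qed

text \<open>Since the rows of v are orthonormal, the squared norm of \<open>yv\<close> is 1 plus the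
  squared sum of the elimination coefficients. By \<open>det_coeff_on\<close> and t < 1 this excess
  is at most the mass in the dropped columns, so at most 1 remains.\<close>

lemma xv_norm:
  assumes v: "v \<in> Shilov" and t: "0 < t" "t < 1" and k: "k \<notin> A"
  shows "norm (xv A k t v) \<le> 1"
proof -
  have nz: "det (Mx A t v) \<noteq> 0" using det_Mx_nz[OF Shilov_Cl[OF v]] t by simp
  define \<beta> where "\<beta> = det_coeff A k t v"
  define b' where "b' = (\<chi> i. if i = k then 1 else \<beta> $ i)"
  have \<beta>k: "\<beta> $ k = 0" using det_coeff_off[OF nz k] by (simp add: \<beta>_def)
  have y: "yv A k t v = (\<Sum>i\<in>UNIV. b' $ i *s v $ i)"
  proof -
    have "b' $ i *s v $ i = (if i = k then v $ i else 0) + \<beta> $ i *s v $ i" for i using \<beta>k by (simp add: b'_def)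
    then show ?thesis by (simp add: yv_def \<beta>_def sum.distrib)
  qed
  have cs: "cip (\<Sum>i\<in>UNIV. f i) z = (\<Sum>i\<in>UNIV. cip (f i) z)" "cip z (\<Sum>i\<in>UNIV. f i) = (\<Sum>i\<in>UNIV. cip z (f i))"
    for f :: "'r \<Rightarrow> complex^'l" and z
    by (simp_all add: cip_def sum_distrib_left sum_distrib_right) (rule sum.swap)+
  have "cip (yv A k t v) (yv A k t v) = (\<Sum>i\<in>UNIV. \<Sum>j\<in>UNIV. b' $ i * cnj (b' $ j) * cip (v $ i) (v $ j))"
    unfolding y cs(1) unfolding cs(2) by (simp add: mult_ac)
  also have "\<dots> = cip b' b'" by (simp add: Shilov_row(1)[OF v] cip_def[of b' b'] if_distrib cong: if_cong)
  finally have "of_real ((norm (yv A k t v))\<^sup>2) = (of_real ((norm b')\<^sup>2) :: complex)" unfolding cip_self .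
  then have n1: "(norm (yv A k t v))\<^sup>2 = (norm b')\<^sup>2" by (simp only: of_real_eq_iff)
  have "(cmod (b' $ i))\<^sup>2 = (if i = k then 1 else 0) + (cmod (\<beta> $ i))\<^sup>2" for i using \<beta>k by (simp add: b'_def)
  then have n2: "(norm b')\<^sup>2 = 1 + (\<Sum>i\<in>UNIV. (cmod (\<beta> $ i))\<^sup>2)" unfolding norm_vec_sq by (simp add: sum.distrib)
  have "(\<Sum>i\<in>UNIV. (cmod (\<beta> $ i))\<^sup>2) = (\<Sum>i\<in>A. (cmod (\<beta> $ i))\<^sup>2)"
    by (rule sum.mono_neutral_right) (use det_coeff_off[OF nz] in \<open>auto simp: \<beta>_def\<close>)
  also have "\<dots> \<le> (\<Sum>i\<in>A. (cmod (yv A k t v $ \<iota> i))\<^sup>2)"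
  proof (intro sum_mono power_mono)
    fix i assume "i \<in> A"
    then show "cmod (\<beta> $ i) \<le> cmod (yv A k t v $ \<iota> i)"
      using t det_coeff_on[OF nz, of i k] by (simp add: \<beta>_def norm_mult mult_left_le_one_le)
  qed simp
  also have "\<dots> = (\<Sum>a\<in>\<iota> ` A. (cmod (yv A k t v $ a))\<^sup>2)"
    using inj by (subst sum.reindex) (auto simp: inj_def inj_on_def)
  finally have n3: "(\<Sum>i\<in>UNIV. (cmod (\<beta> $ i))\<^sup>2) \<le> (\<Sum>a\<in>\<iota> ` A. (cmod (yv A k t v $ a))\<^sup>2)" .
  have "(norm (xv A k t v))\<^sup>2 = (\<Sum>a\<in>- (\<iota> ` A). (cmod (yv A k t v $ a))\<^sup>2)"
    unfolding norm_vec_sq by (rule sum.mono_neutral_cong_right) (auto simp: xv_def)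
  moreover have "(norm (yv A k t v))\<^sup>2 = (\<Sum>a\<in>\<iota> ` A. (cmod (yv A k t v $ a))\<^sup>2) + (\<Sum>a\<in>- (\<iota> ` A). (cmod (yv A k t v $ a))\<^sup>2)"
    unfolding norm_vec_sq by (subst sum.union_disjoint[symmetric]) auto
  ultimately have "(norm (xv A k t v))\<^sup>2 \<le> 1\<^sup>2" using n1 n2 n3 by simp
  then show ?thesis by (rule power2_le_imp_le) simp
qed

lemma rot_fix: "y $ a = 0 \<Longrightarrow> rot y \<theta> x $ a = x $ a"
  by (simp add: rot_def)

text \<open>The matrix and the elimination coefficients read v only in the columns selected by A,
  which a rotation with axis vanishing there leaves fixed. The vector \<open>yv\<close> is a linear
  combination of rows with these unchanged coefficients, so it rotates with the rows.\<close>

lemma equivariance: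
  assumes y: "\<And>a. a \<in> \<iota> ` A \<Longrightarrow> y $ a = 0" and k: "k \<notin> A"
  shows "Mx A t (v ** rotation_matrix y \<theta>) = Mx A t v" "xv A k t (v ** rotation_matrix y \<theta>) = rot y \<theta> (xv A k t v)"
proof -
  have e: "(v ** rotation_matrix y \<theta>) $ i $ \<iota> j = v $ i $ \<iota> j" if "j \<in> A" for i j
    unfolding rotation_matrix_row using y[of "\<iota> j"] that by (simp add: rot_fix)
  show M: "Mx A t (v ** rotation_matrix y \<theta>) = Mx A t v" by (simp add: vec_eq_iff Mx_nth e)
  have b: "det_coeff A k t (v ** rotation_matrix y \<theta>) = det_coeff A k t v"
    unfolding det_coeff_def M by (simp add: e cong: if_cong)
  have rs: "rot y \<theta> (x + x') = rot y \<theta> x + rot y \<theta> x'" "rot y \<theta> (c *s x) = c *s rot y \<theta> x" for x x' c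
    by (simp_all add: rot_def vec_eq_iff algebra_simps)
  have r0: "rot y \<theta> 0 = 0" by (simp add: rot_def)
  have rsum: "rot y \<theta> (\<Sum>i\<in>F. f i) = (\<Sum>i\<in>F. rot y \<theta> (f i))" for F :: "'r set" and f
    using r0 by (induction F rule: infinite_finite_induct) (auto simp: rs)
  have yy: "yv A k t (v ** rotation_matrix y \<theta>) = rot y \<theta> (yv A k t v)"
    unfolding yv_def b rotation_matrix_row by (simp add: rs rsum)
  have "cip (xv A k t v) y = cip (yv A k t v) y"
    unfolding cip_def by (intro sum.cong refl) (use y in \<open>auto simp: xv_def\<close>)
  then show "xv A k t (v ** rotation_matrix y \<theta>) = rot y \<theta> (xv A k t v)"
    using y by (auto simp: vec_eq_iff xv_def yy rot_def)
qed

text \<open>As quotients of polynomials in the entries and their real coefficients, the elimination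
  coefficients are Borel on the whole matrix space, including the zero set of the denominator, where
  the quotient is 0.\<close>

lemma xv_measurable: "(\<lambda>v. xv A k t v) \<in> borel_measurable borel"
proof -
  have n: "(\<lambda>v. det_coeff A k t v $ j) \<in> borel_measurable borel" for j
  proof -
    have 1: "continuous_on UNIV (\<lambda>v :: complex^'l^'r. det (transpose (Mx A t v)))"
      unfolding det_transpose by (intro continuous_intros Mx_cont)
    have 2: "continuous_on UNIV (\<lambda>v :: complex^'l^'r. if m = j then (if i \<in> A then of_real t * v $ k $ \<iota> i else 0) else transpose (Mx A t v) $ i $ m)" for i m
      by (cases "m = j"; cases "i \<in> A") (auto simp: transpose_def intro!: continuous_intros Mx_cont)
    have "continuous_on UNIV (\<lambda>v :: complex^'l^'r. det (\<chi> i m. if m = j then (if i \<in> A then of_real t * v $ k $ \<iota> i else 0) else transpose (Mx A t v) $ i $ m))"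
      by (intro continuous_intros 2)
    with 1 show ?thesis unfolding det_coeff_def vec_lambda_beta
      by (intro borel_measurable_divide borel_measurable_continuous_onI)
  qed
  have c: "(\<lambda>v :: complex^'l^'r. v $ i $ a) \<in> borel_measurable borel" for i a
    by (intro borel_measurable_continuous_onI continuous_intros)
  have "(\<lambda>v. xv A k t v $ a) \<in> borel_measurable borel" for a
  proof (cases "a \<in> \<iota> ` A")
    case False
    have "(\<lambda>v. v $ k $ a + (\<Sum>i\<in>UNIV. det_coeff A k t v $ i * v $ i $ a)) \<in> borel_measurable borel" using n c by measurable
    then show ?thesis using False by (simp add: xv_def yv_def)
  qed (simp add: xv_def)
  then have "(\<lambda>v. xv A k t v \<bullet> b) \<in> borel_measurable borel" if "b \<in> Basis" for b
    unfolding inner_vec_def by (intro borel_measurable_sum borel_measurable_inner) auto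
  then show ?thesis by (subst borel_measurable_euclidean_space) auto
qed

end

context shilov_space begin

text \<open>Induction over the rows already added. The weight given by the old determinant is
  invariant under rotations of the free columns, so the new coordinate has an invariant law for the
  weighted measure as well. Each row then costs a constant independent of t.\<close>

lemma bound_minors:
  fixes \<iota> :: "'r \<Rightarrow> 'l"
  assumes inj: "inj \<iota>" and c: "2 * Suc s + CARD('r) \<le> CARD('l)"
  shows "\<exists>C. \<forall>t. 0 < t \<and> t < 1 \<longrightarrow> (\<integral>v. inverse (cmod (det (minors.Mx \<iota> A t v))) ^ (2 * Suc s) \<partial>\<mu>) \<le> C"
proof -
  interpret minors \<iota> by unfold_locales (rule inj)
  have fm: "(\<lambda>v. inverse (cmod (det (Mx A t v))) ^ (2 * Suc s)) \<in> borel_measurable borel" for A t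
  proof -
    have "(\<lambda>v. det (Mx A t v)) \<in> borel_measurable borel" by (intro borel_measurable_continuous_onI continuous_intros Mx_cont)
    then show ?thesis by measurable
  qed
  have fi: "integrable \<mu> (\<lambda>v. inverse (cmod (det (Mx A t v))) ^ (2 * Suc s))" if "0 < t" "t < 1" for A t
  proof (rule cont_integrable[OF _ fm])
    show "continuous_on Shilov (\<lambda>v. inverse (cmod (det (Mx A t v))) ^ (2 * Suc s))"
      by (intro continuous_intros Mx_cont) (use det_Mx_nz[OF Shilov_Cl] that in auto)
  qed
  have "finite A" by simp
  then show ?thesis
  proof (induction A)
    case empty
    have "Mx {} t v = mat 1" for t v by (simp add: vec_eq_iff Mx_nth mat_def)
    then show ?case by (intro exI[of _ 1]) (simp add: det_I prob_space)
  next
    case (insert k A)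
    then obtain C where C: "\<And>t. 0 < t \<Longrightarrow> t < 1 \<Longrightarrow> (\<integral>v. inverse (cmod (det (Mx A t v))) ^ (2 * Suc s) \<partial>\<mu>) \<le> C" by blast
    define Q where "Q = fact (2 * Suc s) * (\<Sum>n. 1 / real (Suc n) ^ 2)"
    have Q0: "0 \<le> Q" unfolding Q_def
    proof (intro mult_nonneg_nonneg suminf_nonneg)
      have "summable (\<lambda>n. inverse (real n ^ 2))" by (rule inverse_power_summable) simp
      then show "summable (\<lambda>n. 1 / real (Suc n) ^ 2)" by (subst (asm) summable_Suc_iff[symmetric]) (simp add: inverse_eq_divide)
    qed auto
    have "(\<integral>v. inverse (cmod (det (Mx (insert k A) t v))) ^ (2 * Suc s) \<partial>\<mu>) \<le> Q * C" if t: "0 < t" "t < 1" for t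
    proof -
      define f where "f v = inverse (cmod (det (Mx A t v))) ^ (2 * Suc s)" for v
      \<comment> \<open>The old determinant is absorbed into the measure, so that the integral for
        the enlarged set has only the new factor as its integrand and the induction hypothesis
        bounds the total mass.\<close>
      define M where "M = density \<mu> (\<lambda>v. ennreal (f v))"
      define J where "J = - (\<iota> ` A)"
      have f0: "0 \<le> f v" for v by (simp add: f_def)
      have fM: "f \<in> borel_measurable \<mu>" unfolding f_def by (rule mu_cong[OF fm])
      have f_int: "integrable \<mu> f" unfolding f_def by (rule fi[OF t])
      have Mint: "(\<integral>v. g v \<partial>M) = (\<integral>v. f v *\<^sub>R g v \<partial>\<mu>)" if "g \<in> borel_measurable \<mu>" for g :: "_ \<Rightarrow> 'z::{banach,second_countable_topology}"
        unfolding M_def by (rule integral_density[OF that fM]) (simp add: f0)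
      have sM: "sets M = sets \<mu>" "space M = space \<mu>" by (simp_all add: M_def)
      have xm: "(\<lambda>v. xv A k t v) \<in> borel_measurable M" using mu_cong[OF xv_measurable] unfolding M_def by simp
      have emM: "emeasure M (space M) = ennreal (\<integral>v. f v \<partial>\<mu>)"
        unfolding M_def space_density space_mu using fM f0
        by (subst emeasure_density) (auto simp: nn_integral_eq_integral[OF f_int])
      have fin: "finite_measure M" by (rule finite_measureI) (simp add: emM)
      interpret U: rotation_invariant M "\<lambda>v. xv A k t v" J
      proof (intro rotation_invariant.intro rotation_invariant_axioms.intro fin)
        show "(\<lambda>v. xv A k t v) \<in> borel_measurable M" by (rule xm)
        have "AE v in \<mu>. norm (xv A k t v) \<le> 1" using AE_Shilov by eventually_elim (rule xv_norm[OF _ t insert.hyps(2)])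
        then show "AE v in M. norm (xv A k t v) \<le> 1" unfolding M_def using fM by (subst AE_density) auto
        fix y :: "complex^'l" and \<theta> :: real and g :: "complex^'l \<Rightarrow> complex"
        assume y: "norm y = 1" "\<And>a. a \<notin> J \<Longrightarrow> y $ a = 0" and g: "g \<in> borel_measurable borel"
        have y': "\<And>a. a \<in> \<iota> ` A \<Longrightarrow> y $ a = 0" using y(2) by (simp add: J_def)
        have gx: "(\<lambda>v. g (xv A k t v)) \<in> borel_measurable \<mu>" by (rule measurable_compose[OF mu_cong[OF xv_measurable] g])
        have rm: "rot y \<theta> \<in> borel_measurable borel"
          unfolding rot_def cip_def vector_scalar_mult_def by (intro borel_measurable_continuous_onI continuous_intros)
        have grx: "(\<lambda>v. g (rot y \<theta> (xv A k t v))) \<in> borel_measurable \<mu>"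
          by (rule measurable_compose[OF measurable_compose[OF mu_cong[OF xv_measurable] rm] g])
        have "(\<integral>v. g (rot y \<theta> (xv A k t v)) \<partial>M) = (\<integral>v. f v *\<^sub>R g (rot y \<theta> (xv A k t v)) \<partial>\<mu>)" by (rule Mint[OF grx])
        also have "\<dots> = (\<integral>v. f (v ** rotation_matrix y \<theta>) *\<^sub>R g (xv A k t (v ** rotation_matrix y \<theta>)) \<partial>\<mu>)"
        proof -
          have e1: "Mx A t (v ** rotation_matrix y \<theta>) = Mx A t v" for v by (rule equivariance(1)[of A y k]) (use y' insert.hyps(2) in auto)
          have e2: "xv A k t (v ** rotation_matrix y \<theta>) = rot y \<theta> (xv A k t v)" for v by (rule equivariance(2)[of A y k]) (use y' insert.hyps(2) in auto)
          show ?thesis unfolding f_def e1 e2 ..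
        qed
        also have "\<dots> = (\<integral>v. f v *\<^sub>R g (xv A k t v) \<partial>\<mu>)"
        proof (rule unitary_integral[OF rotation_matrix_unitary[OF y(1)], of "\<lambda>v. f v *\<^sub>R g (xv A k t v)"])
          have a: "f \<in> borel_measurable borel" unfolding f_def by (rule fm)
          have b: "(\<lambda>v. g (xv A k t v)) \<in> borel_measurable borel" by (rule measurable_compose[OF xv_measurable g])
          show "(\<lambda>v. f v *\<^sub>R g (xv A k t v)) \<in> borel_measurable borel" using a b by measurable
        qed
        also have "\<dots> = (\<integral>v. g (xv A k t v) \<partial>M)" by (rule Mint[OF gx, symmetric])
        finally show "(\<integral>v. g (rot y \<theta> (xv A k t v)) \<partial>M) = (\<integral>v. g (xv A k t v) \<partial>M)" .
      qed
      have kJ: "\<iota> k \<in> J" using insert.hyps(2) inj by (auto simp: J_def inj_def)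
      \<comment> \<open>As k is not yet in A, at most r - 1 columns are used, and at least l - r + 1
        > 2 \<open>Suc s\<close> are free; the strict inequality is the one
        \<open>power_bound\<close> asks for.\<close>
      have cardJ: "2 * Suc s < card J"
      proof -
        have "card (\<iota> ` A) = card A" using inj by (intro card_image) (auto simp: inj_def inj_on_def)
        moreover have "card A < CARD('r)" using insert.hyps by (intro psubset_card_mono) auto
        moreover have "card J = CARD('l) - card (\<iota> ` A)" unfolding J_def by (simp add: Compl_eq_Diff_UNIV card_Diff_subset)
        ultimately show ?thesis using c by linarith
      qed
      have "(\<integral>v. inverse (cmod (det (Mx (insert k A) t v))) ^ (2 * Suc s) \<partial>\<mu>)
          = (\<integral>v. f v *\<^sub>R inverse (cmod (1 - of_real t * xv A k t v $ \<iota> k)) ^ (2 * Suc s) \<partial>\<mu>)"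
      proof (rule integral_cong_AE)
        show "(\<lambda>v. inverse (cmod (det (Mx (insert k A) t v))) ^ (2 * Suc s)) \<in> borel_measurable \<mu>" by (rule mu_cong[OF fm])
        have "(\<lambda>v. xv A k t v $ \<iota> k) \<in> borel_measurable \<mu>"
          by (rule measurable_compose[OF mu_cong[OF xv_measurable]]) (intro borel_measurable_continuous_onI continuous_intros)
        then show "(\<lambda>v. f v *\<^sub>R inverse (cmod (1 - of_real t * xv A k t v $ \<iota> k)) ^ (2 * Suc s)) \<in> borel_measurable \<mu>"
          using fM by measurable
        show "AE v in \<mu>. inverse (cmod (det (Mx (insert k A) t v))) ^ (2 * Suc s)
            = f v *\<^sub>R inverse (cmod (1 - of_real t * xv A k t v $ \<iota> k)) ^ (2 * Suc s)"
          using AE_Shilov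
        proof eventually_elim
          case (elim v)
          have "det (Mx A t v) \<noteq> 0" using det_Mx_nz[OF Shilov_Cl[OF elim]] t by simp
          from det_step[OF this insert.hyps(2)] show ?case
            by (simp add: f_def norm_mult power_mult_distrib del: power_Suc mult_Suc_right)
        qed
      qed
      also have "\<dots> = (\<integral>v. inverse (cmod (1 - of_real t * xv A k t v $ \<iota> k)) ^ (2 * Suc s) \<partial>M)"
      proof (rule Mint[symmetric])
        have "(\<lambda>v. xv A k t v $ \<iota> k) \<in> borel_measurable \<mu>"
          by (rule measurable_compose[OF mu_cong[OF xv_measurable]]) (intro borel_measurable_continuous_onI continuous_intros)
        then show "(\<lambda>v. inverse (cmod (1 - of_real t * xv A k t v $ \<iota> k)) ^ (2 * Suc s)) \<in> borel_measurable \<mu>" by measurable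
      qed
      also have "\<dots> \<le> Q * measure M (space M)"
        unfolding Q_def by (rule U.power_bound[OF kJ cardJ]) (use t in auto)
      also have "measure M (space M) = (\<integral>v. f v \<partial>\<mu>)"
        unfolding measure_def emM using f0 by (simp add: integral_nonneg_AE)
      also have "Q * \<dots> \<le> Q * C" unfolding f_def by (intro mult_left_mono C t Q0)
      finally show ?thesis .
    qed
    then show ?case by blast
  qed
qed

lemma hfun_right: "hfun z (w ** U) = hfun (z ** ctrans U) w"
  by (simp add: hfun_def ctrans_mul matrix_mul_assoc)

lemma shilov_bound:
  assumes c: "2 * Suc s + CARD('r) \<le> CARD('l)"
  shows "\<exists>u0 \<in> (Shilov :: (complex^'l^'r) set). \<exists>C. \<forall>t. 0 < t \<and> t < 1 \<longrightarrow> (\<integral>v. inverse (cmod (hfun (t *\<^sub>R v) u0)) ^ (2 * Suc s) \<partial>\<mu>) \<le> C"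
proof -
  obtain \<iota> :: "'r \<Rightarrow> 'l" where i: "inj \<iota>"
    using card_le_inj[of "UNIV :: 'r set" "UNIV :: 'l set"] c by auto
  interpret minors \<iota> by unfold_locales (rule i)
  have p: "pr UNIV v = v" for v :: "complex^'l^'r" by (simp add: pr_def vec_eq_iff)
  show ?thesis
    using bound_minors[OF i c, of UNIV] u0_Shilov unfolding det_Mx p by blast
qed

end

section \<open>Boundary kernel functions\<close>

lemma Shilov_iff_rows: "v \<in> Shilov \<longleftrightarrow> (\<forall>i j. cip (v $ i) (v $ j) = (if i = j then 1 else 0))"
proof
  assume *: "\<forall>i j. cip (v $ i) (v $ j) = (if i = j then 1 else 0)"
  have "(v ** ctrans v) $ i $ j = cip (v $ i) (v $ j)" for i j
    by (simp add: cip_def matrix_matrix_mult_def ctrans_def)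
  then show "v \<in> Shilov" using * by (simp add: Shilov_def vec_eq_iff mat_def)
qed (use Shilov_row in blast)

text \<open>A Householder matrix acting on rows from the right. The coefficient \<tau> is complex
  because two unit vectors with a non-real inner product must be exchanged by it up to order: the
  first has to go exactly to the second.\<close>

definition complex_reflection :: "complex^'n::finite \<Rightarrow> complex \<Rightarrow> complex^'n^'n" where
  "complex_reflection n \<tau> = (\<chi> a b. (if a = b then 1 else 0) - \<tau> * cnj (n $ a) * n $ b)"

lemma complex_reflection_row: "(v ** complex_reflection n \<tau>) $ i = (v :: complex^'n::finite^'m::finite) $ i - (\<tau> * cip (v $ i) n) *s n"
proof -
  have "v $ i $ a * ((if a = b then 1 else 0) - \<tau> * cnj (n $ a) * n $ b)
    = (if a = b then v $ i $ a else 0) - \<tau> * (v $ i $ a * cnj (n $ a)) * n $ b" for a b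
    by (simp add: algebra_simps)
  then show ?thesis
    by (simp add: vec_eq_iff matrix_matrix_mult_def complex_reflection_def cip_def sum_subtractf sum_distrib_left sum_distrib_right)
qed

lemma complex_reflection_unitary:
  assumes "\<tau> * cnj \<tau> * cip n n = \<tau> + cnj \<tau>" shows "ctrans (complex_reflection n \<tau>) ** complex_reflection n \<tau> = mat 1"
  unfolding unitary_cip
proof (intro allI)
  fix x y
  define m where "m = (\<chi> a. cnj (n $ a))"
  have mm: "cip m m = cip n n" by (simp add: m_def cip_def mult.commute)
  have R: "complex_reflection n \<tau> *v x = x - (\<tau> * cip x m) *s m" for x
  proof -
    have "((if a = b then 1 else 0) - \<tau> * cnj (n $ a) * n $ b) * x $ b
      = (if a = b then x $ b else 0) - \<tau> * (x $ b * n $ b) * cnj (n $ a)" for a b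
      by (simp add: algebra_simps)
    then show ?thesis
      by (simp add: vec_eq_iff matrix_vector_mult_def complex_reflection_def cip_def sum_subtractf sum_distrib_left sum_distrib_right m_def)
  qed
  have "cip (complex_reflection n \<tau> *v x) (complex_reflection n \<tau> *v y) = cip x y + (cip x m * cnj (cip y m)) * (\<tau> * cnj \<tau> * cip n n - (\<tau> + cnj \<tau>))"
    unfolding R by (simp add: mm cip_cnj[of y m] algebra_simps)
  then show "cip (complex_reflection n \<tau> *v x) (complex_reflection n \<tau> *v y) = cip x y" unfolding assms by simp
qed

lemma unitary_mult: assumes "ctrans U ** U = mat 1" "ctrans V ** V = (mat 1 :: complex^'n::finite^'n)"
  shows "ctrans (U ** V) ** (U ** V) = mat 1"
proof -
  have "ctrans (U ** V) ** (U ** V) = ctrans V ** ((ctrans U ** U) ** V)" by (simp only: ctrans_mul matrix_mul_assoc)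
  then show ?thesis using assms by simp
qed

lemma Shilov_unitary:
  fixes v :: "complex^'l::finite^'r::finite" and U :: "complex^'l^'l"
  assumes "v \<in> Shilov" "ctrans U ** U = mat 1" shows "v ** U \<in> Shilov"
proof -
  have U: "U ** ctrans U = mat 1" by (rule matrix_left_right_inverse[THEN iffD1, OF assms(2)])
  have "(v ** U) ** ctrans (v ** U) = v ** ((U ** ctrans U) ** ctrans v)" by (simp only: ctrans_mul matrix_mul_assoc)
  then show ?thesis using assms(1) unfolding U by (simp add: Shilov_def)
qed

text \<open>Rows are matched one at a time. The reflection along n = v_k - w_k with \<tau> = 1/(1 -
  c), c the inner product of the two rows, sends v_k to w_k because the inner product of v_k with n
  is 1 - c. Rows that already agree are orthogonal to both v_k and w_k, hence to n, and stay
  fixed.\<close>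

lemma Shilov_transitive:
  fixes v w :: "complex^'l::finite^'r::finite"
  assumes v: "v \<in> Shilov" and w: "w \<in> Shilov"
  shows "\<exists>U :: complex^'l^'l. ctrans U ** U = mat 1 \<and> w = v ** U"
proof -
  have "\<exists>U :: complex^'l^'l. ctrans U ** U = mat 1 \<and> (\<forall>i\<in>A. (v ** U) $ i = w $ i)" if "finite A" for A :: "'r set"
    using that
  proof induction
    case empty
    show ?case by (rule exI[of _ "mat 1"]) simp
  next
    case (insert k A)
    then obtain U where U: "ctrans U ** U = mat 1" "\<And>i. i \<in> A \<Longrightarrow> (v ** U) $ i = w $ i" by blast
    define v' where "v' = v ** U"
    have v': "v' \<in> Shilov" unfolding v'_def by (rule Shilov_unitary[OF v U(1)])
    show ?case
    proof (cases "v' $ k = w $ k")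
      case True
      then show ?thesis using U by (intro exI[of _ U]) (auto simp: v'_def)
    next
      case False
      define n where "n = v' $ k - w $ k"
      define c where "c = cip (v' $ k) (w $ k)"
      have nn: "cip n n = (1 - c) + cnj (1 - c)"
        unfolding n_def c_def by (simp add: Shilov_row(1)[OF v'] Shilov_row(1)[OF w] cip_cnj[of "w $ k" "v' $ k"])
      have "1 - c \<noteq> 0"
      proof
        assume "1 - c = 0"
        then have "cip n n = 0" using nn by simp
        then have "norm n = 0" by (simp add: cip_self)
        then show False using False by (simp add: n_def)
      qed
      define \<tau> where "\<tau> = inverse (1 - c)"
      have t1: "\<tau> * (1 - c) = 1" "cnj \<tau> * cnj (1 - c) = 1"
        using \<open>1 - c \<noteq> 0\<close> unfolding \<tau>_def by (simp, metis complex_cnj_mult complex_cnj_one left_inverse)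
      have "\<tau> * cnj \<tau> * cip n n = (\<tau> * (1 - c)) * cnj \<tau> + \<tau> * (cnj \<tau> * cnj (1 - c))"
        unfolding nn by (simp only: distrib_left mult_ac)
      then have un: "ctrans (complex_reflection n \<tau>) ** complex_reflection n \<tau> = mat 1"
        unfolding t1 by (intro complex_reflection_unitary) simp
      have k: "(v' ** complex_reflection n \<tau>) $ k = w $ k"
      proof -
        have "cip (v' $ k) n = 1 - c" unfolding n_def c_def by (simp add: Shilov_row(1)[OF v'])
        then have "\<tau> * cip (v' $ k) n = 1" using t1(1) by simp
        then show ?thesis unfolding complex_reflection_row by (simp add: n_def)
      qed
      have "(v' ** complex_reflection n \<tau>) $ i = w $ i" if "i \<in> A" for i
      proof -
        have e: "v' $ i = w $ i" using U(2)[OF that] by (simp add: v'_def)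
        have ik: "i \<noteq> k" using that insert.hyps by auto
        have "cip (v' $ i) n = cip (v' $ i) (v' $ k) - cip (w $ i) (w $ k)" unfolding n_def using e by simp
        then have "cip (v' $ i) n = 0" using ik by (simp add: Shilov_row(1)[OF v'] Shilov_row(1)[OF w])
        then show ?thesis unfolding complex_reflection_row using e by simp
      qed
      then have "\<forall>i\<in>insert k A. (v ** (U ** complex_reflection n \<tau>)) $ i = w $ i"
        using k by (simp add: v'_def matrix_mul_assoc)
      then show ?thesis using unitary_mult[OF U(1) un] by blast
    qed
  qed
  from this[of UNIV] obtain U where "ctrans U ** U = mat 1" "\<forall>i. (v ** U) $ i = w $ i" by auto
  then show ?thesis by (intro exI[of _ U]) (simp add: vec_eq_iff[of w] vec_eq_iff)
qed

lemma matrix_inv_nth: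
  fixes A :: "complex^'n::finite^'n"
  assumes "invertible A"
  shows "matrix_inv A $ i $ j = det (\<chi> p q. if q = i then (if p = j then 1 else 0) else A $ p $ q) / det A"
proof -
  have d: "det A \<noteq> 0" using assms by (simp add: invertible_det_nz)
  have "A *v (matrix_inv A *v axis j 1) = axis j 1"
    by (simp add: matrix_vector_mul_assoc matrix_inv_works[OF assms])
  then have "matrix_inv A *v axis j 1 = (\<chi> k. det (\<chi> p q. if q = k then axis j 1 $ p else A $ p $ q) / det A)"
    unfolding cramer[OF d] .
  then have "(matrix_inv A *v axis j 1) $ i = det (\<chi> p q. if q = i then axis j 1 $ p else A $ p $ q) / det A"
    by simp
  moreover have "(matrix_inv A *v axis j 1) $ i = matrix_inv A $ i $ j" by (simp add: mv_axis)
  ultimately show ?thesis by (simp add: axis_def cong: if_cong)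
qed

lemma continuous_matrix_inv:
  fixes f :: "'a::topological_space \<Rightarrow> complex^'n::finite^'n"
  assumes f: "continuous_on S f" and i: "\<And>x. x \<in> S \<Longrightarrow> invertible (f x)"
  shows "continuous_on S (\<lambda>x. matrix_inv (f x))"
proof -
  have c: "continuous_on S (\<lambda>x. if q = i then (if p = j then 1 else 0) else f x $ p $ q)" for p q i j
    using f by (cases "q = i") (auto intro!: continuous_intros)
  have "continuous_on S (\<lambda>x. \<chi> i j. det (\<chi> p q. if q = i then (if p = j then 1 else 0) else f x $ p $ q) / det (f x))"
    by (intro continuous_intros c f) (use i invertible_det_nz in auto)
  then show ?thesis
    by (rule continuous_on_eq) (simp add: vec_eq_iff matrix_inv_nth i)
qed

lemma continuous_act: assumes "g \<in> SUgrp" "S \<subseteq> Cl" shows "continuous_on S (act g)" "continuous_on S (jfac g)"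
proof -
  have d: "continuous_on S (\<lambda>z. den g z)" unfolding den_def by (intro continuous_intros)
  show "continuous_on S (act g)"
    unfolding act_def den_def[symmetric]
    by (intro continuous_intros continuous_matrix_inv d) (use den_inv[OF assms(1)] assms(2) in auto)
  show "continuous_on S (jfac g)" unfolding jfac_den by (intro continuous_intros d)
qed

lemma hfun_scale: "hfun z (t *\<^sub>R w) = hfun (t *\<^sub>R z) w"
proof -
  have "z ** ctrans (t *\<^sub>R w) = (t *\<^sub>R z) ** ctrans w"
    by (simp add: vec_eq_iff matrix_matrix_mult_def ctrans_def)
  then show ?thesis by (simp add: hfun_def)
qed

lemma hfun_0 [simp]: "hfun 0 w = 1"
  by (simp add: hfun_def det_I)

lemma zero_Dom: "0 \<in> (Dom :: (complex^'l::finite^'r::finite) set)"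
  by (simp add: Dom_iff)

text \<open>The indicator makes every integrand that is continuous on the Shilov boundary measurable
  and integrable, whatever its values elsewhere; this matters for \<open>act\<close> and
  \<open>jfac\<close>, which are controlled only on \<open>Cl\<close>.\<close>

definition (in shilov_space) SI :: "(complex^'l^'r \<Rightarrow> complex) \<Rightarrow> complex" where
  "SI f = (\<integral>v. indicator Shilov v *\<^sub>R f v \<partial>\<mu>)"

context shilov_space begin

lemma Shilov_borel: "Shilov \<in> sets borel"
  by (intro borel_closed compact_imp_closed compact_Shilov)

lemma SI_integrable: assumes "continuous_on Shilov f" shows "integrable \<mu> (\<lambda>v. indicator Shilov v *\<^sub>R (f v :: complex))"
proof (rule cont_integrable)
  show "(\<lambda>v. indicator Shilov v *\<^sub>R f v) \<in> borel_measurable borel"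
    by (rule borel_measurable_continuous_on_indicator[OF Shilov_borel assms])
  show "continuous_on Shilov (\<lambda>v. indicator Shilov v *\<^sub>R f v)"
    by (rule continuous_on_eq[OF assms]) simp
qed

lemma SI_eq: assumes "continuous_on Shilov f" "f \<in> borel_measurable borel" shows "SI f = (\<integral>v. f v \<partial>\<mu>)"
  unfolding SI_def
proof (rule integral_cong_AE)
  show "(\<lambda>v. indicator Shilov v *\<^sub>R f v) \<in> borel_measurable \<mu>" using SI_integrable[OF assms(1)] by simp
  show "f \<in> borel_measurable \<mu>" by (rule mu_cong[OF assms(2)])
  show "AE v in \<mu>. indicator Shilov v *\<^sub>R f v = f v" using AE_Shilov by eventually_elim simp
qed

lemma SI_cong: "(\<And>v. v \<in> Shilov \<Longrightarrow> f v = g v) \<Longrightarrow> SI f = SI g"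
  unfolding SI_def by (intro Bochner_Integration.integral_cong refl) (metis indicator_simps(2) scaleR_zero_left)

lemma SI_add: assumes "continuous_on Shilov f" "continuous_on Shilov g" shows "SI (\<lambda>v. f v + g v) = SI f + SI g"
  unfolding SI_def using Bochner_Integration.integral_add[OF SI_integrable[OF assms(1)] SI_integrable[OF assms(2)]]
  by (simp add: scaleR_add_right)

lemma SI_mult: "SI (\<lambda>v. c * f v) = c * SI f"
  unfolding SI_def by (simp add: integral_mult_right_zero[symmetric] mult_scaleR_right del: integral_mult_right_zero)

lemma SI_cnj: "SI (\<lambda>v. cnj (f v)) = cnj (SI f)"
proof -
  have e: "indicator Shilov v *\<^sub>R cnj (f v) = cnj (indicator Shilov v *\<^sub>R f v)" for v by simp
  show ?thesis unfolding SI_def e by (rule Bochner_Integration.integral_cnj)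
qed

lemma SI_const: "SI (\<lambda>v. c) = c"
  using SI_eq[of "\<lambda>_. c"] prob_space by simp

lemma SI_bound: assumes "continuous_on Shilov f" "\<And>v. v \<in> Shilov \<Longrightarrow> cmod (f v) \<le> B" shows "cmod (SI f) \<le> B"
proof -
  have i: "integrable \<mu> (\<lambda>v. indicator Shilov v *\<^sub>R f v)" by (rule SI_integrable[OF assms(1)])
  have "cmod (SI f) \<le> (\<integral>v. norm (indicator Shilov v *\<^sub>R f v) \<partial>\<mu>)" unfolding SI_def by (rule integral_norm_bound)
  also have "\<dots> \<le> (\<integral>v. B \<partial>\<mu>)"
  proof (rule integral_mono)
    show "integrable \<mu> (\<lambda>v. norm (indicator Shilov v *\<^sub>R f v))" by (rule integrable_norm[OF i])
    obtain u :: "complex^'l^'r" where "u \<in> Shilov" using AE_Shilov by (metis (mono_tags, lifting) AE_E_prob AE_False eventually_mono)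
    then have B: "0 \<le> B" using assms(2) norm_ge_zero order_trans by blast
    show "norm (indicator Shilov v *\<^sub>R f v) \<le> B" for v
      using assms(2)[of v] B by (simp add: indicator_def)
  qed simp
  finally show ?thesis using prob_space by simp
qed

lemma SI_tendsto:
  assumes "\<And>n. continuous_on Shilov (fs n)" "continuous_on Shilov f"
    "\<And>v. v \<in> Shilov \<Longrightarrow> (\<lambda>n. fs n v) \<longlonglongrightarrow> f v" "\<And>n v. v \<in> Shilov \<Longrightarrow> cmod (fs n v) \<le> B"
  shows "(\<lambda>n. SI (fs n)) \<longlonglongrightarrow> SI f"
  unfolding SI_def
proof (rule integral_dominated_convergence[where w = "\<lambda>_. B"])
  show "(\<lambda>v. indicator Shilov v *\<^sub>R f v) \<in> borel_measurable \<mu>" using SI_integrable[OF assms(2)] by simp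
  show "(\<lambda>v. indicator Shilov v *\<^sub>R fs n v) \<in> borel_measurable \<mu>" for n using SI_integrable[OF assms(1)] by simp
  show "AE v in \<mu>. (\<lambda>n. indicator Shilov v *\<^sub>R fs n v) \<longlonglongrightarrow> indicator Shilov v *\<^sub>R f v"
    using AE_Shilov by eventually_elim (simp add: assms(3))
  show "AE v in \<mu>. norm (indicator Shilov v *\<^sub>R fs n v) \<le> B" for n
    using AE_Shilov by eventually_elim (simp add: assms(4))
qed simp

end

section \<open>The tensor product space as a reproducing kernel Hilbert space\<close>

locale wallach = shilov_space \<mu> for \<mu> :: "(complex^'l::finite^'r::finite) measure" +
  fixes s :: nat
  assumes dims: "2 * Suc s + CARD('r) \<le> CARD('l)"
begin

abbreviation "\<nu> \<equiv> Suc s"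
abbreviation "XX \<equiv> (DD :: ((complex^'l^'r) \<times> (complex^'l^'r)) set)"
abbreviation "KK \<equiv> (tkernel (Suc s) :: (complex^'l^'r) \<times> (complex^'l^'r) \<Rightarrow> _)"

lemma DD_iff: "p \<in> XX \<longleftrightarrow> fst p \<in> Dom \<and> snd p \<in> Dom"
  by (cases p) (simp add: DD_def)

sublocale rkhs_locale XX KK
proof
  show "pd_kernel XX KK" by (rule tkernel_pdk)
  show "\<exists>x\<in>XX. KK x x \<noteq> 0" by (rule bexI[of _ "(0,0)"]) (simp_all add: tkernel_def DD_iff zero_Dom)
qed

lemma KK_herm: "p \<in> XX \<Longrightarrow> p' \<in> XX \<Longrightarrow> KK p' p = cnj (KK p p')"
  by (rule pd_kernel_herm[OF tkernel_pdk])

lemma h_Dom_nz: "z \<in> Dom \<Longrightarrow> w \<in> Dom \<Longrightarrow> hfun z w \<noteq> 0"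
  by (intro hfun_nz) (auto intro: Dom_Cl)

lemma KK_cont:
  assumes "continuous_on S f" "continuous_on S g" "\<And>x. x \<in> S \<Longrightarrow> f x \<in> XX" "\<And>x. x \<in> S \<Longrightarrow> g x \<in> XX"
  shows "continuous_on S (\<lambda>x. KK (f x) (g x))"
  unfolding tkernel_def using assms(3,4)
  by (intro continuous_intros assms(1,2)) (auto simp: DD_iff h_Dom_nz)

text \<open>The increment of F is its inner product with a difference of two kernel functions, whose
  squared norm \<open>\<phi>\<close> tends to 0 because the kernel is continuous.\<close>

lemma H_cont: assumes F: "F \<in> H" shows "continuous_on XX F"
  unfolding continuous_on_def
proof
  fix p assume p: "p \<in> XX"
  define \<phi> where "\<phi> p' = Re (KK p p - KK p p' - KK p' p + KK p' p')" for p'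
  have c: "continuous_on XX \<phi>" unfolding \<phi>_def by (intro continuous_intros KK_cont) (use p in auto)
  have "(\<phi> \<longlongrightarrow> \<phi> p) (at p within XX)" using c p unfolding continuous_on_def by blast
  from tendsto_real_sqrt[OF tendsto_mult[OF tendsto_const this]]
  have "((\<lambda>p'. sqrt (N F * \<phi> p')) \<longlongrightarrow> sqrt (N F * \<phi> p)) (at p within XX)" .
  moreover have "\<phi> p = 0" by (simp add: \<phi>_def)
  ultimately have "((\<lambda>p'. sqrt (N F * \<phi> p')) \<longlongrightarrow> 0) (at p within XX)" by simp
  then have "((\<lambda>p'. F p' - F p) \<longlongrightarrow> 0) (at p within XX)"
  proof (rule Lim_null_comparison[rotated])
    show "\<forall>\<^sub>F p' in at p within XX. norm (F p' - F p) \<le> sqrt (N F * \<phi> p')"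
      unfolding eventually_at_filter
    proof (intro always_eventually allI impI)
      fix p' assume "p' \<in> XX"
      then have ps: "pts XX [(1,p'),(-1,p)]" using p by simp
      have "ev F [(1,p'),(-1,p)] = F p' - F p" by (simp add: ev_def)
      moreover have "Re (qf KK [(1,p'),(-1,p)] [(1,p'),(-1,p)]) = \<phi> p'" by (simp add: qf_def \<phi>_def)
      ultimately show "norm (F p' - F p) \<le> sqrt (N F * \<phi> p')"
        using ev_bound[OF F ps] by (intro real_le_rsqrt) simp
    qed
  qed
  then show "(F \<longlongrightarrow> F p) (at p within XX)" by (simp add: LIM_zero_iff)
qed

definition bp :: "real \<Rightarrow> complex^'l^'r \<Rightarrow> (complex^'l^'r) \<times> (complex^'l^'r)" where
  "bp t v = (t *\<^sub>R v, t *\<^sub>R v)"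

lemma bp_DD: "v \<in> Cl \<Longrightarrow> 0 \<le> t \<Longrightarrow> t < 1 \<Longrightarrow> bp t v \<in> XX"
  by (simp add: bp_def DD_iff scale_Dom)

text \<open>The factor that g puts on a boundary kernel function when moving it from v to
  \<open>act g v\<close>. Its mean over the Shilov boundary is the spherical function at the inverse
  of g.\<close>

definition ag :: "complex^('r + 'l)^('r + 'l) \<Rightarrow> complex^'l^'r \<Rightarrow> real" where
  "ag g v = inverse (cmod (jfac g v)) ^ (2 * \<nu>)"

lemma Shilov_subset_Cl: "Shilov \<subseteq> (Cl :: (complex^'l^'r) set)" using Shilov_Cl by blast

lemma ag_cont: "g \<in> SUgrp \<Longrightarrow> continuous_on Shilov (ag g)"
  unfolding ag_def using continuous_act(2)[OF _ Shilov_subset_Cl, of g] jfac_nz[of g] Shilov_subset_Cl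
  by (intro continuous_intros) auto

lemma bp_cont: "g \<in> SUgrp \<Longrightarrow> continuous_on Shilov (\<lambda>v. bp t (act g v))"
  unfolding bp_def using continuous_act(1)[OF _ Shilov_subset_Cl, of g] by (intro continuous_intros) auto

lemma bp_act: "g \<in> SUgrp \<Longrightarrow> v \<in> Shilov \<Longrightarrow> 0 \<le> t \<Longrightarrow> t < 1 \<Longrightarrow> bp t (act g v) \<in> XX"
  by (intro bp_DD act_Cl Shilov_Cl)

lemma F_bp_cont: "F \<in> H \<Longrightarrow> g \<in> SUgrp \<Longrightarrow> 0 \<le> t \<Longrightarrow> t < 1 \<Longrightarrow> continuous_on Shilov (\<lambda>v. F (bp t (act g v)))"
  by (rule continuous_on_compose2[OF H_cont bp_cont]) (auto intro: bp_act)

text \<open>A regularized translate of xi: boundary points are pulled inside by the factor t, so the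
  average runs over genuine kernel functions.\<close>

definition eta :: "complex^('r + 'l)^('r + 'l) \<Rightarrow> real \<Rightarrow> (complex^'l^'r) \<times> (complex^'l^'r) \<Rightarrow> complex" where
  "eta g t p = (if p \<in> XX then SI (\<lambda>v. of_real (ag g v) * KK p (bp t (act g v))) else 0)"

text \<open>The weighted average of evaluations at the points \<open>bp t (act g v)\<close> is a
  bounded functional, since these points form a compact subset of the domain for t < 1;
  \<open>eta g t\<close> is its representing vector by \<open>riesz\<close>.\<close>

lemma eta_H:
  assumes g: "g \<in> SUgrp" and t: "0 \<le> t" "t < 1"
  shows "eta g t \<in> H" "\<And>F. F \<in> H \<Longrightarrow> ip F (eta g t) = SI (\<lambda>v. of_real (ag g v) * F (bp t (act g v)))"
proof -
  define L where "L F = SI (\<lambda>v. of_real (ag g v) * F (bp t (act g v)))" for F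
  have ca: "continuous_on Shilov (\<lambda>v. of_real (ag g v) * F (bp t (act g v)) :: complex)" if "F \<in> H" for F
    by (intro continuous_intros ag_cont g F_bp_cont that t)
  define b where "b v = ag g v * sqrt (Re (KK (bp t (act g v)) (bp t (act g v))))" for v
  have "continuous_on Shilov b" unfolding b_def
    by (intro continuous_intros ag_cont g KK_cont bp_cont bp_act t)
  then have "bounded (b ` Shilov)" by (intro compact_imp_bounded compact_continuous_image compact_Shilov)
  then obtain B where B: "B > 0" "\<And>v. v \<in> Shilov \<Longrightarrow> norm (b v) \<le> B" unfolding bounded_pos by blast
  have ag0: "0 \<le> ag g v" for v by (simp add: ag_def)
  have Lb: "(cmod (L F))\<^sup>2 \<le> B\<^sup>2 * N F" if F: "F \<in> H" for F
  proof -
    have "cmod (L F) \<le> B * sqrt (N F)" unfolding L_def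
    proof (rule SI_bound[OF ca[OF F]])
      fix v :: "complex^'l^'r" assume v: "v \<in> Shilov"
      have "cmod (F (bp t (act g v))) \<le> sqrt (N F * Re (KK (bp t (act g v)) (bp t (act g v))))"
        by (intro real_le_rsqrt pt_bound F bp_act g v t)
      then have "ag g v * cmod (F (bp t (act g v))) \<le> ag g v * sqrt (N F * Re (KK (bp t (act g v)) (bp t (act g v))))"
        by (intro mult_left_mono ag0)
      also have "\<dots> = b v * sqrt (N F)" by (simp add: b_def real_sqrt_mult)
      also have "\<dots> \<le> B * sqrt (N F)" using B(2)[OF v] N_nonneg[OF F] by (intro mult_right_mono) auto
      finally show "cmod (of_real (ag g v) * F (bp t (act g v))) \<le> B * sqrt (N F)"
        using ag0 by (simp add: norm_mult)
    qed
    then have "(cmod (L F))\<^sup>2 \<le> (B * sqrt (N F))\<^sup>2" by (intro power_mono) auto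
    then show ?thesis using N_nonneg[OF F] by (simp add: power_mult_distrib)
  qed
  have Lc: "L (cmb ps) = cnj (ev (eta g t) ps)" if "pts XX ps" for ps
    using that
  proof (induction ps)
    case Nil
    show ?case by (simp add: L_def comb_Nil SI_const)
  next
    case (Cons p ps)
    have p: "snd p \<in> XX" and ps: "pts XX ps" using Cons.prems by auto
    have "L (cmb (p # ps)) = SI (\<lambda>v. fst p * cnj (of_real (ag g v) * KK (snd p) (bp t (act g v))) + of_real (ag g v) * cmb ps (bp t (act g v)))"
      unfolding L_def
    proof (rule SI_cong)
      fix v :: "complex^'l^'r" assume v: "v \<in> Shilov"
      have b: "bp t (act g v) \<in> XX" by (rule bp_act[OF g v t])
      show "of_real (ag g v) * cmb (p # ps) (bp t (act g v)) = fst p * cnj (of_real (ag g v) * KK (snd p) (bp t (act g v))) + of_real (ag g v) * cmb ps (bp t (act g v))"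
        using b KK_herm[OF p b] by (simp add: comb_def split_beta algebra_simps)
    qed
    also have "\<dots> = SI (\<lambda>v. fst p * cnj (of_real (ag g v) * KK (snd p) (bp t (act g v)))) + L (cmb ps)"
      unfolding L_def
    proof (rule SI_add)
      show "continuous_on Shilov (\<lambda>v. fst p * cnj (of_real (ag g v) * KK (snd p) (bp t (act g v))))"
        by (intro continuous_intros ag_cont g KK_cont bp_cont bp_act t p)
    qed (rule ca[OF comb_H(1)[OF ps]])
    also have "SI (\<lambda>v. fst p * cnj (of_real (ag g v) * KK (snd p) (bp t (act g v)))) = fst p * cnj (eta g t (snd p))"
      unfolding SI_mult SI_cnj using p by (simp add: eta_def)
    finally show ?case using Cons.IH[OF ps] by (simp add: ev_Cons)
  qed
  have Ld: "L (\<lambda>x. F x - G x) = L F - L G" if "F \<in> H" "G \<in> H" for F G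
  proof -
    have "L (\<lambda>x. F x - G x) = SI (\<lambda>v. of_real (ag g v) * F (bp t (act g v)) + (-1) * (of_real (ag g v) * G (bp t (act g v))))"
      unfolding L_def by (simp add: algebra_simps)
    also have "\<dots> = L F + SI (\<lambda>v. (-1) * (of_real (ag g v) * G (bp t (act g v))))"
      unfolding L_def by (rule SI_add) (intro continuous_on_mult continuous_on_const ca that)+
    finally show ?thesis unfolding SI_mult by (simp add: L_def)
  qed
  have off: "eta g t x = 0" if "x \<notin> XX" for x using that by (simp add: eta_def)
  have B2: "0 \<le> B\<^sup>2" by simp
  show "eta g t \<in> H" by (rule riesz(1)[OF off Ld Lb B2 Lc])
  show "ip F (eta g t) = SI (\<lambda>v. of_real (ag g v) * F (bp t (act g v)))" if "F \<in> H" for F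
    by (rule trans[OF riesz(2)[OF off Ld Lb B2 Lc that] L_def])
qed

section \<open>The diagonal action as a unitary representation\<close>

definition mfac :: "complex^('r + 'l)^('r + 'l) \<Rightarrow> (complex^'l^'r) \<times> (complex^'l^'r) \<Rightarrow> complex" where
  "mfac g p = inverse (jfac (matrix_inv g) (fst p) ^ \<nu>) * cnj (inverse (jfac (matrix_inv g) (snd p) ^ \<nu>))"

definition gp :: "complex^('r + 'l)^('r + 'l) \<Rightarrow> (complex^'l^'r) \<times> (complex^'l^'r) \<Rightarrow> (complex^'l^'r) \<times> (complex^'l^'r)" where
  "gp g p = (act (matrix_inv g) (fst p), act (matrix_inv g) (snd p))"

abbreviation "ta \<equiv> (tact (Suc s) :: complex^('r + 'l)^('r + 'l) \<Rightarrow> ((complex^'l^'r) \<times> (complex^'l^'r) \<Rightarrow> complex) \<Rightarrow> _)"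

lemma ta_eq: "ta g F p = (if p \<in> XX then mfac g p * F (gp g p) else 0)"
  by (cases p) (simp add: tact_def mfac_def gp_def)

lemma gp_DD: "g \<in> SUgrp \<Longrightarrow> p \<in> XX \<Longrightarrow> gp g p \<in> XX"
  by (simp add: DD_iff gp_def act_Dom SU_inv)

lemma KK_trans:
  assumes g: "g \<in> SUgrp" and p: "p \<in> XX" "p' \<in> XX"
  shows "KK p p' = mfac g p * KK (gp g p) (gp g p') * cnj (mfac g p')"
proof -
  have d: "fst p \<in> Dom" "snd p \<in> Dom" "fst p' \<in> Dom" "snd p' \<in> Dom" using p by (simp_all add: DD_iff)
  note h1 = hfun_act[OF SU_inv(2)[OF g] Dom_Cl[OF d(1)] Dom_Cl[OF d(3)] disjI1[OF d(1)]]
  note h2 = hfun_act[OF SU_inv(2)[OF g] Dom_Cl[OF d(4)] Dom_Cl[OF d(2)] disjI1[OF d(4)]]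
  show ?thesis unfolding tkernel_def h1 h2 mfac_def gp_def fst_conv snd_conv
    by (simp add: power_mult_distrib inverse_mult_distrib mult_ac del: power_Suc)
qed

text \<open>Evaluating the translate on a combination amounts to evaluating F on the transported
  combination, and covariance of the kernel keeps the quadratic form the same. Equality of norms
  follows later by applying the bound to the inverse.\<close>

lemma ta_H1:
  assumes g: "g \<in> SUgrp" and F: "F \<in> H"
  shows "ta g F \<in> H" "N (ta g F) \<le> N F"
proof -
  define T where "T ps = map (\<lambda>p. (fst p * cnj (mfac g (snd p)), gp g (snd p))) ps" for ps :: "(complex \<times> _) list"
  have pT: "pts XX (T ps)" if "pts XX ps" for ps
    using that gp_DD[OF g] unfolding pts_def T_def by force
  have eT: "ev (ta g F) ps = ev F (T ps)" if "pts XX ps" for ps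
    using that
  proof (induction ps)
    case (Cons p ps)
    then show ?case by (simp add: ev_Cons T_def ta_eq mult_ac)
  qed (simp add: T_def)
  have qT: "qf KK (T ps) (T ps) = qf KK ps ps" if ps: "pts XX ps" for ps
  proof -
    have x: "snd (ps ! i) \<in> XX" if "i < length ps" for i using ps that unfolding pts_def by (meson image_subset_iff nth_mem)
    have len: "length (T ps) = length ps" by (simp add: T_def)
    show ?thesis unfolding qf_sum len
    proof (intro sum.cong refl)
      fix i j assume ij: "i \<in> {..<length ps}" "j \<in> {..<length ps}"
      have "KK (snd (ps ! j)) (snd (ps ! i)) = mfac g (snd (ps ! j)) * KK (gp g (snd (ps ! j))) (gp g (snd (ps ! i))) * cnj (mfac g (snd (ps ! i)))"
        by (rule KK_trans[OF g]) (use ij x in auto)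
      then show "fst (T ps ! i) * cnj (fst (T ps ! j)) * KK (snd (T ps ! j)) (snd (T ps ! i))
          = fst (ps ! i) * cnj (fst (ps ! j)) * KK (snd (ps ! j)) (snd (ps ! i))"
        using ij by (simp add: T_def mult_ac)
    qed
  qed
  have b: "rkhs_bound XX KK (ta g F) (N F)"
    unfolding rkhs_bound_iff
  proof (intro allI impI)
    fix ps assume ps: "pts XX ps"
    show "(cmod (ev (ta g F) ps))\<^sup>2 \<le> N F * Re (qf KK ps ps)"
      using ev_bound[OF F pT[OF ps]] unfolding eT[OF ps] qT[OF ps] .
  qed
  show "ta g F \<in> H" by (rule HI[OF b]) (simp add: ta_eq)
  show "N (ta g F) \<le> N F" by (rule N_le[OF b])
qed

lemma inv_mult: "g \<in> SUgrp \<Longrightarrow> h \<in> SUgrp \<Longrightarrow> matrix_inv (g ** h) = matrix_inv h ** matrix_inv (g :: complex^('r + 'l)^('r + 'l))"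
proof (rule matrix_inv_eqI)
  assume g: "g \<in> SUgrp" and h: "h \<in> SUgrp"
  note gi = matrix_inv_works[OF SU_inv(1)[OF g]] and hi = matrix_inv_works[OF SU_inv(1)[OF h]]
  have "g ** h ** (matrix_inv h ** matrix_inv g) = g ** ((h ** matrix_inv h) ** matrix_inv g)" by (simp only: matrix_mul_assoc)
  then show "g ** h ** (matrix_inv h ** matrix_inv g) = mat 1" unfolding hi by (simp add: gi)
  have "matrix_inv h ** matrix_inv g ** (g ** h) = matrix_inv h ** ((matrix_inv g ** g) ** h)" by (simp only: matrix_mul_assoc)
  then show "matrix_inv h ** matrix_inv g ** (g ** h) = mat 1" unfolding gi by (simp add: hi)
qed

lemma inv_inv: "g \<in> SUgrp \<Longrightarrow> matrix_inv (matrix_inv g) = (g :: complex^('r + 'l)^('r + 'l))"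
  using matrix_inv_works[OF SU_inv(1)] by (intro matrix_inv_eqI)

lemma ta_comp:
  assumes g: "g \<in> SUgrp" and h: "h \<in> SUgrp"
  shows "ta g (ta h F) = ta (g ** h) F"
proof
  fix p
  show "ta g (ta h F) p = ta (g ** h) F p"
  proof (cases "p \<in> XX")
    case True
    have c: "fst p \<in> Cl" "snd p \<in> Cl" using True by (auto simp: DD_iff intro: Dom_Cl)
    note gi = SU_inv(2)[OF g] and hi = SU_inv(2)[OF h]
    have "gp h (gp g p) = gp (g ** h) p"
      unfolding gp_def inv_mult[OF g h] den_mult(2)[OF gi c(1) hi] den_mult(2)[OF gi c(2) hi] by simp
    moreover have "mfac g p * mfac h (gp g p) = mfac (g ** h) p"
      unfolding mfac_def gp_def inv_mult[OF g h] jfac_mult[OF gi c(1) hi] jfac_mult[OF gi c(2) hi] fst_conv snd_conv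
      by (simp add: power_mult_distrib inverse_mult_distrib mult_ac del: power_Suc)
    ultimately show ?thesis using True gp_DD[OF g True] by (simp add: ta_eq mult.assoc[symmetric])
  qed (simp add: ta_eq)
qed

lemma inv_1: "matrix_inv (mat 1) = (mat 1 :: complex^('r + 'l)^('r + 'l))"
  by (rule matrix_inv_eqI) simp_all

lemma ta_1: assumes "\<And>p. p \<notin> XX \<Longrightarrow> F p = 0" shows "ta (mat 1) F = F"
  by (rule ext) (simp add: ta_eq mfac_def gp_def inv_1 assms)

lemma ta_inv: assumes "g \<in> SUgrp" "F \<in> H" shows "ta (matrix_inv g) (ta g F) = F" "ta g (ta (matrix_inv g) F) = F"
  using ta_comp[OF SU_inv(2)[OF assms(1)] assms(1)] ta_comp[OF assms(1) SU_inv(2)[OF assms(1)]]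
    matrix_inv_works[OF SU_inv(1)[OF assms(1)]] ta_1[OF H_off[OF assms(2)]] by simp_all

lemma ta_N: assumes "g \<in> SUgrp" "F \<in> H" shows "N (ta g F) = N F"
  using ta_H1(2)[OF assms] ta_H1(2)[OF SU_inv(2)[OF assms(1)] ta_H1(1)[OF assms]] ta_inv(1)[OF assms] by simp

lemma ta_lin: "ta g (\<lambda>x. F x + a * G x) = (\<lambda>x. ta g F x + a * ta g G x)"
  by (rule ext) (simp add: ta_eq algebra_simps)

lemma ta_scale: "ta g (\<lambda>x. a * G x) = (\<lambda>x. a * ta g G x)"
  by (rule ext) (simp add: ta_eq algebra_simps)

lemma ta_ip: assumes g: "g \<in> SUgrp" and F: "F \<in> H" and G: "G \<in> H" shows "ip (ta g F) (ta g G) = ip F G"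
proof -
  have n: "N (\<lambda>x. ta g F x + a * ta g G x) = N (\<lambda>x. F x + a * G x)" for a
    unfolding ta_lin[symmetric] by (rule ta_N[OF g H_add(1)[OF F H_scale(1)[OF G]]])
  show ?thesis unfolding ip_expand using n[of 1] n[of "\<i>"] n[of "-1"] n[of "-\<i>"] by simp
qed

lemma ta_ip_adj: assumes g: "g \<in> SUgrp" and F: "F \<in> H" and G: "G \<in> H" shows "ip (ta g F) G = ip F (ta (matrix_inv g) G)"
  using ta_ip[OF SU_inv(2)[OF g] ta_H1(1)[OF g F] G] unfolding ta_inv(1)[OF g F] by simp

text \<open>The second argument (v, v) lies outside \<open>XX\<close>; here the kernel is used
  through its formula, whose denominators do not vanish as long as one of the two arguments is
  interior.\<close>

definition xi :: "(complex^'l^'r) \<times> (complex^'l^'r) \<Rightarrow> complex" where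
  "xi p = (if p \<in> XX then SI (\<lambda>v. KK p (v, v)) else 0)"

lemma ta_1_xi: "ta (mat 1) xi = xi" by (rule ta_1) (simp add: xi_def)

text \<open>The transformation law of h remains valid with one argument on the boundary. The
  automorphy factors of the inverse at \<open>act g v\<close> are the reciprocals of those of g at
  v, and together they form the weight \<open>ag g v\<close>.\<close>

lemma ta_xi: assumes g: "g \<in> SUgrp" and p: "p \<in> XX"
  shows "ta g xi p = SI (\<lambda>v. of_real (ag g v) * KK p (act g v, act g v))"
proof -
  have d: "fst p \<in> Dom" "snd p \<in> Dom" using p by (simp_all add: DD_iff)
  have "ta g xi p = SI (\<lambda>v. mfac g p * KK (gp g p) (v, v))"
    using p gp_DD[OF g p] by (simp add: ta_eq xi_def SI_mult)
  also have "\<dots> = SI (\<lambda>v. of_real (ag g v) * KK p (act g v, act g v))"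
  proof (rule SI_cong)
    fix v :: "complex^'l^'r" assume "v \<in> Shilov"
    then have v: "v \<in> Cl" by (rule Shilov_Cl)
    let ?gi = "matrix_inv g"
    define u where "u = jfac ?gi (act g v)"
    have u: "u * jfac g v = 1" unfolding u_def by (rule act_inv(3)[OF g v])
    then have u0: "u \<noteq> 0" by auto
    have "cmod u = inverse (cmod (jfac g v))"
      using arg_cong[OF u, of cmod] by (intro inverse_unique[symmetric]) (simp add: norm_mult mult.commute)
    then have a: "of_real (ag g v) = u ^ \<nu> * cnj u ^ \<nu>"
      unfolding ag_def of_real_cmod_power[symmetric] by simp
    note gv = act_Cl[OF g v]
    have h1: "hfun (fst p) (act g v) = hfun (act ?gi (fst p)) v * jfac ?gi (fst p) * cnj u"
      using hfun_act[OF SU_inv(2)[OF g] Dom_Cl[OF d(1)] gv disjI1[OF d(1)]] unfolding act_inv(1)[OF g v] u_def .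
    have h2: "hfun (act g v) (snd p) = hfun v (act ?gi (snd p)) * u * cnj (jfac ?gi (snd p))"
      using hfun_act[OF SU_inv(2)[OF g] gv Dom_Cl[OF d(2)] disjI2[OF d(2)]] unfolding act_inv(1)[OF g v] u_def .
    have un: "u ^ \<nu> * inverse (u ^ \<nu>) = 1" "cnj u ^ \<nu> * inverse (cnj u ^ \<nu>) = 1"
      using u0 by (simp_all del: power_Suc)
    have "of_real (ag g v) * KK p (act g v, act g v) = (u ^ \<nu> * inverse (u ^ \<nu>)) * (cnj u ^ \<nu> * inverse (cnj u ^ \<nu>)) *
       (mfac g p * KK (gp g p) (v, v))"
      unfolding a tkernel_def fst_conv snd_conv h1 h2 mfac_def gp_def
      by (simp add: power_mult_distrib inverse_mult_distrib mult_ac del: power_Suc)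
    then show "mfac g p * KK (gp g p) (v, v) = of_real (ag g v) * KK p (act g v, act g v)"
      unfolding un by simp
  qed
  finally show ?thesis .
qed

section \<open>Dilations, the norm estimate and the passage to the boundary\<close>

lemma dl_DD: "p \<in> XX \<Longrightarrow> 0 \<le> t \<Longrightarrow> t \<le> 1 \<Longrightarrow> dl t p \<in> XX"
  by (simp add: DD_iff dl_def scale_Dom1)

lemma KK_dl: "KK p (bp t v) = KK (dl t p) (v, v)"
  unfolding tkernel_def bp_def dl_def fst_conv snd_conv hfun_scale[of "fst p"] hfun_scale[of v t "snd p", symmetric] ..

text \<open>A real dilation moves from one argument of h to the other, so shrinking the boundary
  points is the same as shrinking the argument of the translate.\<close>

lemma eta_dl: assumes g: "g \<in> SUgrp" and p: "p \<in> XX" and t: "0 \<le> t" "t \<le> 1"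
  shows "eta g t p = ta g xi (dl t p)"
  unfolding ta_xi[OF g dl_DD[OF p t]] eta_def KK_dl using p by simp

text \<open>Dilating a function is dual to dilating the points of a combination, and by
  \<open>tkernel_dl\<close> the latter does not increase the quadratic form.\<close>

lemma dil_H:
  assumes F: "F \<in> H" and t: "0 \<le> t" "t \<le> 1" and G: "\<And>p. p \<in> XX \<Longrightarrow> G p = F (dl t p)" "\<And>p. p \<notin> XX \<Longrightarrow> G p = 0"
  shows "N G \<le> N F"
proof -
  define T where "T ps = map (\<lambda>p. (fst p, dl t (snd p))) ps" for ps :: "(complex \<times> _) list"
  have pT: "pts XX (T ps)" if "pts XX ps" for ps
    using that dl_DD[OF _ t] unfolding pts_def T_def by force
  have eT: "ev G ps = ev F (T ps)" if "pts XX ps" for ps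
    using that by (induction ps) (simp_all add: T_def ev_Cons G(1))
  have qT: "Re (qf KK (T ps) (T ps)) \<le> Re (qf KK ps ps)" if ps: "pts XX ps" for ps
  proof -
    have "0 \<le> Re (qf (\<lambda>p p'. KK p p' - KK (dl t p) (dl t p')) ps ps)"
      by (rule pd_kernel_nonneg[OF tkernel_dl[OF t] ps])
    moreover have "qf (\<lambda>p p'. KK p p' - KK (dl t p) (dl t p')) ps ps = qf KK ps ps - qf KK (T ps) (T ps)"
      unfolding qf_sum by (simp add: T_def sum_subtractf right_diff_distrib)
    ultimately show ?thesis by simp
  qed
  have "rkhs_bound XX KK G (N F)"
    unfolding rkhs_bound_iff
  proof (intro allI impI)
    fix ps assume ps: "pts XX ps"
    have "(cmod (ev G ps))\<^sup>2 \<le> N F * Re (qf KK (T ps) (T ps))" unfolding eT[OF ps] by (rule ev_bound[OF F pT[OF ps]])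
    also have "\<dots> \<le> N F * Re (qf KK ps ps)" by (intro mult_left_mono qT ps N_nonneg F)
    finally show "(cmod (ev G ps))\<^sup>2 \<le> N F * Re (qf KK ps ps)" .
  qed
  then show ?thesis by (rule N_le)
qed

definition tn :: "nat \<Rightarrow> real" where "tn n = 1 - 1 / real (n + 2)"

lemma tn_bounds: "0 < tn n" "tn n < 1" by (simp_all add: tn_def)

lemma tn_bounds_le: "0 \<le> tn n" "tn n \<le> 1" using tn_bounds[of n] by simp_all

lemma tn_lim: "tn \<longlonglongrightarrow> 1"
  unfolding tn_def by real_asymp

lemma ag_1: "ag (mat 1) v = 1"
  by (simp add: ag_def)

text \<open>The representing property applied to the vector itself makes its squared norm a double
  integral of |h|^(-2\<nu>) over the boundary. Both points are dilated by t, whence t^2. By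
  transitivity the inner integral does not depend on the outer point, so it may be taken at the base
  point where the determinant estimate holds.\<close>

lemma eta_norm_bound: "\<exists>C. \<forall>n. N (eta (mat 1) (tn n)) \<le> C"
proof -
  obtain u0 :: "complex^'l^'r" and C where u0: "u0 \<in> Shilov"
    and C: "\<And>t. 0 < t \<Longrightarrow> t < 1 \<Longrightarrow> (\<integral>v. inverse (cmod (hfun (t *\<^sub>R v) u0)) ^ (2 * \<nu>) \<partial>\<mu>) \<le> C"
    using shilov_bound[OF dims] by blast
  have "N (eta (mat 1) t) \<le> C" if t: "0 < t" "t < 1" for t
  proof -
    have t0: "0 \<le> t" using t by simp
    have t2: "0 < t\<^sup>2" "t\<^sup>2 < 1" using t by (simp_all add: power2_eq_square) (metis mult_strict_mono' mult_1 less_imp_le)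
    define J where "J = (\<integral>v. inverse (cmod (hfun (t\<^sup>2 *\<^sub>R v) u0)) ^ (2 * \<nu>) \<partial>\<mu>)"
    have meas: "(\<lambda>v. inverse (cmod (hfun (t\<^sup>2 *\<^sub>R v) w)) ^ (2 * \<nu>)) \<in> borel_measurable borel" for w :: "complex^'l^'r"
    proof -
      have "(\<lambda>v. hfun (t\<^sup>2 *\<^sub>R v) w) \<in> borel_measurable borel" by (intro borel_measurable_continuous_onI continuous_intros)
      then show ?thesis by measurable
    qed
    have inner: "eta (mat 1) t (bp t v) = of_real J" if v: "v \<in> Shilov" for v
    proof -
      have vC: "v \<in> Cl" by (rule Shilov_Cl[OF v])
      have "eta (mat 1) t (bp t v) = SI (\<lambda>u. of_real (inverse (cmod (hfun (t\<^sup>2 *\<^sub>R u) v)) ^ (2 * \<nu>)))"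
        using bp_DD[OF vC t0 t(2)] unfolding eta_def
      proof (simp only: if_True, intro SI_cong)
        fix u :: "complex^'l^'r" assume "u \<in> Shilov"
        have 1: "hfun (t *\<^sub>R u) (t *\<^sub>R v) = hfun (t\<^sup>2 *\<^sub>R u) v"
          unfolding hfun_scale by (simp add: power2_eq_square)
        have 2: "hfun (t *\<^sub>R v) (t *\<^sub>R u) = cnj (hfun (t\<^sup>2 *\<^sub>R u) v)"
          unfolding 1[symmetric] by (rule hfun_cnj)
        show "of_real (ag (mat 1) u) * KK (bp t v) (bp t (act (mat 1) u)) = of_real (inverse (cmod (hfun (t\<^sup>2 *\<^sub>R u) v)) ^ (2 * \<nu>))"
          unfolding ag_1 act_1 tkernel_def bp_def fst_conv snd_conv 1 2 power_inverse of_real_inverse of_real_cmod_power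
          by (simp add: inverse_mult_distrib mult.commute del: power_Suc)
      qed
      also have "\<dots> = (\<integral>u. of_real (inverse (cmod (hfun (t\<^sup>2 *\<^sub>R u) v)) ^ (2 * \<nu>)) \<partial>\<mu>)"
      proof (rule SI_eq)
        have "hfun (t\<^sup>2 *\<^sub>R u) v \<noteq> 0" if "u \<in> Shilov" for u
          using scale_Dom[OF Shilov_Cl[OF that], of "t\<^sup>2"] t2 vC by (intro hfun_nz) (auto intro: Dom_Cl)
        then show "continuous_on Shilov (\<lambda>u. of_real (inverse (cmod (hfun (t\<^sup>2 *\<^sub>R u) v)) ^ (2 * \<nu>)) :: complex)"
          by (intro continuous_intros) simp_all
        show "(\<lambda>u. of_real (inverse (cmod (hfun (t\<^sup>2 *\<^sub>R u) v)) ^ (2 * \<nu>)) :: complex) \<in> borel_measurable borel"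
          using meas[of v] by measurable
      qed
      also have "\<dots> = of_real (\<integral>u. inverse (cmod (hfun (t\<^sup>2 *\<^sub>R u) v)) ^ (2 * \<nu>) \<partial>\<mu>)" by (rule integral_complex_of_real)
      also have "(\<integral>u. inverse (cmod (hfun (t\<^sup>2 *\<^sub>R u) v)) ^ (2 * \<nu>) \<partial>\<mu>) = J"
      proof -
        obtain U :: "complex^'l^'l" where U: "ctrans U ** U = mat 1" "v = u0 ** U" using Shilov_transitive[OF u0 v] by blast
        have U': "ctrans (ctrans U) ** ctrans U = mat 1"
          unfolding ctrans_ctrans by (rule matrix_left_right_inverse[THEN iffD1, OF U(1)])
        have e: "hfun (t\<^sup>2 *\<^sub>R u) v = hfun (t\<^sup>2 *\<^sub>R (u ** ctrans U)) u0" for u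
          unfolding U(2) hfun_right by (simp add: mat_real[symmetric] matrix_mul_assoc)
        show ?thesis unfolding e J_def
          by (rule unitary_integral[OF U' meas, of u0])
      qed
      finally show ?thesis .
    qed
    have eH: "eta (mat 1) t \<in> H" by (rule eta_H(1)[OF SU_1 t0 t(2)])
    have "of_real (N (eta (mat 1) t)) = ip (eta (mat 1) t) (eta (mat 1) t)" by (rule ip_self[OF eH, symmetric])
    also have "\<dots> = SI (\<lambda>v. of_real (ag (mat 1) v) * eta (mat 1) t (bp t (act (mat 1) v)))" by (rule eta_H(2)[OF SU_1 t0 t(2) eH])
    also have "\<dots> = SI (\<lambda>v. of_real J)" by (rule SI_cong) (simp add: ag_1 inner)
    also have "\<dots> = of_real J" by (rule SI_const)
    finally have "N (eta (mat 1) t) = J" by (simp only: of_real_eq_iff)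
    then show ?thesis using C[OF t2] by (simp add: J_def)
  qed
  then show ?thesis using tn_bounds by blast
qed

lemma hfun_Dom_nz:
  fixes z v :: "complex^'l^'r"
  assumes "z \<in> Dom" "v \<in> Cl"
  shows "hfun z v \<noteq> 0" "hfun v z \<noteq> 0"
  by (rule hfun_nz[OF Dom_Cl[OF assms(1)] assms(2) disjI1[OF assms(1)]])
    (rule hfun_nz[OF assms(2) Dom_Cl[OF assms(1)] disjI2[OF assms(1)]])

text \<open>The regularizations at g = 1 have bounded norms and converge pointwise to xi, so
  \<open>limit_bound\<close> places the limit in the space.\<close>

lemma xi_H: "xi \<in> H"
proof -
  obtain C where C: "\<And>n. N (eta (mat 1) (tn n)) \<le> C" using eta_norm_bound by blast
  have e: "eta (mat 1) (tn n) \<in> H" for n by (rule eta_H(1)[OF SU_1 tn_bounds_le(1) tn_bounds(2)])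
  have lim: "(\<lambda>n. eta (mat 1) (tn n) p) \<longlonglongrightarrow> xi p" if p: "p \<in> XX" for p
  proof -
    have d: "fst p \<in> Dom" "snd p \<in> Dom" using p by (simp_all add: DD_iff)
    \<comment> \<open>Regarding t as a variable on the closed interval makes the integrand
      continuous on a compact product; this gives one bound for all n, as dominated convergence
      requires.\<close>
    define f where "f x = KK p (bp (fst x) (snd x))" for x :: "real \<times> (complex^'l^'r)"
    have tv: "t *\<^sub>R v \<in> Cl" if "0 \<le> t" "t \<le> 1" "v \<in> Shilov" for t and v :: "complex^'l^'r"
      using scale_Dom[OF Shilov_Cl[OF that(3)] that(1)] that Shilov_Cl[OF that(3)] Dom_Cl by (cases "t = 1") auto
    have cf: "continuous_on ({0..1} \<times> Shilov) f"
      unfolding f_def tkernel_def bp_def fst_conv snd_conv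
    proof (intro continuous_intros)
      show "\<forall>x\<in>{0..1} \<times> Shilov. hfun (fst p) (fst x *\<^sub>R snd x) ^ \<nu> \<noteq> 0"
        using hfun_Dom_nz(1)[OF d(1) tv] by auto
      show "\<forall>x\<in>{0..1} \<times> Shilov. hfun (fst x *\<^sub>R snd x) (snd p) ^ \<nu> \<noteq> 0"
        using hfun_Dom_nz(2)[OF d(2) tv] by auto
    qed
    have "bounded (f ` ({0..1} \<times> Shilov))"
      by (intro compact_imp_bounded compact_continuous_image cf compact_Times compact_Icc compact_Shilov)
    then obtain B where B: "\<And>x. x \<in> {0..1} \<times> Shilov \<Longrightarrow> norm (f x) \<le> B" unfolding bounded_pos by blast
    have cs: "continuous_on Shilov (\<lambda>v. f (t, v))" if "0 \<le> t" "t \<le> 1" for t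
      by (rule continuous_on_compose2[OF cf]) (use that in \<open>auto intro!: continuous_intros\<close>)
    have "(\<lambda>n. SI (\<lambda>v. f (tn n, v))) \<longlonglongrightarrow> SI (\<lambda>v. f (1, v))"
    proof (rule SI_tendsto[where B = B])
      show "continuous_on Shilov (\<lambda>v. f (tn n, v))" for n by (rule cs[OF tn_bounds_le])
      show "continuous_on Shilov (\<lambda>v. f (1, v))" by (rule cs) simp_all
      show "cmod (f (tn n, v)) \<le> B" if "v \<in> Shilov" for n v using B[of "(tn n, v)"] tn_bounds_le[of n] that by simp
      show "(\<lambda>n. f (tn n, v)) \<longlonglongrightarrow> f (1, v)" if "v \<in> Shilov" for v
      proof (rule continuous_on_tendsto_compose[OF cf])
        show "(\<lambda>n. (tn n, v)) \<longlonglongrightarrow> (1, v)" by (intro tendsto_intros tn_lim)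
      qed (use that tn_bounds_le in auto)
    qed
    moreover have "SI (\<lambda>v. f (tn n, v)) = eta (mat 1) (tn n) p" for n using p by (simp add: eta_def f_def ag_1)
    moreover have "SI (\<lambda>v. f (1, v)) = xi p" using p by (simp add: xi_def f_def bp_def)
    ultimately show ?thesis by simp
  qed
  show ?thesis by (rule limit_bound(1)[OF e C lim]) (simp_all add: xi_def)
qed

text \<open>Now that the translate of xi is known to lie in the space, its dilates have no larger
  norm by \<open>dil_H\<close>. They converge pointwise by continuity of the translate, hence
  weakly.\<close>

lemma eta_weak:
  assumes g: "g \<in> SUgrp" and F: "F \<in> H"
  shows "(\<lambda>n. ip F (eta g (tn n))) \<longlonglongrightarrow> ip F (ta g xi)"
proof -
  have P: "ta g xi \<in> H" by (rule ta_H1(1)[OF g xi_H])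
  have e: "eta g (tn n) \<in> H" for n by (rule eta_H(1)[OF g tn_bounds_le(1) tn_bounds(2)])
  have b: "N (eta g (tn n)) \<le> N (ta g xi)" for n
    by (rule dil_H[OF P tn_bounds_le(1)[of n] tn_bounds_le(2)[of n]], rule eta_dl[OF g _ tn_bounds_le]) (simp_all add: eta_def)
  have lim: "(\<lambda>n. eta g (tn n) p) \<longlonglongrightarrow> ta g xi p" if p: "p \<in> XX" for p
  proof -
    have "(\<lambda>n. dl (tn n) p) \<longlonglongrightarrow> (1 *\<^sub>R fst p, 1 *\<^sub>R snd p)"
      unfolding dl_def by (intro tendsto_intros tn_lim)
    then have "(\<lambda>n. dl (tn n) p) \<longlonglongrightarrow> p" by simp
    from continuous_on_tendsto_compose[OF H_cont[OF P] this p]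
    have "(\<lambda>n. ta g xi (dl (tn n) p)) \<longlonglongrightarrow> ta g xi p" using dl_DD[OF p tn_bounds_le] by simp
    then show ?thesis unfolding eta_dl[OF g p tn_bounds_le] .
  qed
  have "(\<lambda>n. ip (eta g (tn n)) F) \<longlonglongrightarrow> ip (ta g xi) F"
    by (rule weak_limit[OF e b lim _ F]) (simp_all add: ta_eq)
  then have "(\<lambda>n. cnj (ip (eta g (tn n)) F)) \<longlonglongrightarrow> cnj (ip (ta g xi) F)" by (rule tendsto_cnj)
  then show ?thesis unfolding ip_cnj[OF e F, symmetric] ip_cnj[OF P F, symmetric] .
qed

section \<open>Vectors fixed by K and the spherical function\<close>

lemma Kgrp_SU: "k \<in> Kgrp \<Longrightarrow> k \<in> SUgrp" by (simp add: Kgrp_def)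

text \<open>Two boundary points are related by a right unitary factor, which comes from an element
  of K and commutes with the dilation. At a pair with equal entries the multiplier is a power of the
  modulus of the automorphy factor, which is 1 on K.\<close>

lemma Kfix_const:
  assumes fx: "\<And>k. k \<in> (Kgrp :: (complex^('r + 'l)^('r + 'l)) set) \<Longrightarrow> ta k F = F"
    and vw: "v \<in> Shilov" "w \<in> Shilov" and t: "0 \<le> t" "t < 1"
  shows "F (bp t w) = F (bp t v)"
proof -
  obtain U :: "complex^'l^'l" where U: "ctrans U ** U = mat 1" "w = v ** U" using Shilov_transitive[OF vw] by blast
  obtain k where k: "k \<in> (Kgrp :: (complex^('r + 'l)^('r + 'l)) set)" "\<And>z :: complex^'l^'r. act k z = z ** U" "\<And>z :: complex^'l^'r. cmod (jfac k z) = 1"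
    using K_right_unitary[OF U(1)] by blast
  note kS = Kgrp_SU[OF k(1)]
  define z where "z = t *\<^sub>R v"
  have zC: "z \<in> Cl" unfolding z_def by (rule Dom_Cl[OF scale_Dom[OF Shilov_Cl[OF vw(1)] t]])
  have az: "act k z = t *\<^sub>R w" unfolding k(2) U(2) z_def by (simp add: mat_real[symmetric] matrix_mul_assoc)
  have p: "bp t w \<in> XX" by (rule bp_DD[OF Shilov_Cl[OF vw(2)] t])
  have "jfac (matrix_inv k) (act k z) * jfac k z = 1" by (rule act_inv(3)[OF kS zC])
  from arg_cong[OF this, of cmod] have j: "cmod (jfac (matrix_inv k) (act k z)) = 1" by (simp add: norm_mult k(3))
  define u where "u = jfac (matrix_inv k) (t *\<^sub>R w) ^ \<nu>"
  have "cmod u = 1" using j by (simp add: u_def az norm_power del: power_Suc)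
  then have uu: "inverse u * cnj (inverse u) = 1"
    unfolding complex_norm_square[symmetric] by (simp add: norm_inverse)
  have "F (bp t w) = ta k F (bp t w)" by (simp add: fx[OF k(1)])
  also have "\<dots> = mfac k (bp t w) * F (gp k (bp t w))" using p by (simp add: ta_eq)
  also have "gp k (bp t w) = bp t v"
    unfolding gp_def bp_def fst_conv snd_conv az[symmetric] act_inv(1)[OF kS zC] unfolding z_def ..
  also have "mfac k (bp t w) = inverse u * cnj (inverse u)" by (simp add: mfac_def bp_def u_def del: power_Suc)
  finally show ?thesis unfolding uu by simp
qed

lemma ex_Shilov: "\<exists>u. u \<in> (Shilov :: (complex^'l^'r) set)"
  using shilov_bound[OF dims] by blast

text \<open>At each stage of the dilation the pairing is the common value of F at the dilated
  boundary pairs times the mean of \<open>ag g\<close>. The case g = 1 identifies the limit of these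
  values as the inner product with xi.\<close>

lemma Kfix_ip:
  assumes F: "F \<in> H" and fx: "\<And>k. k \<in> (Kgrp :: (complex^('r + 'l)^('r + 'l)) set) \<Longrightarrow> ta k F = F" and g: "g \<in> SUgrp"
  shows "ip F (ta g xi) = ip F xi * SI (\<lambda>v. of_real (ag g v))"
proof -
  obtain u :: "complex^'l^'r" where u: "u \<in> Shilov" using ex_Shilov by blast
  have *: "ip F (eta h (tn n)) = F (bp (tn n) u) * SI (\<lambda>v. of_real (ag h v))" if h: "h \<in> SUgrp" for h n
  proof -
    have "ip F (eta h (tn n)) = SI (\<lambda>v. of_real (ag h v) * F (bp (tn n) (act h v)))" by (rule eta_H(2)[OF h tn_bounds_le(1) tn_bounds(2) F])
    also have "\<dots> = SI (\<lambda>v. F (bp (tn n) u) * of_real (ag h v))"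
    proof (rule SI_cong)
      fix v :: "complex^'l^'r" assume "v \<in> Shilov"
      from Kfix_const[OF fx u act_Shilov[OF h this] tn_bounds_le(1) tn_bounds(2)]
      show "of_real (ag h v) * F (bp (tn n) (act h v)) = F (bp (tn n) u) * of_real (ag h v)" by simp
    qed
    finally show ?thesis unfolding SI_mult .
  qed
  have one: "SI (\<lambda>v. of_real (ag (mat 1) v)) = 1" unfolding ag_1 using SI_const[of 1] by simp
  have "(\<lambda>n. F (bp (tn n) u)) \<longlonglongrightarrow> ip F xi"
    using eta_weak[OF SU_1 F] unfolding *[OF SU_1] one ta_1_xi by simp
  then have "(\<lambda>n. F (bp (tn n) u) * SI (\<lambda>v. of_real (ag g v))) \<longlonglongrightarrow> ip F xi * SI (\<lambda>v. of_real (ag g v))"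
    by (rule tendsto_mult_right)
  moreover have "(\<lambda>n. F (bp (tn n) u) * SI (\<lambda>v. of_real (ag g v))) \<longlonglongrightarrow> ip F (ta g xi)"
    using eta_weak[OF g F] unfolding *[OF g] .
  ultimately show ?thesis by (metis LIMSEQ_unique)
qed

text \<open>For k in K the denominator does not depend on the point, and k fixes the origin; the
  transformation law of h at the origin, where h is 1, gives modulus 1.\<close>

lemma K_jfac: assumes k: "k \<in> (Kgrp :: (complex^('r + 'l)^('r + 'l)) set)" shows "cmod (jfac k (v :: complex^'l^'r)) = 1"
proof -
  have b: "bblk k = 0" "cblk k = 0" using k by (simp_all add: Kgrp_def)
  have z: "ablk k ** (0 :: complex^'l^'r) = 0" by (simp add: vec_eq_iff matrix_matrix_mult_def)
  have a0: "act k (0 :: complex^'l^'r) = 0" unfolding act_def b z by simp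
  have c: "(0 :: complex^'l^'r) \<in> Dom" by (rule zero_Dom)
  have "hfun (0 :: complex^'l^'r) 0 = hfun (act k 0) (act k (0 :: complex^'l^'r)) * jfac k (0 :: complex^'l^'r) * cnj (jfac k (0 :: complex^'l^'r))"
    by (rule hfun_act[OF Kgrp_SU[OF k] Dom_Cl[OF c] Dom_Cl[OF c] disjI1[OF c]])
  then have "jfac k (0 :: complex^'l^'r) * cnj (jfac k (0 :: complex^'l^'r)) = 1" unfolding a0 by simp
  then have "(cmod (jfac k (0 :: complex^'l^'r)))\<^sup>2 = 1" unfolding complex_norm_square[symmetric] by (metis of_real_1 of_real_eq_iff)
  then have "cmod (jfac k (0 :: complex^'l^'r)) = 1" using abs_square_eq_1[of "cmod (jfac k (0 :: complex^'l^'r))"] by simp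
  moreover have "jfac k v = jfac k (0 :: complex^'l^'r)" unfolding jfac_def b by simp
  ultimately show ?thesis by simp
qed

lemma xi_Kfix: assumes k: "k \<in> (Kgrp :: (complex^('r + 'l)^('r + 'l)) set)" shows "ta k xi = xi"
proof
  fix p
  show "ta k xi p = xi p"
  proof (cases "p \<in> XX")
    case True
    have d: "fst p \<in> Dom" "snd p \<in> Dom" using True by (simp_all add: DD_iff)
    define f where "f v = KK p (v, v)" for v
    have b: "bblk k = 0" "cblk k = 0" using k by (simp_all add: Kgrp_def)
    have ak: "act k z = ablk k ** z ** matrix_inv (dblk k)" for z :: "complex^'l^'r" unfolding act_def b by simp
    have akc: "continuous_on S (act k)" for S :: "(complex^'l^'r) set"
      unfolding ak[abs_def] by (intro continuous_intros)
    have cf: "continuous_on Shilov f" unfolding f_def tkernel_def fst_conv snd_conv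
    proof (intro continuous_intros)
      show "\<forall>v\<in>Shilov. hfun (fst p) v ^ \<nu> \<noteq> 0" using hfun_Dom_nz(1)[OF d(1) Shilov_Cl] by simp
      show "\<forall>v\<in>Shilov. hfun v (snd p) ^ \<nu> \<noteq> 0" using hfun_Dom_nz(2)[OF d(2) Shilov_Cl] by simp
    qed
    have mf: "f \<in> borel_measurable borel"
    proof -
      have "(\<lambda>v. hfun (fst p) v) \<in> borel_measurable borel" "(\<lambda>v. hfun v (snd p)) \<in> borel_measurable borel"
        by (intro borel_measurable_continuous_onI continuous_intros)+
      then show ?thesis unfolding f_def tkernel_def fst_conv snd_conv by measurable
    qed
    have ma: "act k \<in> borel_measurable (borel :: (complex^'l^'r) measure)" by (rule borel_measurable_continuous_onI[OF akc])
    have cfa: "continuous_on Shilov (\<lambda>v. f (act k v))"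
      by (rule continuous_on_compose2[OF cf akc]) (use act_Shilov[OF Kgrp_SU[OF k]] in auto)
    have "ta k xi p = SI (\<lambda>v. of_real (ag k v) * KK p (act k v, act k v))" by (rule ta_xi[OF Kgrp_SU[OF k] True])
    also have "\<dots> = SI (\<lambda>v. f (act k v))" by (simp add: ag_def K_jfac[OF k] f_def)
    also have "\<dots> = (\<integral>v. f (act k v) \<partial>\<mu>)" by (rule SI_eq[OF cfa measurable_compose[OF ma mf]])
    also have "\<dots> = (\<integral>v. f v \<partial>distr \<mu> borel (act k))" by (rule integral_distr[OF mu_cong[OF ma] mf, symmetric])
    also have "distr \<mu> borel (act k) = \<mu>" using sm k unfolding shilov_measure_def by blast
    also have "(\<integral>v. f v \<partial>\<mu>) = SI f" by (rule SI_eq[OF cf mf, symmetric])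
    also have "\<dots> = xi p" unfolding xi_def f_def using True by simp
    finally show ?thesis .
  qed (simp add: ta_eq xi_def)
qed

lemma xi_pos: "0 < N xi"
proof -
  have p: "(0 :: complex^'l^'r, 0 :: complex^'l^'r) \<in> XX" by (simp add: DD_iff zero_Dom)
  have k: "KK (0, 0) (v, v) = 1" for v :: "complex^'l^'r"
    unfolding tkernel_def fst_conv snd_conv hfun_cnj[of v 0] by simp
  have "xi (0, 0) = SI (\<lambda>v. 1)" unfolding xi_def k using p by simp
  then have "xi (0, 0) = 1" using SI_const[of 1] by simp
  then have "N xi \<noteq> 0" using N_eq0[OF xi_H] by auto
  then show ?thesis using N_nonneg[OF xi_H] by simp
qed

text \<open>The inverse of g carries z = \<open>act g 0\<close> back to the origin, where h is 1.
  The transformation law thus turns the Poisson-type quotient into a squared modulus of the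
  automorphy factor at v; the factors at z cancel.\<close>

lemma sph_SI: assumes g: "g \<in> SUgrp" shows "sph \<mu> \<nu> (act g 0) = SI (\<lambda>v. of_real (ag (matrix_inv g) v))"
proof -
  have c0: "(0 :: complex^'l^'r) \<in> Dom" by (rule zero_Dom)
  define z where "z = act g (0 :: complex^'l^'r)"
  have zD: "z \<in> Dom" unfolding z_def by (rule act_Dom[OF g c0])
  note gi = SU_inv(2)[OF g]
  have az: "act (matrix_inv g) z = 0" unfolding z_def by (rule act_inv(1)[OF g Dom_Cl[OF c0]])
  define f where "f v = (hfun z z / (hfun z v * hfun v z)) ^ \<nu>" for v
  have cf: "continuous_on Shilov f" unfolding f_def
  proof (intro continuous_intros)
    show "\<forall>v\<in>Shilov. hfun z v * hfun v z \<noteq> 0" using hfun_Dom_nz[OF zD Shilov_Cl] by simp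
  qed
  have mf: "f \<in> borel_measurable borel"
  proof -
    have "(\<lambda>v. hfun z v) \<in> borel_measurable borel" "(\<lambda>v. hfun v z) \<in> borel_measurable borel"
      by (intro borel_measurable_continuous_onI continuous_intros)+
    then show ?thesis unfolding f_def by measurable
  qed
  have "sph \<mu> \<nu> z = SI f" unfolding sph_def f_def[symmetric] by (rule SI_eq[OF cf mf, symmetric])
  also have "\<dots> = SI (\<lambda>v. of_real (ag (matrix_inv g) v))"
  proof (rule SI_cong)
    fix v :: "complex^'l^'r" assume "v \<in> Shilov"
    then have v: "v \<in> Cl" by (rule Shilov_Cl)
    define a where "a = jfac (matrix_inv g) z"
    define b where "b = jfac (matrix_inv g) v"
    have a0: "a \<noteq> 0" "b \<noteq> 0" unfolding a_def b_def by (intro jfac_nz gi Dom_Cl[OF zD] v)+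
    have 1: "hfun z z = a * cnj a" using hfun_act[OF gi Dom_Cl[OF zD] Dom_Cl[OF zD] disjI1[OF zD]] unfolding az by (simp add: a_def)
    have 2: "hfun z v = a * cnj b" using hfun_act[OF gi Dom_Cl[OF zD] v disjI1[OF zD]] unfolding az by (simp add: a_def b_def)
    have 3: "hfun v z = cnj a * b" unfolding hfun_cnj[of v z] 2 by simp
    have "hfun z z / (hfun z v * hfun v z) = inverse b * cnj (inverse b)" unfolding 1 2 3 using a0 by (simp add: field_simps)
    then have "f v = inverse b ^ \<nu> * cnj (inverse b) ^ \<nu>" unfolding f_def by (simp only: power_mult_distrib)
    also have "\<dots> = of_real (cmod (inverse b) ^ (2 * \<nu>))" by (rule of_real_cmod_power[symmetric])
    finally show "f v = of_real (ag (matrix_inv g) v)" by (simp only: ag_def norm_inverse b_def)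
  qed
  finally show ?thesis unfolding z_def .
qed

lemma xi_matrix_coeff: assumes g: "g \<in> SUgrp" shows "ip (ta g xi) xi = of_real (N xi) * sph \<mu> \<nu> (act g 0)"
proof -
  have "ip (ta g xi) xi = ip xi (ta (matrix_inv g) xi)" by (rule ta_ip_adj[OF g xi_H xi_H])
  also have "\<dots> = ip xi xi * SI (\<lambda>v. of_real (ag (matrix_inv g) v))" by (rule Kfix_ip[OF xi_H xi_Kfix SU_inv(2)[OF g]])
  finally show ?thesis unfolding ip_self[OF xi_H] sph_SI[OF g] .
qed

section \<open>Positive definiteness and the cyclic subspace\<close>

lemma H_sum:
  fixes n :: nat and f :: "nat \<Rightarrow> (complex^'l^'r) \<times> (complex^'l^'r) \<Rightarrow> complex" and c :: "nat \<Rightarrow> complex"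
  assumes "\<And>i. i < n \<Longrightarrow> f i \<in> H" shows "(\<lambda>x. \<Sum>i<n. c i * f i x) \<in> H"
    "\<And>G. G \<in> H \<Longrightarrow> ip (\<lambda>x. \<Sum>i<n. c i * f i x) G = (\<Sum>i<n. c i * ip (f i) G)"
proof -
  have "(\<lambda>x. \<Sum>i<n. c i * f i x) \<in> H \<and> (\<forall>G\<in>H. ip (\<lambda>x. \<Sum>i<n. c i * f i x) G = (\<Sum>i<n. c i * ip (f i) G))"
    using assms
  proof (induction n)
    case 0
    have "ip (\<lambda>x. 0) G = 0" if "G \<in> H" for G using ip_scale[OF that that, of 0] by simp
    then show ?case using zero_H(1) by simp
  next
    case (Suc n)
    then have IH: "(\<lambda>x. \<Sum>i<n. c i * f i x) \<in> H" "\<And>G. G \<in> H \<Longrightarrow> ip (\<lambda>x. \<Sum>i<n. c i * f i x) G = (\<Sum>i<n. c i * ip (f i) G)" and fn: "f n \<in> H" by auto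
    have cf: "(\<lambda>x. c n * f n x) \<in> H" by (rule H_scale(1)[OF fn])
    have "ip (\<lambda>x. (\<Sum>i<n. c i * f i x) + c n * f n x) G = (\<Sum>i<n. c i * ip (f i) G) + c n * ip (f n) G" if G: "G \<in> H" for G
      unfolding ip_add[OF IH(1) cf G] ip_scale[OF fn G] IH(2)[OF G] ..
    then show ?case using H_add(1)[OF IH(1) cf] by simp
  qed
  then show "(\<lambda>x. \<Sum>i<n. c i * f i x) \<in> H" "\<And>G. G \<in> H \<Longrightarrow> ip (\<lambda>x. \<Sum>i<n. c i * f i x) G = (\<Sum>i<n. c i * ip (f i) G)" by auto
qed

text \<open>By unitarity the values of the spherical function are the entries of the Gram matrix of
  translates of xi, divided by the squared norm of xi.\<close>

lemma pos_def: "pos_def_on_G (\<lambda>g :: complex^('r + 'l)^('r + 'l). sph \<mu> \<nu> (act g 0))"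
  unfolding pos_def_on_G_def Let_def
proof (intro allI impI)
  fix n and gs :: "nat \<Rightarrow> complex^('r + 'l)^('r + 'l)" and cs :: "nat \<Rightarrow> complex"
  assume gs: "\<forall>i<n. gs i \<in> SUgrp"
  define G where "G x = (\<Sum>i<n. cs i * ta (gs i) xi x)" for x
  have tH: "ta (gs i) xi \<in> H" if "i < n" for i by (rule ta_H1(1)[OF _ xi_H]) (use gs that in blast)
  have GH: "G \<in> H" unfolding G_def[abs_def] by (rule H_sum(1)[OF tH])
  let ?S = "\<Sum>i<n. \<Sum>k<n. cs i * cnj (cs k) * sph \<mu> \<nu> (act (matrix_inv (gs k) ** gs i) 0)"
  have "of_real (N G) = ip G G" by (rule ip_self[OF GH, symmetric])
  also have "\<dots> = (\<Sum>i<n. cs i * ip (ta (gs i) xi) G)" unfolding G_def[abs_def] by (rule H_sum(2)[OF tH GH[unfolded G_def[abs_def]]])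
  also have "\<dots> = (\<Sum>i<n. \<Sum>k<n. of_real (N xi) * (cs i * cnj (cs k) * sph \<mu> \<nu> (act (matrix_inv (gs k) ** gs i) 0)))"
  proof (intro sum.cong refl)
    fix i assume "i \<in> {..<n}"
    then have i: "i < n" "gs i \<in> SUgrp" using gs by auto
    have "ip (ta (gs i) xi) G = cnj (ip G (ta (gs i) xi))" by (rule ip_cnj[OF GH tH[OF i(1)]])
    also have "ip G (ta (gs i) xi) = (\<Sum>k<n. cs k * ip (ta (gs k) xi) (ta (gs i) xi))"
      unfolding G_def[abs_def] by (rule H_sum(2)[OF tH tH[OF i(1)]])
    also have "cnj \<dots> = (\<Sum>k<n. cnj (cs k) * (of_real (N xi) * sph \<mu> \<nu> (act (matrix_inv (gs k) ** gs i) 0)))"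
      unfolding cnj_sum
    proof (intro sum.cong refl)
      fix k assume "k \<in> {..<n}"
      then have k: "k < n" "gs k \<in> SUgrp" using gs by auto
      have "cnj (ip (ta (gs k) xi) (ta (gs i) xi)) = ip (ta (gs i) xi) (ta (gs k) xi)" by (rule ip_cnj[OF tH[OF k(1)] tH[OF i(1)], symmetric])
      also have "\<dots> = ip (ta (matrix_inv (gs k)) (ta (gs i) xi)) (ta (matrix_inv (gs k)) (ta (gs k) xi))"
        by (rule ta_ip[OF SU_inv(2)[OF k(2)] tH[OF i(1)] tH[OF k(1)], symmetric])
      also have "\<dots> = ip (ta (matrix_inv (gs k) ** gs i) xi) xi"
        unfolding ta_inv(1)[OF k(2) xi_H] ta_comp[OF SU_inv(2)[OF k(2)] i(2)] ..
      also have "\<dots> = of_real (N xi) * sph \<mu> \<nu> (act (matrix_inv (gs k) ** gs i) 0)"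
        by (rule xi_matrix_coeff[OF SU_mult[OF SU_inv(2)[OF k(2)] i(2)]])
      finally show "cnj (cs k * ip (ta (gs k) xi) (ta (gs i) xi)) = cnj (cs k) * (of_real (N xi) * sph \<mu> \<nu> (act (matrix_inv (gs k) ** gs i) 0))"
        by simp
    qed
    finally show "cs i * ip (ta (gs i) xi) G = (\<Sum>k<n. of_real (N xi) * (cs i * cnj (cs k) * sph \<mu> \<nu> (act (matrix_inv (gs k) ** gs i) 0)))"
      by (simp add: sum_distrib_left mult_ac)
  qed
  finally have e: "of_real (N G) = of_real (N xi) * ?S" by (simp only: sum_distrib_left)
  have "?S = of_real (N G / N xi)" using xi_pos by (simp add: e)
  then have "Im ?S = 0" "Re ?S = N G / N xi" by (simp_all only: Im_complex_of_real Re_complex_of_real)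
  moreover have "0 \<le> N G / N xi" using N_nonneg[OF GH] xi_pos by simp
  ultimately show "Im ?S = 0 \<and> 0 \<le> Re ?S" by simp
qed

text \<open>The double orthogonal complement of the orbit of \<open>xi\<close>, that is, its closed span.\<close>

definition cyclic_span :: "((complex^'l^'r) \<times> (complex^'l^'r) \<Rightarrow> complex) set" where
  "cyclic_span = {F \<in> H. \<forall>G\<in>H. (\<forall>g\<in>SUgrp. ip G (ta g xi) = 0) \<longrightarrow> ip F G = 0}"

lemma cyclic_span_H: "F \<in> cyclic_span \<Longrightarrow> F \<in> H" by (simp add: cyclic_span_def)

lemma cyclic_span_D: "F \<in> cyclic_span \<Longrightarrow> G \<in> H \<Longrightarrow> (\<And>g. g \<in> SUgrp \<Longrightarrow> ip G (ta g xi) = 0) \<Longrightarrow> ip F G = 0"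
  unfolding cyclic_span_def by blast

lemma cyclic_span_I: "F \<in> H \<Longrightarrow> (\<And>G. G \<in> H \<Longrightarrow> (\<And>g. g \<in> SUgrp \<Longrightarrow> ip G (ta g xi) = 0) \<Longrightarrow> ip F G = 0) \<Longrightarrow> F \<in> cyclic_span"
  unfolding cyclic_span_def by blast

lemma ip_zero: "G \<in> H \<Longrightarrow> ip (\<lambda>x. 0) G = 0"
  using ip_scale[of G G 0] by simp

lemma cyclic_span_closed: "closed_subspace XX KK cyclic_span"
  unfolding closed_subspace_def
proof (intro conjI ballI allI impI)
  show "cyclic_span \<subseteq> H" by (auto simp: cyclic_span_def)
  show "(\<lambda>x. 0) \<in> cyclic_span" by (rule cyclic_span_I[OF zero_H(1)]) (rule ip_zero)
  show "(\<lambda>x. f x + g x) \<in> cyclic_span" if "f \<in> cyclic_span" "g \<in> cyclic_span" for f g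
  proof (rule cyclic_span_I[OF H_add(1)[OF cyclic_span_H[OF that(1)] cyclic_span_H[OF that(2)]]])
    fix G assume G: "G \<in> H" "\<And>g. g \<in> SUgrp \<Longrightarrow> ip G (ta g xi) = 0"
    have f0: "ip f G = 0" by (rule cyclic_span_D[OF that(1) G])
    have g0: "ip g G = 0" by (rule cyclic_span_D[OF that(2) G])
    show "ip (\<lambda>x. f x + g x) G = 0"
      unfolding ip_add[OF cyclic_span_H[OF that(1)] cyclic_span_H[OF that(2)] G(1)] f0 g0 by simp
  qed
  show "(\<lambda>x. c * f x) \<in> cyclic_span" if "f \<in> cyclic_span" for f c
  proof (rule cyclic_span_I[OF H_scale(1)[OF cyclic_span_H[OF that]]])
    fix G assume G: "G \<in> H" "\<And>g. g \<in> SUgrp \<Longrightarrow> ip G (ta g xi) = 0"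
    have "ip f G = 0" by (rule cyclic_span_D[OF that G])
    then show "ip (\<lambda>x. c * f x) G = 0" unfolding ip_scale[OF cyclic_span_H[OF that] G(1)] by simp
  qed
  show "f \<in> cyclic_span" if *: "(\<forall>m. fs m \<in> cyclic_span) \<and> f \<in> H \<and> (\<lambda>m. N (\<lambda>x. f x - fs m x)) \<longlonglongrightarrow> 0" for fs f
  proof -
    have fs: "fs m \<in> cyclic_span" for m using * by blast
    have f: "f \<in> H" "(\<lambda>m. N (\<lambda>x. f x - fs m x)) \<longlonglongrightarrow> 0" using * by blast+
    show ?thesis
    proof (rule cyclic_span_I[OF f(1)])
      fix G assume G: "G \<in> H" "\<And>g. g \<in> SUgrp \<Longrightarrow> ip G (ta g xi) = 0"
      have "(\<lambda>m. ip G (fs m)) \<longlonglongrightarrow> ip G f" by (rule ip_tendsto[OF G(1) f(1) cyclic_span_H[OF fs] f(2)])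
      moreover have "ip G (fs m) = 0" for m
      proof -
        have "ip (fs m) G = 0" by (rule cyclic_span_D[OF fs G])
        then show ?thesis using ip_cnj[OF cyclic_span_H[OF fs[of m]] G(1)] by simp
      qed
      ultimately have "ip G f = 0" by (simp add: LIMSEQ_const_iff)
      then show "ip f G = 0" using ip_cnj[OF G(1) f(1)] by simp
    qed
  qed
qed

lemma cyclic_span_add: "f \<in> cyclic_span \<Longrightarrow> g \<in> cyclic_span \<Longrightarrow> (\<lambda>x. f x + g x) \<in> cyclic_span"
  and cyclic_span_scale: "f \<in> cyclic_span \<Longrightarrow> (\<lambda>x. c * f x) \<in> cyclic_span"
  using cyclic_span_closed unfolding closed_subspace_def by blast+

lemma cyclic_span_inv: "invariant_closed_subspace \<nu> cyclic_span"
  unfolding invariant_closed_subspace_def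
proof (intro conjI ballI cyclic_span_closed)
  fix g :: "complex^('r + 'l)^('r + 'l)" and F assume g: "g \<in> SUgrp" and F: "F \<in> cyclic_span"
  show "ta g F \<in> cyclic_span"
  proof (rule cyclic_span_I[OF ta_H1(1)[OF g cyclic_span_H[OF F]]])
    fix G assume G: "G \<in> H" "\<And>g. g \<in> SUgrp \<Longrightarrow> ip G (ta g xi) = 0"
    note gi = SU_inv(2)[OF g]
    have "ip (ta (matrix_inv g) G) (ta h xi) = 0" if h: "h \<in> SUgrp" for h
    proof -
      have "ip (ta (matrix_inv g) G) (ta h xi) = ip G (ta (matrix_inv (matrix_inv g)) (ta h xi))"
        by (rule ta_ip_adj[OF gi G(1) ta_H1(1)[OF h xi_H]])
      also have "\<dots> = ip G (ta (g ** h) xi)" unfolding inv_inv[OF g] ta_comp[OF g h] ..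
      also have "\<dots> = 0" by (rule G(2)[OF SU_mult[OF g h]])
      finally show ?thesis .
    qed
    then have "ip F (ta (matrix_inv g) G) = 0" by (rule cyclic_span_D[OF F ta_H1(1)[OF gi G(1)]])
    then show "ip (ta g F) G = 0" unfolding ta_ip_adj[OF g cyclic_span_H[OF F] G(1)] .
  qed
qed

lemma xi_VV: "xi \<in> cyclic_span"
proof (rule cyclic_span_I[OF xi_H])
  fix G assume G: "G \<in> H" "\<And>g. g \<in> SUgrp \<Longrightarrow> ip G (ta g xi) = 0"
  have "ip G xi = 0" using G(2)[OF SU_1] unfolding ta_1_xi .
  then show "ip xi G = 0" using ip_cnj[OF G(1) xi_H] by simp
qed

text \<open>An invariant subspace is tested on the projection of xi to it. \<open>Kfix_ip\<close>
  leaves only the multiples of xi as possible projections, and the multiple decides whether the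
  subspace is zero or everything.\<close>

lemma cyclic_span_irreducible: "irreducible_component \<nu> cyclic_span"
  unfolding irreducible_component_def
proof (intro conjI allI impI cyclic_span_inv)
  have "xi \<noteq> (\<lambda>x. 0)" using xi_pos zero_H(2) by auto
  then show "cyclic_span \<noteq> {\<lambda>x. 0}" using xi_VV by blast
  fix W assume "invariant_closed_subspace \<nu> W \<and> W \<subseteq> cyclic_span"
  then have WV: "W \<subseteq> cyclic_span" and Wc: "closed_subspace XX KK W"
    and Wi: "\<And>g F. g \<in> (SUgrp :: (complex^('r + 'l)^('r + 'l)) set) \<Longrightarrow> F \<in> W \<Longrightarrow> ta g F \<in> W"
    unfolding invariant_closed_subspace_def by blast+
  have WH: "F \<in> W \<Longrightarrow> F \<in> H" for F using WV cyclic_span_H by blast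
  have W0: "(\<lambda>x. 0) \<in> W" and Wadd: "\<And>u v. u \<in> W \<Longrightarrow> v \<in> W \<Longrightarrow> (\<lambda>x. u x + v x) \<in> W"
    and Wsc: "\<And>u a. u \<in> W \<Longrightarrow> (\<lambda>x. a * u x) \<in> W"
    using Wc unfolding closed_subspace_def by blast+
  have Wdiff: "(\<lambda>x. u x - v x) \<in> W" if "u \<in> W" "v \<in> W" for u v
    using Wadd[OF that(1) Wsc[OF that(2), of "-1"]] by simp
  obtain \<eta> where \<eta>: "\<eta> \<in> W" "\<And>w. w \<in> W \<Longrightarrow> ip (\<lambda>x. xi x - \<eta> x) w = 0"
    using projection[OF Wc xi_H] by blast
  have \<eta>H: "\<eta> \<in> H" by (rule WH[OF \<eta>(1)])
  have dH: "(\<lambda>x. xi x - \<eta> x) \<in> H" by (rule H_diff[OF xi_H \<eta>H])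
  \<comment> \<open>Both xi and W are invariant under k, so the translate of the projection is again
    the projection of xi; the difference d of the two lies in W and is orthogonal to W.\<close>
  have \<eta>K: "ta k \<eta> = \<eta>" if k: "k \<in> (Kgrp :: (complex^('r + 'l)^('r + 'l)) set)" for k
  proof -
    note kS = Kgrp_SU[OF k]
    have tk: "ta k \<eta> \<in> W" by (rule Wi[OF kS \<eta>(1)])
    have tkH: "ta k \<eta> \<in> H" by (rule WH[OF tk])
    define d where "d = (\<lambda>x. ta k \<eta> x - \<eta> x)"
    have dW: "d \<in> W" unfolding d_def by (rule Wdiff[OF tk \<eta>(1)])
    have dH': "d \<in> H" by (rule WH[OF dW])
    have "ta k (\<lambda>x. xi x + (-1) * \<eta> x) = (\<lambda>x. xi x - ta k \<eta> x)" unfolding ta_lin xi_Kfix[OF k] by simp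
    then have e: "ta k (\<lambda>x. xi x - \<eta> x) = (\<lambda>x. xi x - ta k \<eta> x)" by simp
    have "ip (\<lambda>x. xi x - ta k \<eta> x) d = ip (\<lambda>x. xi x - \<eta> x) (ta (matrix_inv k) d)"
      unfolding e[symmetric] by (rule ta_ip_adj[OF kS dH dH'])
    also have "\<dots> = 0" by (rule \<eta>(2)[OF Wi[OF SU_inv(2)[OF kS] dW]])
    finally have 1: "ip (\<lambda>x. xi x - ta k \<eta> x) d = 0" .
    have "ip d d = ip (\<lambda>x. (xi x - \<eta> x) - (xi x - ta k \<eta> x)) d" by (simp add: d_def)
    also have "\<dots> = ip (\<lambda>x. xi x - \<eta> x) d - ip (\<lambda>x. xi x - ta k \<eta> x) d"
      by (rule ip_diff[OF dH H_diff[OF xi_H tkH] dH'])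
    also have "\<dots> = 0" unfolding 1 \<eta>(2)[OF dW] by simp
    finally have "N d = 0" unfolding ip_self[OF dH'] by simp
    then have d0: "d = (\<lambda>x. 0)" by (rule N_eq0[OF dH'])
    show ?thesis
    proof
      fix x show "ta k \<eta> x = \<eta> x" using fun_cong[OF d0, of x] by (simp add: d_def)
    qed
  qed
  \<comment> \<open>Chosen so that \<eta> - c xi is orthogonal to xi. \<open>Kfix_ip\<close> gives
    both vectors the same dependence on g, so this single condition yields orthogonality to the
    whole orbit.\<close>
  define c where "c = ip \<eta> xi / of_real (N xi)"
  have Nx: "of_real (N xi) \<noteq> (0 :: complex)" using xi_pos by simp
  define \<delta> where "\<delta> = (\<lambda>x. \<eta> x - c * xi x)"
  have cxH: "(\<lambda>x. c * xi x) \<in> H" by (rule H_scale(1)[OF xi_H])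
  have \<delta>H: "\<delta> \<in> H" unfolding \<delta>_def by (rule H_diff[OF \<eta>H cxH])
  have "ip \<delta> (ta g xi) = 0" if g: "g \<in> SUgrp" for g
  proof -
    have t: "ta g xi \<in> H" by (rule ta_H1(1)[OF g xi_H])
    have "ip \<delta> (ta g xi) = ip \<eta> (ta g xi) - c * ip xi (ta g xi)"
      unfolding \<delta>_def ip_diff[OF \<eta>H cxH t] ip_scale[OF xi_H t] ..
    also have "ip \<eta> (ta g xi) = ip \<eta> xi * SI (\<lambda>v. of_real (ag g v))"
      by (rule Kfix_ip[OF \<eta>H \<eta>K g])
    also have "ip xi (ta g xi) = ip xi xi * SI (\<lambda>v. of_real (ag g v))"
      by (rule Kfix_ip[OF xi_H xi_Kfix g])
    also have "ip \<eta> xi * SI (\<lambda>v. of_real (ag g v)) - c * (ip xi xi * SI (\<lambda>v. of_real (ag g v)))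
        = (ip \<eta> xi - c * ip xi xi) * SI (\<lambda>v. of_real (ag g v))"
      by (simp only: left_diff_distrib mult.assoc)
    also have "ip \<eta> xi - c * ip xi xi = 0" unfolding ip_self[OF xi_H] c_def using Nx by simp
    finally show ?thesis by simp
  qed
  note \<delta>o = this
  have \<delta>V: "\<delta> \<in> cyclic_span"
  proof -
    have "(\<lambda>x. \<eta> x + (- c) * xi x) \<in> cyclic_span"
      by (rule cyclic_span_add[OF subsetD[OF WV \<eta>(1)] cyclic_span_scale[OF xi_VV]])
    then show ?thesis by (simp add: \<delta>_def)
  qed
  have "ip \<delta> \<delta> = 0" by (rule cyclic_span_D[OF \<delta>V \<delta>H \<delta>o])
  then have "N \<delta> = 0" unfolding ip_self[OF \<delta>H] by simp
  then have \<delta>0: "\<delta> = (\<lambda>x. 0)" by (rule N_eq0[OF \<delta>H])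
  have \<eta>c: "\<eta> = (\<lambda>x. c * xi x)"
  proof
    fix x show "\<eta> x = c * xi x" using fun_cong[OF \<delta>0, of x] by (simp add: \<delta>_def)
  qed
  \<comment> \<open>If c = 0, xi is orthogonal to W, and by invariance so is its orbit, which leaves
    only 0 inside the cyclic span. Otherwise W contains xi, and a vector of the span minus its
    projection to W is orthogonal to the orbit.\<close>
  show "W = {\<lambda>x. 0} \<or> W = cyclic_span"
  proof (cases "c = 0")
    case True
    then have "\<eta> = (\<lambda>x. 0)" using \<eta>c by simp
    then have xo: "ip xi w = 0" if "w \<in> W" for w using \<eta>(2)[OF that] by simp
    have "F = (\<lambda>x. 0)" if F: "F \<in> W" for F
    proof -
      note FH = WH[OF F]
      have "ip F (ta g xi) = 0" if g: "g \<in> SUgrp" for g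
      proof -
        have "ip (ta g xi) F = ip xi (ta (matrix_inv g) F)" by (rule ta_ip_adj[OF g xi_H FH])
        also have "\<dots> = 0" by (rule xo[OF Wi[OF SU_inv(2)[OF g] F]])
        finally show ?thesis using ip_cnj[OF ta_H1(1)[OF g xi_H] FH] by simp
      qed
      then have "ip F F = 0" by (rule cyclic_span_D[OF subsetD[OF WV F] FH])
      then have "N F = 0" unfolding ip_self[OF FH] by simp
      then show ?thesis by (rule N_eq0[OF FH])
    qed
    then show ?thesis using W0 by blast
  next
    case False
    have "(\<lambda>x. inverse c * \<eta> x) \<in> W" by (rule Wsc[OF \<eta>(1)])
    then have xiW: "xi \<in> W" using False unfolding \<eta>c by (simp add: mult.assoc[symmetric])
    have "F \<in> W" if F: "F \<in> cyclic_span" for F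
    proof -
      note FH = cyclic_span_H[OF F]
      obtain P where P: "P \<in> W" "\<And>w. w \<in> W \<Longrightarrow> ip (\<lambda>x. F x - P x) w = 0" using projection[OF Wc FH] by blast
      note PH = WH[OF P(1)]
      define D where "D = (\<lambda>x. F x - P x)"
      have DH: "D \<in> H" unfolding D_def by (rule H_diff[OF FH PH])
      have D0: "ip D w = 0" if "w \<in> W" for w unfolding D_def by (rule P(2)[OF that])
      have o: "ip D (ta g xi) = 0" if "g \<in> SUgrp" for g by (rule D0[OF Wi[OF that xiW]])
      have "ip F D = 0" by (rule cyclic_span_D[OF F DH o])
      moreover have "ip P D = 0" using ip_cnj[OF DH PH] D0[OF P(1)] by simp
      ultimately have "ip D D = 0" using ip_diff[OF FH PH DH] by (simp add: D_def)
      then have "N D = 0" unfolding ip_self[OF DH] by simp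
      then have z: "D = (\<lambda>x. 0)" by (rule N_eq0[OF DH])
      have "F = P"
      proof
        fix x show "F x = P x" using fun_cong[OF z, of x] by (simp add: D_def)
      qed
      then show ?thesis using P(1) by simp
    qed
    then show ?thesis using WV by blast
  qed
qed

text \<open>A unit vector whose matrix coefficient is the spherical function identifies the
  component: the vector is cyclic by irreducibility, and a cyclic representation is determined up to
  unitary equivalence by this coefficient.\<close>

lemma spherical_component:
  "\<exists>V \<xi>. irreducible_component \<nu> V \<and> \<xi> \<in> V \<and> rkhs_norm2 XX KK \<xi> = 1
      \<and> (\<forall>g \<in> (SUgrp :: (complex^('r+'l)^('r+'l)) set). rkhs_inner XX KK (ta g \<xi>) \<xi> = sph \<mu> \<nu> (act g 0))"
proof (intro exI conjI ballI)
  define a where "a = complex_of_real (1 / sqrt (N xi))"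
  have a2: "(cmod a)\<^sup>2 = 1 / N xi" using xi_pos by (simp add: a_def norm_divide power_divide)
  show "irreducible_component \<nu> cyclic_span" by (rule cyclic_span_irreducible)
  show "(\<lambda>x. a * xi x) \<in> cyclic_span" by (rule cyclic_span_scale[OF xi_VV])
  show "N (\<lambda>x. a * xi x) = 1" unfolding H_scale(2)[OF xi_H] a2 using xi_pos by simp
  fix g :: "complex^('r+'l)^('r+'l)" assume g: "g \<in> SUgrp"
  have t: "ta g xi \<in> H" by (rule ta_H1(1)[OF g xi_H])
  have "ip (ta g (\<lambda>x. a * xi x)) (\<lambda>x. a * xi x) = (a * cnj a) * ip (ta g xi) xi"
    unfolding ta_scale ip_scale[OF t H_scale(1)[OF xi_H]] ip_scale2[OF xi_H t] by simp
  also have "\<dots> = of_real (1 / N xi) * (of_real (N xi) * sph \<mu> \<nu> (act g 0))"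
    unfolding complex_norm_square[symmetric] xi_matrix_coeff[OF g] a2 ..
  also have "\<dots> = sph \<mu> \<nu> (act g 0)" using xi_pos by simp
  finally show "ip (ta g (\<lambda>x. a * xi x)) (\<lambda>x. a * xi x) = sph \<mu> \<nu> (act g 0)" .
qed

end

theorem theorem4p6:
  fixes j :: nat and \<mu> :: "(complex^'l::finite^'r::finite) measure"
  assumes "int CARD('l) - int CARD('r) > 2"
    and "2 \<le> j" and "j \<le> CARD('r)"
    and "int CARD('l) - int CARD('r) > 2 * int j - 3"
    and "shilov_measure \<mu>"
  shows "pos_def_on_G (\<lambda>g::complex^('r+'l)^('r+'l). sph \<mu> (j - 1) (act g 0))
    \<and> (\<exists>V \<xi>. irreducible_component (j - 1) V \<and> \<xi> \<in> V
          \<and> rkhs_norm2 DD (tkernel (j - 1)) \<xi> = 1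
          \<and> (\<forall>g \<in> (SUgrp :: (complex^('r+'l)^('r+'l)) set).
                rkhs_inner DD (tkernel (j - 1)) (tact (j - 1) g \<xi>) \<xi> = sph \<mu> (j - 1) (act g 0)))"
proof -
  \<comment> \<open>With this choice \<nu> = j - 1 is the successor of s, and the strict integer
    inequality l - r > 2j - 3 becomes l - r \<ge> 2\<nu>.\<close>
  define s where "s = j - 2"
  have j: "j - 1 = Suc s" using assms(2) by (simp add: s_def)
  have d: "2 * Suc s + CARD('r) \<le> CARD('l)" using assms(2,4) by (simp add: s_def)
  interpret wallach \<mu> s by unfold_locales (rule assms(5), rule d)
  show ?thesis unfolding j using pos_def spherical_component by blast
qed

end
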